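(* Let $\mathfrak g$ be a symmetrizable Kac-Moody algebra, $F=\mathbb Q((\hbar))$, let $B_F$ be the Kashiwara algebra of $\mathfrak g$ over $F$ and $U_F=U_\hbar(\mathfrak g)$ the quantized enveloping algebra of $\mathfrak g$ over $F$. Then $B_F$, equipped with its natural structure of $U_F$-comodule algebra $$\beta:B_F\to B_F\otimes U_F,\quad e'_i\mapsto(q_i-q_i^{-1})\,1\otimes\mathbf t_i^{-1}\mathbf e_i+e'_i\otimes\mathbf t_i^{-1},\quad f_i\mapsto f_i\otimes\mathbf t_i^{-1}+1\otimes\mathbf f_i,\quad q^h\mapsto q^h\otimes\mathbf q^h,$$ is a $U_F$-Galois extension of $\mathbb Q((\hbar))$.
   Context: Notation. $\mathfrak g$ is a symmetrizable Kac-Moody algebra over $\mathbb Q$ with Cartan subalgebra $\mathfrak t$, simple roots $\alpha_i\in\mathfrak t^*$ and coroots $h_i\in\mathfrak t$ ($i\in I$, $I$ finite). Fix an inner product on $\mathfrak t^*$ with $(\alpha_i,\alpha_i)$ a positive even integer and $\langle h_i,\lambda\rangle=2(\alpha_i,\lambda)/(\alpha_i,\alpha_i)$ for $\lambda\in\mathfrak t^*$. Put $P=\bigoplus_i\mathbb Zh_i$, $q=\exp(\hbar)\in F$, $q_i=q^{(\alpha_i,\alpha_i)/2}$, $t_i=q^{(\alpha_i,\alpha_i)h_i/2}$, $\mathbf t_i=\mathbf q^{(\alpha_i,\alpha_i)h_i/2}$, $[n]_i=(q_i^n-q_i^{-n})/(q_i-q_i^{-1})$, $[n]_i!=\prod_{k=1}^n[k]_i$.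 The Serre relations for $X=(X_i)_{i\in I}$ are, for all $i\ne j$, $\sum_{k=0}^{1-\langle h_i,\alpha_j\rangle}(-1)^kX_i^{(k)}X_jX_i^{(1-\langle h_i,\alpha_j\rangle-k)}=0$, with $X_i^{(n)}=X_i^n/[n]_i!$. The symbols $q^h$ (resp. $\mathbf q^h$), $h\in P$, satisfy $q^0=1$, $q^hq^{h'}=q^{h+h'}$ (resp. the same for $\mathbf q^h$). $B_F$: the associative unital $F$-algebra generated by $e'_i,f_i$ ($i\in I$), $q^h$ ($h\in P$) with $q^he'_iq^{-h}=q^{\langle h,\alpha_i\rangle}e'_i$, $q^hf_iq^{-h}=q^{-\langle h,\alpha_i\rangle}f_i$, $e'_if_j=q_i^{\langle h_i,\alpha_j\rangle}f_je'_i+\delta_{i,j}$ and the Serre relations for $e'$ and for $f$. $U_F$: the $F$-algebra generated by $\mathbf e_i,\mathbf f_i$ ($i\in I$), $\mathbf q^h$ ($h\in P$) with $\mathbf q^h\mathbf e_i\mathbf q^{-h}=q^{\langle h,\alpha_i\rangle}\mathbf e_i$, $\mathbf q^h\mathbf f_i\mathbf q^{-h}=q^{-\langle h,\alpha_i\rangle}\mathbf f_i$, $[\mathbf e_i,\mathbf f_j]=\delta_{i,j}(\mathbf t_i-\mathbf t_i^{-1})/(q_i-q_i^{-1})$ and the Serre relations for $\mathbf e$ and for $\mathbf f$. It is a Hopf algebra with $\Delta(\mathbf q^h)=\mathbf q^h\otimes\mathbf q^h$, $\Delta(\mathbf e_i)=\mathbf e_i\otimes1+\mathbf t_i\otimes\mathbf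 e_i$, $\Delta(\mathbf f_i)=\mathbf f_i\otimes\mathbf t_i^{-1}+1\otimes\mathbf f_i$, counit $\mathbf e_i,\mathbf f_i\mapsto0$, $\mathbf q^h\mapsto1$, antipode $\mathbf e_i\mapsto-\mathbf t_i^{-1}\mathbf e_i$, $\mathbf f_i\mapsto-\mathbf f_i\mathbf t_i$, $\mathbf q^h\mapsto\mathbf q^{-h}$. For a Hopf algebra $H$ over a field $F$, an $H$-Galois extension of $F$ is a right $H$-comodule algebra $T$ (coaction $\beta:T\to T\otimes H$) whose coinvariants are $F$ and such that the canonical map $T\otimes T\to T\otimes H$, $x\otimes y\mapsto(x\otimes1)\beta(y)$, is bijective. *)

theory Defs
  imports
    "HOL-Algebra.Module"
    "HOL-Algebra.QuotRing"
    "HOL-Library.Poly_Mapping"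
    "HOL-Computational_Algebra.Formal_Laurent_Series"
begin

section \<open>Associative algebras over a field\<close>

text \<open>
  The ground field is a type \<open>'k\<close> of class \<open>field\<close>, viewed as a ring with carrier (and as an
  algebra over itself) by \<open>ground_algebra\<close>. Algebras are records of type \<open>module\<close>; the
  library locale \<^locale>\<open>algebra\<close> cannot be used because it demands commutativity.
\<close>

definition ground_algebra :: "('k::field, 'k) module" where
  "ground_algebra =
     \<lparr>carrier = UNIV, monoid.mult = (*), one = 1, ring.zero = 0, add = (+), module.smult = (*)\<rparr>"

locale assoc_algebra =
  Module.module "ground_algebra :: ('k::field, 'k) module" A + Ring.ring A
  for A :: "('k::field, 'a) module" (structure) +
  assumes smult_mult_left:
      "\<And>r x y. x \<in> carrier A \<Longrightarrow> y \<in> carrier A \<Longrightarrow> (r \<odot> x) \<otimes> y = r \<odot> (x \<otimes> y)"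
    and smult_mult_right:
      "\<And>r x y. x \<in> carrier A \<Longrightarrow> y \<in> carrier A \<Longrightarrow> x \<otimes> (r \<odot> y) = r \<odot> (x \<otimes> y)"

definition alg_hom :: "('k, 'a) module \<Rightarrow> ('k, 'b) module \<Rightarrow> ('a \<Rightarrow> 'b) set" where
  "alg_hom A B =
     {f \<in> ring_hom A B. \<forall>r. \<forall>x \<in> carrier A. f (r \<odot>\<^bsub>A\<^esub> x) = r \<odot>\<^bsub>B\<^esub> f x}"

definition opposite_algebra :: "('k, 'a) module \<Rightarrow> ('k, 'a) module" where
  "opposite_algebra A = A\<lparr>mult := (\<lambda>x y. y \<otimes>\<^bsub>A\<^esub> x)\<rparr>"

definition quot_algebra :: "('k, 'a) module \<Rightarrow> 'a set \<Rightarrow> ('k, 'a set) module" where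
  "quot_algebra A J =
     ring.extend (A Quot J) (module.fields (\<lambda>r C. \<Union>x\<in>C. J +>\<^bsub>A\<^esub> (r \<odot>\<^bsub>A\<^esub> x)))"

definition monoid_algebra :: "('m, 'z) monoid_scheme \<Rightarrow> ('k::field, 'm \<Rightarrow>\<^sub>0 'k) module" where
  "monoid_algebra M =
     \<lparr>carrier = {p. Poly_Mapping.keys p \<subseteq> carrier M},
      monoid.mult = (\<lambda>p q. \<Sum>a\<in>Poly_Mapping.keys p. \<Sum>b\<in>Poly_Mapping.keys q.
        Poly_Mapping.single (a \<otimes>\<^bsub>M\<^esub> b) (Poly_Mapping.lookup p a * Poly_Mapping.lookup q b)),
      one = Poly_Mapping.single \<one>\<^bsub>M\<^esub> 1,
      ring.zero = 0,
      add = (+),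
      module.smult = (\<lambda>r. Poly_Mapping.map ((*) r))\<rparr>"

definition linear_extension :: "('k::field, 'n) module \<Rightarrow> ('m \<Rightarrow> 'n) \<Rightarrow> ('m \<Rightarrow>\<^sub>0 'k) \<Rightarrow> 'n" where
  "linear_extension N \<phi> p = (\<Oplus>\<^bsub>N\<^esub>m\<in>Poly_Mapping.keys p. Poly_Mapping.lookup p m \<odot>\<^bsub>N\<^esub> \<phi> m)"


section \<open>Presentations by generators and relations\<close>

definition free_monoid :: "'g set \<Rightarrow> 'g list monoid" where
  "free_monoid X = \<lparr>carrier = lists X, monoid.mult = (@), one = []\<rparr>"

definition free_algebra :: "'g set \<Rightarrow> ('k::field, 'g list \<Rightarrow>\<^sub>0 'k) module" where
  "free_algebra X = monoid_algebra (free_monoid X)"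

text \<open>A pair \<open>(u, v)\<close> stands for the relation \<open>u = v\<close>.\<close>

definition relation_ideal ::
    "'g set \<Rightarrow> (('g list \<Rightarrow>\<^sub>0 'k::field) \<times> ('g list \<Rightarrow>\<^sub>0 'k)) set \<Rightarrow> ('g list \<Rightarrow>\<^sub>0 'k) set" where
  "relation_ideal X R =
     Idl\<^bsub>free_algebra X :: ('k, _) module\<^esub> {u \<ominus>\<^bsub>free_algebra X :: ('k, _) module\<^esub> v |u v. (u, v) \<in> R}"

definition presented_algebra ::
    "'g set \<Rightarrow> (('g list \<Rightarrow>\<^sub>0 'k::field) \<times> ('g list \<Rightarrow>\<^sub>0 'k)) set
      \<Rightarrow> ('k, ('g list \<Rightarrow>\<^sub>0 'k) set) module" where
  "presented_algebra X R = quot_algebra (free_algebra X) (relation_ideal X R)"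

definition presented_gen ::
    "'g set \<Rightarrow> (('g list \<Rightarrow>\<^sub>0 'k::field) \<times> ('g list \<Rightarrow>\<^sub>0 'k)) set \<Rightarrow> 'g \<Rightarrow> ('g list \<Rightarrow>\<^sub>0 'k) set" where
  "presented_gen X R x =
     relation_ideal X R +>\<^bsub>free_algebra X :: ('k, _) module\<^esub> Poly_Mapping.single [x] 1"

text \<open>
  The algebra homomorphism from a presented algebra to \<open>N\<close> sending each generator \<open>x\<close> to \<open>g x\<close>.
  It evaluates an arbitrary representative of the residue class, hence is meaningful only if the
  elements \<open>g x\<close> satisfy the defining relations.
\<close>

definition presented_lift ::
    "('k::field, 'n) module \<Rightarrow> ('g \<Rightarrow> 'n) \<Rightarrow> ('g list \<Rightarrow>\<^sub>0 'k) set \<Rightarrow> 'n" where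
  "presented_lift N g X =
     the_elem (linear_extension N (\<lambda>w. foldr (\<lambda>x y. g x \<otimes>\<^bsub>N\<^esub> y) w \<one>\<^bsub>N\<^esub>) ` X)"


section \<open>Tensor products of algebras\<close>

text \<open>
  The underlying space of \<open>A \<otimes> B\<close> is the free vector space on the pairs \<open>(a, b)\<close> modulo the
  subspace spanned by the bilinearity relations. This free space is the monoid algebra of the
  multiplicative monoid of \<open>A \<times> B\<close>, and the subspace is an ideal in it, so that the quotient
  carries the product \<open>(a \<otimes> b) (a' \<otimes> b') = a a' \<otimes> b b'\<close>.
\<close>

definition bilinearity_relations ::
    "('k::field, 'a) module \<Rightarrow> ('k, 'b) module \<Rightarrow> (('a \<times> 'b) \<Rightarrow>\<^sub>0 'k) set" where
  "bilinearity_relations A B =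
     (let pair = (\<lambda>a b. Poly_Mapping.single (a, b) (1 :: 'k)) in
       {pair (a \<oplus>\<^bsub>A\<^esub> a') b - pair a b - pair a' b |a a' b.
          a \<in> carrier A \<and> a' \<in> carrier A \<and> b \<in> carrier B} \<union>
       {pair a (b \<oplus>\<^bsub>B\<^esub> b') - pair a b - pair a b' |a b b'.
          a \<in> carrier A \<and> b \<in> carrier B \<and> b' \<in> carrier B} \<union>
       {pair (r \<odot>\<^bsub>A\<^esub> a) b - Poly_Mapping.single (a, b) r |r a b.
          a \<in> carrier A \<and> b \<in> carrier B} \<union>
       {pair a (r \<odot>\<^bsub>B\<^esub> b) - Poly_Mapping.single (a, b) r |r a b.
          a \<in> carrier A \<and> b \<in> carrier B})"

definition tensor_kernel ::
    "('k::field, 'a) module \<Rightarrow> ('k, 'b) module \<Rightarrow> (('a \<times> 'b) \<Rightarrow>\<^sub>0 'k) set" where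
  "tensor_kernel A B =
     \<Inter>{N. submodule N (ground_algebra :: ('k, 'k) module) (monoid_algebra (A \<times>\<times> B)) \<and>
          bilinearity_relations A B \<subseteq> N}"

definition tensor_algebra ::
    "('k::field, 'a) module \<Rightarrow> ('k, 'b) module \<Rightarrow> ('k, (('a \<times> 'b) \<Rightarrow>\<^sub>0 'k) set) module" where
  "tensor_algebra A B = quot_algebra (monoid_algebra (A \<times>\<times> B)) (tensor_kernel A B)"

definition pure_tensor ::
    "('k::field, 'a) module \<Rightarrow> ('k, 'b) module \<Rightarrow> 'a \<Rightarrow> 'b \<Rightarrow> (('a \<times> 'b) \<Rightarrow>\<^sub>0 'k) set" where
  "pure_tensor A B a b =
     tensor_kernel A B +>\<^bsub>monoid_algebra (A \<times>\<times> B) :: ('k, _) module\<^esub> Poly_Mapping.single (a, b) 1"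

text \<open>The linear map sending \<open>a \<otimes> b\<close> to \<open>\<phi> a b\<close>, for a bilinear map \<open>\<phi>\<close> into \<open>N\<close>.\<close>

definition tensor_lift ::
    "('k::field, 'n) module \<Rightarrow> ('a \<Rightarrow> 'b \<Rightarrow> 'n) \<Rightarrow> (('a \<times> 'b) \<Rightarrow>\<^sub>0 'k) set \<Rightarrow> 'n" where
  "tensor_lift N \<phi> X = the_elem (linear_extension N (\<lambda>(a, b). \<phi> a b) ` X)"

definition tensor_map ::
    "('k::field, 'c) module \<Rightarrow> ('k, 'd) module \<Rightarrow> ('a \<Rightarrow> 'c) \<Rightarrow> ('b \<Rightarrow> 'd)
      \<Rightarrow> (('a \<times> 'b) \<Rightarrow>\<^sub>0 'k) set \<Rightarrow> (('c \<times> 'd) \<Rightarrow>\<^sub>0 'k) set" where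
  "tensor_map C D f g = tensor_lift (tensor_algebra C D) (\<lambda>a b. pure_tensor C D (f a) (g b))"

text \<open>The isomorphism from \<open>(A \<otimes> B) \<otimes> C\<close> to \<open>A \<otimes> (B \<otimes> C)\<close>.\<close>

definition tensor_assoc where
  "tensor_assoc A B C =
     (let N = tensor_algebra A (tensor_algebra B C) in
       tensor_lift N (\<lambda>x c. tensor_lift N
         (\<lambda>a b. pure_tensor A (tensor_algebra B C) a (pure_tensor B C b c)) x))"


section \<open>Hopf-Galois extensions of the ground field\<close>

locale hopf_algebra = assoc_algebra H for H :: "('k::field, 'h) module" (structure) +
  fixes \<Delta> :: "'h \<Rightarrow> (('h \<times> 'h) \<Rightarrow>\<^sub>0 'k) set"
    and \<epsilon> :: "'h \<Rightarrow> 'k"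
    and S :: "'h \<Rightarrow> 'h"
  assumes comult_hom: "\<Delta> \<in> alg_hom H (tensor_algebra H H)"
    and counit_hom: "\<epsilon> \<in> alg_hom H ground_algebra"
    and coassoc: "\<And>h. h \<in> carrier H \<Longrightarrow>
      tensor_assoc H H H (tensor_map (tensor_algebra H H) H \<Delta> id (\<Delta> h)) =
      tensor_map H (tensor_algebra H H) id \<Delta> (\<Delta> h)"
    and counit_left: "\<And>h. h \<in> carrier H \<Longrightarrow> tensor_lift H (\<lambda>a b. \<epsilon> a \<odot> b) (\<Delta> h) = h"
    and counit_right: "\<And>h. h \<in> carrier H \<Longrightarrow> tensor_lift H (\<lambda>a b. \<epsilon> b \<odot> a) (\<Delta> h) = h"
    and antipode_closed: "\<And>h. h \<in> carrier H \<Longrightarrow> S h \<in> carrier H"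
    and antipode_add: "\<And>g h. g \<in> carrier H \<Longrightarrow> h \<in> carrier H \<Longrightarrow> S (g \<oplus> h) = S g \<oplus> S h"
    and antipode_smult: "\<And>r h. h \<in> carrier H \<Longrightarrow> S (r \<odot> h) = r \<odot> S h"
    and antipode_left: "\<And>h. h \<in> carrier H \<Longrightarrow> tensor_lift H (\<lambda>a b. S a \<otimes> b) (\<Delta> h) = \<epsilon> h \<odot> \<one>"
    and antipode_right: "\<And>h. h \<in> carrier H \<Longrightarrow> tensor_lift H (\<lambda>a b. a \<otimes> S b) (\<Delta> h) = \<epsilon> h \<odot> \<one>"

locale comodule_algebra =
  H: hopf_algebra H \<Delta> \<epsilon> S + T: assoc_algebra T
  for H :: "('k::field, 'h) module" and \<Delta> \<epsilon> S and T :: "('k, 't) module" +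
  fixes \<beta> :: "'t \<Rightarrow> (('t \<times> 'h) \<Rightarrow>\<^sub>0 'k) set"
  assumes coaction_hom: "\<beta> \<in> alg_hom T (tensor_algebra T H)"
    and coaction_coassoc: "\<And>x. x \<in> carrier T \<Longrightarrow>
      tensor_assoc T H H (tensor_map (tensor_algebra T H) H \<beta> id (\<beta> x)) =
      tensor_map T (tensor_algebra H H) id \<Delta> (\<beta> x)"
    and coaction_counit: "\<And>x. x \<in> carrier T \<Longrightarrow> tensor_lift T (\<lambda>y h. \<epsilon> h \<odot>\<^bsub>T\<^esub> y) (\<beta> x) = x"

definition coinvariants ::
    "('k::field, 'h) module \<Rightarrow> ('k, 't) module \<Rightarrow> ('t \<Rightarrow> (('t \<times> 'h) \<Rightarrow>\<^sub>0 'k) set) \<Rightarrow> 't set" where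
  "coinvariants H T \<beta> = {x \<in> carrier T. \<beta> x = pure_tensor T H x \<one>\<^bsub>H\<^esub>}"

definition canonical_map ::
    "('k::field, 'h) module \<Rightarrow> ('k, 't) module \<Rightarrow> ('t \<Rightarrow> (('t \<times> 'h) \<Rightarrow>\<^sub>0 'k) set)
      \<Rightarrow> (('t \<times> 't) \<Rightarrow>\<^sub>0 'k) set \<Rightarrow> (('t \<times> 'h) \<Rightarrow>\<^sub>0 'k) set" where
  "canonical_map H T \<beta> =
     tensor_lift (tensor_algebra T H)
       (\<lambda>x y. pure_tensor T H x \<one>\<^bsub>H\<^esub> \<otimes>\<^bsub>tensor_algebra T H\<^esub> \<beta> y)"

text \<open>
  That the coinvariants are the ground field includes injectivity of \<open>r \<mapsto> r \<cdot> 1\<close>, that is,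
  \<open>T \<noteq> 0\<close>.
\<close>

locale hopf_galois_extension = comodule_algebra +
  assumes coinvariants_ground: "bij_betw (\<lambda>r. r \<odot>\<^bsub>T\<^esub> \<one>\<^bsub>T\<^esub>) UNIV (coinvariants H T \<beta>)"
    and canonical_map_bij: "bij_betw (canonical_map H T \<beta>)
      (carrier (tensor_algebra T T)) (carrier (tensor_algebra T H))"


section \<open>Symmetrizable Kac-Moody data\<close>

text \<open>
  The Cartan subalgebra is the type \<open>'t\<close> with scalar multiplication \<open>scaling\<close>; the pairing
  \<open>\<langle>h, \<xi>\<rangle>\<close> is function application \<open>\<xi> h\<close>. The form is only relevant on the linear dual.
\<close>

record ('i, 't) km_datum =
  index_set :: "'i set"
  scaling :: "rat \<Rightarrow> 't \<Rightarrow> 't"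
  simple_root :: "'i \<Rightarrow> 't \<Rightarrow> rat"
  simple_coroot :: "'i \<Rightarrow> 't"
  form :: "('t \<Rightarrow> rat) \<Rightarrow> ('t \<Rightarrow> rat) \<Rightarrow> rat"

definition cartan_dual :: "('i, 't::ab_group_add) km_datum \<Rightarrow> ('t \<Rightarrow> rat) set" where
  "cartan_dual K = {\<xi>. Vector_Spaces.linear (scaling K) (*) \<xi>}"

text \<open>
  The realization need not be minimal: \<open>dim t = 2 |I| - rank\<close> of the Cartan matrix
  is allowed but not imposed.
\<close>

locale symmetrizable_kac_moody =
  fixes K :: "('i, 't::ab_group_add) km_datum"
  assumes cartan_finite_dim: "\<exists>b. finite_dimensional_vector_space (scaling K) b"
    and finite_index: "finite (index_set K)"
    and root_dual: "\<And>i. i \<in> index_set K \<Longrightarrow> simple_root K i \<in> cartan_dual K"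
    and roots_independent: "\<And>c. (\<forall>h. (\<Sum>i\<in>index_set K. c i * simple_root K i h) = 0) \<Longrightarrow>
      \<forall>i\<in>index_set K. c i = 0"
    and coroots_independent: "\<And>c. (\<Sum>i\<in>index_set K. scaling K (c i) (simple_coroot K i)) = 0 \<Longrightarrow>
      \<forall>i\<in>index_set K. c i = 0"
    and cartan_diag: "\<And>i. i \<in> index_set K \<Longrightarrow> simple_root K i (simple_coroot K i) = 2"
    and cartan_int: "\<And>i j. i \<in> index_set K \<Longrightarrow> j \<in> index_set K \<Longrightarrow>
      simple_root K j (simple_coroot K i) \<in> \<int>"
    and cartan_nonpos: "\<And>i j. i \<in> index_set K \<Longrightarrow> j \<in> index_set K \<Longrightarrow> i \<noteq> j \<Longrightarrow>
      simple_root K j (simple_coroot K i) \<le> 0"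
    and cartan_zero: "\<And>i j. i \<in> index_set K \<Longrightarrow> j \<in> index_set K \<Longrightarrow>
      simple_root K j (simple_coroot K i) = 0 \<Longrightarrow> simple_root K i (simple_coroot K j) = 0"
    and form_add: "\<And>\<xi> \<mu> \<nu>. \<xi> \<in> cartan_dual K \<Longrightarrow> \<mu> \<in> cartan_dual K \<Longrightarrow> \<nu> \<in> cartan_dual K \<Longrightarrow>
      form K (\<lambda>h. \<xi> h + \<mu> h) \<nu> = form K \<xi> \<nu> + form K \<mu> \<nu>"
    and form_scale: "\<And>c \<xi> \<mu>. \<xi> \<in> cartan_dual K \<Longrightarrow> \<mu> \<in> cartan_dual K \<Longrightarrow>
      form K (\<lambda>h. c * \<xi> h) \<mu> = c * form K \<xi> \<mu>"
    and form_sym: "\<And>\<xi> \<mu>. \<xi> \<in> cartan_dual K \<Longrightarrow> \<mu> \<in> cartan_dual K \<Longrightarrow> form K \<xi> \<mu> = form K \<mu> \<xi>"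
    and form_nondegenerate: "\<And>\<xi>. \<xi> \<in> cartan_dual K \<Longrightarrow>
      (\<forall>\<mu>\<in>cartan_dual K. form K \<xi> \<mu> = 0) \<Longrightarrow> \<xi> = (\<lambda>h. 0)"
    and form_root: "\<And>i. i \<in> index_set K \<Longrightarrow>
      \<exists>n::nat. n > 0 \<and> form K (simple_root K i) (simple_root K i) = of_nat (2 * n)"
    and form_coroot: "\<And>i \<xi>. i \<in> index_set K \<Longrightarrow> \<xi> \<in> cartan_dual K \<Longrightarrow>
      \<xi> (simple_coroot K i) =
        2 * form K (simple_root K i) \<xi> / form K (simple_root K i) (simple_root K i)"

definition coroot_lattice :: "('i, 't::ab_group_add) km_datum \<Rightarrow> 't set" where
  "coroot_lattice K =
     {\<Sum>i\<in>index_set K. scaling K (of_int (n i)) (simple_coroot K i) |n :: 'i \<Rightarrow> int. True}"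

definition half_norm :: "('i, 't) km_datum \<Rightarrow> 'i \<Rightarrow> rat" where
  "half_norm K i = form K (simple_root K i) (simple_root K i) / 2"


section \<open>Quantum parameters\<close>

type_synonym laurent = "rat fls"

definition q_param :: laurent where
  "q_param = fps_to_fls (fps_exp 1)"

definition q_index :: "('i, 't) km_datum \<Rightarrow> 'i \<Rightarrow> laurent" where
  "q_index K i = q_param powi \<lfloor>half_norm K i\<rfloor>"

definition q_int :: "laurent \<Rightarrow> nat \<Rightarrow> laurent" where
  "q_int c n = (c ^ n - inverse c ^ n) / (c - inverse c)"

definition q_fact :: "laurent \<Rightarrow> nat \<Rightarrow> laurent" where
  "q_fact c n = (\<Prod>k=1..n. q_int c k)"

text \<open>The integer \<open>\<langle>h, \<alpha>\<^sub>i\<rangle>\<close>, for \<open>h\<close> in the coroot lattice.\<close>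

definition weight :: "('i, 't) km_datum \<Rightarrow> 't \<Rightarrow> 'i \<Rightarrow> int" where
  "weight K h i = \<lfloor>simple_root K i h\<rfloor>"

definition cartan_entry :: "('i, 't) km_datum \<Rightarrow> 'i \<Rightarrow> 'i \<Rightarrow> int" where
  "cartan_entry K i j = weight K (simple_coroot K i) j"

definition divided_power :: "(laurent, 'a) module \<Rightarrow> laurent \<Rightarrow> 'a \<Rightarrow> nat \<Rightarrow> 'a" where
  "divided_power A c x n = inverse (q_fact c n) \<odot>\<^bsub>A\<^esub> (x [^]\<^bsub>A\<^esub> n)"

definition serre_element :: "(laurent, 'a) module \<Rightarrow> laurent \<Rightarrow> nat \<Rightarrow> 'a \<Rightarrow> 'a \<Rightarrow> 'a" where
  "serre_element A c m x y =
     (\<Oplus>\<^bsub>A\<^esub>k\<in>{0..m}. (- 1) ^ k \<odot>\<^bsub>A\<^esub>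
        (divided_power A c x k \<otimes>\<^bsub>A\<^esub> y \<otimes>\<^bsub>A\<^esub> divided_power A c x (m - k)))"


section \<open>The Kashiwara algebra and the quantized enveloping algebra\<close>

text \<open>
  The same symbols serve as generators of both algebras: \<open>GenE i\<close> for \<open>e'\<^sub>i\<close> resp. \<open>\<^bold>e\<^sub>i\<close>,
  \<open>GenF i\<close> for \<open>f\<^sub>i\<close> resp. \<open>\<^bold>f\<^sub>i\<close>, and \<open>GenQ h\<close> for \<open>q\<^sup>h\<close> resp. \<open>\<^bold>q\<^sup>h\<close>.
\<close>

datatype ('i, 't) gen = GenE 'i | GenF 'i | GenQ 't

type_synonym ('i, 't) gen_poly = "('i, 't) gen list \<Rightarrow>\<^sub>0 laurent"

definition generators :: "('i, 't::ab_group_add) km_datum \<Rightarrow> ('i, 't) gen set" where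
  "generators K = GenE ` index_set K \<union> GenF ` index_set K \<union> GenQ ` coroot_lattice K"

text \<open>\<open>t\<^sub>i = q\<close> to the power of this element.\<close>

definition t_exponent :: "('i, 't) km_datum \<Rightarrow> 'i \<Rightarrow> 't" where
  "t_exponent K i = scaling K (half_norm K i) (simple_coroot K i)"

definition gen_var :: "('i, 't) gen \<Rightarrow> ('i, 't) gen_poly" where
  "gen_var x = Poly_Mapping.single [x] 1"

definition common_relations ::
    "('i, 't::ab_group_add) km_datum \<Rightarrow> (('i, 't) gen_poly \<times> ('i, 't) gen_poly) set" where
  "common_relations K =
     (let A = free_algebra (generators K) :: (laurent, ('i, 't) gen_poly) module;
          I = index_set K; P = coroot_lattice K;
          e = (\<lambda>i. gen_var (GenE i)); f = (\<lambda>i. gen_var (GenF i)); q = (\<lambda>h. gen_var (GenQ h));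
          serre = (\<lambda>x i j.
            serre_element A (q_index K i) (nat (1 - cartan_entry K i j)) (x i) (x j))
      in {(q 0, \<one>\<^bsub>A\<^esub>)} \<union>
         {(q h \<otimes>\<^bsub>A\<^esub> q h', q (h + h')) |h h'. h \<in> P \<and> h' \<in> P} \<union>
         {(q h \<otimes>\<^bsub>A\<^esub> e i \<otimes>\<^bsub>A\<^esub> q (- h), q_param powi (weight K h i) \<odot>\<^bsub>A\<^esub> e i) |h i.
            h \<in> P \<and> i \<in> I} \<union>
         {(q h \<otimes>\<^bsub>A\<^esub> f i \<otimes>\<^bsub>A\<^esub> q (- h), q_param powi (- weight K h i) \<odot>\<^bsub>A\<^esub> f i) |h i.
            h \<in> P \<and> i \<in> I} \<union>
         {(serre e i j, \<zero>\<^bsub>A\<^esub>) |i j. i \<in> I \<and> j \<in> I \<and> i \<noteq> j} \<union>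
         {(serre f i j, \<zero>\<^bsub>A\<^esub>) |i j. i \<in> I \<and> j \<in> I \<and> i \<noteq> j})"

definition kashiwara_relations ::
    "('i, 't::ab_group_add) km_datum \<Rightarrow> (('i, 't) gen_poly \<times> ('i, 't) gen_poly) set" where
  "kashiwara_relations K =
     (let A = free_algebra (generators K) :: (laurent, ('i, 't) gen_poly) module;
          e = (\<lambda>i. gen_var (GenE i)); f = (\<lambda>i. gen_var (GenF i))
      in common_relations K \<union>
         {(e i \<otimes>\<^bsub>A\<^esub> f j,
           (q_index K i powi (cartan_entry K i j) \<odot>\<^bsub>A\<^esub> (f j \<otimes>\<^bsub>A\<^esub> e i))
             \<oplus>\<^bsub>A\<^esub> (if i = j then \<one>\<^bsub>A\<^esub> else \<zero>\<^bsub>A\<^esub>)) |i j.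
            i \<in> index_set K \<and> j \<in> index_set K})"

definition quantum_group_relations ::
    "('i, 't::ab_group_add) km_datum \<Rightarrow> (('i, 't) gen_poly \<times> ('i, 't) gen_poly) set" where
  "quantum_group_relations K =
     (let A = free_algebra (generators K) :: (laurent, ('i, 't) gen_poly) module;
          e = (\<lambda>i. gen_var (GenE i)); f = (\<lambda>i. gen_var (GenF i)); q = (\<lambda>h. gen_var (GenQ h))
      in common_relations K \<union>
         {((e i \<otimes>\<^bsub>A\<^esub> f j) \<ominus>\<^bsub>A\<^esub> (f j \<otimes>\<^bsub>A\<^esub> e i),
           (if i = j
            then inverse (q_index K i - inverse (q_index K i)) \<odot>\<^bsub>A\<^esub>
              (q (t_exponent K i) \<ominus>\<^bsub>A\<^esub> q (- t_exponent K i))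
            else \<zero>\<^bsub>A\<^esub>)) |i j.
            i \<in> index_set K \<and> j \<in> index_set K})"

definition B_alg :: "('i, 't::ab_group_add) km_datum \<Rightarrow> (laurent, ('i, 't) gen_poly set) module" where
  "B_alg K = presented_algebra (generators K) (kashiwara_relations K)"

definition B_gen :: "('i, 't::ab_group_add) km_datum \<Rightarrow> ('i, 't) gen \<Rightarrow> ('i, 't) gen_poly set" where
  "B_gen K = presented_gen (generators K) (kashiwara_relations K)"

definition U_alg :: "('i, 't::ab_group_add) km_datum \<Rightarrow> (laurent, ('i, 't) gen_poly set) module" where
  "U_alg K = presented_algebra (generators K) (quantum_group_relations K)"

definition U_gen :: "('i, 't::ab_group_add) km_datum \<Rightarrow> ('i, 't) gen \<Rightarrow> ('i, 't) gen_poly set" where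
  "U_gen K = presented_gen (generators K) (quantum_group_relations K)"

definition U_t :: "('i, 't::ab_group_add) km_datum \<Rightarrow> 'i \<Rightarrow> ('i, 't) gen_poly set" where
  "U_t K i = U_gen K (GenQ (t_exponent K i))"

definition U_t_inv :: "('i, 't::ab_group_add) km_datum \<Rightarrow> 'i \<Rightarrow> ('i, 't) gen_poly set" where
  "U_t_inv K i = U_gen K (GenQ (- t_exponent K i))"


subsection \<open>The Hopf structure and the coaction\<close>

definition U_comult where
  "U_comult K =
     (let U = U_alg K; UU = tensor_algebra U U
      in presented_lift UU (\<lambda>x. case x of
           GenE i \<Rightarrow> pure_tensor U U (U_gen K (GenE i)) \<one>\<^bsub>U\<^esub>
             \<oplus>\<^bsub>UU\<^esub> pure_tensor U U (U_t K i) (U_gen K (GenE i))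
         | GenF i \<Rightarrow> pure_tensor U U (U_gen K (GenF i)) (U_t_inv K i)
             \<oplus>\<^bsub>UU\<^esub> pure_tensor U U \<one>\<^bsub>U\<^esub> (U_gen K (GenF i))
         | GenQ h \<Rightarrow> pure_tensor U U (U_gen K (GenQ h)) (U_gen K (GenQ h))))"

definition U_counit :: "('i, 't::ab_group_add) km_datum \<Rightarrow> ('i, 't) gen_poly set \<Rightarrow> laurent" where
  "U_counit K =
     presented_lift ground_algebra
       (\<lambda>x :: ('i, 't) gen. case x of GenE i \<Rightarrow> 0 | GenF i \<Rightarrow> 0 | GenQ h \<Rightarrow> 1)"

definition U_antipode ::
    "('i, 't::ab_group_add) km_datum \<Rightarrow> ('i, 't) gen_poly set \<Rightarrow> ('i, 't) gen_poly set" where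
  "U_antipode K =
     (let U = U_alg K
      in presented_lift (opposite_algebra U) (\<lambda>x. case x of
           GenE i \<Rightarrow> \<ominus>\<^bsub>U\<^esub> (U_t_inv K i \<otimes>\<^bsub>U\<^esub> U_gen K (GenE i))
         | GenF i \<Rightarrow> \<ominus>\<^bsub>U\<^esub> (U_gen K (GenF i) \<otimes>\<^bsub>U\<^esub> U_t K i)
         | GenQ h \<Rightarrow> U_gen K (GenQ (- h))))"

definition B_coaction_gen where
  "B_coaction_gen K x =
     (let B = B_alg K; U = U_alg K; BU = tensor_algebra B U
      in case x of
           GenE i \<Rightarrow>
             ((q_index K i - inverse (q_index K i)) \<odot>\<^bsub>BU\<^esub>
               pure_tensor B U \<one>\<^bsub>B\<^esub> (U_t_inv K i \<otimes>\<^bsub>U\<^esub> U_gen K (GenE i)))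
             \<oplus>\<^bsub>BU\<^esub> pure_tensor B U (B_gen K (GenE i)) (U_t_inv K i)
         | GenF i \<Rightarrow> pure_tensor B U (B_gen K (GenF i)) (U_t_inv K i)
             \<oplus>\<^bsub>BU\<^esub> pure_tensor B U \<one>\<^bsub>B\<^esub> (U_gen K (GenF i))
         | GenQ h \<Rightarrow> pure_tensor B U (B_gen K (GenQ h)) (U_gen K (GenQ h)))"

definition B_coaction where
  "B_coaction K = presented_lift (tensor_algebra (B_alg K) (U_alg K)) (B_coaction_gen K)"

end

theory Submission
  imports Defs
begin

text \<open>
  Write \<open>B\<close> and \<open>U\<close> for the two algebras, \<open>\<beta>\<close> for the coaction and \<open>c\<^sub>i = q\<^sub>i - q\<^sub>i\<^sup>-\<^sup>1\<close>.

  \<^emph>\<open>Why the canonical map is bijective.\<close>  One writes down its inverse.  In a Galois extension of the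
  ground field, \<open>h \<mapsto> can\<^sup>-\<^sup>1 (1 \<otimes> h)\<close> is an algebra homomorphism \<open>\<tau>\<close> from \<open>U\<close> to \<open>B\<^sup>o\<^sup>p \<otimes> B\<close>, and
  solving for its values on generators forces
  \<open>\<tau>(q\<^sup>h) = q\<^sup>-\<^sup>h \<otimes> q\<^sup>h\<close>,
  \<open>\<tau>(f\<^sub>i) = 1 \<otimes> f\<^sub>i - f\<^sub>i t\<^sub>i \<otimes> t\<^sub>i\<^sup>-\<^sup>1\<close> and
  \<open>\<tau>(e\<^sub>i) = c\<^sub>i\<^sup>-\<^sup>1 (t\<^sub>i\<^sup>-\<^sup>1 \<otimes> t\<^sub>i e'\<^sub>i - e'\<^sub>i \<otimes> 1)\<close>.
  Conversely these elements satisfy the defining relations of \<open>U\<close>, so that \<open>\<tau>\<close> exists, and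
  \<open>x \<otimes> h \<mapsto> x \<tau>(h)\<close> inverts the canonical map.  The two identities to be checked are inherited by products, so they
  need only be verified on generators (locale \<open>translation_map\<close>, \<open>B_hopf_galois\<close>).

  \<^emph>\<open>Why the coinvariants are the ground field.\<close>  If \<open>\<beta>(x) = x \<otimes> 1\<close>, then \<open>1 \<otimes> x\<close> and \<open>x \<otimes> 1\<close> have the same
  image under the canonical map, hence are equal, and a linear functional \<open>\<phi>\<close> on \<open>B\<close> with \<open>\<phi>(1) = 1\<close> gives
  \<open>x = \<phi>(x) 1\<close>.  Such a functional exists only if \<open>B \<noteq> 0\<close>, which is not visible from the presentation.
  It is read off from Kashiwara's action: the free algebra on \<open>I\<close>, modulo the ideal generated by
  the Serre elements, is acted upon by left multiplications \<open>f\<^sub>i\<close> and \<open>q\<close>-derivations \<open>e'\<^sub>i\<close>, and \<open>\<phi>(b)\<close> is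
  the constant term of \<open>b \<cdot> 1\<close> (\<open>B_functional_exists\<close>).

  \<^emph>\<open>Why the structure maps are well defined.\<close>  The comultiplication, the coaction and \<open>\<tau>\<close> all send
  a generator \<open>e\<^sub>i\<close> or \<open>f\<^sub>i\<close> to a sum \<open>X\<^sub>i + Y\<^sub>i\<close> with \<open>Y\<^sub>i X\<^sub>j = q\<^bsup>(\<alpha>\<^sub>i, \<alpha>\<^sub>j)\<^esup> X\<^sub>j Y\<^sub>i\<close>, in which \<open>X\<close> and \<open>Y\<close> are obtained
  from solutions of the Serre relations by multiplication with torus elements.  Two facts therefore cover
  every Serre relation that occurs: the relations survive torus twists (\<open>serre_element_twist\<close>),
  and they are additive under the displayed commutation rule (\<open>serre_element_add\<close>).  Both are proved by
  rewriting the Serre element, up to a nonzero scalar, as an iterated \<open>q\<close>-commutator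
  (\<open>q_ad\<close>, \<open>serre_element_eq_q_ad\<close>).  The same form shows that \<open>q\<close>-derivations commute with Serre elements up to a scalar,
  which is what Kashiwara's action needs.
\<close>

section \<open>Algebras and linear maps\<close>

lemma ground_algebra_simps [simp]:
  "carrier ground_algebra = UNIV"
  "x \<otimes>\<^bsub>ground_algebra\<^esub> y = x * y"
  "\<one>\<^bsub>ground_algebra\<^esub> = 1"
  "\<zero>\<^bsub>ground_algebra\<^esub> = 0"
  "x \<oplus>\<^bsub>ground_algebra\<^esub> y = x + y"
  "x \<odot>\<^bsub>ground_algebra\<^esub> y = x * y"
  by (simp_all add: ground_algebra_def)

lemma ground_algebra_cring: "cring (ground_algebra :: ('k::field, 'k) module)"
  by (rule cringI, rule abelian_groupI, simp_all add: algebra_simps)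
     (rule_tac exI[of _ "- x" for x], simp, rule comm_monoidI, simp_all add: algebra_simps)

lemma assoc_algebraI:
  fixes A :: "('k::field, 'a) module" (structure)
  assumes "ring A"
    and "\<And>r x. x \<in> carrier A \<Longrightarrow> r \<odot> x \<in> carrier A"
    and "\<And>r s x. x \<in> carrier A \<Longrightarrow> (r + s) \<odot> x = r \<odot> x \<oplus> s \<odot> x"
    and "\<And>r x y. x \<in> carrier A \<Longrightarrow> y \<in> carrier A \<Longrightarrow> r \<odot> (x \<oplus> y) = r \<odot> x \<oplus> r \<odot> y"
    and "\<And>r s x. x \<in> carrier A \<Longrightarrow> (r * s) \<odot> x = r \<odot> (s \<odot> x)"
    and "\<And>x. x \<in> carrier A \<Longrightarrow> 1 \<odot> x = x"
    and "\<And>r x y. x \<in> carrier A \<Longrightarrow> y \<in> carrier A \<Longrightarrow> (r \<odot> x) \<otimes> y = r \<odot> (x \<otimes> y)"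
    and "\<And>r x y. x \<in> carrier A \<Longrightarrow> y \<in> carrier A \<Longrightarrow> x \<otimes> (r \<odot> y) = r \<odot> (x \<otimes> y)"
  shows "assoc_algebra A"
proof -
  interpret ring A by fact
  show ?thesis
    by (intro assoc_algebra.intro assoc_algebra_axioms.intro Module.module.intro Module.module_axioms.intro
        ground_algebra_cring abelian_group_axioms ring_axioms) (simp_all add: assms)
qed

lemma ground_algebra_assoc: "assoc_algebra (ground_algebra :: ('k::field, 'k) module)"
  using ground_algebra_cring
  by (intro assoc_algebraI) (auto simp: cring_def algebra_simps)

context assoc_algebra
begin

lemma scalar_closed [simp, intro]: "x \<in> carrier A \<Longrightarrow> r \<odot> x \<in> carrier A"
  by (simp add: smult_closed)

lemma scalar_add_left: "x \<in> carrier A \<Longrightarrow> (r + s) \<odot> x = r \<odot> x \<oplus> s \<odot> x"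
  using smult_l_distr[of r s x] by simp

lemma scalar_add_right:
  "x \<in> carrier A \<Longrightarrow> y \<in> carrier A \<Longrightarrow> r \<odot> (x \<oplus> y) = r \<odot> x \<oplus> r \<odot> y"
  using smult_r_distr[of r x y] by simp

lemma scalar_scalar: "x \<in> carrier A \<Longrightarrow> r \<odot> (s \<odot> x) = (r * s) \<odot> x"
  using smult_assoc1[of r s x] by simp

lemma scalar_one [simp]: "x \<in> carrier A \<Longrightarrow> 1 \<odot> x = x"
  using smult_one[of x] by simp

lemma scalar_zero_left [simp]: "x \<in> carrier A \<Longrightarrow> 0 \<odot> x = \<zero>"
  using smult_l_null[of x] by simp

lemma scalar_zero_right [simp]: "r \<odot> \<zero> = \<zero>"
  using smult_r_null[of r] by simp

lemma uminus_eq_scalar: "x \<in> carrier A \<Longrightarrow> \<ominus> x = (- 1) \<odot> x"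
proof -
  assume x: "x \<in> carrier A"
  have "x \<oplus> (- 1) \<odot> x = \<zero>"
    using scalar_add_left[of x 1 "-1"] x by simp
  then show ?thesis
    using x by (simp add: minus_equality a_comm)
qed

lemma minus_eq_scalar: "x \<in> carrier A \<Longrightarrow> y \<in> carrier A \<Longrightarrow> x \<ominus> y = x \<oplus> (- 1) \<odot> y"
  by (simp add: a_minus_def uminus_eq_scalar)

lemma scalar_cancel: "x \<in> carrier A \<Longrightarrow> y \<in> carrier A \<Longrightarrow> r \<noteq> 0 \<Longrightarrow> r \<odot> x = r \<odot> y \<longleftrightarrow> x = y"
  by (metis divide_self_if scalar_one scalar_scalar times_divide_eq_left mult_1 inverse_eq_divide)

lemma scalar_eq_zero_iff: "x \<in> carrier A \<Longrightarrow> r \<noteq> 0 \<Longrightarrow> r \<odot> x = \<zero> \<longleftrightarrow> x = \<zero>"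
  using scalar_cancel[of x \<zero> r] by simp

lemma finsum_scalar:
  "finite I \<Longrightarrow> f \<in> I \<rightarrow> carrier A \<Longrightarrow> r \<odot> (\<Oplus>i\<in>I. f i) = (\<Oplus>i\<in>I. r \<odot> f i)"
  by (induction I rule: finite_induct) (auto simp: finsum_insert scalar_add_right Pi_def)

end

definition linear_maps :: "('k, 'a) module \<Rightarrow> ('k, 'b) module \<Rightarrow> ('a \<Rightarrow> 'b) set" where
  "linear_maps A B = {f \<in> carrier A \<rightarrow> carrier B.
     (\<forall>x\<in>carrier A. \<forall>y\<in>carrier A. f (x \<oplus>\<^bsub>A\<^esub> y) = f x \<oplus>\<^bsub>B\<^esub> f y) \<and>
     (\<forall>r. \<forall>x\<in>carrier A. f (r \<odot>\<^bsub>A\<^esub> x) = r \<odot>\<^bsub>B\<^esub> f x)}"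

lemma linear_mapsI:
  assumes "\<And>x. x \<in> carrier A \<Longrightarrow> f x \<in> carrier B"
    and "\<And>x y. x \<in> carrier A \<Longrightarrow> y \<in> carrier A \<Longrightarrow> f (x \<oplus>\<^bsub>A\<^esub> y) = f x \<oplus>\<^bsub>B\<^esub> f y"
    and "\<And>r x. x \<in> carrier A \<Longrightarrow> f (r \<odot>\<^bsub>A\<^esub> x) = r \<odot>\<^bsub>B\<^esub> f x"
  shows "f \<in> linear_maps A B"
  using assms by (auto simp: linear_maps_def)

lemma linear_mapsD:
  assumes "f \<in> linear_maps A B"
  shows "x \<in> carrier A \<Longrightarrow> f x \<in> carrier B"
    and "x \<in> carrier A \<Longrightarrow> y \<in> carrier A \<Longrightarrow> f (x \<oplus>\<^bsub>A\<^esub> y) = f x \<oplus>\<^bsub>B\<^esub> f y"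
    and "x \<in> carrier A \<Longrightarrow> f (r \<odot>\<^bsub>A\<^esub> x) = r \<odot>\<^bsub>B\<^esub> f x"
  using assms by (auto simp: linear_maps_def)

lemma linear_maps_zero:
  assumes "f \<in> linear_maps A B" "assoc_algebra A" "assoc_algebra B"
  shows "f \<zero>\<^bsub>A\<^esub> = \<zero>\<^bsub>B\<^esub>"
proof -
  interpret A: assoc_algebra A by fact
  interpret B: assoc_algebra B by fact
  have "f (0 \<odot>\<^bsub>A\<^esub> \<zero>\<^bsub>A\<^esub>) = 0 \<odot>\<^bsub>B\<^esub> f \<zero>\<^bsub>A\<^esub>" "f \<zero>\<^bsub>A\<^esub> \<in> carrier B"
    using linear_mapsD[OF assms(1)] by blast+
  then show ?thesis by simp
qed

lemma linear_maps_uminus: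
  assumes "f \<in> linear_maps A B" "assoc_algebra A" "assoc_algebra B" "x \<in> carrier A"
  shows "f (\<ominus>\<^bsub>A\<^esub> x) = \<ominus>\<^bsub>B\<^esub> f x"
proof -
  interpret A: assoc_algebra A by fact
  interpret B: assoc_algebra B by fact
  show ?thesis using linear_mapsD[OF assms(1)] assms(4)
    by (simp add: A.uminus_eq_scalar B.uminus_eq_scalar)
qed

lemma linear_maps_minus:
  assumes "f \<in> linear_maps A B" "assoc_algebra A" "assoc_algebra B" "x \<in> carrier A" "y \<in> carrier A"
  shows "f (x \<ominus>\<^bsub>A\<^esub> y) = f x \<ominus>\<^bsub>B\<^esub> f y"
proof -
  interpret A: assoc_algebra A by fact
  interpret B: assoc_algebra B by fact
  show ?thesis using linear_mapsD[OF assms(1)] assms(4,5) linear_maps_uminus[OF assms(1-3)]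
    by (simp add: a_minus_def)
qed

lemma linear_maps_finsum:
  assumes "f \<in> linear_maps A B" "assoc_algebra A" "assoc_algebra B" "finite I" "g \<in> I \<rightarrow> carrier A"
  shows "f (\<Oplus>\<^bsub>A\<^esub>i\<in>I. g i) = (\<Oplus>\<^bsub>B\<^esub>i\<in>I. f (g i))"
proof -
  interpret A: assoc_algebra A by fact
  interpret B: assoc_algebra B by fact
  note * = linear_mapsD[OF assms(1)]
  show ?thesis using assms(4,5)
  proof (induction I rule: finite_induct)
    case empty
    show ?case using linear_maps_zero[OF assms(1-3)] by simp
  next
    case (insert i I)
    then have "(\<lambda>i. f (g i)) \<in> I \<rightarrow> carrier B" "f (g i) \<in> carrier B" using *(1) by (auto simp: Pi_def)
    moreover have "g \<in> I \<rightarrow> carrier A" "g i \<in> carrier A" using insert by auto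
    ultimately show ?case using insert
      by (simp add: A.finsum_insert B.finsum_insert *)
  qed
qed

lemma linear_maps_comp:
  "f \<in> linear_maps A B \<Longrightarrow> g \<in> linear_maps B C \<Longrightarrow> (\<lambda>x. g (f x)) \<in> linear_maps A C"
  by (auto simp: linear_maps_def Pi_def)

lemma linear_maps_id: "(\<lambda>x. x) \<in> linear_maps A A"
  by (auto simp: linear_maps_def)

lemma alg_hom_iff:
  "f \<in> alg_hom A B \<longleftrightarrow> f \<in> linear_maps A B \<and>
     (\<forall>x\<in>carrier A. \<forall>y\<in>carrier A. f (x \<otimes>\<^bsub>A\<^esub> y) = f x \<otimes>\<^bsub>B\<^esub> f y) \<and> f \<one>\<^bsub>A\<^esub> = \<one>\<^bsub>B\<^esub>"
  by (auto simp: alg_hom_def linear_maps_def ring_hom_def)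

lemma alg_hom_linear: "f \<in> alg_hom A B \<Longrightarrow> f \<in> linear_maps A B"
  by (simp add: alg_hom_iff)

lemma alg_homI:
  assumes "f \<in> linear_maps A B"
    and "\<And>x y. x \<in> carrier A \<Longrightarrow> y \<in> carrier A \<Longrightarrow> f (x \<otimes>\<^bsub>A\<^esub> y) = f x \<otimes>\<^bsub>B\<^esub> f y"
    and "f \<one>\<^bsub>A\<^esub> = \<one>\<^bsub>B\<^esub>"
  shows "f \<in> alg_hom A B"
  using assms by (auto simp: alg_hom_iff)

lemma alg_homD:
  assumes "f \<in> alg_hom A B"
  shows "x \<in> carrier A \<Longrightarrow> f x \<in> carrier B"
    and "x \<in> carrier A \<Longrightarrow> y \<in> carrier A \<Longrightarrow> f (x \<oplus>\<^bsub>A\<^esub> y) = f x \<oplus>\<^bsub>B\<^esub> f y"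
    and "x \<in> carrier A \<Longrightarrow> f (r \<odot>\<^bsub>A\<^esub> x) = r \<odot>\<^bsub>B\<^esub> f x"
    and "x \<in> carrier A \<Longrightarrow> y \<in> carrier A \<Longrightarrow> f (x \<otimes>\<^bsub>A\<^esub> y) = f x \<otimes>\<^bsub>B\<^esub> f y"
    and "f \<one>\<^bsub>A\<^esub> = \<one>\<^bsub>B\<^esub>"
  using assms by (auto simp: alg_hom_iff linear_maps_def)

lemma alg_hom_comp:
  "f \<in> alg_hom A B \<Longrightarrow> g \<in> alg_hom B C \<Longrightarrow> (\<lambda>x. g (f x)) \<in> alg_hom A C"
  using linear_maps_comp[of f A B g C]
  by (auto simp: alg_hom_iff linear_mapsD)

lemma alg_hom_id: "(\<lambda>x. x) \<in> alg_hom A A"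
  by (auto simp: alg_hom_iff linear_maps_id)

lemma alg_hom_pow:
  assumes "f \<in> alg_hom A B" "assoc_algebra A" "x \<in> carrier A"
  shows "f (x [^]\<^bsub>A\<^esub> (n::nat)) = f x [^]\<^bsub>B\<^esub> n"
proof -
  interpret A: assoc_algebra A by fact
  show ?thesis using assms(3) by (induction n) (simp_all add: alg_homD[OF assms(1)])
qed

lemma opposite_algebra_simps [simp]:
  "carrier (opposite_algebra A) = carrier A"
  "x \<otimes>\<^bsub>opposite_algebra A\<^esub> y = y \<otimes>\<^bsub>A\<^esub> x"
  "\<one>\<^bsub>opposite_algebra A\<^esub> = \<one>\<^bsub>A\<^esub>"
  "\<zero>\<^bsub>opposite_algebra A\<^esub> = \<zero>\<^bsub>A\<^esub>"
  "add (opposite_algebra A) = add A"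
  "r \<odot>\<^bsub>opposite_algebra A\<^esub> x = r \<odot>\<^bsub>A\<^esub> x"
  by (simp_all add: opposite_algebra_def)

lemma opposite_algebra_add_monoid:
  "add_monoid (opposite_algebra A) = add_monoid A"
  by (simp add: opposite_algebra_def)

lemma opposite_algebra_finsum [simp]: "finsum (opposite_algebra A) f I = finsum A f I"
  by (simp add: finsum_def opposite_algebra_add_monoid)

lemma opposite_algebra_uminus [simp]: "\<ominus>\<^bsub>opposite_algebra A\<^esub> x = \<ominus>\<^bsub>A\<^esub> x"
  by (simp add: a_inv_def opposite_algebra_add_monoid)

lemma opposite_assoc_algebra:
  assumes "assoc_algebra A"
  shows "assoc_algebra (opposite_algebra A)"
proof -
  interpret assoc_algebra A by fact
  have "abelian_group (opposite_algebra A)"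
    using abelian_group_axioms
    by (simp add: abelian_group_def abelian_monoid_def abelian_group_axioms_def opposite_algebra_add_monoid)
  then have "ring (opposite_algebra A)"
    by (intro ringI monoidI) (simp_all add: m_assoc l_distr r_distr)
  then show ?thesis
    by (intro assoc_algebraI)
      (simp_all add: scalar_add_left scalar_add_right scalar_scalar smult_mult_left smult_mult_right)
qed

lemma opposite_algebra_pow:
  assumes "assoc_algebra A" "x \<in> carrier A"
  shows "x [^]\<^bsub>opposite_algebra A\<^esub> (n::nat) = x [^]\<^bsub>A\<^esub> n"
proof -
  interpret A: assoc_algebra A by fact
  interpret O: assoc_algebra "opposite_algebra A" by (rule opposite_assoc_algebra) fact
  show ?thesis using assms(2) A.nat_pow_comm[of x n 1] by (induction n) (simp_all, metis A.nat_pow_Suc A.nat_pow_Suc2)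
qed

section \<open>Monoid algebras\<close>

lemma lookup_map_times: "Poly_Mapping.lookup (Poly_Mapping.map ((*) r) p) k = r * Poly_Mapping.lookup p k"
  for r :: "'k::field"
  by (simp add: Poly_Mapping.map.rep_eq when_def)

lemma map_times_single: "Poly_Mapping.map ((*) r) (Poly_Mapping.single k c) = Poly_Mapping.single k (r * c)"
  for r :: "'k::field"
  by (rule poly_mapping_eqI) (simp add: lookup_map_times lookup_single when_def)

lemma monoid_algebra_carrier: "p \<in> carrier (monoid_algebra M) \<longleftrightarrow> Poly_Mapping.keys p \<subseteq> carrier M"
  by (simp add: monoid_algebra_def)

lemma monoid_algebra_simps:
  "\<one>\<^bsub>monoid_algebra M\<^esub> = Poly_Mapping.single \<one>\<^bsub>M\<^esub> 1"
  "\<zero>\<^bsub>monoid_algebra M\<^esub> = 0"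
  "p \<oplus>\<^bsub>monoid_algebra M\<^esub> q = p + q"
  "r \<odot>\<^bsub>monoid_algebra M\<^esub> p = Poly_Mapping.map ((*) r) p"
  by (simp_all add: monoid_algebra_def)

lemma monoid_algebra_single_closed:
  "m \<in> carrier M \<Longrightarrow> Poly_Mapping.single m c \<in> carrier (monoid_algebra M)"
  by (simp add: monoid_algebra_carrier)

lemma monoid_algebra_zero_closed: "0 \<in> carrier (monoid_algebra M)"
  by (simp add: monoid_algebra_carrier)

lemma monoid_algebra_add_closed:
  "p \<in> carrier (monoid_algebra M) \<Longrightarrow> q \<in> carrier (monoid_algebra M) \<Longrightarrow> p + q \<in> carrier (monoid_algebra M)"
  using keys_add[of p q] by (auto simp: monoid_algebra_carrier)

lemma monoid_algebra_smult_closed: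
  "p \<in> carrier (monoid_algebra M) \<Longrightarrow> Poly_Mapping.map ((*) r) p \<in> carrier (monoid_algebra M)"
  for r :: "'k::field"
  by (auto simp: monoid_algebra_carrier in_keys_iff lookup_map_times)

lemma poly_mapping_sum_singles:
  "p = (\<Sum>k\<in>Poly_Mapping.keys p. Poly_Mapping.single k (Poly_Mapping.lookup p k))"
proof (rule poly_mapping_eqI)
  fix k
  show "Poly_Mapping.lookup p k = Poly_Mapping.lookup
      (\<Sum>k\<in>Poly_Mapping.keys p. Poly_Mapping.single k (Poly_Mapping.lookup p k)) k"
    by (cases "k \<in> Poly_Mapping.keys p")
       (auto simp: lookup_sum lookup_single when_def in_keys_iff)
qed

lemma monoid_algebra_induct [consumes 1, case_names zero single add]:
  assumes "p \<in> carrier (monoid_algebra M)"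
    and zero: "P 0"
    and single: "\<And>m c. m \<in> carrier M \<Longrightarrow> P (Poly_Mapping.single m c)"
    and add: "\<And>p q. p \<in> carrier (monoid_algebra M) \<Longrightarrow> q \<in> carrier (monoid_algebra M) \<Longrightarrow>
       P p \<Longrightarrow> P q \<Longrightarrow> P (p + q)"
  shows "P p"
proof -
  have "finite K \<Longrightarrow> K \<subseteq> carrier M \<Longrightarrow>
     (\<Sum>k\<in>K. Poly_Mapping.single k (c k)) \<in> carrier (monoid_algebra M) \<and>
     P (\<Sum>k\<in>K. Poly_Mapping.single k (c k))" for K c
    by (induction K rule: finite_induct)
      (auto intro!: zero single add monoid_algebra_add_closed monoid_algebra_single_closed
         simp: monoid_algebra_zero_closed)
  from this[of "Poly_Mapping.keys p" "Poly_Mapping.lookup p"] show ?thesis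
    using assms(1) by (simp add: monoid_algebra_carrier flip: poly_mapping_sum_singles)
qed

lemma monoid_algebra_mult_add_left:
  "(p + p') \<otimes>\<^bsub>monoid_algebra M\<^esub> q = p \<otimes>\<^bsub>monoid_algebra M\<^esub> q + p' \<otimes>\<^bsub>monoid_algebra M\<^esub> q"
  unfolding monoid_algebra_def
  by simp (subst setsum_keys_plus_distrib, auto simp: algebra_simps single_add sum.distrib)

lemma monoid_algebra_mult_add_right:
  "p \<otimes>\<^bsub>monoid_algebra M\<^esub> (q + q') = p \<otimes>\<^bsub>monoid_algebra M\<^esub> q + p \<otimes>\<^bsub>monoid_algebra M\<^esub> q'"
  unfolding monoid_algebra_def
  by simp (subst setsum_keys_plus_distrib, auto simp: algebra_simps single_add sum.distrib)

lemma monoid_algebra_mult_single: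
  "Poly_Mapping.single a r \<otimes>\<^bsub>monoid_algebra M\<^esub> Poly_Mapping.single b s =
     Poly_Mapping.single (a \<otimes>\<^bsub>M\<^esub> b) (r * s)"
  by (simp add: monoid_algebra_def)

lemma monoid_algebra_mult_zero [simp]:
  "0 \<otimes>\<^bsub>monoid_algebra M\<^esub> q = 0" "q \<otimes>\<^bsub>monoid_algebra M\<^esub> 0 = 0"
  by (simp_all add: monoid_algebra_def)

lemma map_times_add:
  "Poly_Mapping.map ((*) r) (p + q) = Poly_Mapping.map ((*) r) p + Poly_Mapping.map ((*) r) q"
  for r :: "'k::field"
  by (rule poly_mapping_eqI) (simp add: lookup_map_times lookup_add algebra_simps)

lemma map_times_zero [simp]: "Poly_Mapping.map ((*) r) 0 = 0" for r :: "'k::field"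
  by (rule poly_mapping_eqI) (simp add: lookup_map_times)

lemma monoid_algebra_assoc_algebra:
  fixes M (structure)
  assumes "Group.monoid M"
  shows "assoc_algebra (monoid_algebra M :: ('k::field, _) module)"
proof -
  interpret M: Group.monoid M by fact
  let ?A = "monoid_algebra M :: ('k, _) module"
  have mclosed: "p \<otimes>\<^bsub>?A\<^esub> q \<in> carrier ?A" if "p \<in> carrier ?A" "q \<in> carrier ?A" for p q
    using that(1)
  proof (induction p rule: monoid_algebra_induct)
    case (single m c)
    show ?case using that(2)
      by (induction q rule: monoid_algebra_induct)
        (auto simp: monoid_algebra_zero_closed monoid_algebra_mult_add_right monoid_algebra_mult_single
          intro!: monoid_algebra_add_closed monoid_algebra_single_closed single)
  qed (auto simp: monoid_algebra_zero_closed monoid_algebra_mult_add_left monoid_algebra_add_closed)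
  have massoc: "(p \<otimes>\<^bsub>?A\<^esub> q) \<otimes>\<^bsub>?A\<^esub> r = p \<otimes>\<^bsub>?A\<^esub> (q \<otimes>\<^bsub>?A\<^esub> r)"
    if "p \<in> carrier ?A" "q \<in> carrier ?A" "r \<in> carrier ?A" for p q r
    using that(1)
  proof (induction p rule: monoid_algebra_induct)
    case (single m c)
    show ?case using that(2)
    proof (induction q rule: monoid_algebra_induct)
      case (single m' c')
      show ?case using that(3)
        by (induction r rule: monoid_algebra_induct)
          (simp_all add: monoid_algebra_mult_add_right monoid_algebra_mult_single mult.assoc M.m_assoc
             single \<open>m \<in> carrier M\<close>)
    qed (simp_all add: monoid_algebra_mult_add_left monoid_algebra_mult_add_right)
  qed (simp_all add: monoid_algebra_mult_add_left)
  have one: "\<one>\<^bsub>?A\<^esub> \<otimes>\<^bsub>?A\<^esub> p = p" "p \<otimes>\<^bsub>?A\<^esub> \<one>\<^bsub>?A\<^esub> = p" if "p \<in> carrier ?A" for p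
    using that by (induction p rule: monoid_algebra_induct)
      (simp_all add: monoid_algebra_simps monoid_algebra_mult_single monoid_algebra_mult_add_left
         monoid_algebra_mult_add_right)
  have "abelian_group ?A"
  proof (rule abelian_groupI)
    fix p assume "p \<in> carrier ?A"
    then show "\<exists>q\<in>carrier ?A. q \<oplus>\<^bsub>?A\<^esub> p = \<zero>\<^bsub>?A\<^esub>"
      by (intro bexI[of _ "Poly_Mapping.map ((*) (-1)) p"])
        (auto intro!: monoid_algebra_smult_closed poly_mapping_eqI
          simp: monoid_algebra_simps lookup_add lookup_map_times)
  qed (auto simp: monoid_algebra_simps monoid_algebra_zero_closed algebra_simps intro: monoid_algebra_add_closed)
  then have "ring ?A"
    by (intro ringI monoidI)
      (auto simp: mclosed massoc one monoid_algebra_mult_add_left monoid_algebra_mult_add_right,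
       auto simp: monoid_algebra_simps monoid_algebra_single_closed
         monoid_algebra_mult_add_left monoid_algebra_mult_add_right)
  then show ?thesis
  proof (rule assoc_algebraI)
    fix r p q assume "p \<in> carrier ?A" and q: "q \<in> carrier ?A"
    then show "r \<odot>\<^bsub>?A\<^esub> p \<otimes>\<^bsub>?A\<^esub> q = r \<odot>\<^bsub>?A\<^esub> (p \<otimes>\<^bsub>?A\<^esub> q)"
    proof (induction p rule: monoid_algebra_induct)
      case (single m c)
      show ?case using q
        by (induction q rule: monoid_algebra_induct)
          (simp_all add: monoid_algebra_simps map_times_single map_times_add monoid_algebra_mult_add_right
            monoid_algebra_mult_single mult.assoc)
    qed (simp_all add: monoid_algebra_simps map_times_add monoid_algebra_mult_add_left)
  next
    fix r p q assume "p \<in> carrier ?A" and q: "q \<in> carrier ?A"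
    then show "p \<otimes>\<^bsub>?A\<^esub> (r \<odot>\<^bsub>?A\<^esub> q) = r \<odot>\<^bsub>?A\<^esub> (p \<otimes>\<^bsub>?A\<^esub> q)"
    proof (induction p rule: monoid_algebra_induct)
      case (single m c)
      show ?case using q
        by (induction q rule: monoid_algebra_induct)
          (simp_all add: monoid_algebra_simps map_times_single map_times_add monoid_algebra_mult_add_right
            monoid_algebra_mult_single mult.left_commute)
    qed (simp_all add: monoid_algebra_simps map_times_add monoid_algebra_mult_add_left)
  qed (auto simp: monoid_algebra_simps monoid_algebra_smult_closed map_times_add
        intro!: poly_mapping_eqI simp: lookup_add lookup_map_times algebra_simps)
qed

text \<open>
  A linear extension is a sum over the support of its argument; enlarging the index set to any
  finite set containing the support makes additivity visible.
\<close>

lemma linear_extension_superset: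
  assumes "assoc_algebra N" "\<phi> \<in> X \<rightarrow> carrier N" "finite X" "Poly_Mapping.keys p \<subseteq> X"
  shows "linear_extension N \<phi> p = (\<Oplus>\<^bsub>N\<^esub>m\<in>X. Poly_Mapping.lookup p m \<odot>\<^bsub>N\<^esub> \<phi> m)"
proof -
  interpret N: assoc_algebra N by fact
  show ?thesis unfolding linear_extension_def
    by (rule N.add.finprod_mono_neutral_cong_left)
       (use assms in \<open>auto simp: in_keys_iff Pi_def\<close>)
qed

lemma linear_extension_single:
  assumes "assoc_algebra N" "\<phi> m \<in> carrier N"
  shows "linear_extension N \<phi> (Poly_Mapping.single m c) = c \<odot>\<^bsub>N\<^esub> \<phi> m"
proof -
  interpret N: assoc_algebra N by fact
  show ?thesis
    using linear_extension_superset[OF assms(1), of \<phi> "{m}" "Poly_Mapping.single m c"] assms(2)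
    by (simp add: N.finsum_insert)
qed

lemma linear_extension_linear:
  fixes M :: "('m, 'z) monoid_scheme" and N :: "('k::field, 'n) module"
  assumes "assoc_algebra N" and \<phi>: "\<phi> \<in> carrier M \<rightarrow> carrier N"
  shows "linear_extension N \<phi> \<in> linear_maps (monoid_algebra M) N"
proof -
  interpret N: assoc_algebra N by fact
  let ?A = "monoid_algebra M :: ('k, 'm \<Rightarrow>\<^sub>0 'k) module"
  show ?thesis
  proof (rule linear_mapsI)
    fix p assume "p \<in> carrier ?A"
    then show "linear_extension N \<phi> p \<in> carrier N"
      using \<phi> unfolding linear_extension_def
      by (intro N.finsum_closed) (auto simp: monoid_algebra_carrier Pi_def)
  next
    fix p q assume pq: "p \<in> carrier ?A" "q \<in> carrier ?A"
    let ?X = "Poly_Mapping.keys p \<union> Poly_Mapping.keys q"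
    have X: "\<phi> \<in> ?X \<rightarrow> carrier N" using pq \<phi> by (auto simp: monoid_algebra_carrier Pi_def)
    note * = linear_extension_superset[OF assms(1) X]
    have "linear_extension N \<phi> (p + q) = (\<Oplus>\<^bsub>N\<^esub>m\<in>?X. Poly_Mapping.lookup (p + q) m \<odot>\<^bsub>N\<^esub> \<phi> m)"
      using keys_add[of p q] by (intro *) auto
    also have "\<dots> = (\<Oplus>\<^bsub>N\<^esub>m\<in>?X. Poly_Mapping.lookup p m \<odot>\<^bsub>N\<^esub> \<phi> m \<oplus>\<^bsub>N\<^esub> Poly_Mapping.lookup q m \<odot>\<^bsub>N\<^esub> \<phi> m)"
      using X by (intro N.finsum_cong') (auto simp: lookup_add Pi_iff intro!: N.scalar_add_left)
    also have "\<dots> = linear_extension N \<phi> p \<oplus>\<^bsub>N\<^esub> linear_extension N \<phi> q"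
      using X by (subst N.finsum_addf) (auto simp: * Pi_def)
    finally show "linear_extension N \<phi> (p \<oplus>\<^bsub>?A\<^esub> q) = linear_extension N \<phi> p \<oplus>\<^bsub>N\<^esub> linear_extension N \<phi> q"
      by (simp add: monoid_algebra_simps)
  next
    fix r p assume p: "p \<in> carrier ?A"
    let ?X = "Poly_Mapping.keys p"
    have X: "\<phi> \<in> ?X \<rightarrow> carrier N" using p \<phi> by (auto simp: monoid_algebra_carrier Pi_def)
    note * = linear_extension_superset[OF assms(1) X]
    have "linear_extension N \<phi> (Poly_Mapping.map ((*) r) p) =
      (\<Oplus>\<^bsub>N\<^esub>m\<in>?X. r \<odot>\<^bsub>N\<^esub> (Poly_Mapping.lookup p m \<odot>\<^bsub>N\<^esub> \<phi> m))"
      using X by (subst *) (auto simp: lookup_map_times in_keys_iff N.scalar_scalar Pi_def intro!: N.finsum_cong')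
    also have "\<dots> = r \<odot>\<^bsub>N\<^esub> linear_extension N \<phi> p"
      using X by (subst N.finsum_scalar[symmetric]) (auto simp: linear_extension_def Pi_def)
    finally show "linear_extension N \<phi> (r \<odot>\<^bsub>?A\<^esub> p) = r \<odot>\<^bsub>N\<^esub> linear_extension N \<phi> p"
      by (simp add: monoid_algebra_simps)
  qed
qed

lemma linear_extension_hom:
  fixes M :: "('m, 'z) monoid_scheme" and N :: "('k::field, 'n) module"
  assumes "assoc_algebra N" "Group.monoid M" and \<phi>: "\<phi> \<in> hom M N" "\<phi> \<one>\<^bsub>M\<^esub> = \<one>\<^bsub>N\<^esub>"
  shows "linear_extension N \<phi> \<in> alg_hom (monoid_algebra M) N"
proof -
  interpret N: assoc_algebra N by fact
  interpret M: Group.monoid M by fact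
  have \<phi>c: "\<phi> \<in> carrier M \<rightarrow> carrier N" and \<phi>m:
    "\<And>a b. a \<in> carrier M \<Longrightarrow> b \<in> carrier M \<Longrightarrow> \<phi> (a \<otimes>\<^bsub>M\<^esub> b) = \<phi> a \<otimes>\<^bsub>N\<^esub> \<phi> b"
    using \<phi> by (auto simp: hom_def)
  let ?A = "monoid_algebra M :: ('k, 'm \<Rightarrow>\<^sub>0 'k) module" and ?f = "linear_extension N \<phi>"
  interpret A: assoc_algebra ?A by (rule monoid_algebra_assoc_algebra) fact
  have lin: "?f \<in> linear_maps ?A N" by (rule linear_extension_linear) fact+
  have fs: "?f (Poly_Mapping.single m c) = c \<odot>\<^bsub>N\<^esub> \<phi> m" if "m \<in> carrier M" for m c
    using that \<phi>c by (intro linear_extension_single) (auto simp: assms)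
  have f0: "?f 0 = \<zero>\<^bsub>N\<^esub>"
    using linear_maps_zero[OF lin A.assoc_algebra_axioms N.assoc_algebra_axioms] by (simp add: monoid_algebra_simps)
  have fa: "?f (p + q) = ?f p \<oplus>\<^bsub>N\<^esub> ?f q" if "p \<in> carrier ?A" "q \<in> carrier ?A" for p q
    using linear_mapsD(2)[OF lin that] by (simp add: monoid_algebra_simps)
  have mc: "m \<in> carrier M \<Longrightarrow> \<phi> m \<in> carrier N" for m using \<phi>c by auto
  show ?thesis
  proof (rule alg_homI[OF lin])
    fix p q assume "p \<in> carrier ?A" and q: "q \<in> carrier ?A"
    then show "?f (p \<otimes>\<^bsub>?A\<^esub> q) = ?f p \<otimes>\<^bsub>N\<^esub> ?f q"
    proof (induction p rule: monoid_algebra_induct)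
      case zero
      then show ?case using linear_mapsD(1)[OF lin q] by (simp add: f0)
    next
      case (single m c)
      show ?case using q
      proof (induction q rule: monoid_algebra_induct)
        case zero
        then show ?case using single by (simp add: f0 fs mc)
      next
        case (single m' c')
        then show ?case using \<open>m \<in> carrier M\<close>
          by (simp add: monoid_algebra_mult_single fs mc \<phi>m N.smult_mult_left N.smult_mult_right N.scalar_scalar mult.commute)
      next
        case (add p q)
        moreover have "Poly_Mapping.single m c \<in> carrier ?A"
          using \<open>m \<in> carrier M\<close> by (rule monoid_algebra_single_closed)
        ultimately show ?case
          by (simp add: monoid_algebra_mult_add_right fa N.r_distr linear_mapsD(1)[OF lin])
      qed
    next
      case (add p p')
      then show ?case using q
        by (simp add: monoid_algebra_mult_add_left fa N.l_distr linear_mapsD(1)[OF lin])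
    qed
  next
    show "?f \<one>\<^bsub>?A\<^esub> = \<one>\<^bsub>N\<^esub>" by (simp add: monoid_algebra_simps fs \<phi>)
  qed
qed

section \<open>Quotient algebras\<close>

locale algebra_ideal = assoc_algebra A + ideal J A for A :: "('k::field, 'a) module" (structure) and J
begin

abbreviation Q where "Q \<equiv> quot_algebra A J"

lemma scalar_mem: "x \<in> J \<Longrightarrow> r \<odot> x \<in> J"
proof -
  assume x: "x \<in> J"
  have "r \<odot> x = (r \<odot> \<one>) \<otimes> x" using a_Hcarr[OF x] by (simp add: smult_mult_left)
  then show ?thesis using I_l_closed[OF x, of "r \<odot> \<one>"] by simp
qed

lemma quot_simps:
  "carrier Q = a_rcosets J" "monoid.mult Q = rcoset_mult A J" "\<one>\<^bsub>Q\<^esub> = J +> \<one>" "\<zero>\<^bsub>Q\<^esub> = J"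
  "add Q = set_add A" "module.smult Q = (\<lambda>r C. \<Union>x\<in>C. J +> (r \<odot> x))"
  by (simp_all add: quot_algebra_def ring.defs module.defs FactRing_def)

lemma quot_carrierE:
  assumes "X \<in> carrier Q" obtains x where "x \<in> carrier A" "X = J +> x"
  using assms by (auto simp: quot_simps A_RCOSETS_defs a_r_coset_def[symmetric])

lemma quot_closed: "x \<in> carrier A \<Longrightarrow> J +> x \<in> carrier Q"
  by (simp add: quot_simps a_rcosetsI a_subset)

lemma coset_eq_iff: "x \<in> carrier A \<Longrightarrow> y \<in> carrier A \<Longrightarrow> J +> x = J +> y \<longleftrightarrow> x \<ominus> y \<in> J"
  by (metis a_rcos_module_minus a_repr_independence' a_repr_independenceD ring_axioms)

lemma coset_eq_zero_iff: "x \<in> carrier A \<Longrightarrow> J +> x = \<zero>\<^bsub>Q\<^esub> \<longleftrightarrow> x \<in> J"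
  by (metis a_rcos_const a_rcos_self quot_simps(4))

lemma coset_mult: "x \<in> carrier A \<Longrightarrow> y \<in> carrier A \<Longrightarrow> (J +> x) \<otimes>\<^bsub>Q\<^esub> (J +> y) = J +> (x \<otimes> y)"
  by (simp add: quot_simps rcoset_mult_add)

lemma coset_add: "x \<in> carrier A \<Longrightarrow> y \<in> carrier A \<Longrightarrow> (J +> x) \<oplus>\<^bsub>Q\<^esub> (J +> y) = J +> (x \<oplus> y)"
  by (simp add: quot_simps a_rcos_sum)

lemma coset_smult: assumes x: "x \<in> carrier A" shows "r \<odot>\<^bsub>Q\<^esub> (J +> x) = J +> (r \<odot> x)"
proof -
  have "J +> (r \<odot> y) = J +> (r \<odot> x)" if y: "y \<in> J +> x" for y
  proof -
    have yc: "y \<in> carrier A" using y x a_elemrcos_carrier by blast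
    have "y \<ominus> x \<in> J" using y x yc by (simp add: a_rcos_module_minus ring_axioms)
    then have "r \<odot> (y \<ominus> x) \<in> J" by (rule scalar_mem)
    also have "r \<odot> (y \<ominus> x) = r \<odot> y \<ominus> r \<odot> x"
      using x yc by (simp add: minus_eq_scalar scalar_add_right scalar_scalar)
    finally show ?thesis using x yc by (simp add: coset_eq_iff)
  qed
  then have "r \<odot>\<^bsub>Q\<^esub> (J +> x) = (\<Union>y\<in>J +> x. J +> (r \<odot> x))"
    by (simp add: quot_simps)
  also have "\<dots> = J +> (r \<odot> x)" using a_rcos_self[OF x] by blast
  finally show ?thesis .
qed

lemma quot_ring: "ring Q"
proof -
  interpret F: ring "A Quot J" by (rule quotient_is_ring)
  have eq: "carrier Q = carrier (A Quot J)" "monoid.mult Q = monoid.mult (A Quot J)"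
    "\<one>\<^bsub>Q\<^esub> = \<one>\<^bsub>A Quot J\<^esub>" "\<zero>\<^bsub>Q\<^esub> = \<zero>\<^bsub>A Quot J\<^esub>" "add Q = add (A Quot J)"
    by (simp_all add: quot_simps FactRing_def)
  have "abelian_group Q"
    by (rule abelian_groupI; unfold eq)
      (auto simp: F.a_ac intro: F.add.l_inv_ex)
  then show ?thesis
    by (rule ringI; (intro monoidI)?; unfold eq)
      (auto simp: F.m_assoc F.l_distr F.r_distr)
qed

lemma quot_assoc_algebra: "assoc_algebra Q"
  by (rule assoc_algebraI[OF quot_ring]; (elim quot_carrierE, simp add: coset_smult coset_add coset_mult
      quot_closed scalar_scalar scalar_add_left scalar_add_right smult_mult_left smult_mult_right))

lemma coset_hom: "(\<lambda>x. J +> x) \<in> alg_hom A Q"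
  by (rule alg_homI, rule linear_mapsI)
    (simp_all add: coset_smult coset_add coset_mult quot_closed quot_simps(3))

lemma quot_lift:
  assumes f: "f \<in> linear_maps A N" and N: "assoc_algebra N" and f0: "\<And>j. j \<in> J \<Longrightarrow> f j = \<zero>\<^bsub>N\<^esub>"
    and x: "x \<in> carrier A"
  shows "the_elem (f ` (J +> x)) = f x"
proof -
  interpret N: assoc_algebra N by fact
  have "f y = f x" if y: "y \<in> J +> x" for y
  proof -
    obtain j where j: "j \<in> J" "y = j \<oplus> x" using y by (auto simp: a_r_coset_def r_coset_def)
    show ?thesis using j f0[OF j(1)] x a_Hcarr[OF j(1)] linear_mapsD[OF f] by simp
  qed
  moreover have "x \<in> J +> x" using x by (rule a_rcos_self)
  ultimately have "f ` (J +> x) = {f x}" by blast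
  then show ?thesis by simp
qed

lemma quot_lift_linear:
  assumes "f \<in> linear_maps A N" "assoc_algebra N" "\<And>j. j \<in> J \<Longrightarrow> f j = \<zero>\<^bsub>N\<^esub>"
  shows "(\<lambda>X. the_elem (f ` X)) \<in> linear_maps Q N"
  using linear_mapsD[OF assms(1)]
  by (intro linear_mapsI; (elim quot_carrierE, simp add: coset_smult coset_add quot_lift[OF assms]))

lemma quot_lift_hom:
  assumes "f \<in> alg_hom A N" "assoc_algebra N" "\<And>j. j \<in> J \<Longrightarrow> f j = \<zero>\<^bsub>N\<^esub>"
  shows "(\<lambda>X. the_elem (f ` X)) \<in> alg_hom Q N"
proof -
  have l: "f \<in> linear_maps A N" using assms(1) by (rule alg_hom_linear)
  show ?thesis
    using alg_homD[OF assms(1)]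
    by (intro alg_homI quot_lift_linear l assms(2,3);
      (elim quot_carrierE)?, simp add: coset_mult quot_simps(3) quot_lift[OF l assms(2,3)])
qed

end


section \<open>Presented algebras\<close>

definition eval_word :: "('k, 'n) module \<Rightarrow> ('g \<Rightarrow> 'n) \<Rightarrow> 'g list \<Rightarrow> 'n" where
  "eval_word N g w = foldr (\<lambda>x y. g x \<otimes>\<^bsub>N\<^esub> y) w \<one>\<^bsub>N\<^esub>"

definition free_lift :: "('k::field, 'n) module \<Rightarrow> ('g \<Rightarrow> 'n) \<Rightarrow> ('g list \<Rightarrow>\<^sub>0 'k) \<Rightarrow> 'n" where
  "free_lift N g = linear_extension N (eval_word N g)"

lemma free_monoid_monoid: "Group.monoid (free_monoid X)"
  by (rule monoidI) (auto simp: free_monoid_def)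

lemma free_algebra_assoc: "assoc_algebra (free_algebra X)"
  unfolding free_algebra_def by (rule monoid_algebra_assoc_algebra) (rule free_monoid_monoid)

lemma eval_word_closed:
  assumes "assoc_algebra N" "g \<in> X \<rightarrow> carrier N" "w \<in> lists X"
  shows "eval_word N g w \<in> carrier N"
proof -
  interpret N: assoc_algebra N by fact
  show ?thesis using assms(3) assms(2) by (induction w) (auto simp: eval_word_def)
qed

lemma free_lift_hom:
  assumes "assoc_algebra N" "g \<in> X \<rightarrow> carrier N"
  shows "free_lift N g \<in> alg_hom (free_algebra X) N"
proof -
  interpret N: assoc_algebra N by fact
  have "eval_word N g (v @ w) = eval_word N g v \<otimes>\<^bsub>N\<^esub> eval_word N g w"
    if "v \<in> lists X" "w \<in> lists X" for v w
    using that(1)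
  proof (induction v)
    case Nil
    show ?case using eval_word_closed[OF assms that(2)] by (simp add: eval_word_def)
  next
    case (Cons x v)
    then have "g x \<in> carrier N" "eval_word N g v \<in> carrier N"
      using eval_word_closed[OF assms, of v] assms(2) by auto
    with Cons eval_word_closed[OF assms that(2)] show ?case
      by (simp add: eval_word_def N.m_assoc)
  qed
  then have "eval_word N g \<in> hom (free_monoid X) N"
    using eval_word_closed[OF assms] by (auto simp: hom_def free_monoid_def)
  then show ?thesis unfolding free_lift_def free_algebra_def
    by (rule linear_extension_hom[OF assms(1) free_monoid_monoid])
      (simp add: eval_word_def free_monoid_def)
qed

lemma free_gen_closed: "x \<in> X \<Longrightarrow> Poly_Mapping.single [x] c \<in> carrier (free_algebra X)"
  unfolding free_algebra_def by (rule monoid_algebra_single_closed) (simp add: free_monoid_def)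

lemma free_lift_gen:
  assumes "assoc_algebra N" "g x \<in> carrier N"
  shows "free_lift N g (Poly_Mapping.single [x] 1) = g x"
proof -
  interpret N: assoc_algebra N by fact
  show ?thesis unfolding free_lift_def
    by (subst linear_extension_single) (use assms in \<open>auto simp: eval_word_def\<close>)
qed

lemma free_algebra_induct [consumes 1, case_names one gen smult add mult]:
  fixes p :: "'g list \<Rightarrow>\<^sub>0 'k::field"
  assumes "p \<in> carrier (free_algebra X)"
    and one: "P \<one>\<^bsub>free_algebra X\<^esub>"
    and gen: "\<And>x. x \<in> X \<Longrightarrow> P (Poly_Mapping.single [x] 1)"
    and smult: "\<And>r p. p \<in> carrier (free_algebra X) \<Longrightarrow> P p \<Longrightarrow> P (r \<odot>\<^bsub>free_algebra X\<^esub> p)"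
    and add: "\<And>p q. p \<in> carrier (free_algebra X) \<Longrightarrow> q \<in> carrier (free_algebra X) \<Longrightarrow>
       P p \<Longrightarrow> P q \<Longrightarrow> P (p \<oplus>\<^bsub>free_algebra X\<^esub> q)"
    and mult: "\<And>p q. p \<in> carrier (free_algebra X) \<Longrightarrow> q \<in> carrier (free_algebra X) \<Longrightarrow>
       P p \<Longrightarrow> P q \<Longrightarrow> P (p \<otimes>\<^bsub>free_algebra X\<^esub> q)"
  shows "P p"
proof -
  let ?A = "free_algebra X :: ('k, 'g list \<Rightarrow>\<^sub>0 'k) module"
  interpret A: assoc_algebra ?A by (rule free_algebra_assoc)
  have word: "P (Poly_Mapping.single w 1)" if "w \<in> lists X" for w
    using that
  proof (induction w)
    case Nil
    show ?case using one by (simp add: free_algebra_def monoid_algebra_simps free_monoid_def)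
  next
    case (Cons x w)
    have "Poly_Mapping.single (x # w) (1::'k) = Poly_Mapping.single [x] 1 \<otimes>\<^bsub>?A\<^esub> Poly_Mapping.single w 1"
      by (simp add: free_algebra_def monoid_algebra_mult_single free_monoid_def)
    moreover have "Poly_Mapping.single w (1::'k) \<in> carrier ?A"
      unfolding free_algebra_def by (rule monoid_algebra_single_closed) (use Cons in \<open>simp add: free_monoid_def\<close>)
    ultimately show ?case using Cons by (auto intro!: mult gen free_gen_closed)
  qed
  show ?thesis using assms(1) unfolding free_algebra_def
  proof (induction p rule: monoid_algebra_induct)
    case zero
    show ?case using smult[OF A.one_closed one, of 0] by (simp add: A.scalar_zero_left)
        (simp add: free_algebra_def monoid_algebra_simps)
  next
    case (single m c)
    have "P (c \<odot>\<^bsub>?A\<^esub> Poly_Mapping.single m 1)"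
      using single by (intro smult word) (auto simp: free_algebra_def free_monoid_def monoid_algebra_carrier)
    then show ?case by (simp add: free_algebra_def monoid_algebra_simps map_times_single)
  next
    case (add p q)
    then show ?case using assms(5)[of p q] by (simp add: free_algebra_def monoid_algebra_simps)
  qed
qed

locale presentation =
  fixes X :: "'g set" and R :: "(('g list \<Rightarrow>\<^sub>0 'k::field) \<times> ('g list \<Rightarrow>\<^sub>0 'k)) set"
  assumes relations_closed: "R \<subseteq> carrier (free_algebra X) \<times> carrier (free_algebra X)"
begin

abbreviation "FA \<equiv> free_algebra X :: ('k, 'g list \<Rightarrow>\<^sub>0 'k) module"
abbreviation "PA \<equiv> presented_algebra X R"

sublocale FA: assoc_algebra FA by (rule free_algebra_assoc)

lemma difference_closed: "{u \<ominus>\<^bsub>FA\<^esub> v |u v. (u, v) \<in> R} \<subseteq> carrier FA"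
  using relations_closed by auto

sublocale algebra_ideal FA "relation_ideal X R"
proof -
  have "ideal (relation_ideal X R) FA"
    unfolding relation_ideal_def by (rule FA.genideal_ideal) (rule difference_closed)
  then show "algebra_ideal FA (relation_ideal X R)"
    by (intro algebra_ideal.intro FA.assoc_algebra_axioms)
qed

lemma assoc_presented: "assoc_algebra PA"
  unfolding presented_algebra_def by (rule quot_assoc_algebra)

lemma gen_closed: "x \<in> X \<Longrightarrow> presented_gen X R x \<in> carrier PA"
  unfolding presented_algebra_def presented_gen_def by (rule quot_closed) (rule free_gen_closed)

abbreviation cls where "cls p \<equiv> relation_ideal X R +>\<^bsub>FA\<^esub> p"

lemma cls_hom: "(\<lambda>p. cls p) \<in> alg_hom FA PA"
  unfolding presented_algebra_def by (rule coset_hom)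

lemma cls_relation: assumes "(u, v) \<in> R" shows "cls u = cls v"
proof -
  have "u \<ominus>\<^bsub>FA\<^esub> v \<in> relation_ideal X R"
    unfolding relation_ideal_def using FA.genideal_self[OF difference_closed] assms by blast
  then show ?thesis using relations_closed assms by (subst coset_eq_iff) auto
qed

lemma presented_induct [consumes 1, case_names one gen smult add mult]:
  assumes "z \<in> carrier PA"
    and one: "P \<one>\<^bsub>PA\<^esub>"
    and gen: "\<And>x. x \<in> X \<Longrightarrow> P (presented_gen X R x)"
    and smult: "\<And>r p. p \<in> carrier PA \<Longrightarrow> P p \<Longrightarrow> P (r \<odot>\<^bsub>PA\<^esub> p)"
    and add: "\<And>p q. p \<in> carrier PA \<Longrightarrow> q \<in> carrier PA \<Longrightarrow> P p \<Longrightarrow> P q \<Longrightarrow> P (p \<oplus>\<^bsub>PA\<^esub> q)"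
    and mult: "\<And>p q. p \<in> carrier PA \<Longrightarrow> q \<in> carrier PA \<Longrightarrow> P p \<Longrightarrow> P q \<Longrightarrow> P (p \<otimes>\<^bsub>PA\<^esub> q)"
  shows "P z"
proof -
  obtain p where p: "p \<in> carrier FA" "z = cls p"
    using assms(1) unfolding presented_algebra_def by (rule quot_carrierE)
  note h = alg_homD[OF cls_hom]
  have "P (cls p)" using p(1)
  proof (induction p rule: free_algebra_induct)
    case (gen x)
    then show ?case using assms(3)[of x] by (simp add: presented_gen_def)
  qed (auto simp: h intro!: assms)
  then show ?thesis using p by simp
qed

text \<open>The kernel of the evaluation map is an ideal containing all differences \<open>u - v\<close>.\<close>

lemma free_lift_relation_ideal:
  assumes N: "assoc_algebra N" and g: "g \<in> X \<rightarrow> carrier N"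
    and rel: "\<And>u v. (u, v) \<in> R \<Longrightarrow> free_lift N g u = free_lift N g v"
    and j: "j \<in> relation_ideal X R"
  shows "free_lift N g j = \<zero>\<^bsub>N\<^esub>"
proof -
  interpret N: assoc_algebra N by fact
  have h: "free_lift N g \<in> alg_hom FA N" by (rule free_lift_hom) fact+
  let ?K = "{p \<in> carrier FA. free_lift N g p = \<zero>\<^bsub>N\<^esub>}"
  have "ideal ?K FA"
    using alg_homD[OF h] linear_maps_zero[OF alg_hom_linear[OF h] FA.assoc_algebra_axioms N]
      linear_maps_uminus[OF alg_hom_linear[OF h] FA.assoc_algebra_axioms N]
    by (intro idealI) (auto intro!: FA.ring_axioms group.subgroupI FA.a_group simp flip: a_inv_def)
  moreover have "{u \<ominus>\<^bsub>FA\<^esub> v |u v. (u, v) \<in> R} \<subseteq> ?K"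
    using relations_closed rel linear_mapsD[OF alg_hom_linear[OF h]]
      linear_maps_minus[OF alg_hom_linear[OF h] FA.assoc_algebra_axioms N]
    by (auto simp: N.r_neg a_minus_def)
  ultimately have "relation_ideal X R \<subseteq> ?K"
    unfolding relation_ideal_def by (rule FA.genideal_minimal)
  then show ?thesis using j by auto
qed

lemma presented_lift_hom:
  assumes "assoc_algebra N" "g \<in> X \<rightarrow> carrier N"
    and "\<And>u v. (u, v) \<in> R \<Longrightarrow> free_lift N g u = free_lift N g v"
  shows "presented_lift N g \<in> alg_hom PA N"
proof -
  have "presented_lift N g = (\<lambda>X. the_elem (free_lift N g ` X))"
    by (rule ext) (simp add: presented_lift_def free_lift_def eval_word_def[abs_def])
  then show ?thesis unfolding presented_algebra_def
    using quot_lift_hom[OF free_lift_hom[OF assms(1,2)] assms(1) free_lift_relation_ideal[OF assms]]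
    by simp
qed

lemma presented_lift_gen:
  assumes "assoc_algebra N" "g \<in> X \<rightarrow> carrier N"
    and "\<And>u v. (u, v) \<in> R \<Longrightarrow> free_lift N g u = free_lift N g v" and "x \<in> X"
  shows "presented_lift N g (presented_gen X R x) = g x"
proof -
  have "presented_lift N g = (\<lambda>X. the_elem (free_lift N g ` X))"
    by (rule ext) (simp add: presented_lift_def free_lift_def eval_word_def[abs_def])
  then have "presented_lift N g (presented_gen X R x) = free_lift N g (Poly_Mapping.single [x] 1)"
    unfolding presented_gen_def
    using quot_lift[OF alg_hom_linear[OF free_lift_hom[OF assms(1,2)]] assms(1) free_lift_relation_ideal[OF assms(1-3)]
        free_gen_closed[OF assms(4)]] by simp
  then show ?thesis using assms by (simp add: free_lift_gen Pi_def)
qed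

end

section \<open>Tensor products\<close>

locale algebra_pair = A: assoc_algebra A + B: assoc_algebra B
  for A :: "('k::field, 'a) module" and B :: "('k, 'b) module"
begin

abbreviation "MA \<equiv> monoid_algebra (A \<times>\<times> B) :: ('k, ('a \<times> 'b) \<Rightarrow>\<^sub>0 'k) module"
abbreviation "TP \<equiv> tensor_algebra A B"
abbreviation tens (infixl \<open>\<otimes>\<otimes>\<close> 75) where "a \<otimes>\<otimes> b \<equiv> pure_tensor A B a b"

lemma DirProd_monoid': "Group.monoid (A \<times>\<times> B)"
  by (intro DirProd_monoid A.monoid_axioms B.monoid_axioms)

sublocale MA: assoc_algebra MA
  by (rule monoid_algebra_assoc_algebra) (rule DirProd_monoid')

lemma submoduleI':
  assumes "N \<subseteq> carrier MA" "0 \<in> N" "\<And>x y. x \<in> N \<Longrightarrow> y \<in> N \<Longrightarrow> x + y \<in> N"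
    and "\<And>r x. x \<in> N \<Longrightarrow> Poly_Mapping.map ((*) r) x \<in> N"
  shows "submodule N (ground_algebra :: ('k, 'k) module) MA"
proof (rule MA.submoduleI)
  fix x assume "x \<in> N"
  then show "\<ominus>\<^bsub>MA\<^esub> x \<in> N"
    using assms(1) assms(4)[of x "- 1"] by (subst MA.uminus_eq_scalar) (auto simp: monoid_algebra_simps)
qed (use assms in \<open>auto simp: monoid_algebra_simps\<close>)

lemma submodule_carrier: "submodule (carrier MA) (ground_algebra :: ('k, 'k) module) MA"
  by (rule MA.carrier_is_submodule)

lemma MA_minus: "p \<in> carrier MA \<Longrightarrow> q \<in> carrier MA \<Longrightarrow> p \<ominus>\<^bsub>MA\<^esub> q = p - q"
  by (rule poly_mapping_eqI)
    (simp add: MA.minus_eq_scalar monoid_algebra_simps lookup_add lookup_map_times lookup_minus)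

lemma bilinearity_relations_closed: "bilinearity_relations A B \<subseteq> carrier MA"
proof -
  have s: "Poly_Mapping.single (a, b) c \<in> carrier MA" if "a \<in> carrier A" "b \<in> carrier B" for a b c
    using that by (intro monoid_algebra_single_closed) simp
  have d: "p - q \<in> carrier MA" if "p \<in> carrier MA" "q \<in> carrier MA" for p q
    using MA.minus_closed[OF that] that by (simp add: MA_minus)
  show ?thesis unfolding bilinearity_relations_def Let_def
    by (auto intro!: d s)
qed

lemma kernel_submodule: "submodule (tensor_kernel A B) (ground_algebra :: ('k, 'k) module) MA"
proof (rule submoduleI')
  show "tensor_kernel A B \<subseteq> carrier MA"
    unfolding tensor_kernel_def using submodule_carrier bilinearity_relations_closed by auto
  note E = MA.submoduleE[of _, unfolded monoid_algebra_simps]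
  show "0 \<in> tensor_kernel A B"
    unfolding tensor_kernel_def
    by (auto dest: subgroup.one_closed[OF submodule.axioms(1)] simp: monoid_algebra_simps)
  show "x + y \<in> tensor_kernel A B" if "x \<in> tensor_kernel A B" "y \<in> tensor_kernel A B" for x y
    using that E(5) unfolding tensor_kernel_def by auto
  show "Poly_Mapping.map ((*) r) x \<in> tensor_kernel A B" if "x \<in> tensor_kernel A B" for r x
    using that E(4)[of _ r x] unfolding tensor_kernel_def by auto
qed

lemma kernel_relations: "bilinearity_relations A B \<subseteq> tensor_kernel A B"
  unfolding tensor_kernel_def by auto

lemma kernel_minimal:
  assumes "submodule N (ground_algebra :: ('k, 'k) module) MA" "bilinearity_relations A B \<subseteq> N"
  shows "tensor_kernel A B \<subseteq> N"
  unfolding tensor_kernel_def using assms by auto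

lemma kernelD:
  "0 \<in> tensor_kernel A B"
  "x \<in> tensor_kernel A B \<Longrightarrow> y \<in> tensor_kernel A B \<Longrightarrow> x + y \<in> tensor_kernel A B"
  "x \<in> tensor_kernel A B \<Longrightarrow> Poly_Mapping.map ((*) r) x \<in> tensor_kernel A B"
  using MA.submoduleE(5)[OF kernel_submodule, of x y] MA.submoduleE(4)[OF kernel_submodule, of r x]
    subgroup.one_closed[OF submodule.axioms(1)[OF kernel_submodule]]
  by (auto simp: monoid_algebra_simps)

lemma bilinearity_relationsE:
  assumes "u \<in> bilinearity_relations A B"
  obtains (add_left) x y z where "u = Poly_Mapping.single (x \<oplus>\<^bsub>A\<^esub> y, z) 1 - Poly_Mapping.single (x, z) 1
      - Poly_Mapping.single (y, z) 1" "x \<in> carrier A" "y \<in> carrier A" "z \<in> carrier B"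
  | (add_right) x z w where "u = Poly_Mapping.single (x, z \<oplus>\<^bsub>B\<^esub> w) 1 - Poly_Mapping.single (x, z) 1
      - Poly_Mapping.single (x, w) 1" "x \<in> carrier A" "z \<in> carrier B" "w \<in> carrier B"
  | (smult_left) s x z where "u = Poly_Mapping.single (s \<odot>\<^bsub>A\<^esub> x, z) 1 - Poly_Mapping.single (x, z) s"
      "x \<in> carrier A" "z \<in> carrier B"
  | (smult_right) s x z where "u = Poly_Mapping.single (x, s \<odot>\<^bsub>B\<^esub> z) 1 - Poly_Mapping.single (x, z) s"
      "x \<in> carrier A" "z \<in> carrier B"
  using assms unfolding bilinearity_relations_def Let_def
  by (elim UnE CollectE exE conjE)
    ((rule add_left, assumption+) | (rule add_right, assumption+) |
     (rule smult_left, assumption+) | (rule smult_right, assumption+))+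

lemma bilinearity_relationsI:
  "x \<in> carrier A \<Longrightarrow> y \<in> carrier A \<Longrightarrow> z \<in> carrier B \<Longrightarrow>
     Poly_Mapping.single (x \<oplus>\<^bsub>A\<^esub> y, z) 1 - Poly_Mapping.single (x, z) 1 - Poly_Mapping.single (y, z) 1
       \<in> bilinearity_relations A B"
  "x \<in> carrier A \<Longrightarrow> z \<in> carrier B \<Longrightarrow> w \<in> carrier B \<Longrightarrow>
     Poly_Mapping.single (x, z \<oplus>\<^bsub>B\<^esub> w) 1 - Poly_Mapping.single (x, z) 1 - Poly_Mapping.single (x, w) 1
       \<in> bilinearity_relations A B"
  "x \<in> carrier A \<Longrightarrow> z \<in> carrier B \<Longrightarrow>
     Poly_Mapping.single (s \<odot>\<^bsub>A\<^esub> x, z) 1 - Poly_Mapping.single (x, z) s \<in> bilinearity_relations A B"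
  "x \<in> carrier A \<Longrightarrow> z \<in> carrier B \<Longrightarrow>
     Poly_Mapping.single (x, s \<odot>\<^bsub>B\<^esub> z) 1 - Poly_Mapping.single (x, z) s \<in> bilinearity_relations A B"
  unfolding bilinearity_relations_def Let_def by blast+

text \<open>
  Multiplying a bilinearity relation by a monomial \<open>r (a, b)\<close> gives \<open>r\<close> times another
  bilinearity relation; this is why the span of the relations is a two-sided ideal.
\<close>

lemma monomial_times_relation:
  assumes "u \<in> bilinearity_relations A B" and ab: "a \<in> carrier A" "b \<in> carrier B"
  shows "\<exists>v\<in>bilinearity_relations A B. Poly_Mapping.single (a, b) r \<otimes>\<^bsub>MA\<^esub> u = Poly_Mapping.map ((*) r) v"
    and "\<exists>v\<in>bilinearity_relations A B. u \<otimes>\<^bsub>MA\<^esub> Poly_Mapping.single (a, b) r = Poly_Mapping.map ((*) r) v"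
proof -
  have diff: "p \<otimes>\<^bsub>MA\<^esub> (x - y) = p \<otimes>\<^bsub>MA\<^esub> x - p \<otimes>\<^bsub>MA\<^esub> y" "(x - y) \<otimes>\<^bsub>MA\<^esub> p = x \<otimes>\<^bsub>MA\<^esub> p - y \<otimes>\<^bsub>MA\<^esub> p" for p x y
    using monoid_algebra_mult_add_right[where M = "A \<times>\<times> B" and p = p and q = "x - y" and q' = y]
      monoid_algebra_mult_add_left[where M = "A \<times>\<times> B" and p = "x - y" and p' = y and q = p]
    by (simp_all add: algebra_simps)
  have sdiff: "Poly_Mapping.map ((*) r) (x - y) = Poly_Mapping.map ((*) r) x - Poly_Mapping.map ((*) r) y"
    for x y :: "('a \<times> 'b) \<Rightarrow>\<^sub>0 'k"
    by (rule poly_mapping_eqI) (simp add: lookup_map_times lookup_minus algebra_simps)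
  note simps = diff sdiff monoid_algebra_mult_single map_times_single
     A.r_distr B.r_distr A.l_distr B.l_distr A.smult_mult_left A.smult_mult_right
     B.smult_mult_left B.smult_mult_right
  show "\<exists>v\<in>bilinearity_relations A B. Poly_Mapping.single (a, b) r \<otimes>\<^bsub>MA\<^esub> u = Poly_Mapping.map ((*) r) v"
    using assms(1)
  proof (cases rule: bilinearity_relationsE)
    case (add_left x y z)
    show ?thesis
      by (rule bexI[OF _ bilinearity_relationsI(1)[of "a \<otimes>\<^bsub>A\<^esub> x" "a \<otimes>\<^bsub>A\<^esub> y" "b \<otimes>\<^bsub>B\<^esub> z"]])
        (simp_all add: add_left ab simps)
  next
    case (add_right x z w)
    show ?thesis
      by (rule bexI[OF _ bilinearity_relationsI(2)[of "a \<otimes>\<^bsub>A\<^esub> x" "b \<otimes>\<^bsub>B\<^esub> z" "b \<otimes>\<^bsub>B\<^esub> w"]])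
        (simp_all add: add_right ab simps)
  next
    case (smult_left s x z)
    show ?thesis
      by (rule bexI[OF _ bilinearity_relationsI(3)[of "a \<otimes>\<^bsub>A\<^esub> x" "b \<otimes>\<^bsub>B\<^esub> z" s]])
        (simp_all add: smult_left ab simps)
  next
    case (smult_right s x z)
    show ?thesis
      by (rule bexI[OF _ bilinearity_relationsI(4)[of "a \<otimes>\<^bsub>A\<^esub> x" "b \<otimes>\<^bsub>B\<^esub> z" s]])
        (simp_all add: smult_right ab simps)
  qed
  show "\<exists>v\<in>bilinearity_relations A B. u \<otimes>\<^bsub>MA\<^esub> Poly_Mapping.single (a, b) r = Poly_Mapping.map ((*) r) v"
    using assms(1)
  proof (cases rule: bilinearity_relationsE)
    case (add_left x y z)
    show ?thesis
      by (rule bexI[OF _ bilinearity_relationsI(1)[of "x \<otimes>\<^bsub>A\<^esub> a" "y \<otimes>\<^bsub>A\<^esub> a" "z \<otimes>\<^bsub>B\<^esub> b"]])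
        (simp_all add: add_left ab simps)
  next
    case (add_right x z w)
    show ?thesis
      by (rule bexI[OF _ bilinearity_relationsI(2)[of "x \<otimes>\<^bsub>A\<^esub> a" "z \<otimes>\<^bsub>B\<^esub> b" "w \<otimes>\<^bsub>B\<^esub> b"]])
        (simp_all add: add_right ab simps)
  next
    case (smult_left s x z)
    show ?thesis
      by (rule bexI[OF _ bilinearity_relationsI(3)[of "x \<otimes>\<^bsub>A\<^esub> a" "z \<otimes>\<^bsub>B\<^esub> b" s]])
        (simp_all add: smult_left ab simps mult.commute)
  next
    case (smult_right s x z)
    show ?thesis
      by (rule bexI[OF _ bilinearity_relationsI(4)[of "x \<otimes>\<^bsub>A\<^esub> a" "z \<otimes>\<^bsub>B\<^esub> b" s]])
        (simp_all add: smult_right ab simps mult.commute)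
  qed
qed

text \<open>
  The elements whose products with all monomials lie in the span form a subspace containing the relations.
\<close>

lemma kernel_mult:
  assumes q: "q \<in> carrier MA" and p: "p \<in> tensor_kernel A B"
  shows "q \<otimes>\<^bsub>MA\<^esub> p \<in> tensor_kernel A B" "p \<otimes>\<^bsub>MA\<^esub> q \<in> tensor_kernel A B"
proof -
  let ?N = "{p \<in> carrier MA. \<forall>a\<in>carrier A. \<forall>b\<in>carrier B. \<forall>r.
     Poly_Mapping.single (a, b) r \<otimes>\<^bsub>MA\<^esub> p \<in> tensor_kernel A B \<and>
     p \<otimes>\<^bsub>MA\<^esub> Poly_Mapping.single (a, b) r \<in> tensor_kernel A B}"
  have s: "Poly_Mapping.single (a, b) c \<in> carrier MA" if "a \<in> carrier A" "b \<in> carrier B" for a b c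
    using that by (intro monoid_algebra_single_closed) simp
  have "submodule ?N (ground_algebra :: ('k, 'k) module) MA"
  proof (rule submoduleI')
    fix x y assume "x \<in> ?N" "y \<in> ?N"
    then show "x + y \<in> ?N"
      by (auto simp: monoid_algebra_add_closed monoid_algebra_mult_add_left monoid_algebra_mult_add_right
          intro!: kernelD)
  next
    fix x r assume x: "x \<in> ?N"
    have "Poly_Mapping.single (a, b) t \<otimes>\<^bsub>MA\<^esub> Poly_Mapping.map ((*) r) x =
        Poly_Mapping.map ((*) r) (Poly_Mapping.single (a, b) t \<otimes>\<^bsub>MA\<^esub> x)"
      "Poly_Mapping.map ((*) r) x \<otimes>\<^bsub>MA\<^esub> Poly_Mapping.single (a, b) t =
        Poly_Mapping.map ((*) r) (x \<otimes>\<^bsub>MA\<^esub> Poly_Mapping.single (a, b) t)"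
      if "a \<in> carrier A" "b \<in> carrier B" for a b t
      using MA.smult_mult_right[of "Poly_Mapping.single (a, b) t" x r]
        MA.smult_mult_left[of x "Poly_Mapping.single (a, b) t" r] s[OF that] x
      by (simp_all add: monoid_algebra_simps)
    then show "Poly_Mapping.map ((*) r) x \<in> ?N"
      using x by (auto intro!: monoid_algebra_smult_closed kernelD)
  qed (auto simp: monoid_algebra_zero_closed kernelD)
  moreover have "bilinearity_relations A B \<subseteq> ?N"
  proof (rule subsetI, rule CollectI, intro conjI ballI allI)
    fix u a b r
    assume u: "u \<in> bilinearity_relations A B"
    show "u \<in> carrier MA" using u bilinearity_relations_closed by (rule rev_subsetD)
    assume ab: "a \<in> carrier A" "b \<in> carrier B"
    show "Poly_Mapping.single (a, b) r \<otimes>\<^bsub>MA\<^esub> u \<in> tensor_kernel A B"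
      using monomial_times_relation(1)[OF u ab, of r] kernelD(3) subsetD[OF kernel_relations] by fastforce
    show "u \<otimes>\<^bsub>MA\<^esub> Poly_Mapping.single (a, b) r \<in> tensor_kernel A B"
      using monomial_times_relation(2)[OF u ab, of r] kernelD(3) subsetD[OF kernel_relations] by fastforce
  qed
  ultimately have pN: "p \<in> ?N" using kernel_minimal p by blast
  show "q \<otimes>\<^bsub>MA\<^esub> p \<in> tensor_kernel A B"
    using q by (induction q rule: monoid_algebra_induct)
      (use pN in \<open>auto simp: kernelD monoid_algebra_mult_add_left\<close>)
  show "p \<otimes>\<^bsub>MA\<^esub> q \<in> tensor_kernel A B"
    using q by (induction q rule: monoid_algebra_induct)
      (use pN in \<open>auto simp: kernelD monoid_algebra_mult_add_right\<close>)
qed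

sublocale K: algebra_ideal MA "tensor_kernel A B"
proof -
  have "ideal (tensor_kernel A B) MA"
    using kernel_mult submodule.axioms(1)[OF kernel_submodule]
    by (intro idealI) (auto intro!: MA.ring_axioms)
  then show "algebra_ideal MA (tensor_kernel A B)"
    by (intro algebra_ideal.intro MA.assoc_algebra_axioms)
qed

lemma tensor_assoc_algebra: "assoc_algebra TP"
  unfolding tensor_algebra_def by (rule K.quot_assoc_algebra)

sublocale T: assoc_algebra TP by (rule tensor_assoc_algebra)

lemma single_closed [simp]:
  "a \<in> carrier A \<Longrightarrow> b \<in> carrier B \<Longrightarrow> Poly_Mapping.single (a, b) c \<in> carrier MA"
  by (intro monoid_algebra_single_closed) simp

lemma tens_closed [simp, intro]: "a \<in> carrier A \<Longrightarrow> b \<in> carrier B \<Longrightarrow> a \<otimes>\<otimes> b \<in> carrier TP"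
  unfolding pure_tensor_def tensor_algebra_def by (intro K.quot_closed) simp

lemma tens_mult:
  assumes "a \<in> carrier A" "b \<in> carrier B" "a' \<in> carrier A" "b' \<in> carrier B"
  shows "(a \<otimes>\<otimes> b) \<otimes>\<^bsub>TP\<^esub> (a' \<otimes>\<otimes> b') = (a \<otimes>\<^bsub>A\<^esub> a') \<otimes>\<otimes> (b \<otimes>\<^bsub>B\<^esub> b')"
  using assms unfolding pure_tensor_def tensor_algebra_def
  by (subst K.coset_mult) (auto simp: monoid_algebra_mult_single)

lemma tens_one: "\<one>\<^bsub>TP\<^esub> = \<one>\<^bsub>A\<^esub> \<otimes>\<otimes> \<one>\<^bsub>B\<^esub>"
  unfolding pure_tensor_def tensor_algebra_def
  by (simp add: K.quot_simps monoid_algebra_simps)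

lemma MA_add_eq: "p \<oplus>\<^bsub>MA\<^esub> q = p + q" by (simp add: monoid_algebra_simps)

lemma tens_add_left:
  assumes "a \<in> carrier A" "a' \<in> carrier A" "b \<in> carrier B"
  shows "(a \<oplus>\<^bsub>A\<^esub> a') \<otimes>\<otimes> b = (a \<otimes>\<otimes> b) \<oplus>\<^bsub>TP\<^esub> (a' \<otimes>\<otimes> b)"
proof -
  have "Poly_Mapping.single (a \<oplus>\<^bsub>A\<^esub> a', b) 1 - (Poly_Mapping.single (a, b) 1 + Poly_Mapping.single (a', b) 1)
    \<in> tensor_kernel A B"
    by (rule subsetD[OF kernel_relations])
      (use assms in \<open>simp add: bilinearity_relationsI(1) diff_diff_eq[symmetric]\<close>)
  then show ?thesis using assms unfolding pure_tensor_def tensor_algebra_def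
    by (simp add: K.coset_add K.coset_eq_iff MA_add_eq MA_minus monoid_algebra_add_closed)
qed

lemma tens_add_right:
  assumes "a \<in> carrier A" "b \<in> carrier B" "b' \<in> carrier B"
  shows "a \<otimes>\<otimes> (b \<oplus>\<^bsub>B\<^esub> b') = (a \<otimes>\<otimes> b) \<oplus>\<^bsub>TP\<^esub> (a \<otimes>\<otimes> b')"
proof -
  have "Poly_Mapping.single (a, b \<oplus>\<^bsub>B\<^esub> b') 1 - (Poly_Mapping.single (a, b) 1 + Poly_Mapping.single (a, b') 1)
    \<in> tensor_kernel A B"
    by (rule subsetD[OF kernel_relations])
      (use assms in \<open>simp add: bilinearity_relationsI(2) diff_diff_eq[symmetric]\<close>)
  then show ?thesis using assms unfolding pure_tensor_def tensor_algebra_def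
    by (simp add: K.coset_add K.coset_eq_iff MA_add_eq MA_minus monoid_algebra_add_closed)
qed

lemma tens_smult_left:
  assumes "a \<in> carrier A" "b \<in> carrier B"
  shows "(r \<odot>\<^bsub>A\<^esub> a) \<otimes>\<otimes> b = r \<odot>\<^bsub>TP\<^esub> (a \<otimes>\<otimes> b)"
proof -
  have "Poly_Mapping.single (r \<odot>\<^bsub>A\<^esub> a, b) 1 - Poly_Mapping.single (a, b) r \<in> tensor_kernel A B"
    by (rule subsetD[OF kernel_relations])
      (use assms in \<open>simp add: bilinearity_relationsI(3)\<close>)
  then show ?thesis using assms unfolding pure_tensor_def tensor_algebra_def
    by (simp add: K.coset_smult K.coset_eq_iff MA_minus)
      (simp add: monoid_algebra_simps map_times_single K.coset_eq_iff MA_minus)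
qed

lemma tens_smult_right:
  assumes "a \<in> carrier A" "b \<in> carrier B"
  shows "a \<otimes>\<otimes> (r \<odot>\<^bsub>B\<^esub> b) = r \<odot>\<^bsub>TP\<^esub> (a \<otimes>\<otimes> b)"
proof -
  have "Poly_Mapping.single (a, r \<odot>\<^bsub>B\<^esub> b) 1 - Poly_Mapping.single (a, b) r \<in> tensor_kernel A B"
    by (rule subsetD[OF kernel_relations])
      (use assms in \<open>simp add: bilinearity_relationsI(4)\<close>)
  then show ?thesis using assms unfolding pure_tensor_def tensor_algebra_def
    by (simp add: K.coset_smult K.coset_eq_iff MA_minus)
      (simp add: monoid_algebra_simps map_times_single K.coset_eq_iff MA_minus)
qed

lemma tensor_induct [consumes 1, case_names tens add]:
  assumes "z \<in> carrier TP"
    and tens: "\<And>a b. a \<in> carrier A \<Longrightarrow> b \<in> carrier B \<Longrightarrow> P (a \<otimes>\<otimes> b)"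
    and add: "\<And>x y. x \<in> carrier TP \<Longrightarrow> y \<in> carrier TP \<Longrightarrow> P x \<Longrightarrow> P y \<Longrightarrow> P (x \<oplus>\<^bsub>TP\<^esub> y)"
  shows "P z"
proof -
  obtain p where p: "p \<in> carrier MA" "z = tensor_kernel A B +>\<^bsub>MA\<^esub> p"
    using assms(1) unfolding tensor_algebra_def by (rule K.quot_carrierE)
  have sc: "P (tensor_kernel A B +>\<^bsub>MA\<^esub> Poly_Mapping.single (a, b) c)"
    if "a \<in> carrier A" "b \<in> carrier B" for a b c
  proof -
    have "tensor_kernel A B +>\<^bsub>MA\<^esub> Poly_Mapping.single (a, b) c = c \<odot>\<^bsub>TP\<^esub> (a \<otimes>\<otimes> b)"
      using that unfolding pure_tensor_def tensor_algebra_def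
      by (simp add: K.coset_smult) (simp add: monoid_algebra_simps map_times_single)
    also have "\<dots> = (c \<odot>\<^bsub>A\<^esub> a) \<otimes>\<otimes> b" using that by (simp add: tens_smult_left)
    finally show ?thesis using that by (simp add: tens)
  qed
  have "P (tensor_kernel A B +>\<^bsub>MA\<^esub> p)" using p(1)
  proof (induction p rule: monoid_algebra_induct)
    case zero
    show ?case using sc[of "\<zero>\<^bsub>A\<^esub>" "\<zero>\<^bsub>B\<^esub>" 0] by simp
  next
    case (single m c)
    then show ?case using sc by (cases m) auto
  next
    case (add p q)
    have "tensor_kernel A B +>\<^bsub>MA\<^esub> (p + q) =
        (tensor_kernel A B +>\<^bsub>MA\<^esub> p) \<oplus>\<^bsub>TP\<^esub> (tensor_kernel A B +>\<^bsub>MA\<^esub> q)"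
      using add K.coset_add[of p q] by (simp add: tensor_algebra_def MA_add_eq)
    moreover have "tensor_kernel A B +>\<^bsub>MA\<^esub> p \<in> carrier TP" "tensor_kernel A B +>\<^bsub>MA\<^esub> q \<in> carrier TP"
      using add by (auto simp: tensor_algebra_def intro: K.quot_closed)
    ultimately show ?case using add assms(3) by simp
  qed
  then show ?thesis using p by simp
qed

end

definition bilinear_maps ::
    "('k, 'a) module \<Rightarrow> ('k, 'b) module \<Rightarrow> ('k, 'n) module \<Rightarrow> ('a \<Rightarrow> 'b \<Rightarrow> 'n) set" where
  "bilinear_maps A B N = {\<phi>. (\<forall>a\<in>carrier A. \<phi> a \<in> linear_maps B N) \<and>
     (\<forall>b\<in>carrier B. (\<lambda>a. \<phi> a b) \<in> linear_maps A N)}"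

lemma bilinear_mapsI:
  assumes "\<And>a. a \<in> carrier A \<Longrightarrow> (\<lambda>b. \<phi> a b) \<in> linear_maps B N"
    and "\<And>b. b \<in> carrier B \<Longrightarrow> (\<lambda>a. \<phi> a b) \<in> linear_maps A N"
  shows "\<phi> \<in> bilinear_maps A B N"
  using assms by (auto simp: bilinear_maps_def)

lemma bilinear_mapsD:
  assumes "\<phi> \<in> bilinear_maps A B N"
  shows "a \<in> carrier A \<Longrightarrow> \<phi> a \<in> linear_maps B N"
    and "b \<in> carrier B \<Longrightarrow> (\<lambda>a. \<phi> a b) \<in> linear_maps A N"
  using assms by (auto simp: bilinear_maps_def)

context algebra_pair
begin

lemma bilinear_extension_kernel:
  assumes N: "assoc_algebra N" and \<phi>: "\<phi> \<in> bilinear_maps A B N" and j: "j \<in> tensor_kernel A B"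
  shows "linear_extension N (\<lambda>(a, b). \<phi> a b) j = \<zero>\<^bsub>N\<^esub>"
proof -
  interpret N: assoc_algebra N by fact
  note 1 = linear_mapsD[OF bilinear_mapsD(1)[OF \<phi>]] and 2 = linear_mapsD[OF bilinear_mapsD(2)[OF \<phi>]]
  let ?f = "linear_extension N (\<lambda>(a, b). \<phi> a b)"
  have lin: "?f \<in> linear_maps MA N"
    by (rule linear_extension_linear[OF N]) (auto simp: 1)
  have fs: "?f (Poly_Mapping.single (a, b) c) = c \<odot>\<^bsub>N\<^esub> \<phi> a b" if "a \<in> carrier A" "b \<in> carrier B" for a b c
    using that 1(1) by (subst linear_extension_single[OF N]) auto
  have f_diff: "?f (p - q) = ?f p \<ominus>\<^bsub>N\<^esub> ?f q" if "p \<in> carrier MA" "q \<in> carrier MA" for p q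
    using linear_maps_minus[OF lin MA.assoc_algebra_axioms N that] that by (simp add: MA_minus)
  have dc: "p - q \<in> carrier MA" if "p \<in> carrier MA" "q \<in> carrier MA" for p q
    using MA.minus_closed[OF that] that by (simp add: MA_minus)
  have cancel: "(p \<oplus>\<^bsub>N\<^esub> q) \<ominus>\<^bsub>N\<^esub> p \<ominus>\<^bsub>N\<^esub> q = \<zero>\<^bsub>N\<^esub>" if "p \<in> carrier N" "q \<in> carrier N" for p q
    using that by (simp add: a_minus_def N.a_comm[of p q] N.a_assoc N.r_neg)
  let ?K = "{p \<in> carrier MA. ?f p = \<zero>\<^bsub>N\<^esub>}"
  have "submodule ?K (ground_algebra :: ('k, 'k) module) MA"
    using linear_mapsD(2,3)[OF lin] linear_maps_zero[OF lin MA.assoc_algebra_axioms N]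
    by (intro submoduleI')
      (auto simp: monoid_algebra_simps monoid_algebra_add_closed monoid_algebra_smult_closed monoid_algebra_zero_closed)
  moreover have "bilinearity_relations A B \<subseteq> ?K"
  proof
    fix u assume "u \<in> bilinearity_relations A B"
    then show "u \<in> ?K"
    proof (cases rule: bilinearity_relationsE)
      case (add_left x y z)
      then show ?thesis
        by (simp add: f_diff dc fs 1(1) 2(2) cancel)
    next
      case (add_right x z w)
      then show ?thesis
        by (simp add: f_diff dc fs 1(1,2) cancel)
    next
      case (smult_left s x z)
      then show ?thesis by (simp add: f_diff dc fs 1(1) 2(3) a_minus_def N.r_neg)
    next
      case (smult_right s x z)
      then show ?thesis by (simp add: f_diff dc fs 1(1,3) a_minus_def N.r_neg)
    qed
  qed
  ultimately show ?thesis using kernel_minimal j by blast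
qed

lemma tensor_lift_linear:
  assumes N: "assoc_algebra N" and \<phi>: "\<phi> \<in> bilinear_maps A B N"
  shows "tensor_lift N \<phi> \<in> linear_maps TP N"
proof -
  have "linear_extension N (\<lambda>(a, b). \<phi> a b) \<in> linear_maps MA N"
    using linear_mapsD[OF bilinear_mapsD(1)[OF \<phi>]]
    by (intro linear_extension_linear[OF N]) auto
  from K.quot_lift_linear[OF this N bilinear_extension_kernel[OF assms]]
  show ?thesis unfolding tensor_algebra_def tensor_lift_def[abs_def] .
qed

lemma tensor_lift_tens:
  assumes N: "assoc_algebra N" and \<phi>: "\<phi> \<in> bilinear_maps A B N"
    and ab: "a \<in> carrier A" "b \<in> carrier B"
  shows "tensor_lift N \<phi> (a \<otimes>\<otimes> b) = \<phi> a b"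
proof -
  interpret N: assoc_algebra N by fact
  have c: "\<phi> a b \<in> carrier N" using linear_mapsD(1)[OF bilinear_mapsD(1)[OF \<phi> ab(1)] ab(2)] .
  have "linear_extension N (\<lambda>(a, b). \<phi> a b) \<in> linear_maps MA N"
    using linear_mapsD[OF bilinear_mapsD(1)[OF \<phi>]]
    by (intro linear_extension_linear[OF N]) auto
  from K.quot_lift[OF this N bilinear_extension_kernel[OF N \<phi>], of "Poly_Mapping.single (a, b) 1"]
  show ?thesis unfolding pure_tensor_def tensor_lift_def
    using ab c by (simp add: linear_extension_single[OF N])
qed

lemma tensor_lift_hom:
  assumes N: "assoc_algebra N" and \<phi>: "\<phi> \<in> bilinear_maps A B N"
    and m: "\<And>a b a' b'. a \<in> carrier A \<Longrightarrow> b \<in> carrier B \<Longrightarrow> a' \<in> carrier A \<Longrightarrow> b' \<in> carrier B \<Longrightarrow>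
      \<phi> (a \<otimes>\<^bsub>A\<^esub> a') (b \<otimes>\<^bsub>B\<^esub> b') = \<phi> a b \<otimes>\<^bsub>N\<^esub> \<phi> a' b'"
    and one: "\<phi> \<one>\<^bsub>A\<^esub> \<one>\<^bsub>B\<^esub> = \<one>\<^bsub>N\<^esub>"
  shows "tensor_lift N \<phi> \<in> alg_hom TP N"
proof -
  interpret N: assoc_algebra N by fact
  note l = tensor_lift_linear[OF N \<phi>] and t = tensor_lift_tens[OF N \<phi>]
  note lD = linear_mapsD[OF l]
  show ?thesis
  proof (rule alg_homI[OF l])
    fix x y assume "x \<in> carrier TP" and y: "y \<in> carrier TP"
    then show "tensor_lift N \<phi> (x \<otimes>\<^bsub>TP\<^esub> y) = tensor_lift N \<phi> x \<otimes>\<^bsub>N\<^esub> tensor_lift N \<phi> y"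
    proof (induction x rule: tensor_induct)
      case (tens a b)
      show ?case using y
        by (induction y rule: tensor_induct)
          (use tens in \<open>simp_all add: t tens_mult m T.r_distr N.r_distr lD linear_mapsD(1)[OF bilinear_mapsD(1)[OF \<phi>]]\<close>)
    next
      case (add x x')
      then show ?case using y by (simp add: T.l_distr N.l_distr lD)
    qed
  next
    show "tensor_lift N \<phi> \<one>\<^bsub>TP\<^esub> = \<one>\<^bsub>N\<^esub>" by (simp add: tens_one t one)
  qed
qed

end

section \<open>Checking Hopf-Galois data on generators\<close>

definition generates :: "('k, 'a) module \<Rightarrow> 'a set \<Rightarrow> bool" where
  "generates A G \<longleftrightarrow> G \<subseteq> carrier A \<and>
     (\<forall>Q. \<one>\<^bsub>A\<^esub> \<in> Q \<longrightarrow> G \<subseteq> Q \<longrightarrow>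
       (\<forall>r. \<forall>x\<in>carrier A \<inter> Q. r \<odot>\<^bsub>A\<^esub> x \<in> Q) \<longrightarrow>
       (\<forall>x\<in>carrier A \<inter> Q. \<forall>y\<in>carrier A \<inter> Q. x \<oplus>\<^bsub>A\<^esub> y \<in> Q) \<longrightarrow>
       (\<forall>x\<in>carrier A \<inter> Q. \<forall>y\<in>carrier A \<inter> Q. x \<otimes>\<^bsub>A\<^esub> y \<in> Q) \<longrightarrow> carrier A \<subseteq> Q)"

lemma generates_induct [consumes 2, case_names one gen smult add mult]:
  assumes "generates A G" "z \<in> carrier A"
    and "P \<one>\<^bsub>A\<^esub>"
    and "\<And>x. x \<in> G \<Longrightarrow> P x"
    and "\<And>r x. x \<in> carrier A \<Longrightarrow> P x \<Longrightarrow> P (r \<odot>\<^bsub>A\<^esub> x)"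
    and "\<And>x y. x \<in> carrier A \<Longrightarrow> y \<in> carrier A \<Longrightarrow> P x \<Longrightarrow> P y \<Longrightarrow> P (x \<oplus>\<^bsub>A\<^esub> y)"
    and "\<And>x y. x \<in> carrier A \<Longrightarrow> y \<in> carrier A \<Longrightarrow> P x \<Longrightarrow> P y \<Longrightarrow> P (x \<otimes>\<^bsub>A\<^esub> y)"
  shows "P z"
  using conjunct2[OF assms(1)[unfolded generates_def], THEN spec[of _ "Collect P"]] assms(2-)
  by auto

lemma (in presentation) presented_generates: "generates PA (presented_gen X R ` X)"
  unfolding generates_def
proof (intro conjI allI impI subsetI)
  fix Q z
  assume Q: "\<one>\<^bsub>PA\<^esub> \<in> Q" "presented_gen X R ` X \<subseteq> Q"
    "\<forall>r. \<forall>x\<in>carrier PA \<inter> Q. r \<odot>\<^bsub>PA\<^esub> x \<in> Q"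
    "\<forall>x\<in>carrier PA \<inter> Q. \<forall>y\<in>carrier PA \<inter> Q. x \<oplus>\<^bsub>PA\<^esub> y \<in> Q"
    "\<forall>x\<in>carrier PA \<inter> Q. \<forall>y\<in>carrier PA \<inter> Q. x \<otimes>\<^bsub>PA\<^esub> y \<in> Q" and z: "z \<in> carrier PA"
  show "z \<in> Q" using z
  proof (induction z rule: presented_induct)
    case (gen x)
    with Q(2) show ?case by (rule subsetD[OF _ imageI])
  next
    case (smult r p)
    then show ?case using Q(3) by simp
  next
    case (add p q)
    then show ?case using Q(4) by simp
  next
    case (mult p q)
    then show ?case using Q(5) by simp
  qed (rule Q(1))
qed (auto intro: gen_closed)

lemma alg_hom_eq_on_generators:
  assumes "generates A G" "f \<in> alg_hom A N" "f' \<in> alg_hom A N"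
    and "\<And>x. x \<in> G \<Longrightarrow> f x = f' x" and "z \<in> carrier A"
  shows "f z = f' z"
  using assms(1,5) by (induction z rule: generates_induct)
    (simp_all add: alg_homD[OF assms(2)] alg_homD[OF assms(3)] assms(4))

lemma alg_hom_id': "id \<in> alg_hom A A"
  using alg_hom_id[of A] by (simp add: id_def)

lemma algebra_pairI: "assoc_algebra A \<Longrightarrow> assoc_algebra B \<Longrightarrow> algebra_pair A B"
  by (simp add: algebra_pair_def)

lemma tensor_map_hom:
  assumes "assoc_algebra A" "assoc_algebra B" "assoc_algebra C" "assoc_algebra D"
    and f: "f \<in> alg_hom A C" and g: "g \<in> alg_hom B D"
  shows "tensor_map C D f g \<in> alg_hom (tensor_algebra A B) (tensor_algebra C D)"
    and "\<And>a b. a \<in> carrier A \<Longrightarrow> b \<in> carrier B \<Longrightarrow>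
      tensor_map C D f g (pure_tensor A B a b) = pure_tensor C D (f a) (g b)"
proof -
  interpret AB: algebra_pair A B using assms by (intro algebra_pairI)
  interpret CD: algebra_pair C D using assms by (intro algebra_pairI)
  note f' = alg_homD[OF f] and g' = alg_homD[OF g]
  have bil: "(\<lambda>a b. pure_tensor C D (f a) (g b)) \<in> bilinear_maps A B (tensor_algebra C D)"
    by (intro bilinear_mapsI linear_mapsI)
      (simp_all add: f' g' CD.tens_add_left CD.tens_add_right CD.tens_smult_left CD.tens_smult_right)
  show "tensor_map C D f g \<in> alg_hom (tensor_algebra A B) (tensor_algebra C D)"
    unfolding tensor_map_def
    by (rule AB.tensor_lift_hom[OF CD.tensor_assoc_algebra bil])
      (simp_all add: f' g' CD.tens_mult CD.tens_one)
  show "tensor_map C D f g (pure_tensor A B a b) = pure_tensor C D (f a) (g b)"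
    if "a \<in> carrier A" "b \<in> carrier B" for a b
    unfolding tensor_map_def using that by (rule AB.tensor_lift_tens[OF CD.tensor_assoc_algebra bil])
qed

lemma tensor_assoc_hom:
  assumes "assoc_algebra A" "assoc_algebra B" "assoc_algebra C"
  shows "tensor_assoc A B C \<in>
      alg_hom (tensor_algebra (tensor_algebra A B) C) (tensor_algebra A (tensor_algebra B C))"
    and "\<And>a b c. a \<in> carrier A \<Longrightarrow> b \<in> carrier B \<Longrightarrow> c \<in> carrier C \<Longrightarrow>
      tensor_assoc A B C (pure_tensor (tensor_algebra A B) C (pure_tensor A B a b) c) =
      pure_tensor A (tensor_algebra B C) a (pure_tensor B C b c)"
proof -
  interpret AB: algebra_pair A B using assms by (intro algebra_pairI)
  interpret BC: algebra_pair B C using assms by (intro algebra_pairI)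
  interpret L: algebra_pair "tensor_algebra A B" C
    using assms AB.tensor_assoc_algebra by (intro algebra_pairI)
  interpret R: algebra_pair A "tensor_algebra B C"
    using assms BC.tensor_assoc_algebra by (intro algebra_pairI)
  let ?N = "tensor_algebra A (tensor_algebra B C)"
  define \<psi> where "\<psi> c = (\<lambda>a b. pure_tensor A (tensor_algebra B C) a (pure_tensor B C b c))" for c
  note N = R.tensor_assoc_algebra
  note simps = R.tens_add_left R.tens_add_right R.tens_smult_left R.tens_smult_right
    BC.tens_add_left BC.tens_add_right BC.tens_smult_left BC.tens_smult_right
  have bil: "\<psi> c \<in> bilinear_maps A B ?N" if "c \<in> carrier C" for c
    unfolding \<psi>_def using that by (intro bilinear_mapsI linear_mapsI) (simp_all add: simps)
  note val = AB.tensor_lift_tens[OF N bil]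
  note lin = linear_mapsD[OF AB.tensor_lift_linear[OF N bil]]
  have \<psi>c: "\<psi> c a b \<in> carrier ?N" if "a \<in> carrier A" "b \<in> carrier B" "c \<in> carrier C" for a b c
    using that by (simp add: \<psi>_def)
  have bil2: "(\<lambda>x c. tensor_lift ?N (\<psi> c) x) \<in> bilinear_maps (tensor_algebra A B) C ?N"
  proof (intro bilinear_mapsI AB.tensor_lift_linear[OF N bil])
    fix x assume x: "x \<in> carrier (tensor_algebra A B)"
    show "(\<lambda>c. tensor_lift ?N (\<psi> c) x) \<in> linear_maps C ?N"
    proof (rule linear_mapsI)
      fix c c' assume c: "c \<in> carrier C" "c' \<in> carrier C"
      show "tensor_lift ?N (\<psi> (c \<oplus>\<^bsub>C\<^esub> c')) x = tensor_lift ?N (\<psi> c) x \<oplus>\<^bsub>?N\<^esub> tensor_lift ?N (\<psi> c') x"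
        using x
      proof (induction x rule: AB.tensor_induct)
        case (tens a b)
        then show ?case using c by (simp add: val) (simp add: \<psi>_def simps)
      next
        case (add x y)
        then show ?case using c by (simp add: lin R.T.a_ac)
      qed
    next
      fix r c assume c: "c \<in> carrier C"
      show "tensor_lift ?N (\<psi> (r \<odot>\<^bsub>C\<^esub> c)) x = r \<odot>\<^bsub>?N\<^esub> tensor_lift ?N (\<psi> c) x"
        using x
      proof (induction x rule: AB.tensor_induct)
        case (tens a b)
        then show ?case using c by (simp add: val) (simp add: \<psi>_def simps)
      next
        case (add x y)
        then show ?case using c by (simp add: lin R.T.scalar_add_right)
      qed
    qed (simp add: lin x)
  qed
  have eq: "tensor_assoc A B C = tensor_lift ?N (\<lambda>x c. tensor_lift ?N (\<psi> c) x)"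
    by (simp add: tensor_assoc_def \<psi>_def Let_def)
  have m: "tensor_lift ?N (\<psi> (c \<otimes>\<^bsub>C\<^esub> c')) (x \<otimes>\<^bsub>tensor_algebra A B\<^esub> x') =
      tensor_lift ?N (\<psi> c) x \<otimes>\<^bsub>?N\<^esub> tensor_lift ?N (\<psi> c') x'"
    if "x \<in> carrier (tensor_algebra A B)" "c \<in> carrier C" "x' \<in> carrier (tensor_algebra A B)" "c' \<in> carrier C"
    for x c x' c'
    using that(1)
  proof (induction x rule: AB.tensor_induct)
    case (tens a b)
    show ?case using that(3)
    proof (induction x' rule: AB.tensor_induct)
      case (tens a' b')
      then show ?case using that \<open>a \<in> carrier A\<close> \<open>b \<in> carrier B\<close>
        by (simp add: val AB.tens_mult) (simp add: \<psi>_def R.tens_mult BC.tens_mult)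
    next
      case (add x y)
      then show ?case using that \<open>a \<in> carrier A\<close> \<open>b \<in> carrier B\<close>
        by (simp add: AB.T.r_distr lin R.T.r_distr)
    qed
  next
    case (add x y)
    then show ?case using that by (simp add: AB.T.l_distr lin R.T.l_distr)
  qed
  show "tensor_assoc A B C \<in> alg_hom (tensor_algebra (tensor_algebra A B) C) ?N"
    unfolding eq
    by (rule L.tensor_lift_hom[OF N bil2])
      (simp_all add: m AB.tens_one val, simp add: \<psi>_def R.tens_one BC.tens_one)
  show "tensor_assoc A B C (pure_tensor (tensor_algebra A B) C (pure_tensor A B a b) c) =
      pure_tensor A (tensor_algebra B C) a (pure_tensor B C b c)"
    if "a \<in> carrier A" "b \<in> carrier B" "c \<in> carrier C" for a b c
    unfolding eq using that by (simp add: L.tensor_lift_tens[OF N bil2] val) (simp add: \<psi>_def)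
qed

text \<open>
  Coassociativity and the counit axioms equate two algebra homomorphisms, so they may be tested on generators.  The
  antipode axioms involve \<open>a \<otimes> b \<mapsto> \<psi>(a) \<phi>(b)\<close> with \<open>\<psi>\<close> an antihomomorphism, which is not multiplicative.
  But in the image of \<open>x (c \<otimes> d)\<close> the image of \<open>x\<close> appears as an inner factor; if it is central, it
  can be pulled out, and this lets identities pass to products.
\<close>

lemma tensor_lift_anti_hom:
  assumes "assoc_algebra A" "assoc_algebra B" "assoc_algebra N"
    and \<psi>: "\<psi> \<in> alg_hom A (opposite_algebra N)" and \<phi>: "\<phi> \<in> alg_hom B N"
  shows "(\<lambda>a b. \<psi> a \<otimes>\<^bsub>N\<^esub> \<phi> b) \<in> bilinear_maps A B N"
    and "\<And>x c d. x \<in> carrier (tensor_algebra A B) \<Longrightarrow> c \<in> carrier A \<Longrightarrow> d \<in> carrier B \<Longrightarrow>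
      tensor_lift N (\<lambda>a b. \<psi> a \<otimes>\<^bsub>N\<^esub> \<phi> b) (x \<otimes>\<^bsub>tensor_algebra A B\<^esub> pure_tensor A B c d) =
      \<psi> c \<otimes>\<^bsub>N\<^esub> tensor_lift N (\<lambda>a b. \<psi> a \<otimes>\<^bsub>N\<^esub> \<phi> b) x \<otimes>\<^bsub>N\<^esub> \<phi> d"
proof -
  interpret AB: algebra_pair A B using assms by (intro algebra_pairI)
  interpret N: assoc_algebra N by fact
  note psi = alg_homD[OF \<psi>, simplified] and phi = alg_homD[OF \<phi>]
  show bil: "(\<lambda>a b. \<psi> a \<otimes>\<^bsub>N\<^esub> \<phi> b) \<in> bilinear_maps A B N"
    by (intro bilinear_mapsI linear_mapsI)
      (simp_all add: psi phi N.l_distr N.r_distr N.smult_mult_left N.smult_mult_right)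
  note val = AB.tensor_lift_tens[OF assms(3) bil]
  note lin = linear_mapsD[OF AB.tensor_lift_linear[OF assms(3) bil]]
  show "tensor_lift N (\<lambda>a b. \<psi> a \<otimes>\<^bsub>N\<^esub> \<phi> b) (x \<otimes>\<^bsub>tensor_algebra A B\<^esub> pure_tensor A B c d) =
      \<psi> c \<otimes>\<^bsub>N\<^esub> tensor_lift N (\<lambda>a b. \<psi> a \<otimes>\<^bsub>N\<^esub> \<phi> b) x \<otimes>\<^bsub>N\<^esub> \<phi> d"
    if x: "x \<in> carrier (tensor_algebra A B)" and cd: "c \<in> carrier A" "d \<in> carrier B" for x c d
    using x
  proof (induction x rule: AB.tensor_induct)
    case (tens a b)
    then show ?case using cd by (simp add: AB.tens_mult val psi phi N.m_assoc)
  next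
    case (add x y)
    then show ?case using cd by (simp add: AB.T.l_distr lin psi phi N.l_distr N.r_distr)
  qed
qed

lemma tensor_lift_hom_anti:
  assumes "assoc_algebra A" "assoc_algebra B" "assoc_algebra N"
    and \<psi>: "\<psi> \<in> alg_hom B (opposite_algebra N)" and \<phi>: "\<phi> \<in> alg_hom A N"
  shows "(\<lambda>a b. \<phi> a \<otimes>\<^bsub>N\<^esub> \<psi> b) \<in> bilinear_maps A B N"
    and "\<And>x c d. x \<in> carrier (tensor_algebra A B) \<Longrightarrow> c \<in> carrier A \<Longrightarrow> d \<in> carrier B \<Longrightarrow>
      tensor_lift N (\<lambda>a b. \<phi> a \<otimes>\<^bsub>N\<^esub> \<psi> b) (pure_tensor A B c d \<otimes>\<^bsub>tensor_algebra A B\<^esub> x) =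
      \<phi> c \<otimes>\<^bsub>N\<^esub> tensor_lift N (\<lambda>a b. \<phi> a \<otimes>\<^bsub>N\<^esub> \<psi> b) x \<otimes>\<^bsub>N\<^esub> \<psi> d"
proof -
  interpret AB: algebra_pair A B using assms by (intro algebra_pairI)
  interpret N: assoc_algebra N by fact
  note psi = alg_homD[OF \<psi>, simplified] and phi = alg_homD[OF \<phi>]
  show bil: "(\<lambda>a b. \<phi> a \<otimes>\<^bsub>N\<^esub> \<psi> b) \<in> bilinear_maps A B N"
    by (intro bilinear_mapsI linear_mapsI)
      (simp_all add: psi phi N.l_distr N.r_distr N.smult_mult_left N.smult_mult_right)
  note val = AB.tensor_lift_tens[OF assms(3) bil]
  note lin = linear_mapsD[OF AB.tensor_lift_linear[OF assms(3) bil]]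
  show "tensor_lift N (\<lambda>a b. \<phi> a \<otimes>\<^bsub>N\<^esub> \<psi> b) (pure_tensor A B c d \<otimes>\<^bsub>tensor_algebra A B\<^esub> x) =
      \<phi> c \<otimes>\<^bsub>N\<^esub> tensor_lift N (\<lambda>a b. \<phi> a \<otimes>\<^bsub>N\<^esub> \<psi> b) x \<otimes>\<^bsub>N\<^esub> \<psi> d"
    if x: "x \<in> carrier (tensor_algebra A B)" and cd: "c \<in> carrier A" "d \<in> carrier B" for x c d
    using x
  proof (induction x rule: AB.tensor_induct)
    case (tens a b)
    then show ?case using cd by (simp add: AB.tens_mult val psi phi N.m_assoc)
  next
    case (add x y)
    then show ?case using cd by (simp add: AB.T.r_distr lin psi phi N.l_distr N.r_distr)
  qed
qed

lemma counit_bilinear: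
  fixes T :: "('k::field, 't) module" and H :: "('k, 'h) module"
  assumes "assoc_algebra T" "assoc_algebra H" and \<epsilon>: "\<epsilon> \<in> alg_hom H (ground_algebra :: ('k, 'k) module)"
  shows "tensor_lift T (\<lambda>y h. \<epsilon> h \<odot>\<^bsub>T\<^esub> y) \<in> alg_hom (tensor_algebra T H) T"
    and "\<And>y h. y \<in> carrier T \<Longrightarrow> h \<in> carrier H \<Longrightarrow>
      tensor_lift T (\<lambda>y h. \<epsilon> h \<odot>\<^bsub>T\<^esub> y) (pure_tensor T H y h) = \<epsilon> h \<odot>\<^bsub>T\<^esub> y"
    and "tensor_lift T (\<lambda>h y. \<epsilon> h \<odot>\<^bsub>T\<^esub> y) \<in> alg_hom (tensor_algebra H T) T"
    and "\<And>y h. y \<in> carrier T \<Longrightarrow> h \<in> carrier H \<Longrightarrow>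
      tensor_lift T (\<lambda>h y. \<epsilon> h \<odot>\<^bsub>T\<^esub> y) (pure_tensor H T h y) = \<epsilon> h \<odot>\<^bsub>T\<^esub> y"
proof -
  interpret TH: algebra_pair T H using assms by (intro algebra_pairI)
  interpret HT: algebra_pair H T using assms by (intro algebra_pairI)
  note e = alg_homD[OF \<epsilon>, simplified]
  have b1: "(\<lambda>y h. \<epsilon> h \<odot>\<^bsub>T\<^esub> y) \<in> bilinear_maps T H T" and b2: "(\<lambda>h y. \<epsilon> h \<odot>\<^bsub>T\<^esub> y) \<in> bilinear_maps H T T"
    by (intro bilinear_mapsI linear_mapsI;
        simp add: e TH.A.scalar_add_left TH.A.scalar_add_right TH.A.scalar_scalar mult.commute)+
  show "tensor_lift T (\<lambda>y h. \<epsilon> h \<odot>\<^bsub>T\<^esub> y) \<in> alg_hom (tensor_algebra T H) T"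
    by (rule TH.tensor_lift_hom[OF assms(1) b1])
      (simp_all add: e TH.A.smult_mult_left TH.A.smult_mult_right TH.A.scalar_scalar mult.commute)
  show "tensor_lift T (\<lambda>h y. \<epsilon> h \<odot>\<^bsub>T\<^esub> y) \<in> alg_hom (tensor_algebra H T) T"
    by (rule HT.tensor_lift_hom[OF assms(1) b2])
      (simp_all add: e TH.A.smult_mult_left TH.A.smult_mult_right TH.A.scalar_scalar mult.commute)
  show "tensor_lift T (\<lambda>y h. \<epsilon> h \<odot>\<^bsub>T\<^esub> y) (pure_tensor T H y h) = \<epsilon> h \<odot>\<^bsub>T\<^esub> y"
    if "y \<in> carrier T" "h \<in> carrier H" for y h
    using that by (rule TH.tensor_lift_tens[OF assms(1) b1])
  show "tensor_lift T (\<lambda>h y. \<epsilon> h \<odot>\<^bsub>T\<^esub> y) (pure_tensor H T h y) = \<epsilon> h \<odot>\<^bsub>T\<^esub> y"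
    if "y \<in> carrier T" "h \<in> carrier H" for y h
    using that(2,1) by (rule HT.tensor_lift_tens[OF assms(1) b2])
qed

lemma hopf_algebra_generatedI:
  fixes H :: "('k::field, 'h) module"
  assumes H: "assoc_algebra H" and G: "generates H G"
    and \<Delta>: "\<Delta> \<in> alg_hom H (tensor_algebra H H)"
    and \<epsilon>: "\<epsilon> \<in> alg_hom H (ground_algebra :: ('k, 'k) module)"
    and S: "S \<in> alg_hom H (opposite_algebra H)"
    and coassoc: "\<And>h. h \<in> G \<Longrightarrow>
      tensor_assoc H H H (tensor_map (tensor_algebra H H) H \<Delta> id (\<Delta> h)) =
      tensor_map H (tensor_algebra H H) id \<Delta> (\<Delta> h)"
    and cl: "\<And>h. h \<in> G \<Longrightarrow> tensor_lift H (\<lambda>a b. \<epsilon> a \<odot>\<^bsub>H\<^esub> b) (\<Delta> h) = h"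
    and cr: "\<And>h. h \<in> G \<Longrightarrow> tensor_lift H (\<lambda>a b. \<epsilon> b \<odot>\<^bsub>H\<^esub> a) (\<Delta> h) = h"
    and al: "\<And>h. h \<in> G \<Longrightarrow> tensor_lift H (\<lambda>a b. S a \<otimes>\<^bsub>H\<^esub> b) (\<Delta> h) = \<epsilon> h \<odot>\<^bsub>H\<^esub> \<one>\<^bsub>H\<^esub>"
    and ar: "\<And>h. h \<in> G \<Longrightarrow> tensor_lift H (\<lambda>a b. a \<otimes>\<^bsub>H\<^esub> S b) (\<Delta> h) = \<epsilon> h \<odot>\<^bsub>H\<^esub> \<one>\<^bsub>H\<^esub>"
  shows "hopf_algebra H \<Delta> \<epsilon> S"
proof -
  interpret H: assoc_algebra H by fact
  interpret HH: algebra_pair H H using H by (intro algebra_pairI)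
  interpret HHH: algebra_pair H "tensor_algebra H H"
    using H HH.tensor_assoc_algebra by (intro algebra_pairI)
  note d = alg_homD[OF \<Delta>] and e = alg_homD[OF \<epsilon>, simplified] and s = alg_homD[OF S, simplified]
  have l: "tensor_lift H (\<lambda>a b. S a \<otimes>\<^bsub>H\<^esub> b) (\<Delta> h) = \<epsilon> h \<odot>\<^bsub>H\<^esub> \<one>\<^bsub>H\<^esub>" if "h \<in> carrier H" for h
  proof -
    let ?L = "tensor_lift H (\<lambda>a b. S a \<otimes>\<^bsub>H\<^esub> b)"
    note anti = tensor_lift_anti_hom[OF H H H S alg_hom_id]
    note lin = linear_mapsD[OF HH.tensor_lift_linear[OF H anti(1)]]
    note val = HH.tensor_lift_tens[OF H anti(1)]
    have *: "?L (x \<otimes>\<^bsub>tensor_algebra H H\<^esub> y) = c \<odot>\<^bsub>H\<^esub> ?L y"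
      if "?L x = c \<odot>\<^bsub>H\<^esub> \<one>\<^bsub>H\<^esub>" "x \<in> carrier (tensor_algebra H H)" "y \<in> carrier (tensor_algebra H H)" for c x y
      using that(3)
    proof (induction y rule: HH.tensor_induct)
      case (tens a b)
      then show ?case using that
        by (simp add: anti(2) val s H.smult_mult_left H.smult_mult_right)
    next
      case (add y z)
      then show ?case using that by (simp add: HH.T.r_distr lin H.scalar_add_right)
    qed
    show ?thesis using G that
      by (induction h rule: generates_induct)
        (simp_all add: d e s al lin * H.scalar_scalar H.scalar_add_left HH.tens_one val mult.commute)
  qed
  have r: "tensor_lift H (\<lambda>a b. a \<otimes>\<^bsub>H\<^esub> S b) (\<Delta> h) = \<epsilon> h \<odot>\<^bsub>H\<^esub> \<one>\<^bsub>H\<^esub>" if "h \<in> carrier H" for h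
  proof -
    let ?L = "tensor_lift H (\<lambda>a b. a \<otimes>\<^bsub>H\<^esub> S b)"
    note anti = tensor_lift_hom_anti[OF H H H S alg_hom_id]
    note lin = linear_mapsD[OF HH.tensor_lift_linear[OF H anti(1)]]
    note val = HH.tensor_lift_tens[OF H anti(1)]
    have *: "?L (y \<otimes>\<^bsub>tensor_algebra H H\<^esub> x) = c \<odot>\<^bsub>H\<^esub> ?L y"
      if "?L x = c \<odot>\<^bsub>H\<^esub> \<one>\<^bsub>H\<^esub>" "x \<in> carrier (tensor_algebra H H)" "y \<in> carrier (tensor_algebra H H)" for c x y
      using that(3)
    proof (induction y rule: HH.tensor_induct)
      case (tens a b)
      then show ?case using that
        by (simp add: anti(2) val s H.smult_mult_left H.smult_mult_right)
    next
      case (add y z)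
      then show ?case using that by (simp add: HH.T.l_distr lin H.scalar_add_right)
    qed
    show ?thesis using G that
      by (induction h rule: generates_induct)
        (simp_all add: d e s ar lin * H.scalar_scalar H.scalar_add_left HH.tens_one val mult.commute)
  qed
  have c1: "tensor_assoc H H H (tensor_map (tensor_algebra H H) H \<Delta> id (\<Delta> h)) =
      tensor_map H (tensor_algebra H H) id \<Delta> (\<Delta> h)" if "h \<in> carrier H" for h
    by (rule alg_hom_eq_on_generators[OF G
          alg_hom_comp[OF alg_hom_comp[OF \<Delta> tensor_map_hom(1)[OF H H HH.tensor_assoc_algebra H \<Delta> alg_hom_id']]
            tensor_assoc_hom(1)[OF H H H]]
          alg_hom_comp[OF \<Delta> tensor_map_hom(1)[OF H H H HH.tensor_assoc_algebra alg_hom_id' \<Delta>]]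
          coassoc that])
  have c2: "tensor_lift H (\<lambda>a b. \<epsilon> a \<odot>\<^bsub>H\<^esub> b) (\<Delta> h) = h" if "h \<in> carrier H" for h
    by (rule alg_hom_eq_on_generators[OF G alg_hom_comp[OF \<Delta> counit_bilinear(3)[OF H H \<epsilon>]] alg_hom_id cl that])
  have c3: "tensor_lift H (\<lambda>a b. \<epsilon> b \<odot>\<^bsub>H\<^esub> a) (\<Delta> h) = h" if "h \<in> carrier H" for h
    by (rule alg_hom_eq_on_generators[OF G alg_hom_comp[OF \<Delta> counit_bilinear(1)[OF H H \<epsilon>]] alg_hom_id cr that])
  show ?thesis
    by (intro hopf_algebra.intro hopf_algebra_axioms.intro H \<Delta> \<epsilon> c1 c2 c3 l r) (simp_all add: s)
qed

lemma comodule_algebra_generatedI: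
  fixes H :: "('k::field, 'h) module" and T :: "('k, 't) module"
  assumes "hopf_algebra H \<Delta> \<epsilon> S" and T: "assoc_algebra T" and G: "generates T G"
    and \<beta>: "\<beta> \<in> alg_hom T (tensor_algebra T H)"
    and coactionG: "\<And>x. x \<in> G \<Longrightarrow>
      tensor_assoc T H H (tensor_map (tensor_algebra T H) H \<beta> id (\<beta> x)) =
      tensor_map T (tensor_algebra H H) id \<Delta> (\<beta> x)"
    and counitG: "\<And>x. x \<in> G \<Longrightarrow> tensor_lift T (\<lambda>y h. \<epsilon> h \<odot>\<^bsub>T\<^esub> y) (\<beta> x) = x"
  shows "comodule_algebra H \<Delta> \<epsilon> S T \<beta>"
proof -
  interpret hopf_algebra H \<Delta> \<epsilon> S by fact
  interpret HH: algebra_pair H H using assoc_algebra_axioms by (intro algebra_pairI)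
  interpret TH: algebra_pair T H using assoc_algebra_axioms T by (intro algebra_pairI)
  have c1: "tensor_assoc T H H (tensor_map (tensor_algebra T H) H \<beta> id (\<beta> x)) =
      tensor_map T (tensor_algebra H H) id \<Delta> (\<beta> x)" if "x \<in> carrier T" for x
    by (rule alg_hom_eq_on_generators[OF G
          alg_hom_comp[OF alg_hom_comp[OF \<beta> tensor_map_hom(1)[OF T assoc_algebra_axioms
                TH.tensor_assoc_algebra assoc_algebra_axioms \<beta> alg_hom_id']]
            tensor_assoc_hom(1)[OF T assoc_algebra_axioms assoc_algebra_axioms]]
          alg_hom_comp[OF \<beta> tensor_map_hom(1)[OF T assoc_algebra_axioms T HH.tensor_assoc_algebra
                alg_hom_id' comult_hom]]
          coactionG that])
  have c2: "tensor_lift T (\<lambda>y h. \<epsilon> h \<odot>\<^bsub>T\<^esub> y) (\<beta> x) = x" if "x \<in> carrier T" for x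
    by (rule alg_hom_eq_on_generators[OF G
          alg_hom_comp[OF \<beta> counit_bilinear(1)[OF T assoc_algebra_axioms counit_hom]] alg_hom_id counitG that])
  show ?thesis
    by (intro comodule_algebra.intro comodule_algebra_axioms.intro hopf_algebra_axioms T \<beta> c1 c2)
qed

text \<open>
  The criterion for bijectivity of the canonical map.  For a Galois extension of the ground field the
  map \<open>h \<mapsto> can\<inverse> (1 \<otimes> h)\<close> is an algebra homomorphism \<open>\<tau>\<close> from \<open>H\<close> to
  \<open>T\<^sup>o\<^sup>p \<otimes> T\<close>; conversely, from such a \<open>\<tau>\<close> one recovers the inverse of the canonical
  map as \<open>x \<otimes> h \<mapsto> x \<tau>(h)\<close>, where \<open>x\<close> multiplies the first factor from the left.
  That this is inverse to the canonical map is a pair of identities whose validity is inherited by products.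
\<close>

locale translation_map = comodule_algebra H \<Delta> \<epsilon> S T \<beta>
  for H :: "('k::field, 'h) module" and \<Delta> \<epsilon> S and T :: "('k, 't) module" and \<beta> +
  fixes \<tau> :: "'h \<Rightarrow> (('t \<times> 't) \<Rightarrow>\<^sub>0 'k) set"
  assumes translation_hom: "\<tau> \<in> alg_hom H (tensor_algebra (opposite_algebra T) T)"
begin

abbreviation "OT \<equiv> opposite_algebra T"
abbreviation "OTT \<equiv> tensor_algebra OT T"
abbreviation "TT \<equiv> tensor_algebra T T"
abbreviation "TH \<equiv> tensor_algebra T H"

lemma OT_algebra: "assoc_algebra OT" by (rule opposite_assoc_algebra) (rule T.assoc_algebra_axioms)

sublocale TH: algebra_pair T H by (intro algebra_pairI T.assoc_algebra_axioms H.assoc_algebra_axioms)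
sublocale TT: algebra_pair T T by (intro algebra_pairI T.assoc_algebra_axioms)
sublocale OTT: algebra_pair "opposite_algebra T" T by (intro algebra_pairI T.assoc_algebra_axioms OT_algebra)

lemmas \<beta>D = alg_homD[OF coaction_hom] and \<tau>D = alg_homD[OF translation_hom]

definition can_op :: "(('t \<times> 't) \<Rightarrow>\<^sub>0 'k) set \<Rightarrow> (('t \<times> 'h) \<Rightarrow>\<^sub>0 'k) set" where
  "can_op = tensor_lift TH (\<lambda>x y. pure_tensor T H x \<one>\<^bsub>H\<^esub> \<otimes>\<^bsub>TH\<^esub> \<beta> y)"

definition act :: "'t \<Rightarrow> (('t \<times> 't) \<Rightarrow>\<^sub>0 'k) set \<Rightarrow> (('t \<times> 't) \<Rightarrow>\<^sub>0 'k) set" where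
  "act x = tensor_lift TT (\<lambda>a b. pure_tensor T T (x \<otimes>\<^bsub>T\<^esub> a) b)"

definition can_inv :: "(('t \<times> 'h) \<Rightarrow>\<^sub>0 'k) set \<Rightarrow> (('t \<times> 't) \<Rightarrow>\<^sub>0 'k) set" where
  "can_inv = tensor_lift TT (\<lambda>x h. act x (\<tau> h))"

lemma can_bilinear: "(\<lambda>x y. pure_tensor T H x \<one>\<^bsub>H\<^esub> \<otimes>\<^bsub>TH\<^esub> \<beta> y) \<in> bilinear_maps T T TH"
  by (intro bilinear_mapsI linear_mapsI)
    (simp_all add: \<beta>D TH.tens_add_left TH.tens_smult_left TH.T.l_distr TH.T.r_distr
      TH.T.smult_mult_left TH.T.smult_mult_right)

lemmas can_linear = TT.tensor_lift_linear[OF TH.tensor_assoc_algebra can_bilinear, folded canonical_map_def]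
lemmas can_tens = TT.tensor_lift_tens[OF TH.tensor_assoc_algebra can_bilinear, folded canonical_map_def]

lemma left_factor_anti: "(\<lambda>a. pure_tensor T H a \<one>\<^bsub>H\<^esub>) \<in> alg_hom OT (opposite_algebra TH)"
  by (rule alg_homI, rule linear_mapsI)
    (simp_all add: TH.tens_add_left TH.tens_smult_left TH.tens_mult TH.tens_one)

lemmas can_op_anti = tensor_lift_anti_hom[OF OT_algebra T.assoc_algebra_axioms TH.tensor_assoc_algebra
    left_factor_anti coaction_hom, folded can_op_def]
lemmas can_op_linear = OTT.tensor_lift_linear[OF TH.tensor_assoc_algebra can_op_anti(1), folded can_op_def]
lemmas can_op_tens = OTT.tensor_lift_tens[OF TH.tensor_assoc_algebra can_op_anti(1), folded can_op_def]
lemmas can_opD = linear_mapsD[OF can_op_linear]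

lemma act_bilinear: "x \<in> carrier T \<Longrightarrow> (\<lambda>a b. pure_tensor T T (x \<otimes>\<^bsub>T\<^esub> a) b) \<in> bilinear_maps OT T TT"
  by (intro bilinear_mapsI linear_mapsI)
    (simp_all add: TT.tens_add_left TT.tens_smult_left TT.tens_add_right TT.tens_smult_right T.r_distr
      T.smult_mult_right)

lemmas act_linear = OTT.tensor_lift_linear[OF TT.tensor_assoc_algebra act_bilinear, folded act_def]
lemmas act_tens = OTT.tensor_lift_tens[OF TT.tensor_assoc_algebra act_bilinear, folded act_def, simplified]
lemmas actD = linear_mapsD[OF act_linear]

lemma act_linear_left: "z \<in> carrier OTT \<Longrightarrow> (\<lambda>x. act x z) \<in> linear_maps T TT"
proof (rule linear_mapsI)
  assume z: "z \<in> carrier OTT"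
  show "act x z \<in> carrier TT" if "x \<in> carrier T" for x using z that by (simp add: actD)
  show "act (x \<oplus>\<^bsub>T\<^esub> y) z = act x z \<oplus>\<^bsub>TT\<^esub> act y z" if "x \<in> carrier T" "y \<in> carrier T" for x y
    using z by (induction z rule: OTT.tensor_induct)
      (use that in \<open>simp_all add: act_tens actD T.l_distr TT.tens_add_left TT.T.a_ac\<close>)
  show "act (r \<odot>\<^bsub>T\<^esub> x) z = r \<odot>\<^bsub>TT\<^esub> act x z" if "x \<in> carrier T" for r x
    using z by (induction z rule: OTT.tensor_induct)
      (use that in \<open>simp_all add: act_tens actD T.smult_mult_left TT.tens_smult_left TT.T.scalar_add_right\<close>)
qed

lemmas act_leftD = linear_mapsD[OF act_linear_left]

lemma can_inv_bilinear: "(\<lambda>x h. act x (\<tau> h)) \<in> bilinear_maps T H TT"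
  by (intro bilinear_mapsI act_linear_left linear_mapsI) (simp_all add: \<tau>D actD)

lemmas can_inv_linear = TH.tensor_lift_linear[OF TT.tensor_assoc_algebra can_inv_bilinear, folded can_inv_def]
lemmas can_inv_tens = TH.tensor_lift_tens[OF TT.tensor_assoc_algebra can_inv_bilinear, folded can_inv_def]
lemmas canD = linear_mapsD[OF can_linear] and can_invD = linear_mapsD[OF can_inv_linear]

lemma can_act:
  assumes "x \<in> carrier T" "z \<in> carrier OTT"
  shows "canonical_map H T \<beta> (act x z) = pure_tensor T H x \<one>\<^bsub>H\<^esub> \<otimes>\<^bsub>TH\<^esub> can_op z"
  using assms(2)
proof (induction z rule: OTT.tensor_induct)
  case (tens a b)
  have "pure_tensor T H (x \<otimes>\<^bsub>T\<^esub> a) \<one>\<^bsub>H\<^esub> = pure_tensor T H x \<one>\<^bsub>H\<^esub> \<otimes>\<^bsub>TH\<^esub> pure_tensor T H a \<one>\<^bsub>H\<^esub>"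
    using assms tens by (simp add: TH.tens_mult)
  then show ?case using assms tens by (simp add: act_tens can_tens can_op_tens TH.T.m_assoc \<beta>D)
next
  case (add y z)
  then show ?case using assms by (simp add: actD canD can_opD TH.T.r_distr)
qed

lemma act_left_mult:
  assumes "x \<in> carrier T" "y \<in> carrier T" "z \<in> carrier OTT"
  shows "act (x \<otimes>\<^bsub>T\<^esub> y) z = pure_tensor T T x \<one>\<^bsub>T\<^esub> \<otimes>\<^bsub>TT\<^esub> act y z"
  using assms(3)
proof (induction z rule: OTT.tensor_induct)
  case (tens a b)
  then show ?case using assms by (simp add: act_tens TT.tens_mult T.m_assoc)
next
  case (add y z)
  then show ?case using assms by (simp add: actD TT.T.r_distr)
qed

lemma can_inv_left_mult:
  assumes "x \<in> carrier T" "z \<in> carrier TH"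
  shows "can_inv (pure_tensor T H x \<one>\<^bsub>H\<^esub> \<otimes>\<^bsub>TH\<^esub> z) = pure_tensor T T x \<one>\<^bsub>T\<^esub> \<otimes>\<^bsub>TT\<^esub> can_inv z"
  using assms(2)
proof (induction z rule: TH.tensor_induct)
  case (tens a b)
  then show ?case using assms by (simp add: can_inv_tens TH.tens_mult act_left_mult \<tau>D)
next
  case (add y z)
  then show ?case using assms by (simp add: can_invD TT.T.r_distr TH.T.r_distr)
qed

text \<open>
  If \<open>can\<close> maps \<open>\<tau>(g)\<close> to \<open>1 \<otimes> g\<close>, this factor commutes with the elements \<open>a \<otimes> 1\<close>
  that surround it in \<open>can (\<tau>(g) \<tau>(h))\<close>.
\<close>

lemma can_op_translation_generated:
  assumes G: "generates H G" and gen: "\<And>h. h \<in> G \<Longrightarrow> can_op (\<tau> h) = pure_tensor T H \<one>\<^bsub>T\<^esub> h"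
    and h: "h \<in> carrier H"
  shows "can_op (\<tau> h) = pure_tensor T H \<one>\<^bsub>T\<^esub> h"
proof -
  have *: "can_op (x \<otimes>\<^bsub>OTT\<^esub> y) = pure_tensor T H \<one>\<^bsub>T\<^esub> g \<otimes>\<^bsub>TH\<^esub> can_op y"
    if x: "x \<in> carrier OTT" "can_op x = pure_tensor T H \<one>\<^bsub>T\<^esub> g" and g: "g \<in> carrier H" and y: "y \<in> carrier OTT"
    for x y g
    using y
  proof (induction y rule: OTT.tensor_induct)
    case (tens a b)
    have "pure_tensor T H a \<one>\<^bsub>H\<^esub> \<otimes>\<^bsub>TH\<^esub> pure_tensor T H \<one>\<^bsub>T\<^esub> g =
        pure_tensor T H \<one>\<^bsub>T\<^esub> g \<otimes>\<^bsub>TH\<^esub> pure_tensor T H a \<one>\<^bsub>H\<^esub>"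
      using tens g by (simp add: TH.tens_mult)
    then show ?case using x tens g by (simp add: can_op_anti(2) can_op_tens TH.T.m_assoc \<beta>D)
  next
    case (add y z)
    then show ?case using x g by (simp add: OTT.T.r_distr can_opD TH.T.r_distr)
  qed
  show ?thesis using G h
    by (induction h rule: generates_induct)
      (simp_all add: gen \<tau>D can_opD * TH.tens_mult TH.tens_add_right TH.tens_smult_right
         OTT.tens_one can_op_tens \<beta>D TH.tens_one)
qed

text \<open>For \<open>u = u\<^sub>1 \<otimes> u\<^sub>2\<close> this is the map \<open>p \<otimes> r \<mapsto> a p u\<^sub>1 \<otimes> u\<^sub>2 r\<close>.\<close>

definition sandwich :: "'t \<Rightarrow> (('t \<times> 't) \<Rightarrow>\<^sub>0 'k) set \<Rightarrow> (('t \<times> 't) \<Rightarrow>\<^sub>0 'k) set \<Rightarrow> (('t \<times> 't) \<Rightarrow>\<^sub>0 'k) set" where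
  "sandwich a u = tensor_lift TT (\<lambda>p r. act (a \<otimes>\<^bsub>T\<^esub> p) u \<otimes>\<^bsub>TT\<^esub> pure_tensor T T \<one>\<^bsub>T\<^esub> r)"

lemma sandwich_bilinear:
  assumes "a \<in> carrier T" "u \<in> carrier OTT"
  shows "(\<lambda>p r. act (a \<otimes>\<^bsub>T\<^esub> p) u \<otimes>\<^bsub>TT\<^esub> pure_tensor T T \<one>\<^bsub>T\<^esub> r) \<in> bilinear_maps T T TT"
  using assms by (intro bilinear_mapsI linear_mapsI)
    (simp_all add: actD act_leftD T.r_distr T.smult_mult_right TT.tens_add_right TT.tens_smult_right
       TT.T.l_distr TT.T.r_distr TT.T.smult_mult_left TT.T.smult_mult_right)

lemmas sandwichD = linear_mapsD[OF TT.tensor_lift_linear[OF TT.tensor_assoc_algebra sandwich_bilinear, folded sandwich_def]]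
lemmas sandwich_tens = TT.tensor_lift_tens[OF TT.tensor_assoc_algebra sandwich_bilinear, folded sandwich_def]

lemma act_mult:
  assumes ab: "a \<in> carrier T" "b \<in> carrier T" and u: "u \<in> carrier OTT" and v: "v \<in> carrier OTT"
  shows "act (a \<otimes>\<^bsub>T\<^esub> b) (u \<otimes>\<^bsub>OTT\<^esub> v) = sandwich a u (act b v)"
  using v
proof (induction v rule: OTT.tensor_induct)
  case (tens c d)
  have "act (a \<otimes>\<^bsub>T\<^esub> b) (u \<otimes>\<^bsub>OTT\<^esub> pure_tensor OT T c d) =
    act (a \<otimes>\<^bsub>T\<^esub> (b \<otimes>\<^bsub>T\<^esub> c)) u \<otimes>\<^bsub>TT\<^esub> pure_tensor T T \<one>\<^bsub>T\<^esub> d"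
    using u
  proof (induction u rule: OTT.tensor_induct)
    case (tens e f)
    then show ?case using ab \<open>c \<in> carrier OT\<close> \<open>d \<in> carrier T\<close>
      by (simp add: OTT.tens_mult act_tens TT.tens_mult T.m_assoc)
  next
    case (add x y)
    then show ?case using ab \<open>c \<in> carrier OT\<close> \<open>d \<in> carrier T\<close>
      by (simp add: OTT.T.l_distr actD TT.T.l_distr)
  qed
  then show ?case using ab u tens by (simp add: act_tens sandwich_tens)
next
  case (add x y)
  then show ?case using ab u by (simp add: OTT.T.r_distr actD sandwichD)
qed

text \<open>
  Since \<open>\<tau>(g h) = \<tau>(g) \<tau>(h)\<close> in \<open>T\<^sup>o\<^sup>p \<otimes> T\<close>, the element \<open>a b \<tau>(g h)\<close> contains \<open>b \<tau>(h)\<close> as its inner part.  When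
  these inner parts add up to \<open>1 \<otimes> y\<close>, what remains is \<open>a \<tau>(g)\<close> times \<open>1 \<otimes> y\<close>.
\<close>

lemma can_inv_mult:
  assumes w: "w \<in> carrier TH" "can_inv w = pure_tensor T T \<one>\<^bsub>T\<^esub> y" and y: "y \<in> carrier T"
    and z: "z \<in> carrier TH"
  shows "can_inv (z \<otimes>\<^bsub>TH\<^esub> w) = can_inv z \<otimes>\<^bsub>TT\<^esub> pure_tensor T T \<one>\<^bsub>T\<^esub> y"
  using z
proof (induction z rule: TH.tensor_induct)
  case (tens a g)
  have "can_inv (pure_tensor T H a g \<otimes>\<^bsub>TH\<^esub> v) = sandwich a (\<tau> g) (can_inv v)" if "v \<in> carrier TH" for v
    using that
  proof (induction v rule: TH.tensor_induct)
    case (tens b h)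
    then show ?case using \<open>a \<in> carrier T\<close> \<open>g \<in> carrier H\<close>
      by (simp add: TH.tens_mult can_inv_tens \<tau>D act_mult)
  next
    case (add v v')
    then show ?case using \<open>a \<in> carrier T\<close> \<open>g \<in> carrier H\<close>
      by (simp add: TH.T.r_distr can_invD sandwichD \<tau>D)
  qed
  then show ?case using tens w y by (simp add: sandwich_tens can_inv_tens \<tau>D)
next
  case (add x x')
  then show ?case using w y by (simp add: TH.T.l_distr can_invD TT.T.l_distr)
qed

lemma can_inv_coaction_generated:
  assumes G: "generates T G" and gen: "\<And>x. x \<in> G \<Longrightarrow> can_inv (\<beta> x) = pure_tensor T T \<one>\<^bsub>T\<^esub> x"
    and x: "x \<in> carrier T"
  shows "can_inv (\<beta> x) = pure_tensor T T \<one>\<^bsub>T\<^esub> x"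
  using G x
proof (induction x rule: generates_induct)
  case (mult x y)
  then show ?case by (simp add: \<beta>D can_inv_mult[OF _ mult(4)] TT.tens_mult)
qed (simp_all add: gen \<beta>D can_invD TT.tens_add_right TT.tens_smult_right
       TH.tens_one can_inv_tens \<tau>D OTT.tens_one act_tens)

text \<open>
  The functional \<open>\<phi>\<close> serves the coinvariants: for coinvariant \<open>x\<close> bijectivity gives \<open>1 \<otimes> x = x \<otimes> 1\<close>, and applying
  \<open>\<phi>\<close> to the first factor yields \<open>x = \<phi>(x) 1\<close>.
\<close>

lemma hopf_galois_extensionI:
  assumes G: "generates H G" and 1: "\<And>h. h \<in> G \<Longrightarrow> can_op (\<tau> h) = pure_tensor T H \<one>\<^bsub>T\<^esub> h"
    and G': "generates T G'" and 2: "\<And>x. x \<in> G' \<Longrightarrow> can_inv (\<beta> x) = pure_tensor T T \<one>\<^bsub>T\<^esub> x"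
    and \<phi>: "\<phi> \<in> linear_maps T (ground_algebra :: ('k, 'k) module)" "\<phi> \<one>\<^bsub>T\<^esub> = 1"
  shows "hopf_galois_extension H \<Delta> \<epsilon> S T \<beta>"
proof -
  note 1 = can_op_translation_generated[OF G 1] and 2 = can_inv_coaction_generated[OF G' 2]
  have ci: "canonical_map H T \<beta> (can_inv z) = z" if "z \<in> carrier TH" for z
    using that
  proof (induction z rule: TH.tensor_induct)
    case (tens x h)
    then show ?case by (simp add: can_inv_tens can_act \<tau>D 1 TH.tens_mult)
  qed (simp add: canD can_invD)
  have ic: "can_inv (canonical_map H T \<beta> z) = z" if "z \<in> carrier TT" for z
    using that
  proof (induction z rule: TT.tensor_induct)
    case (tens x y)
    then show ?case by (simp add: can_tens can_inv_left_mult 2 TT.tens_mult \<beta>D)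
  qed (simp add: canD can_invD)
  have bij: "bij_betw (canonical_map H T \<beta>) (carrier TT) (carrier TH)"
    by (rule bij_betw_byWitness[where f' = can_inv]) (auto simp: ic ci canD can_invD)
  note f = linear_mapsD[OF \<phi>(1), simplified]
  have fb: "(\<lambda>a b. \<phi> a \<odot>\<^bsub>T\<^esub> b) \<in> bilinear_maps T T T"
    by (intro bilinear_mapsI linear_mapsI)
      (simp_all add: f T.scalar_add_left T.scalar_add_right T.scalar_scalar mult.commute)
  note fv = TT.tensor_lift_tens[OF T.assoc_algebra_axioms fb]
  have coinv: "x = \<phi> x \<odot>\<^bsub>T\<^esub> \<one>\<^bsub>T\<^esub>" if "x \<in> carrier T" "\<beta> x = pure_tensor T H x \<one>\<^bsub>H\<^esub>" for x
  proof -
    have "canonical_map H T \<beta> (pure_tensor T T \<one>\<^bsub>T\<^esub> x) = canonical_map H T \<beta> (pure_tensor T T x \<one>\<^bsub>T\<^esub>)"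
      using that by (simp add: can_tens \<beta>D TH.tens_mult TH.tens_one)
    then have "pure_tensor T T \<one>\<^bsub>T\<^esub> x = pure_tensor T T x \<one>\<^bsub>T\<^esub>"
      using ic[OF TT.tens_closed[OF T.one_closed that(1)]] ic[OF TT.tens_closed[OF that(1) T.one_closed]]
      by metis
    then have "tensor_lift T (\<lambda>a b. \<phi> a \<odot>\<^bsub>T\<^esub> b) (pure_tensor T T \<one>\<^bsub>T\<^esub> x) =
      tensor_lift T (\<lambda>a b. \<phi> a \<odot>\<^bsub>T\<^esub> b) (pure_tensor T T x \<one>\<^bsub>T\<^esub>)" by simp
    then show ?thesis using that by (simp add: fv \<phi>(2))
  qed
  have "bij_betw (\<lambda>r. r \<odot>\<^bsub>T\<^esub> \<one>\<^bsub>T\<^esub>) UNIV (coinvariants H T \<beta>)"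
    by (rule bij_betw_byWitness[where f' = \<phi>])
      (auto simp: coinvariants_def f \<phi>(2) coinv[symmetric] \<beta>D TH.tens_smult_left TH.tens_one)
  with bij show ?thesis
    by (intro hopf_galois_extension.intro hopf_galois_extension_axioms.intro comodule_algebra_axioms)
qed

end

section \<open>Quantum Serre elements\<close>

text \<open>
  With \<open>v = q\<^sub>i\<close> and \<open>a\<close> the Cartan entry, the iterated \<open>q\<close>-commutator of length \<open>1 - a\<close> is the Serre
  element up to a nonzero scalar.  Its recursive form is what makes inductive proofs possible.
\<close>

primrec q_ad :: "('k::field, 'a) module \<Rightarrow> 'k \<Rightarrow> int \<Rightarrow> 'a \<Rightarrow> 'a \<Rightarrow> nat \<Rightarrow> 'a" where
  "q_ad A v a x u 0 = u"
| "q_ad A v a x u (Suc l) =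
     (q_ad A v a x u l \<otimes>\<^bsub>A\<^esub> x) \<oplus>\<^bsub>A\<^esub> (- (v powi (a + 2 * int l))) \<odot>\<^bsub>A\<^esub> (x \<otimes>\<^bsub>A\<^esub> q_ad A v a x u l)"

context assoc_algebra
begin

lemma q_ad_closed [simp]: "x \<in> carrier A \<Longrightarrow> u \<in> carrier A \<Longrightarrow> q_ad A v a x u l \<in> carrier A"
  by (induction l) simp_all

lemma q_ad_add:
  assumes "x \<in> carrier A" "u \<in> carrier A" "w \<in> carrier A"
  shows "q_ad A v a x (u \<oplus> w) l = q_ad A v a x u l \<oplus> q_ad A v a x w l"
  using assms by (induction l) (simp_all add: l_distr r_distr scalar_add_right a_ac)

lemma q_ad_zero: "x \<in> carrier A \<Longrightarrow> q_ad A v a x \<zero> l = \<zero>"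
  by (induction l) simp_all

lemma q_ad_commute:
  assumes c: "x \<in> carrier A" "u \<in> carrier A" "t \<in> carrier A"
    and "x \<otimes> t = p \<odot> (t \<otimes> x)" "u \<otimes> t = r \<odot> (t \<otimes> u)"
  shows "q_ad A v a x u l \<otimes> t = (p ^ l * r) \<odot> (t \<otimes> q_ad A v a x u l)"
proof (induction l)
  case (Suc l)
  let ?S = "q_ad A v a x u l"
  have 1: "?S \<otimes> x \<otimes> t = (p ^ Suc l * r) \<odot> (t \<otimes> (?S \<otimes> x))"
  proof -
    have "?S \<otimes> x \<otimes> t = p \<odot> (?S \<otimes> t \<otimes> x)" using assms by (simp add: m_assoc smult_mult_right)
    also have "\<dots> = (p ^ Suc l * r) \<odot> (t \<otimes> ?S \<otimes> x)" using c by (simp add: Suc smult_mult_left scalar_scalar mult_ac)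
    finally show ?thesis using c by (simp add: m_assoc)
  qed
  have 2: "x \<otimes> ?S \<otimes> t = (p ^ Suc l * r) \<odot> (t \<otimes> (x \<otimes> ?S))"
  proof -
    have "x \<otimes> ?S \<otimes> t = (p ^ l * r) \<odot> (x \<otimes> t \<otimes> ?S)" using c by (simp add: m_assoc Suc smult_mult_right)
    also have "\<dots> = (p ^ Suc l * r) \<odot> (t \<otimes> x \<otimes> ?S)" using c assms(4) by (simp add: smult_mult_left scalar_scalar mult_ac)
    finally show ?thesis using c by (simp add: m_assoc)
  qed
  show ?case using c 1 2
    by (simp add: l_distr r_distr smult_mult_left smult_mult_right scalar_add_right scalar_scalar mult_ac)
qed (use assms in simp)

lemma q_ad_commute_left:
  assumes c: "x \<in> carrier A" "u \<in> carrier A" "t \<in> carrier A"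
    and "t \<otimes> x = p \<odot> (x \<otimes> t)" "t \<otimes> u = r \<odot> (u \<otimes> t)" "p \<noteq> 0" "r \<noteq> 0"
  shows "t \<otimes> q_ad A v a x u l = (p ^ l * r) \<odot> (q_ad A v a x u l \<otimes> t)"
proof -
  have "x \<otimes> t = inverse p \<odot> (t \<otimes> x)" "u \<otimes> t = inverse r \<odot> (t \<otimes> u)"
    using assms by (simp_all add: scalar_scalar)
  note * = q_ad_commute[OF c this, of v a l]
  have "p ^ l * r * (inverse p ^ l * inverse r) = 1" using assms by (simp add: field_simps)
  then show ?thesis unfolding * using c by (simp add: scalar_scalar)
qed

lemma pow_commute:
  assumes c: "x \<in> carrier A" "y \<in> carrier A" and "y \<otimes> x = p \<odot> (x \<otimes> y)"
  shows "(y [^] (s::nat)) \<otimes> x = p ^ s \<odot> (x \<otimes> y [^] s)"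
proof (induction s)
  case (Suc s)
  have "y [^] s \<otimes> y \<otimes> x = p \<odot> (y [^] s \<otimes> x \<otimes> y)"
    using assms by (simp add: m_assoc smult_mult_right)
  also have "\<dots> = p ^ Suc s \<odot> (x \<otimes> y [^] s \<otimes> y)"
    using c by (simp add: Suc smult_mult_left scalar_scalar)
  finally show ?case using c by (simp add: m_assoc)
qed (use c in simp)

end

subsection \<open>Iterated q-commutators and the divided power form\<close>

text \<open>
  A Pascal recursion; its solution, given below, is \<open>v\<^bsup>k (a + l - 1)\<^esup>\<close> times the symmetric \<open>q\<close>-binomial coefficient, and the
  power disappears at \<open>l = 1 - a\<close>.
\<close>

primrec q_ad_coeff :: "'k::field \<Rightarrow> int \<Rightarrow> nat \<Rightarrow> nat \<Rightarrow> 'k" where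
  "q_ad_coeff v a 0 k = (if k = 0 then 1 else 0)"
| "q_ad_coeff v a (Suc l) k = q_ad_coeff v a l k +
     (case k of 0 \<Rightarrow> 0 | Suc k' \<Rightarrow> v powi (a + 2 * int l) * q_ad_coeff v a l k')"

lemma q_ad_coeff_0 [simp]: "q_ad_coeff v a l 0 = 1"
  by (induction l) auto

lemma q_ad_coeff_large: "l < k \<Longrightarrow> q_ad_coeff v a l k = 0"
  by (induction l arbitrary: k) (auto split: nat.splits)

lemma (in assoc_algebra) q_ad_expand:
  assumes c: "x \<in> carrier A" "u \<in> carrier A"
  shows "q_ad A v a x u l =
    (\<Oplus>k\<in>{..l}. ((-1) ^ k * q_ad_coeff v a l k) \<odot> (x [^] k \<otimes> u \<otimes> x [^] (l - k)))"
proof (induction l)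
  case 0
  show ?case using c by (simp add: finsum_0)
next
  case (Suc l)
  let ?g = "\<lambda>l k. (-1) ^ k * q_ad_coeff v a l k"
  let ?c = "v powi (a + 2 * int l)"
  let ?m = "\<lambda>i j. x [^] (i::nat) \<otimes> u \<otimes> x [^] (j::nat)"
  have mc: "?m i j \<in> carrier A" for i j using c by simp
  have "q_ad A v a x u l \<otimes> x = (\<Oplus>k\<in>{..l}. (?g l k \<odot> ?m k (l - k)) \<otimes> x)"
    unfolding Suc using c by (intro finsum_ldistr) auto
  also have "\<dots> = (\<Oplus>k\<in>{..l}. ?g l k \<odot> ?m k (Suc l - k))"
    using c by (intro finsum_cong') (auto simp: smult_mult_left m_assoc Suc_diff_le)
  also have "\<dots> = (\<Oplus>k\<in>{..Suc l}. ?g l k \<odot> ?m k (Suc l - k))"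
    using c by (subst finsum_Suc) (auto simp: q_ad_coeff_large)
  also have "\<dots> = (\<Oplus>k\<in>{..l}. ?g l (Suc k) \<odot> ?m (Suc k) (l - k)) \<oplus> ?g l 0 \<odot> ?m 0 (Suc l)"
    using c by (subst finsum_Suc2) auto
  finally have 1: "q_ad A v a x u l \<otimes> x = \<dots>" .
  have "x \<otimes> q_ad A v a x u l = (\<Oplus>k\<in>{..l}. x \<otimes> (?g l k \<odot> ?m k (l - k)))"
    unfolding Suc using c by (intro finsum_rdistr) auto
  also have "\<dots> = (\<Oplus>k\<in>{..l}. ?g l k \<odot> ?m (Suc k) (l - k))"
  proof -
    have "x \<otimes> (x [^] k \<otimes> z) = x [^] k \<otimes> (x \<otimes> z)" if "z \<in> carrier A" for k :: nat and z
      using c that nat_pow_Suc2[OF c(1), of k] by (simp add: m_assoc[symmetric])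
    then show ?thesis using c by (intro finsum_cong') (auto simp: smult_mult_right m_assoc)
  qed
  finally have "(- ?c) \<odot> (x \<otimes> q_ad A v a x u l) = (- ?c) \<odot> (\<Oplus>k\<in>{..l}. ?g l k \<odot> ?m (Suc k) (l - k))" by simp
  also have "\<dots> = (\<Oplus>k\<in>{..l}. (- ?c * ?g l k) \<odot> ?m (Suc k) (l - k))"
    using c by (subst finsum_scalar) (auto simp: scalar_scalar)
  finally have 2: "(- ?c) \<odot> (x \<otimes> q_ad A v a x u l) = \<dots>" .
  have "q_ad A v a x u (Suc l) =
    ((\<Oplus>k\<in>{..l}. ?g l (Suc k) \<odot> ?m (Suc k) (l - k)) \<oplus> ?g l 0 \<odot> ?m 0 (Suc l)) \<oplus>
    (\<Oplus>k\<in>{..l}. (- ?c * ?g l k) \<odot> ?m (Suc k) (l - k))"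
    by (simp only: q_ad.simps 1 2)
  also have "\<dots> = ((\<Oplus>k\<in>{..l}. ?g l (Suc k) \<odot> ?m (Suc k) (l - k)) \<oplus>
    (\<Oplus>k\<in>{..l}. (- ?c * ?g l k) \<odot> ?m (Suc k) (l - k))) \<oplus> ?g l 0 \<odot> ?m 0 (Suc l)"
    using c by (simp add: a_ac)
  also have "(\<Oplus>k\<in>{..l}. ?g l (Suc k) \<odot> ?m (Suc k) (l - k)) \<oplus>
      (\<Oplus>k\<in>{..l}. (- ?c * ?g l k) \<odot> ?m (Suc k) (l - k)) =
      (\<Oplus>k\<in>{..l}. ?g (Suc l) (Suc k) \<odot> ?m (Suc k) (l - k))"
    using c by (subst finsum_addf[symmetric])
      (auto simp: scalar_add_left[symmetric] algebra_simps intro!: finsum_cong')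
  also have "\<dots> \<oplus> ?g l 0 \<odot> ?m 0 (Suc l) = (\<Oplus>k\<in>{..Suc l}. ?g (Suc l) k \<odot> ?m k (Suc l - k))"
    using c by (subst finsum_Suc2[of _ l]) auto
  finally show ?case .
qed

lemma q_fact_Suc: "q_fact c (Suc n) = q_fact c n * q_int c (Suc n)"
  by (simp add: q_fact_def)

lemma q_fact_0 [simp]: "q_fact c 0 = 1"
  by (simp add: q_fact_def)

lemma q_int_pascal:
  assumes "v \<noteq> 0" "k \<le> l"
  shows "v ^ Suc k * q_int v (Suc l) = q_int v (l - k) + v ^ Suc l * q_int v (Suc k)"
proof -
  obtain j where l: "l = k + j" using assms(2) le_Suc_ex by blast
  have "v ^ Suc k * (v ^ Suc l - inverse v ^ Suc l) =
    (v ^ (l - k) - inverse v ^ (l - k)) + v ^ Suc l * (v ^ Suc k - inverse v ^ Suc k)"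
    using assms(1) by (simp add: l power_add field_simps)
  then show ?thesis by (simp add: q_int_def add_divide_distrib[symmetric])
qed

lemma q_ad_coeff_fact:
  assumes v: "v \<noteq> 0"
  shows "k \<le> l \<Longrightarrow> q_ad_coeff v a l k * (q_fact v k * q_fact v (l - k)) =
     v powi (int k * (a + int l - 1)) * q_fact v l"
proof (induction l arbitrary: k)
  case (Suc l)
  show ?case
  proof (cases k)
    case 0
    then show ?thesis by (simp del: q_ad_coeff.simps)
  next
    case [simp]: (Suc k')
    have k': "k' \<le> l" using Suc.prems by simp
    have e: "v powi (a + 2 * int l) * v powi (int k' * (a + int l - 1)) =
        v powi (int (Suc k') * (a + int l - 1)) * v ^ Suc l"
      using v by (simp add: power_int_add[symmetric] power_int_of_nat[symmetric] algebra_simps del: power_Suc)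
    have e2: "v powi (int (Suc k') * (a + int l - 1)) * v ^ Suc k' = v powi (int (Suc k') * (a + int (Suc l) - 1))"
      using v by (simp add: power_int_add[symmetric] power_int_of_nat[symmetric] algebra_simps del: power_Suc)
    have 1: "q_ad_coeff v a l (Suc k') * (q_fact v (Suc k') * q_fact v (l - k')) =
        v powi (int (Suc k') * (a + int l - 1)) * q_fact v l * q_int v (l - k')"
    proof (cases "k' = l")
      case True
      then show ?thesis by (simp add: q_ad_coeff_large q_int_def)
    next
      case False
      then have "l - k' = Suc (l - Suc k')" using k' by simp
      then have "q_fact v (l - k') = q_fact v (l - Suc k') * q_int v (l - k')" by (simp add: q_fact_Suc)
      with Suc.IH[of "Suc k'"] False k' show ?thesis by (simp add: mult_ac)
    qed
    have 2: "v powi (a + 2 * int l) * q_ad_coeff v a l k' * (q_fact v (Suc k') * q_fact v (l - k')) =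
        v powi (int (Suc k') * (a + int l - 1)) * v ^ Suc l * q_fact v l * q_int v (Suc k')"
    proof -
      have "v powi (a + 2 * int l) * q_ad_coeff v a l k' * (q_fact v (Suc k') * q_fact v (l - k')) =
        v powi (a + 2 * int l) * (q_ad_coeff v a l k' * (q_fact v k' * q_fact v (l - k'))) * q_int v (Suc k')"
        by (simp add: q_fact_Suc mult_ac)
      also have "\<dots> = (v powi (a + 2 * int l) * v powi (int k' * (a + int l - 1))) * q_fact v l * q_int v (Suc k')"
        unfolding Suc.IH[OF k'] by (simp only: mult.assoc)
      finally show ?thesis by (simp only: e)
    qed
    have "q_ad_coeff v a (Suc l) k * (q_fact v k * q_fact v (Suc l - k)) =
      v powi (int (Suc k') * (a + int l - 1)) * q_fact v l * (q_int v (l - k') + v ^ Suc l * q_int v (Suc k'))"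
      using 1 2 by (simp add: distrib_right distrib_left mult_ac)
    also have "\<dots> = (v powi (int (Suc k') * (a + int l - 1)) * v ^ Suc k') * q_fact v (Suc l)"
      unfolding q_int_pascal[OF v k', symmetric] q_fact_Suc by (simp only: mult_ac)
    finally show ?thesis unfolding e2 by simp
  qed
qed simp

definition generic_parameter :: "'k::field \<Rightarrow> bool" where
  "generic_parameter v \<longleftrightarrow> v \<noteq> 0 \<and> (\<forall>n>0. v ^ n \<noteq> 1)"

lemma q_fact_nonzero: "generic_parameter v \<Longrightarrow> q_fact v n \<noteq> 0"
proof -
  assume g: "generic_parameter v"
  have "v ^ k \<noteq> inverse v ^ k" if "0 < k" for k :: nat
  proof
    assume "v ^ k = inverse v ^ k"
    then have "v ^ k * v ^ k = v ^ k * inverse (v ^ k)" by (simp add: power_inverse)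
    also have "\<dots> = 1" using g by (simp add: generic_parameter_def)
    finally have "v ^ k * v ^ k = 1" .
    then have "v ^ (k + k) = 1" by (simp add: power_add)
    with that g show False by (simp add: generic_parameter_def)
  qed
  from this this[of 1] show ?thesis by (simp add: q_fact_def q_int_def)
qed

lemma serre_element_eq_q_ad:
  fixes A :: "(laurent, 'a) module"
  assumes A: "assoc_algebra A" and v: "generic_parameter v"
    and c: "x \<in> carrier A" "u \<in> carrier A"
  shows "serre_element A v m x u = inverse (q_fact v m) \<odot>\<^bsub>A\<^esub> q_ad A v (1 - int m) x u m"
proof -
  interpret A: assoc_algebra A by fact
  have v0: "v \<noteq> 0" using v by (simp add: generic_parameter_def)
  note nz = q_fact_nonzero[OF v]
  let ?g = "\<lambda>k. (-1) ^ k * q_ad_coeff v (1 - int m) m k"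
  let ?m = "\<lambda>k. x [^]\<^bsub>A\<^esub> k \<otimes>\<^bsub>A\<^esub> u \<otimes>\<^bsub>A\<^esub> x [^]\<^bsub>A\<^esub> (m - k)"
  have eq: "(-1) ^ k \<odot>\<^bsub>A\<^esub> (divided_power A v x k \<otimes>\<^bsub>A\<^esub> u \<otimes>\<^bsub>A\<^esub> divided_power A v x (m - k)) =
      inverse (q_fact v m) \<odot>\<^bsub>A\<^esub> (?g k \<odot>\<^bsub>A\<^esub> ?m k)" if "k \<le> m" for k
  proof -
    have "q_ad_coeff v (1 - int m) m k = q_fact v m / (q_fact v k * q_fact v (m - k))"
      using q_ad_coeff_fact[OF v0 that, of "1 - int m"] nz by (simp add: field_simps)
    then have sc: "inverse (q_fact v m) * ?g k = (-1) ^ k * (inverse (q_fact v k) * inverse (q_fact v (m - k)))"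
      using nz by (simp add: field_simps)
    show ?thesis using c
      by (simp only: A.scalar_scalar sc A.m_closed A.nat_pow_closed)
        (simp add: divided_power_def A.smult_mult_left A.smult_mult_right A.scalar_scalar mult_ac)
  qed
  have "serre_element A v m x u = (\<Oplus>\<^bsub>A\<^esub>k\<in>{..m}. inverse (q_fact v m) \<odot>\<^bsub>A\<^esub> (?g k \<odot>\<^bsub>A\<^esub> ?m k))"
    unfolding serre_element_def atLeast0AtMost using c eq by (intro A.finsum_cong') auto
  also have "\<dots> = inverse (q_fact v m) \<odot>\<^bsub>A\<^esub> q_ad A v (1 - int m) x u m"
    unfolding A.q_ad_expand[OF c] using c by (subst A.finsum_scalar) auto
  finally show ?thesis .
qed

lemma serre_element_closed:
  assumes "assoc_algebra A" "x \<in> carrier A" "u \<in> carrier A"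
  shows "serre_element A v m x u \<in> carrier A"
proof -
  interpret A: assoc_algebra A by fact
  show ?thesis using assms unfolding serre_element_def divided_power_def by (intro A.finsum_closed) auto
qed

lemma serre_element_hom:
  assumes f: "f \<in> alg_hom A B" and AB: "assoc_algebra A" "assoc_algebra B" and c: "x \<in> carrier A" "u \<in> carrier A"
  shows "f (serre_element A v m x u) = serre_element B v m (f x) (f u)"
proof -
  interpret A: assoc_algebra A by fact
  interpret B: assoc_algebra B by fact
  note h = alg_homD[OF f]
  show ?thesis
    unfolding serre_element_def divided_power_def using c
    by (subst linear_maps_finsum[OF alg_hom_linear[OF f] AB])
      (auto simp: h alg_hom_pow[OF f AB(1)] intro!: B.finsum_cong')
qed

text \<open>Reversing all products exchanges the summands \<open>k\<close> and \<open>m - k\<close>, whose signs differ by \<open>(-1)\<^sup>m\<close>.\<close>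

lemma serre_element_opposite:
  assumes "assoc_algebra A" and c: "x \<in> carrier A" "u \<in> carrier A"
  shows "serre_element (opposite_algebra A) v m x u = (-1) ^ m \<odot>\<^bsub>A\<^esub> serre_element A v m x u"
proof -
  interpret A: assoc_algebra A by fact
  let ?t = "\<lambda>i j. divided_power A v x i \<otimes>\<^bsub>A\<^esub> u \<otimes>\<^bsub>A\<^esub> divided_power A v x j"
  have dc: "divided_power A v x k \<in> carrier A" for k using c by (simp add: divided_power_def)
  have d: "divided_power (opposite_algebra A) v x k = divided_power A v x k" for k
    using c by (simp add: divided_power_def opposite_algebra_pow[OF assms(1)])
  have "serre_element (opposite_algebra A) v m x u = (\<Oplus>\<^bsub>A\<^esub>k\<in>{0..m}. (-1) ^ k \<odot>\<^bsub>A\<^esub> ?t (m - k) k)"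
    using c dc by (auto simp: serre_element_def d A.m_assoc intro!: A.finsum_cong')
  also have "\<dots> = (\<Oplus>\<^bsub>A\<^esub>k\<in>(\<lambda>k. m - k) ` {0..m}. (-1) ^ k \<odot>\<^bsub>A\<^esub> ?t (m - k) k)"
  proof -
    have "k \<in> (\<lambda>k. m - k) ` {0..m}" if "k \<le> m" for k
      using that by (intro image_eqI[of _ _ "m - k"]) auto
    then have "(\<lambda>k. m - k) ` {0..m} = {0..m}" by auto
    then show ?thesis by simp
  qed
  also have "\<dots> = (\<Oplus>\<^bsub>A\<^esub>k\<in>{0..m}. (-1) ^ (m - k) \<odot>\<^bsub>A\<^esub> ?t (m - (m - k)) (m - k))"
    using c dc by (subst A.finsum_reindex) (auto simp: inj_on_def)
  also have "\<dots> = (\<Oplus>\<^bsub>A\<^esub>k\<in>{0..m}. (-1) ^ m \<odot>\<^bsub>A\<^esub> ((-1) ^ k \<odot>\<^bsub>A\<^esub> ?t k (m - k)))"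
  proof -
    have "(-1) ^ (m - k) = (-1 :: laurent) ^ m * (-1) ^ k" if "k \<le> m" for k
      using that by (auto simp: power_add[symmetric] minus_one_power_iff)
    then show ?thesis using c dc by (auto simp: A.scalar_scalar intro!: A.finsum_cong')
  qed
  also have "\<dots> = (-1) ^ m \<odot>\<^bsub>A\<^esub> serre_element A v m x u"
    using c dc unfolding serre_element_def by (subst A.finsum_scalar) auto
  finally show ?thesis .
qed

subsection \<open>Additivity\<close>

text \<open>
  The coefficient of \<open>S\<^bsub>l-s\<^esub>(x, u) y\<^sup>s\<close> in \<open>S\<^sub>l(x + y, u)\<close>, where \<open>S\<^sub>l\<close> denotes the iterated \<open>q\<close>-commutator.
\<close>

primrec add_coeff :: "'k::field \<Rightarrow> int \<Rightarrow> nat \<Rightarrow> nat \<Rightarrow> 'k" where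
  "add_coeff v a 0 s = (if s = 0 then 1 else 0)"
| "add_coeff v a (Suc l) s = (v ^ 2) ^ s * add_coeff v a l s +
     (case s of 0 \<Rightarrow> 0 | Suc s' \<Rightarrow> (1 - v powi (2 * a + 4 * int l - 2 * int s')) * add_coeff v a l s')"

lemma add_coeff_large: "l < s \<Longrightarrow> add_coeff v a l s = 0"
  by (induction l arbitrary: s) (auto split: nat.splits)

lemma add_coeff_0 [simp]: "add_coeff v a l 0 = 1"
  by (induction l) auto

text \<open>
  The coefficient is a Gaussian binomial in \<open>v\<^sup>2\<close> times the product of the factors
  \<open>1 - v\<^bsup>2 (a + l - 1 - p)\<^esup>\<close>; clearing denominators avoids division.  The factor with \<open>p = 0\<close> vanishes at \<open>l = 1 - a\<close>.
\<close>

lemma add_coeff_product: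
  assumes v: "v \<noteq> 0"
  shows "add_coeff v a l s * (\<Prod>p<s. 1 - v powi (2 * int (Suc p))) =
    (\<Prod>p<s. (1 - v powi (2 * (int l - int p))) * (1 - v powi (2 * (a + int l - 1 - int p))))"
proof (induction l arbitrary: s)
  case 0
  show ?case by (cases s) (auto simp: prod.lessThan_Suc_shift simp del: prod.lessThan_Suc)
next
  case (Suc l)
  show ?case
  proof (cases s)
    case [simp]: (Suc t)
    let ?D = "\<lambda>s. \<Prod>p<s. 1 - v powi (2 * int (Suc p))"
    let ?A = "\<lambda>l s. \<Prod>p<s. 1 - v powi (2 * (int l - int p))"
    let ?B = "\<lambda>l s. \<Prod>p<s. 1 - v powi (2 * (a + int l - 1 - int p))"
    have IH: "add_coeff v a l s * ?D s = ?A l s * ?B l s" for s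
      using Suc.IH[of s] by (simp add: prod.distrib)
    have A1: "?A (Suc l) (Suc t) = (1 - v powi (2 * (int l + 1))) * ?A l t"
      by (subst prod.lessThan_Suc_shift) (simp add: algebra_simps)
    have B1: "?B (Suc l) (Suc t) = (1 - v powi (2 * (a + int l))) * ?B l t"
      by (subst prod.lessThan_Suc_shift) (simp add: algebra_simps)
    \<comment> \<open>The recursion for the coefficients after division by the common factors of the three terms.\<close>
    have key: "(1 - v powi (2 * (int l + 1))) * (1 - v powi (2 * (a + int l))) =
      (v ^ 2) ^ Suc t * ((1 - v powi (2 * (int l - int t))) * (1 - v powi (2 * (a + int l - 1 - int t)))) +
      (1 - v powi (2 * a + 4 * int l - 2 * int t)) * (1 - v powi (2 * int (Suc t)))"
    proof -
      define X where "X = v powi (2 * int l)"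
      define Y where "Y = v powi (2 * a)"
      define Z where "Z = v powi (2 * int t)"
      have nz: "X \<noteq> 0" "Y \<noteq> 0" "Z \<noteq> 0" using v by (auto simp: X_def Y_def Z_def)
      have "v powi (2 * int t) = v ^ (2 * t)" using power_int_of_nat[of v "2 * t"] by simp
      then have e0: "(v ^ 2) ^ Suc t = Z * v ^ 2" by (simp add: Z_def power_mult)
      have e: "v powi (2 * (int l + 1)) = X * v ^ 2" "v powi (2 * (a + int l)) = Y * X"
        "v powi (2 * (int l - int t)) = X / Z"
        "v powi (2 * (a + int l - 1 - int t)) = Y * X / (v ^ 2 * Z)"
        "v powi (2 * a + 4 * int l - 2 * int t) = Y * (X * X) / Z"
        "v powi (2 * int (Suc t)) = Z * v ^ 2"
        using v unfolding X_def Y_def Z_def power_int_of_nat[symmetric]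
          power_int_add[OF disjI1[OF v], symmetric] power_int_diff[OF disjI1[OF v], symmetric]
        by (simp_all add: algebra_simps)
      show ?thesis unfolding e0 e using nz v by (simp add: field_simps)
    qed
    have "add_coeff v a (Suc l) s * ?D s =
      (v ^ 2) ^ Suc t * (add_coeff v a l (Suc t) * ?D (Suc t)) +
      (1 - v powi (2 * a + 4 * int l - 2 * int t)) * (1 - v powi (2 * int (Suc t))) * (add_coeff v a l t * ?D t)"
      by (simp add: algebra_simps)
    also have "\<dots> = ((v ^ 2) ^ Suc t * ((1 - v powi (2 * (int l - int t))) * (1 - v powi (2 * (a + int l - 1 - int t)))) +
      (1 - v powi (2 * a + 4 * int l - 2 * int t)) * (1 - v powi (2 * int (Suc t)))) * (?A l t * ?B l t)"
      unfolding IH by (simp add: algebra_simps)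
    also have "\<dots> = ?A (Suc l) (Suc t) * ?B (Suc l) (Suc t)"
      unfolding key[symmetric] A1 B1 by (simp only: mult_ac)
    finally show ?thesis by (simp only: prod.distrib Suc)
  qed simp
qed

lemma add_coeff_vanish:
  assumes v: "generic_parameter v" and "0 < s"
  shows "add_coeff v (1 - int m) m s = 0"
proof -
  have v0: "v \<noteq> 0" using v by (simp add: generic_parameter_def)
  have "v powi (2 * int (Suc p)) \<noteq> 1" for p
  proof -
    have "v powi (2 * int (Suc p)) = v ^ (2 * Suc p)" by (simp only: power_int_of_nat[symmetric] of_nat_mult of_nat_numeral)
    moreover have "v ^ (2 * Suc p) \<noteq> 1"
      using v unfolding generic_parameter_def by (metis mult_pos_pos zero_less_Suc zero_less_numeral)
    ultimately show ?thesis by simp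
  qed
  then have "(\<Prod>p<s. 1 - v powi (2 * int (Suc p))) \<noteq> 0" by (metis (no_types, lifting) finite_lessThan prod_zero_iff right_minus_eq)
  moreover have "add_coeff v (1 - int m) m s * (\<Prod>p<s. 1 - v powi (2 * int (Suc p))) = 0"
    unfolding add_coeff_product[OF v0] using \<open>0 < s\<close> by (auto intro!: bexI[of _ 0])
  ultimately show ?thesis unfolding mult_eq_0_iff by blast
qed

lemma square_power_eq_powi: "(v ^ 2) ^ r = v powi (2 * int r)" for v :: "'k::field"
  using power_int_of_nat[of v "2 * r"] by (simp add: power_mult)

context assoc_algebra
begin

lemma q_ad_sum_expand:
  assumes c: "x \<in> carrier A" "y \<in> carrier A" "u \<in> carrier A" and v: "v \<noteq> 0"
    and yx: "y \<otimes> x = v ^ 2 \<odot> (x \<otimes> y)" and yu: "y \<otimes> u = v powi a \<odot> (u \<otimes> y)"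
  shows "q_ad A v a (x \<oplus> y) u l =
    (\<Oplus>s\<in>{..l}. add_coeff v a l s \<odot> (q_ad A v a x u (l - s) \<otimes> y [^] s))"
proof (induction l)
  case 0
  show ?case using c by (simp add: finsum_0)
next
  case (Suc l)
  let ?S = "q_ad A v a x u" and ?z = "x \<oplus> y"
  let ?c = "v powi (a + 2 * int l)"
  have Sc: "?S i \<otimes> y [^] (j::nat) \<in> carrier A" for i j using c by simp
  have yS: "y \<otimes> ?S r = v powi (a + 2 * int r) \<odot> (?S r \<otimes> y)" for r
  proof -
    have "(v ^ 2) ^ r * v powi a = v powi (a + 2 * int r)"
      unfolding square_power_eq_powi using v by (simp add: power_int_add)
    then show ?thesis using q_ad_commute_left[OF c(1,3,2) yx yu, of v a r] v by simp
  qed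
  have step: "(?S (l - s) \<otimes> y [^] s) \<otimes> ?z \<oplus> (- ?c) \<odot> (?z \<otimes> (?S (l - s) \<otimes> y [^] s)) =
      (v ^ 2) ^ s \<odot> (?S (Suc l - s) \<otimes> y [^] s) \<oplus>
      (1 - v powi (2 * a + 4 * int l - 2 * int s)) \<odot> (?S (l - s) \<otimes> y [^] Suc s)" if s: "s \<le> l" for s
  proof -
    let ?r = "l - s"
    have e1: "?c = v powi (a + 2 * int ?r) * (v ^ 2) ^ s"
      unfolding square_power_eq_powi using v s by (simp add: power_int_add[symmetric] of_nat_diff algebra_simps)
    have e1': "- ?c = (v ^ 2) ^ s * (- (v powi (a + 2 * int ?r)))"
      unfolding e1 by (simp only: mult_minus_right mult.commute)
    have e2: "?c * v powi (a + 2 * int ?r) = v powi (2 * a + 4 * int l - 2 * int s)"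
      using v s by (simp add: power_int_add[symmetric] of_nat_diff algebra_simps)
    have 1: "(?S ?r \<otimes> y [^] s) \<otimes> x = (v ^ 2) ^ s \<odot> (?S ?r \<otimes> x \<otimes> y [^] s)"
      using c pow_commute[OF c(1,2) yx, of s] by (simp add: m_assoc smult_mult_right)
    have 2: "y \<otimes> (?S ?r \<otimes> y [^] s) = v powi (a + 2 * int ?r) \<odot> (?S ?r \<otimes> y [^] Suc s)"
    proof -
      have "y \<otimes> (?S ?r \<otimes> y [^] s) = v powi (a + 2 * int ?r) \<odot> (?S ?r \<otimes> y \<otimes> y [^] s)"
        using c by (simp add: m_assoc[symmetric] yS smult_mult_left)
      also have "?S ?r \<otimes> y \<otimes> y [^] s = ?S ?r \<otimes> y [^] Suc s"
        using c by (simp only: m_assoc nat_pow_Suc2 q_ad_closed nat_pow_closed)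
      finally show ?thesis .
    qed
    have "(?S ?r \<otimes> y [^] s) \<otimes> ?z \<oplus> (- ?c) \<odot> (?z \<otimes> (?S ?r \<otimes> y [^] s)) =
      ((v ^ 2) ^ s \<odot> (?S ?r \<otimes> x \<otimes> y [^] s) \<oplus> ?S ?r \<otimes> y [^] Suc s) \<oplus>
      ((- ?c) \<odot> (x \<otimes> ?S ?r \<otimes> y [^] s) \<oplus> (- (v powi (2 * a + 4 * int l - 2 * int s))) \<odot> (?S ?r \<otimes> y [^] Suc s))"
      using c by (simp add: r_distr l_distr 1 2 scalar_add_right scalar_scalar e2 del: nat_pow_Suc)
        (simp add: m_assoc)
    also have "\<dots> = ((v ^ 2) ^ s \<odot> (?S ?r \<otimes> x \<otimes> y [^] s) \<oplus> (- ?c) \<odot> (x \<otimes> ?S ?r \<otimes> y [^] s)) \<oplus>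
       (?S ?r \<otimes> y [^] Suc s \<oplus> (- (v powi (2 * a + 4 * int l - 2 * int s))) \<odot> (?S ?r \<otimes> y [^] Suc s))"
      using c by (simp add: a_ac del: nat_pow_Suc)
    also have "(v ^ 2) ^ s \<odot> (?S ?r \<otimes> x \<otimes> y [^] s) \<oplus> (- ?c) \<odot> (x \<otimes> ?S ?r \<otimes> y [^] s) =
        (v ^ 2) ^ s \<odot> (?S (Suc ?r) \<otimes> y [^] s)"
      unfolding e1' using c by (simp add: l_distr scalar_add_right scalar_scalar smult_mult_left)
    also have "?S ?r \<otimes> y [^] Suc s \<oplus> (- (v powi (2 * a + 4 * int l - 2 * int s))) \<odot> (?S ?r \<otimes> y [^] Suc s) =
        (1 - v powi (2 * a + 4 * int l - 2 * int s)) \<odot> (?S ?r \<otimes> y [^] Suc s)"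
      using c scalar_add_left[of "?S ?r \<otimes> y [^] Suc s" 1 "- (v powi (2 * a + 4 * int l - 2 * int s))"]
      by (simp del: nat_pow_Suc)
    finally show ?thesis using s by (simp add: Suc_diff_le del: q_ad.simps nat_pow_Suc)
  qed
  let ?k = "\<lambda>s. add_coeff v a l s" and ?t = "\<lambda>s. ?S (l - s) \<otimes> y [^] s"
  have "q_ad A v a ?z u (Suc l) = (\<Oplus>s\<in>{..l}. ?k s \<odot> ?t s) \<otimes> ?z \<oplus> (- ?c) \<odot> (?z \<otimes> (\<Oplus>s\<in>{..l}. ?k s \<odot> ?t s))"
    by (simp only: q_ad.simps Suc)
  also have "(\<Oplus>s\<in>{..l}. ?k s \<odot> ?t s) \<otimes> ?z = (\<Oplus>s\<in>{..l}. ?k s \<odot> (?t s \<otimes> ?z))"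
    using c by (subst finsum_ldistr) (auto simp: smult_mult_left intro!: finsum_cong')
  also have "?z \<otimes> (\<Oplus>s\<in>{..l}. ?k s \<odot> ?t s) = (\<Oplus>s\<in>{..l}. ?k s \<odot> (?z \<otimes> ?t s))"
    using c by (subst finsum_rdistr) (auto simp: smult_mult_right intro!: finsum_cong')
  also have "(- ?c) \<odot> \<dots> = (\<Oplus>s\<in>{..l}. ?k s \<odot> ((- ?c) \<odot> (?z \<otimes> ?t s)))"
    using c by (subst finsum_scalar) (auto simp: scalar_scalar mult.commute intro!: finsum_cong')
  also have "(\<Oplus>s\<in>{..l}. ?k s \<odot> (?t s \<otimes> ?z)) \<oplus> \<dots> =
     (\<Oplus>s\<in>{..l}. ?k s \<odot> (?t s \<otimes> ?z \<oplus> (- ?c) \<odot> (?z \<otimes> ?t s)))"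
    using c by (subst finsum_addf[symmetric]) (auto simp: scalar_add_right intro!: finsum_cong')
  also have "\<dots> = (\<Oplus>s\<in>{..l}. ((v ^ 2) ^ s * ?k s) \<odot> (?S (Suc l - s) \<otimes> y [^] s) \<oplus>
      ((1 - v powi (2 * a + 4 * int l - 2 * int s)) * ?k s) \<odot> (?S (l - s) \<otimes> y [^] Suc s))"
  proof (rule finsum_cong'[OF refl])
    fix s assume s: "s \<in> {..l}"
    show "?k s \<odot> (?t s \<otimes> ?z \<oplus> (- ?c) \<odot> (?z \<otimes> ?t s)) =
      ((v ^ 2) ^ s * ?k s) \<odot> (?S (Suc l - s) \<otimes> y [^] s) \<oplus>
      ((1 - v powi (2 * a + 4 * int l - 2 * int s)) * ?k s) \<odot> (?S (l - s) \<otimes> y [^] Suc s)"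
      unfolding step[OF s[unfolded atMost_iff]] using c
      by (simp add: scalar_add_right scalar_scalar mult.commute del: q_ad.simps nat_pow_Suc)
  qed (use c in \<open>auto simp del: q_ad.simps nat_pow_Suc\<close>)
  also have "\<dots> = (\<Oplus>s\<in>{..l}. ((v ^ 2) ^ s * ?k s) \<odot> (?S (Suc l - s) \<otimes> y [^] s)) \<oplus>
      (\<Oplus>s\<in>{..l}. ((1 - v powi (2 * a + 4 * int l - 2 * int s)) * ?k s) \<odot> (?S (l - s) \<otimes> y [^] Suc s))"
    using c by (intro finsum_addf) (auto simp del: q_ad.simps nat_pow_Suc)
  also have "(\<Oplus>s\<in>{..l}. ((v ^ 2) ^ s * ?k s) \<odot> (?S (Suc l - s) \<otimes> y [^] s)) =
      (\<Oplus>s\<in>{..Suc l}. ((v ^ 2) ^ s * ?k s) \<odot> (?S (Suc l - s) \<otimes> y [^] s))"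
    using c by (subst finsum_Suc[of _ l]) (auto simp: add_coeff_large simp del: q_ad.simps nat_pow_Suc)
  also have "(\<Oplus>s\<in>{..l}. ((1 - v powi (2 * a + 4 * int l - 2 * int s)) * ?k s) \<odot> (?S (l - s) \<otimes> y [^] Suc s)) =
      (\<Oplus>s\<in>{..Suc l}. (case s of 0 \<Rightarrow> 0 | Suc s' \<Rightarrow> (1 - v powi (2 * a + 4 * int l - 2 * int s')) * ?k s') \<odot>
        (?S (Suc l - s) \<otimes> y [^] s))"
    using c by (subst finsum_Suc2[of _ l]) (auto simp del: q_ad.simps nat_pow_Suc)
  also have "(\<Oplus>s\<in>{..Suc l}. ((v ^ 2) ^ s * ?k s) \<odot> (?S (Suc l - s) \<otimes> y [^] s)) \<oplus> \<dots> =
      (\<Oplus>s\<in>{..Suc l}. add_coeff v a (Suc l) s \<odot> (?S (Suc l - s) \<otimes> y [^] s))"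
    using c by (subst finsum_addf[symmetric])
      (auto simp: scalar_add_left simp del: q_ad.simps nat_pow_Suc intro!: finsum_cong')
  finally show ?case .
qed

lemma q_ad_sum:
  assumes c: "x \<in> carrier A" "y \<in> carrier A" "u \<in> carrier A" and v: "generic_parameter v"
    and yx: "y \<otimes> x = v ^ 2 \<odot> (x \<otimes> y)" and yu: "y \<otimes> u = v powi (1 - int m) \<odot> (u \<otimes> y)"
  shows "q_ad A v (1 - int m) (x \<oplus> y) u m = q_ad A v (1 - int m) x u m"
proof -
  have v0: "v \<noteq> 0" using v by (simp add: generic_parameter_def)
  have "q_ad A v (1 - int m) (x \<oplus> y) u m =
    (\<Oplus>s\<in>{..m}. add_coeff v (1 - int m) m s \<odot> (q_ad A v (1 - int m) x u (m - s) \<otimes> y [^] s))"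
    by (rule q_ad_sum_expand) (use assms v0 in auto)
  also have "\<dots> = (\<Oplus>s\<in>{..m}. if 0 = s then q_ad A v (1 - int m) x u m else \<zero>)"
    using c add_coeff_vanish[OF v, of _ m] by (intro finsum_cong') auto
  also have "\<dots> = q_ad A v (1 - int m) x u m"
    using c by (subst finsum_singleton) auto
  finally show ?thesis .
qed

text \<open>
  Moving all \<open>t\<close> and \<open>s\<close> to the left costs a scalar depending only on the number of pairs of letters
  of each kind, not on their order, because the exchange factors of \<open>x\<close> with \<open>s\<close> and of \<open>u\<close> with \<open>t\<close> agree.
\<close>

lemma q_ad_twist:
  assumes c: "x \<in> carrier A" "u \<in> carrier A" "t \<in> carrier A" "s \<in> carrier A"
    and ts: "t \<otimes> s = s \<otimes> t" and xt: "x \<otimes> t = p \<odot> (t \<otimes> x)"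
    and xs: "x \<otimes> s = r \<odot> (s \<otimes> x)" and ut: "u \<otimes> t = r \<odot> (t \<otimes> u)"
  shows "\<exists>\<rho>. q_ad A v a (t \<otimes> x) (s \<otimes> u) l = \<rho> \<odot> (t [^] l \<otimes> s \<otimes> q_ad A v a x u l)"
proof (induction l)
  case 0
  show ?case using c by (intro exI[of _ 1]) simp
next
  case (Suc l)
  then obtain \<rho> where \<rho>: "q_ad A v a (t \<otimes> x) (s \<otimes> u) l = \<rho> \<odot> (t [^] l \<otimes> s \<otimes> q_ad A v a x u l)" by blast
  let ?S = "q_ad A v a x u l" and ?k = "p ^ l * r"
  have St: "?S \<otimes> t = ?k \<odot> (t \<otimes> ?S)" by (rule q_ad_commute[OF c(1,2,3) xt ut])
  have tl: "t \<otimes> (t [^] l \<otimes> s) = t [^] Suc l \<otimes> s"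
    unfolding nat_pow_Suc2[OF c(3)] using c by (simp add: m_assoc)
  have tls: "t [^] l \<otimes> s \<otimes> t = t [^] Suc l \<otimes> s"
    using c ts by (simp add: m_assoc)
  have xtl: "x \<otimes> (t [^] l \<otimes> s) = ?k \<odot> (t [^] l \<otimes> s \<otimes> x)"
  proof -
    have "x \<otimes> t [^] l = p ^ l \<odot> (t [^] l \<otimes> x)"
    proof (induction l)
      case (Suc l)
      have "x \<otimes> t [^] Suc l = p ^ l \<odot> (t [^] l \<otimes> (x \<otimes> t))"
        using c by (simp add: m_assoc[symmetric] Suc smult_mult_left)
      then show ?case using c by (simp add: xt smult_mult_right scalar_scalar m_assoc mult.commute)
    qed (use c in simp)
    then have "x \<otimes> (t [^] l \<otimes> s) = p ^ l \<odot> (t [^] l \<otimes> (x \<otimes> s))"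
      using c by (simp add: m_assoc[symmetric] smult_mult_left) 
    then show ?thesis using c by (simp add: xs smult_mult_right scalar_scalar m_assoc)
  qed
  have 1: "(t [^] l \<otimes> s \<otimes> ?S) \<otimes> (t \<otimes> x) = ?k \<odot> (t [^] Suc l \<otimes> s \<otimes> (?S \<otimes> x))"
  proof -
    have "(t [^] l \<otimes> s \<otimes> ?S) \<otimes> (t \<otimes> x) = t [^] l \<otimes> s \<otimes> (?S \<otimes> t) \<otimes> x"
      using c by (simp add: m_assoc)
    also have "\<dots> = ?k \<odot> ((t [^] l \<otimes> s \<otimes> t) \<otimes> (?S \<otimes> x))"
      unfolding St using c by (simp add: m_assoc smult_mult_right smult_mult_left)
    finally show ?thesis unfolding tls .
  qed
  have 2: "(t \<otimes> x) \<otimes> (t [^] l \<otimes> s \<otimes> ?S) = ?k \<odot> (t [^] Suc l \<otimes> s \<otimes> (x \<otimes> ?S))"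
  proof -
    have "(t \<otimes> x) \<otimes> (t [^] l \<otimes> s \<otimes> ?S) = t \<otimes> (x \<otimes> (t [^] l \<otimes> s)) \<otimes> ?S"
      using c by (simp add: m_assoc)
    also have "\<dots> = ?k \<odot> ((t \<otimes> (t [^] l \<otimes> s)) \<otimes> (x \<otimes> ?S))"
      unfolding xtl using c by (simp add: m_assoc smult_mult_right smult_mult_left)
    finally show ?thesis unfolding tl .
  qed
  have "q_ad A v a (t \<otimes> x) (s \<otimes> u) (Suc l) = (\<rho> * ?k) \<odot> (t [^] Suc l \<otimes> s \<otimes> q_ad A v a x u (Suc l))"
    using c by (simp add: \<rho> smult_mult_left smult_mult_right 1 2 scalar_scalar r_distr scalar_add_right mult_ac
        del: nat_pow_Suc)
  then show ?case by blast
qed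

text \<open>
  A \<open>q\<close>-derivation, realised as commutation with \<open>e\<close>, may act nontrivially on \<open>x\<close> or on \<open>u\<close>.  If it acts on
  \<open>x\<close>, the inhomogeneous terms add up to a multiple of the next shorter commutator, and the
  multiple contains the factor \<open>1 - v\<^bsup>2 (a + l)\<^esup>\<close>, which vanishes when \<open>l + 1 = 1 - a\<close>.  If it acts on \<open>u\<close>, they cancel
  in the first commutator already.  The common denominator \<open>1 - v\<^sup>2\<close> is cleared.
\<close>

lemma q_ad_derivation_base:
  assumes c: "x \<in> carrier A" "u \<in> carrier A" "e \<in> carrier A" and v: "v \<noteq> 0"
    and xe: "x \<otimes> e = v ^ 2 \<odot> (e \<otimes> x) \<oplus> \<one>" and ue: "u \<otimes> e = v powi a \<odot> (e \<otimes> u)"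
  shows "(1 - v ^ 2) \<odot> (q_ad A v a x u (Suc l) \<otimes> e) =
    ((1 - v ^ 2) * v powi (a + 2 * int (Suc l))) \<odot> (e \<otimes> q_ad A v a x u (Suc l)) \<oplus>
    ((1 - v ^ (2 * Suc l)) * (1 - v powi (2 * (a + int l)))) \<odot> q_ad A v a x u l"
proof -
  let ?S = "q_ad A v a x u"
  have step: "?S (Suc l) \<otimes> e = v powi (a + 2 * int (Suc l)) \<odot> (e \<otimes> ?S (Suc l)) \<oplus>
      ((v ^ 2) * d + 1 - v powi (2 * a + 4 * int l)) \<odot> ?S l"
    if IH: "?S l \<otimes> e = v powi (a + 2 * int l) \<odot> (e \<otimes> ?S l) \<oplus> d \<odot> R" and R: "R \<in> carrier A"
      and Rd: "d \<odot> (R \<otimes> x \<oplus> (- (v powi (a + 2 * int l - 2))) \<odot> (x \<otimes> R)) = d \<odot> ?S l" for l d R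
  proof -
    let ?c = "v powi (a + 2 * int l)"
    have cc: "v ^ 2 * v powi (a + 2 * int l - 2) = ?c" "v powi (a + 2 * int (Suc l)) = v ^ 2 * ?c"
      "?c * ?c = v powi (2 * a + 4 * int l)"
    proof -
      have v2: "v ^ 2 = v powi 2" by simp
      show "v ^ 2 * v powi (a + 2 * int l - 2) = ?c" "v powi (a + 2 * int (Suc l)) = v ^ 2 * ?c"
        "?c * ?c = v powi (2 * a + 4 * int l)"
        unfolding v2 power_int_add[OF disjI1[OF v], symmetric] by (simp_all add: algebra_simps)
    qed
    have 1: "?S l \<otimes> x \<otimes> e = (v ^ 2 * ?c) \<odot> (e \<otimes> (?S l \<otimes> x)) \<oplus> (v ^ 2 * d) \<odot> (R \<otimes> x) \<oplus> ?S l"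
    proof -
      have "?S l \<otimes> x \<otimes> e = v ^ 2 \<odot> (?S l \<otimes> e \<otimes> x) \<oplus> ?S l"
        using c by (simp add: m_assoc xe r_distr smult_mult_right)
      then show ?thesis unfolding IH using c R
        by (simp add: l_distr smult_mult_left scalar_add_right scalar_scalar m_assoc)
    qed
    have 2: "x \<otimes> ?S l \<otimes> e = (v ^ 2 * ?c) \<odot> (e \<otimes> (x \<otimes> ?S l)) \<oplus> ?c \<odot> ?S l \<oplus> d \<odot> (x \<otimes> R)"
    proof -
      have "x \<otimes> ?S l \<otimes> e = ?c \<odot> (x \<otimes> e \<otimes> ?S l) \<oplus> d \<odot> (x \<otimes> R)"
        using c R by (simp add: m_assoc IH r_distr smult_mult_right)
      then show ?thesis unfolding xe using c R
        by (simp add: l_distr smult_mult_left scalar_add_right scalar_scalar m_assoc mult.commute)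
    qed
    have "?S (Suc l) \<otimes> e = ((v ^ 2 * ?c) \<odot> (e \<otimes> (?S l \<otimes> x)) \<oplus> (v ^ 2 * d) \<odot> (R \<otimes> x) \<oplus> ?S l) \<oplus>
       (- ?c) \<odot> ((v ^ 2 * ?c) \<odot> (e \<otimes> (x \<otimes> ?S l)) \<oplus> ?c \<odot> ?S l \<oplus> d \<odot> (x \<otimes> R))"
      using c by (simp add: l_distr smult_mult_left 1 2)
    also have "\<dots> = ((v ^ 2 * ?c) \<odot> (e \<otimes> (?S l \<otimes> x)) \<oplus> (v ^ 2 * ?c) \<odot> ((- ?c) \<odot> (e \<otimes> (x \<otimes> ?S l)))) \<oplus>
       ((v ^ 2 * d) \<odot> (R \<otimes> x) \<oplus> (- ?c * d) \<odot> (x \<otimes> R)) \<oplus> (?S l \<oplus> (- (?c * ?c)) \<odot> ?S l)"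
      using c R by (simp add: scalar_add_right scalar_scalar a_ac mult_ac)
    also have "(v ^ 2 * ?c) \<odot> (e \<otimes> (?S l \<otimes> x)) \<oplus> (v ^ 2 * ?c) \<odot> ((- ?c) \<odot> (e \<otimes> (x \<otimes> ?S l))) =
       (v ^ 2 * ?c) \<odot> (e \<otimes> ?S (Suc l))"
      using c by (simp add: scalar_add_right r_distr smult_mult_right)
    also have "(v ^ 2 * d) \<odot> (R \<otimes> x) \<oplus> (- ?c * d) \<odot> (x \<otimes> R) =
       v ^ 2 \<odot> (d \<odot> (R \<otimes> x \<oplus> (- (v powi (a + 2 * int l - 2))) \<odot> (x \<otimes> R)))"
      using c R cc(1) by (simp add: scalar_add_right scalar_scalar mult_ac)
    also have "\<dots> = (v ^ 2 * d) \<odot> ?S l" unfolding Rd using c by (simp add: scalar_scalar)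
    also have "?S l \<oplus> (- (?c * ?c)) \<odot> ?S l = (1 - v powi (2 * a + 4 * int l)) \<odot> ?S l"
      using c scalar_add_left[of "?S l" 1 "- (?c * ?c)"] cc(3) by simp
    finally show ?thesis using c cc(2)
      by (simp add: a_assoc scalar_add_left[symmetric] del: q_ad.simps)
        (simp add: algebra_simps)
  qed
  have "\<exists>d. (1 - v ^ 2) * d = (1 - v ^ (2 * Suc l)) * (1 - v powi (2 * (a + int l))) \<and>
     ?S (Suc l) \<otimes> e = v powi (a + 2 * int (Suc l)) \<odot> (e \<otimes> ?S (Suc l)) \<oplus> d \<odot> ?S l"
  proof (induction l)
    case 0
    have "?S (Suc 0) \<otimes> e = v powi (a + 2 * int (Suc 0)) \<odot> (e \<otimes> ?S (Suc 0)) \<oplus>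
      (v ^ 2 * 0 + 1 - v powi (2 * a + 4 * int 0)) \<odot> ?S 0"
      using c ue by (intro step[where R = \<zero>]) auto
    then show ?case using v by (intro exI[of _ "v ^ 2 * 0 + 1 - v powi (2 * a + 4 * int 0)"])
      (simp del: q_ad.simps add: power2_eq_square)
  next
    case (Suc l)
    then obtain d where d: "(1 - v ^ 2) * d = (1 - v ^ (2 * Suc l)) * (1 - v powi (2 * (a + int l)))"
      "?S (Suc l) \<otimes> e = v powi (a + 2 * int (Suc l)) \<odot> (e \<otimes> ?S (Suc l)) \<oplus> d \<odot> ?S l" by blast
    have "?S (Suc (Suc l)) \<otimes> e = v powi (a + 2 * int (Suc (Suc l))) \<odot> (e \<otimes> ?S (Suc (Suc l))) \<oplus>
      (v ^ 2 * d + 1 - v powi (2 * a + 4 * int (Suc l))) \<odot> ?S (Suc l)"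
      using c by (intro step[OF d(2)]) (simp_all add: algebra_simps)
    moreover have "(1 - v ^ 2) * (v ^ 2 * d + 1 - v powi (2 * a + 4 * int (Suc l))) =
      (1 - v ^ (2 * Suc (Suc l))) * (1 - v powi (2 * (a + int (Suc l))))"
    proof -
      define X where "X = v ^ (2 * l)"
      define Y where "Y = v powi (2 * a)"
      have p: "v ^ (2 * Suc l) = X * v ^ 2" "v ^ (2 * Suc (Suc l)) = X * v ^ 4"
        "v powi (2 * (a + int l)) = Y * X" "v powi (2 * (a + int (Suc l))) = Y * X * v ^ 2"
        "v powi (2 * a + 4 * int (Suc l)) = Y * X * X * v ^ 4"
        unfolding X_def Y_def power_int_of_nat[symmetric] power_int_add[OF disjI1[OF v], symmetric]
        by (simp_all add: algebra_simps del: power_int_of_nat)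
      have "(1 - v ^ 2) * (v ^ 2 * d + 1 - v powi (2 * a + 4 * int (Suc l))) =
        v ^ 2 * ((1 - v ^ 2) * d) + (1 - v ^ 2) * (1 - v powi (2 * a + 4 * int (Suc l)))"
        by (simp add: algebra_simps)
      also have "\<dots> = (1 - v ^ (2 * Suc (Suc l))) * (1 - v powi (2 * (a + int (Suc l))))"
        unfolding d(1) unfolding p by (simp add: algebra_simps power2_eq_square power4_eq_xxxx)
      finally show ?thesis .
    qed
    ultimately show ?case by blast
  qed
  then obtain d where d: "(1 - v ^ 2) * d = (1 - v ^ (2 * Suc l)) * (1 - v powi (2 * (a + int l)))"
     "?S (Suc l) \<otimes> e = v powi (a + 2 * int (Suc l)) \<odot> (e \<otimes> ?S (Suc l)) \<oplus> d \<odot> ?S l" by blast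
  show ?thesis using c unfolding d(2) d(1)[symmetric]
    by (simp add: scalar_add_right scalar_scalar del: q_ad.simps)
qed

lemma q_ad_derivation_x:
  assumes c: "x \<in> carrier A" "u \<in> carrier A" "e \<in> carrier A" and v: "generic_parameter v"
    and xe: "x \<otimes> e = v ^ 2 \<odot> (e \<otimes> x) \<oplus> \<one>"
    and ue: "u \<otimes> e = v powi (1 - int m) \<odot> (e \<otimes> u)" and m: "0 < m"
  shows "q_ad A v (1 - int m) x u m \<otimes> e = v powi (1 + int m) \<odot> (e \<otimes> q_ad A v (1 - int m) x u m)"
proof -
  obtain l where l: "m = Suc l" using m by (cases m) auto
  have v0: "v \<noteq> 0" "1 - v ^ 2 \<noteq> 0" using v by (auto simp: generic_parameter_def)
  have "(1 - v ^ 2) \<odot> (q_ad A v (1 - int m) x u m \<otimes> e) =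
    (1 - v ^ 2) \<odot> (v powi (1 + int m) \<odot> (e \<otimes> q_ad A v (1 - int m) x u m))"
    using q_ad_derivation_base[OF c v0(1) xe ue, of l] c by (simp add: l scalar_scalar add.commute del: q_ad.simps)
  then show ?thesis using c v0(2) by (subst (asm) scalar_cancel) auto
qed

lemma q_ad_derivation_u:
  assumes c: "x \<in> carrier A" "u \<in> carrier A" "e \<in> carrier A"
    and xe: "x \<otimes> e = v powi a \<odot> (e \<otimes> x)" and ue: "u \<otimes> e = b \<odot> (e \<otimes> u) \<oplus> \<one>"
  shows "q_ad A v a x u (Suc l) \<otimes> e = ((v powi a) ^ Suc l * b) \<odot> (e \<otimes> q_ad A v a x u (Suc l))"
proof (induction l)
  case 0
  let ?p = "v powi a"
  have 1: "u \<otimes> x \<otimes> e = (?p * b) \<odot> (e \<otimes> (u \<otimes> x)) \<oplus> ?p \<odot> x"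
  proof -
    have "u \<otimes> x \<otimes> e = ?p \<odot> (u \<otimes> e \<otimes> x)" using c by (simp add: m_assoc xe smult_mult_right)
    then show ?thesis using c by (simp add: ue l_distr smult_mult_left scalar_add_right scalar_scalar m_assoc)
  qed
  have 2: "x \<otimes> u \<otimes> e = (?p * b) \<odot> (e \<otimes> (x \<otimes> u)) \<oplus> x"
  proof -
    have "x \<otimes> u \<otimes> e = b \<odot> (x \<otimes> e \<otimes> u) \<oplus> x" using c by (simp add: m_assoc ue r_distr smult_mult_right)
    then show ?thesis using c by (simp add: xe smult_mult_left scalar_scalar m_assoc mult.commute)
  qed
  have 3: "(?p \<odot> x) \<oplus> (- ?p) \<odot> x = \<zero>" using c scalar_add_left[of x ?p "- ?p"] by simp
  have "q_ad A v a x u (Suc 0) \<otimes> e =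
     ((?p * b) \<odot> (e \<otimes> (u \<otimes> x)) \<oplus> ?p \<odot> x) \<oplus> (- ?p) \<odot> ((?p * b) \<odot> (e \<otimes> (x \<otimes> u)) \<oplus> x)"
    using c by (simp add: l_distr smult_mult_left 1 2)
  also have "\<dots> = ((?p * b) \<odot> (e \<otimes> (u \<otimes> x)) \<oplus> (- ?p) \<odot> ((?p * b) \<odot> (e \<otimes> (x \<otimes> u)))) \<oplus> (?p \<odot> x \<oplus> (- ?p) \<odot> x)"
    using c by (simp add: scalar_add_right a_ac)
  also have "\<dots> = (?p * b) \<odot> (e \<otimes> (u \<otimes> x)) \<oplus> (- ?p) \<odot> ((?p * b) \<odot> (e \<otimes> (x \<otimes> u)))"
    using c unfolding 3 by simp
  also have "\<dots> = (?p ^ Suc 0 * b) \<odot> (e \<otimes> q_ad A v a x u (Suc 0))"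
    using c by (simp add: r_distr smult_mult_right scalar_add_right scalar_scalar mult_ac)
  finally show ?case .
next
  case (Suc l)
  let ?p = "v powi a" and ?S = "q_ad A v a x u (Suc l)"
  have Sc: "?S \<in> carrier A" using c by (simp del: q_ad.simps)
  have 1: "?S \<otimes> x \<otimes> e = (?p ^ Suc (Suc l) * b) \<odot> (e \<otimes> (?S \<otimes> x))"
  proof -
    have "?S \<otimes> x \<otimes> e = ?p \<odot> (?S \<otimes> e \<otimes> x)" using c Sc by (simp add: m_assoc xe smult_mult_right del: q_ad.simps)
    then show ?thesis using c Sc unfolding Suc by (simp add: smult_mult_left scalar_scalar m_assoc mult_ac del: q_ad.simps)
  qed
  have 2: "x \<otimes> ?S \<otimes> e = (?p ^ Suc (Suc l) * b) \<odot> (e \<otimes> (x \<otimes> ?S))"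
  proof -
    have "x \<otimes> ?S \<otimes> e = (?p ^ Suc l * b) \<odot> (x \<otimes> e \<otimes> ?S)"
      using c Sc by (simp add: m_assoc Suc smult_mult_right del: q_ad.simps)
    then show ?thesis using c Sc unfolding xe by (simp add: smult_mult_left scalar_scalar m_assoc mult_ac del: q_ad.simps)
  qed
  show ?case using c Sc 1 2
    unfolding q_ad.simps(2)[of A v a x u "Suc l"]
    by (simp add: l_distr r_distr smult_mult_left smult_mult_right scalar_add_right scalar_scalar mult_ac
       del: q_ad.simps)
qed

end

text \<open>
  Additivity of the Serre relation.  With the commutation rules below, all mixed terms in the expansion of the
  Serre element of \<open>(x + y, u + w)\<close> cancel: those containing \<open>u\<close> by the computation above and
  those containing \<open>w\<close> by the same computation in the opposite algebra, where \<open>x\<close> and \<open>y\<close> swap roles.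
\<close>

lemma serre_element_add:
  fixes A :: "(laurent, 'a) module" (structure)
  assumes A: "assoc_algebra A" and v: "generic_parameter v"
    and c: "x \<in> carrier A" "y \<in> carrier A" "u \<in> carrier A" "w \<in> carrier A"
    and yx: "y \<otimes> x = v ^ 2 \<odot> (x \<otimes> y)" and yu: "y \<otimes> u = v powi (1 - int m) \<odot> (u \<otimes> y)"
    and wx: "w \<otimes> x = v powi (1 - int m) \<odot> (x \<otimes> w)"
  shows "serre_element A v m (x \<oplus> y) (u \<oplus> w) = serre_element A v m x u \<oplus> serre_element A v m y w"
proof -
  interpret A: assoc_algebra A by fact
  let ?O = "opposite_algebra A"
  interpret O: assoc_algebra ?O by (rule opposite_assoc_algebra) fact
  note S = serre_element_eq_q_ad[OF A v] and SO = serre_element_eq_q_ad[OF O.assoc_algebra_axioms v]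
  have "serre_element A v m (x \<oplus> y) (u \<oplus> w) = serre_element A v m (x \<oplus> y) u \<oplus> serre_element A v m (x \<oplus> y) w"
    using c by (simp add: S A.q_ad_add A.scalar_add_right)
  also have "serre_element A v m (x \<oplus> y) u = serre_element A v m x u"
    using A.q_ad_sum[OF c(1-3) v yx yu] c by (simp add: S)
  also have "serre_element A v m (x \<oplus> y) w = serre_element A v m y w"
  proof -
    have "q_ad ?O v (1 - int m) (y \<oplus> x) w m = q_ad ?O v (1 - int m) y w m"
      using O.q_ad_sum[of y x w v m] c v yx wx by simp
    then have "serre_element ?O v m (y \<oplus> x) w = serre_element ?O v m y w"
      using c SO[of "y \<oplus> x" w m] SO[of y w m] by simp
    then have "(-1) ^ m \<odot> serre_element A v m (x \<oplus> y) w = (-1) ^ m \<odot> serre_element A v m y w"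
      using c serre_element_opposite[OF A, of "y \<oplus> x" w v m] serre_element_opposite[OF A, of y w v m]
      by (simp add: A.a_comm)
    then show ?thesis using c A
      by (subst (asm) A.scalar_cancel) (auto intro!: serre_element_closed)
  qed
  finally show ?thesis .
qed

lemma serre_element_eq_0_iff:
  fixes A :: "(laurent, 'a) module" (structure)
  assumes A: "assoc_algebra A" and v: "generic_parameter v" and c: "x \<in> carrier A" "u \<in> carrier A"
  shows "serre_element A v m x u = \<zero> \<longleftrightarrow> q_ad A v (1 - int m) x u m = \<zero>"
proof -
  interpret A: assoc_algebra A by fact
  show ?thesis using c q_fact_nonzero[OF v, of m]
    by (simp add: serre_element_eq_q_ad[OF A v c] A.scalar_eq_zero_iff)
qed

lemma serre_element_twist:
  fixes A :: "(laurent, 'a) module" (structure)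
  assumes A: "assoc_algebra A" and v: "generic_parameter v"
    and c: "x \<in> carrier A" "u \<in> carrier A" "t \<in> carrier A" "s \<in> carrier A"
    and "t \<otimes> s = s \<otimes> t" "x \<otimes> t = p \<odot> (t \<otimes> x)" "x \<otimes> s = r \<odot> (s \<otimes> x)" "u \<otimes> t = r \<odot> (t \<otimes> u)"
    and "serre_element A v m x u = \<zero>"
  shows "serre_element A v m (t \<otimes> x) (s \<otimes> u) = \<zero>"
proof -
  interpret A: assoc_algebra A by fact
  show ?thesis
    using A.q_ad_twist[OF assms(3-10), of v "1 - int m" m] assms(11) c
    by (auto simp: serre_element_eq_0_iff[OF A v])
qed

section \<open>Kac-Moody data\<close>

text \<open>
  The integer \<open>(\<alpha>\<^sub>i, \<alpha>\<^sub>j)\<close>, defined as the weight of \<open>t\<^sub>i\<close> on \<open>\<alpha>\<^sub>j\<close> because it arises from exchanging \<open>t\<^sub>i\<close> with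
  \<open>e\<^sub>j\<close> and \<open>f\<^sub>j\<close>; the invariant form enters through its symmetry.
\<close>

definition root_pairing :: "('i, 't::ab_group_add) km_datum \<Rightarrow> 'i \<Rightarrow> 'i \<Rightarrow> int" where
  "root_pairing K i j = weight K (t_exponent K i) j"

context symmetrizable_kac_moody
begin

abbreviation "I \<equiv> index_set K"
abbreviation "P \<equiv> coroot_lattice K"

lemma cartan_vector_space: "vector_space (scaling K)"
  using cartan_finite_dim by (auto simp: finite_dimensional_vector_space_def)

lemma lattice_memI: "(\<Sum>i\<in>I. scaling K (of_int (n i)) (simple_coroot K i)) \<in> P"
  unfolding coroot_lattice_def by blast

lemma lattice_zero: "0 \<in> P"
proof -
  interpret V: vector_space "scaling K" by (rule cartan_vector_space)
  show ?thesis unfolding coroot_lattice_def by (auto intro!: exI[of _ "\<lambda>_. 0"])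
qed

lemma lattice_add: "h \<in> P \<Longrightarrow> h' \<in> P \<Longrightarrow> h + h' \<in> P"
proof -
  interpret V: vector_space "scaling K" by (rule cartan_vector_space)
  assume "h \<in> P" "h' \<in> P"
  then obtain n n' :: "_ \<Rightarrow> int" where "h = (\<Sum>i\<in>I. scaling K (of_int (n i)) (simple_coroot K i))"
    "h' = (\<Sum>i\<in>I. scaling K (of_int (n' i)) (simple_coroot K i))"
    by (auto simp: coroot_lattice_def)
  then have "h + h' = (\<Sum>i\<in>I. scaling K (of_int (n i + n' i)) (simple_coroot K i))"
    by (simp add: V.scale_left_distrib sum.distrib)
  then show "h + h' \<in> P" using lattice_memI[of "\<lambda>i. n i + n' i"] by (simp only:)
qed

lemma lattice_uminus: "h \<in> P \<Longrightarrow> - h \<in> P"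
proof -
  interpret V: vector_space "scaling K" by (rule cartan_vector_space)
  assume "h \<in> P"
  then obtain n :: "_ \<Rightarrow> int" where "h = (\<Sum>i\<in>I. scaling K (of_int (n i)) (simple_coroot K i))"
    by (auto simp: coroot_lattice_def)
  then have "- h = (\<Sum>i\<in>I. scaling K (of_int (- n i)) (simple_coroot K i))"
    by (simp add: V.scale_minus_left sum_negf)
  then show "- h \<in> P" using lattice_memI[of "\<lambda>i. - n i"] by (simp only:)
qed

lemma root_linear:
  assumes "i \<in> I"
  shows "simple_root K i (x + y) = simple_root K i x + simple_root K i y"
    and "simple_root K i (scaling K r x) = r * simple_root K i x"
    and "simple_root K i (- x) = - simple_root K i x"
    and "simple_root K i (\<Sum>j\<in>J. g j) = (\<Sum>j\<in>J. simple_root K i (g j))"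
proof -
  interpret L: Vector_Spaces.linear "scaling K" "(*)" "simple_root K i"
    using root_dual[OF assms] by (simp add: cartan_dual_def)
  show "simple_root K i (x + y) = simple_root K i x + simple_root K i y" by (rule L.add)
  show "simple_root K i (scaling K r x) = r * simple_root K i x" by (rule L.scale)
  show "simple_root K i (- x) = - simple_root K i x" by (rule L.neg)
  show "simple_root K i (\<Sum>j\<in>J. g j) = (\<Sum>j\<in>J. simple_root K i (g j))" by (rule L.sum)
qed

lemma of_int_weight: "h \<in> P \<Longrightarrow> i \<in> I \<Longrightarrow> of_int (weight K h i) = simple_root K i h"
proof -
  assume "h \<in> P" and i: "i \<in> I"
  then obtain n :: "_ \<Rightarrow> int" where "h = (\<Sum>i\<in>I. scaling K (of_int (n i)) (simple_coroot K i))"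
    by (auto simp: coroot_lattice_def)
  then have "simple_root K i h = (\<Sum>j\<in>I. of_int (n j) * simple_root K i (simple_coroot K j))"
    by (simp add: root_linear[OF i])
  moreover have "(\<Sum>j\<in>I. of_int (n j) * simple_root K i (simple_coroot K j)) \<in> \<int>"
    using i by (intro Ints_sum Ints_mult Ints_of_int cartan_int)
  ultimately have "simple_root K i h \<in> \<int>" by simp
  then show ?thesis unfolding weight_def by (metis Ints_cases floor_of_int)
qed

lemma weight_add: "h \<in> P \<Longrightarrow> h' \<in> P \<Longrightarrow> i \<in> I \<Longrightarrow> weight K (h + h') i = weight K h i + weight K h' i"
proof -
  assume *: "h \<in> P" "h' \<in> P" "i \<in> I"
  have "(of_int (weight K (h + h') i) :: rat) = of_int (weight K h i + weight K h' i)"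
    using * by (simp add: of_int_weight lattice_add root_linear)
  then show ?thesis by (simp only: of_int_eq_iff)
qed

lemma weight_uminus: "h \<in> P \<Longrightarrow> i \<in> I \<Longrightarrow> weight K (- h) i = - weight K h i"
proof -
  assume *: "h \<in> P" "i \<in> I"
  have "(of_int (weight K (- h) i) :: rat) = of_int (- weight K h i)"
    using * by (simp add: of_int_weight lattice_uminus root_linear)
  then show ?thesis by (simp only: of_int_eq_iff)
qed

lemma half_norm_nat: "i \<in> I \<Longrightarrow> \<exists>n::nat. n > 0 \<and> half_norm K i = of_nat n"
  using form_root[of i] by (auto simp: half_norm_def)

lemma coroot_in_lattice: "i \<in> I \<Longrightarrow> scaling K (of_int n) (simple_coroot K i) \<in> P"
proof -
  interpret V: vector_space "scaling K" by (rule cartan_vector_space)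
  assume i: "i \<in> I"
  have "(\<Sum>j\<in>I. scaling K (of_int (if j = i then n else 0)) (simple_coroot K j)) =
      (\<Sum>j\<in>I. if j = i then scaling K (of_int n) (simple_coroot K j) else 0)"
    by (rule sum.cong) auto
  also have "\<dots> = scaling K (of_int n) (simple_coroot K i)"
    using i finite_index by simp
  finally show ?thesis using lattice_memI[of "\<lambda>j. if j = i then n else 0"] by (simp only:)
qed

lemma t_exponent_closed: "i \<in> I \<Longrightarrow> t_exponent K i \<in> P"
  using half_norm_nat[of i] coroot_in_lattice[of i "int _"] by (auto simp: t_exponent_def)

lemma simple_coroot_closed: "i \<in> I \<Longrightarrow> simple_coroot K i \<in> P"
proof -
  interpret V: vector_space "scaling K" by (rule cartan_vector_space)
  assume i: "i \<in> I"
  show ?thesis using coroot_in_lattice[OF i, of 1] by simp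
qed

lemma of_int_cartan_entry:
  "i \<in> I \<Longrightarrow> j \<in> I \<Longrightarrow> of_int (cartan_entry K i j) = simple_root K j (simple_coroot K i)"
  unfolding cartan_entry_def by (rule of_int_weight[OF simple_coroot_closed])

lemma of_int_root_pairing:
  "i \<in> I \<Longrightarrow> j \<in> I \<Longrightarrow> of_int (root_pairing K i j) = form K (simple_root K i) (simple_root K j)"
  using form_coroot[OF _ root_dual, of i j] half_norm_nat[of i]
  by (auto simp: root_pairing_def of_int_weight t_exponent_closed) 
     (auto simp: t_exponent_def root_linear half_norm_def)

lemma root_pairing_sym: "i \<in> I \<Longrightarrow> j \<in> I \<Longrightarrow> root_pairing K i j = root_pairing K j i"
proof -
  assume *: "i \<in> I" "j \<in> I"
  have "(of_int (root_pairing K i j) :: rat) = of_int (root_pairing K j i)"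
    using * form_sym[OF root_dual root_dual] by (simp add: of_int_root_pairing)
  then show ?thesis by (simp only: of_int_eq_iff)
qed

lemma q_index_powi_cartan:
  assumes "i \<in> I" "j \<in> I"
  shows "q_index K i powi cartan_entry K i j = q_param powi root_pairing K i j"
proof -
  obtain n :: nat where n: "half_norm K i = of_nat n" using half_norm_nat[OF assms(1)] by blast
  have "(of_int (root_pairing K i j) :: rat) = of_int (int n * cartan_entry K i j)"
    using assms n by (simp add: of_int_cartan_entry root_pairing_def of_int_weight t_exponent_closed)
      (simp add: t_exponent_def root_linear)
  then have "root_pairing K i j = int n * cartan_entry K i j" by (simp only: of_int_eq_iff)
  then show ?thesis by (simp add: q_index_def n power_int_mult)
qed

lemma cartan_entry_diag: "i \<in> I \<Longrightarrow> cartan_entry K i i = 2"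
proof -
  assume i: "i \<in> I"
  have "(of_int (cartan_entry K i i) :: rat) = of_int 2"
    using i by (simp add: of_int_cartan_entry cartan_diag)
  then show ?thesis by (simp only: of_int_eq_iff)
qed

lemma q_index_square: "i \<in> I \<Longrightarrow> q_index K i ^ 2 = q_param powi root_pairing K i i"
  using q_index_powi_cartan[of i i] by (simp add: cartan_entry_diag)

lemma cartan_entry_nonpos: "i \<in> I \<Longrightarrow> j \<in> I \<Longrightarrow> i \<noteq> j \<Longrightarrow> cartan_entry K i j \<le> 0"
proof -
  assume *: "i \<in> I" "j \<in> I" "i \<noteq> j"
  have "(of_int (cartan_entry K i j) :: rat) \<le> of_int 0"
    using * by (simp add: of_int_cartan_entry cartan_nonpos)
  then show ?thesis by (simp only: of_int_le_iff)
qed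

lemma serre_degree:
  assumes "i \<in> I" "j \<in> I" "i \<noteq> j"
  shows "1 - int (nat (1 - cartan_entry K i j)) = cartan_entry K i j" "0 < nat (1 - cartan_entry K i j)"
  using cartan_entry_nonpos[OF assms] by auto

end

lemma q_param_power: "q_param ^ n = fps_to_fls (fps_exp (of_nat n))"
  unfolding q_param_def fps_to_fls_power[symmetric] fps_exp_power_mult by simp

lemma q_param_nonzero [simp]: "q_param \<noteq> 0"
proof -
  have "fps_nth (fps_exp (1::rat)) 0 \<noteq> fps_nth 0 0" by simp
  then have "fps_exp (1::rat) \<noteq> 0" by metis
  then show ?thesis by (simp add: q_param_def)
qed

lemma q_param_power_neq_1: "0 < n \<Longrightarrow> q_param ^ n \<noteq> 1"
proof
  assume n: "0 < n" and "q_param ^ n = 1"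
  then have "fps_to_fls (fps_exp (of_nat n :: rat)) = fps_to_fls 1" by (simp add: q_param_power)
  then have "fps_exp (of_nat n :: rat) = 1" by (simp only: fps_to_fls_eq_iff)
  then have "fps_nth (fps_exp (of_nat n :: rat)) 1 = fps_nth 1 1" by simp
  then show False using n by simp
qed

context symmetrizable_kac_moody
begin

lemma q_index_generic: "i \<in> I \<Longrightarrow> generic_parameter (q_index K i)"
proof -
  assume "i \<in> I"
  then obtain n :: nat where n: "n > 0" "half_norm K i = of_nat n" using half_norm_nat by blast
  then have "q_index K i = q_param ^ n" by (simp add: q_index_def)
  then show ?thesis using n q_param_power_neq_1
    by (auto simp: generic_parameter_def simp flip: power_mult)
qed

lemma q_index_diff_nonzero: "i \<in> I \<Longrightarrow> q_index K i - inverse (q_index K i) \<noteq> 0"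
proof
  assume i: "i \<in> I" and "q_index K i - inverse (q_index K i) = 0"
  then have "q_index K i ^ 2 = 1" using q_index_generic[OF i]
    by (simp add: generic_parameter_def power2_eq_square) (metis right_inverse)
  then show False using q_index_generic[OF i] by (simp add: generic_parameter_def)
qed

end

lemma powi_mult_powi: "q_param powi a * q_param powi b = q_param powi (a + b)"
  by (simp add: power_int_add)

section \<open>Families of generators\<close>

text \<open>
  Homomorphisms out of \<open>U\<close> and \<open>B\<close> correspond to families of elements satisfying the defining relations.  The relations
  \<open>q\<^sup>h x q\<^sup>-\<^sup>h = q\<^bsup>n\<^esup> x\<close> are kept in the form \<open>q\<^sup>h x = q\<^bsup>n\<^esup> x q\<^sup>h\<close>, where \<open>n\<close> is the weight of \<open>h\<close> times a sign \<open>s\<close>; \<open>s = 0\<close>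
  expresses commutation.
\<close>

definition torus_family :: "('i, 't::ab_group_add) km_datum \<Rightarrow> (laurent, 'a) module \<Rightarrow> ('t \<Rightarrow> 'a) \<Rightarrow> bool" where
  "torus_family K A Q \<longleftrightarrow> Q \<in> coroot_lattice K \<rightarrow> carrier A \<and> Q 0 = \<one>\<^bsub>A\<^esub> \<and>
     (\<forall>h\<in>coroot_lattice K. \<forall>h'\<in>coroot_lattice K. Q h \<otimes>\<^bsub>A\<^esub> Q h' = Q (h + h'))"

definition weight_family ::
    "('i, 't::ab_group_add) km_datum \<Rightarrow> (laurent, 'a) module \<Rightarrow> ('t \<Rightarrow> 'a) \<Rightarrow> ('i \<Rightarrow> 'a) \<Rightarrow> int \<Rightarrow> bool" where
  "weight_family K A Q X s \<longleftrightarrow> (\<forall>h\<in>coroot_lattice K. \<forall>i\<in>index_set K.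
     Q h \<otimes>\<^bsub>A\<^esub> X i = q_param powi (s * weight K h i) \<odot>\<^bsub>A\<^esub> (X i \<otimes>\<^bsub>A\<^esub> Q h))"

definition serre_family ::
    "('i, 't::ab_group_add) km_datum \<Rightarrow> (laurent, 'a) module \<Rightarrow> ('i \<Rightarrow> 'a) \<Rightarrow> bool" where
  "serre_family K A X \<longleftrightarrow> X \<in> index_set K \<rightarrow> carrier A \<and>
     (\<forall>i\<in>index_set K. \<forall>j\<in>index_set K. i \<noteq> j \<longrightarrow>
        serre_element A (q_index K i) (nat (1 - cartan_entry K i j)) (X i) (X j) = \<zero>\<^bsub>A\<^esub>)"

definition q_family ::
    "('i, 't::ab_group_add) km_datum \<Rightarrow> (laurent, 'a) module \<Rightarrow> ('i \<Rightarrow> 'a) \<Rightarrow> ('i \<Rightarrow> 'a) \<Rightarrow> ('t \<Rightarrow> 'a) \<Rightarrow> bool" where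
  "q_family K A E F Q \<longleftrightarrow> torus_family K A Q \<and> weight_family K A Q E 1 \<and> weight_family K A Q F (- 1) \<and>
     serre_family K A E \<and> serre_family K A F"

definition U_family ::
    "('i, 't::ab_group_add) km_datum \<Rightarrow> (laurent, 'a) module \<Rightarrow> ('i \<Rightarrow> 'a) \<Rightarrow> ('i \<Rightarrow> 'a) \<Rightarrow> ('t \<Rightarrow> 'a) \<Rightarrow> bool" where
  "U_family K A E F Q \<longleftrightarrow> q_family K A E F Q \<and> (\<forall>i\<in>index_set K. \<forall>j\<in>index_set K.
     E i \<otimes>\<^bsub>A\<^esub> F j = (F j \<otimes>\<^bsub>A\<^esub> E i) \<oplus>\<^bsub>A\<^esub>
       (if i = j then inverse (q_index K i - inverse (q_index K i)) \<odot>\<^bsub>A\<^esub>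
          (Q (t_exponent K i) \<ominus>\<^bsub>A\<^esub> Q (- t_exponent K i)) else \<zero>\<^bsub>A\<^esub>))"

definition B_family ::
    "('i, 't::ab_group_add) km_datum \<Rightarrow> (laurent, 'a) module \<Rightarrow> ('i \<Rightarrow> 'a) \<Rightarrow> ('i \<Rightarrow> 'a) \<Rightarrow> ('t \<Rightarrow> 'a) \<Rightarrow> bool" where
  "B_family K A E F Q \<longleftrightarrow> q_family K A E F Q \<and> (\<forall>i\<in>index_set K. \<forall>j\<in>index_set K.
     E i \<otimes>\<^bsub>A\<^esub> F j = q_param powi root_pairing K i j \<odot>\<^bsub>A\<^esub> (F j \<otimes>\<^bsub>A\<^esub> E i) \<oplus>\<^bsub>A\<^esub>
       (if i = j then \<one>\<^bsub>A\<^esub> else \<zero>\<^bsub>A\<^esub>))"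

locale km_algebra = symmetrizable_kac_moody K + assoc_algebra A
  for K :: "('i, 't::ab_group_add) km_datum" and A :: "(laurent, 'a) module" (structure)
begin

lemmas index_closed = t_exponent_closed lattice_uminus lattice_zero lattice_add

lemma torusD:
  assumes "torus_family K A Q"
  shows "h \<in> P \<Longrightarrow> Q h \<in> carrier A" "Q 0 = \<one>"
    "h \<in> P \<Longrightarrow> h' \<in> P \<Longrightarrow> Q h \<otimes> Q h' = Q (h + h')"
    "h \<in> P \<Longrightarrow> Q h \<otimes> Q (- h) = \<one>" "h \<in> P \<Longrightarrow> Q (- h) \<otimes> Q h = \<one>"
  using assms lattice_uminus by (auto simp: torus_family_def)

lemma torus_commute: "torus_family K A Q \<Longrightarrow> h \<in> P \<Longrightarrow> h' \<in> P \<Longrightarrow> Q h \<otimes> Q h' = Q h' \<otimes> Q h"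
  by (simp add: torusD add.commute)

lemma weightD: "weight_family K A Q X s \<Longrightarrow> h \<in> P \<Longrightarrow> i \<in> I \<Longrightarrow>
    Q h \<otimes> X i = q_param powi (s * weight K h i) \<odot> (X i \<otimes> Q h)"
  by (simp add: weight_family_def)

lemma serre_familyD: "serre_family K A X \<Longrightarrow> i \<in> I \<Longrightarrow> X i \<in> carrier A"
  by (auto simp: serre_family_def)

lemma weight_rev:
  assumes "weight_family K A Q X s" "torus_family K A Q" "h \<in> P" "i \<in> I" "X i \<in> carrier A"
  shows "X i \<otimes> Q h = q_param powi (- s * weight K h i) \<odot> (Q h \<otimes> X i)"
  using assms by (simp add: weightD torusD scalar_scalar powi_mult_powi)

text \<open>Scalars are the torus twist by multiples of \<open>1\<close>.\<close>

lemma serre_family_scale: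
  assumes X: "serre_family K A X"
  shows "serre_family K A (\<lambda>i. c i \<odot> X i)"
  unfolding serre_family_def
proof (intro conjI ballI impI)
  note Xc = serre_familyD[OF X]
  show "(\<lambda>i. c i \<odot> X i) \<in> I \<rightarrow> carrier A" by (auto simp: Xc)
  fix i j assume ij: "i \<in> I" "j \<in> I" "i \<noteq> j"
  have "serre_element A (q_index K i) (nat (1 - cartan_entry K i j)) ((c i \<odot> \<one>) \<otimes> X i) ((c j \<odot> \<one>) \<otimes> X j) = \<zero>"
    using X ij Xc unfolding serre_family_def
    by (intro serre_element_twist[where p = 1 and r = 1] assoc_algebra_axioms q_index_generic)
      (auto simp: smult_mult_left smult_mult_right scalar_scalar mult.commute)
  then show "serre_element A (q_index K i) (nat (1 - cartan_entry K i j)) (c i \<odot> X i) (c j \<odot> X j) = \<zero>"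
    using ij Xc by (simp add: smult_mult_left)
qed

lemma serre_family_twist:
  assumes X: "serre_family K A X" and Q: "torus_family K A Q" and w: "weight_family K A Q X s"
    and g: "\<And>i. i \<in> I \<Longrightarrow> g i \<in> P" "\<And>i j. i \<in> I \<Longrightarrow> j \<in> I \<Longrightarrow> weight K (g i) j = weight K (g j) i"
  shows "serre_family K A (\<lambda>i. Q (g i) \<otimes> X i)"
  unfolding serre_family_def
proof (intro conjI ballI impI)
  note Xc = serre_familyD[OF X] and Qc = torusD[OF Q]
  show "(\<lambda>i. Q (g i) \<otimes> X i) \<in> I \<rightarrow> carrier A" by (auto simp: Xc Qc g)
  fix i j assume ij: "i \<in> I" "j \<in> I" "i \<noteq> j"
  show "serre_element A (q_index K i) (nat (1 - cartan_entry K i j)) (Q (g i) \<otimes> X i) (Q (g j) \<otimes> X j) = \<zero>"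
    using X ij unfolding serre_family_def
    by (intro serre_element_twist[where p = "q_param powi (- s * weight K (g i) i)" and
          r = "q_param powi (- s * weight K (g j) i)"] assoc_algebra_axioms q_index_generic
          torus_commute[OF Q] weight_rev[OF w Q])
      (auto simp: Xc Qc g weight_rev[OF w Q] g(2)[of j i])
qed

lemma serre_family_add:
  assumes X: "serre_family K A X" and Y: "serre_family K A Y"
    and YX: "\<And>i j. i \<in> I \<Longrightarrow> j \<in> I \<Longrightarrow> Y i \<otimes> X j = q_param powi root_pairing K i j \<odot> (X j \<otimes> Y i)"
  shows "serre_family K A (\<lambda>i. X i \<oplus> Y i)"
  unfolding serre_family_def
proof (intro conjI ballI impI)
  note Xc = serre_familyD[OF X] and Yc = serre_familyD[OF Y]
  show "(\<lambda>i. X i \<oplus> Y i) \<in> I \<rightarrow> carrier A" by (auto simp: Xc Yc)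
  fix i j assume ij: "i \<in> I" "j \<in> I" "i \<noteq> j"
  let ?m = "nat (1 - cartan_entry K i j)"
  have e: "q_index K i powi (1 - int ?m) = q_param powi root_pairing K i j"
    by (simp only: serre_degree(1)[OF ij] q_index_powi_cartan[OF ij(1,2)])
  have "serre_element A (q_index K i) ?m (X i \<oplus> Y i) (X j \<oplus> Y j) =
      serre_element A (q_index K i) ?m (X i) (X j) \<oplus> serre_element A (q_index K i) ?m (Y i) (Y j)"
    by (rule serre_element_add[OF assoc_algebra_axioms q_index_generic[OF ij(1)]];
        (simp only: e q_index_square[OF ij(1)])?;
        use ij Xc Yc in \<open>simp add: YX root_pairing_sym[of j i]\<close>)
  also have "\<dots> = \<zero>" using X Y ij by (simp add: serre_family_def)
  finally show "serre_element A (q_index K i) ?m (X i \<oplus> Y i) (X j \<oplus> Y j) = \<zero>" .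
qed

lemma weight_family_scale:
  assumes "weight_family K A Q X s" "torus_family K A Q" "X \<in> I \<rightarrow> carrier A"
  shows "weight_family K A Q (\<lambda>i. c i \<odot> X i) s"
  using assms by (auto simp: weight_family_def smult_mult_left smult_mult_right scalar_scalar torusD mult.commute Pi_iff)

lemma weight_family_add:
  assumes "weight_family K A Q X s" "weight_family K A Q Y s" "torus_family K A Q"
    "X \<in> I \<rightarrow> carrier A" "Y \<in> I \<rightarrow> carrier A"
  shows "weight_family K A Q (\<lambda>i. X i \<oplus> Y i) s"
  using assms by (auto simp: weight_family_def r_distr l_distr scalar_add_right torusD Pi_iff)

lemma weight_family_twist:
  assumes w: "weight_family K A Q X s" and Q: "torus_family K A Q" and X: "X \<in> I \<rightarrow> carrier A"
    and T: "T \<in> I \<rightarrow> carrier A" and c: "\<And>h i. h \<in> P \<Longrightarrow> i \<in> I \<Longrightarrow> Q h \<otimes> T i = T i \<otimes> Q h"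
  shows "weight_family K A Q (\<lambda>i. T i \<otimes> X i) s"
  unfolding weight_family_def
proof (intro ballI)
  fix h i assume hi: "h \<in> P" "i \<in> I"
  then have car: "Q h \<in> carrier A" "X i \<in> carrier A" "T i \<in> carrier A" using Q X T by (auto simp: torusD)
  have "Q h \<otimes> (T i \<otimes> X i) = T i \<otimes> (Q h \<otimes> X i)"
    using car c[OF hi] by (simp add: m_assoc[symmetric])
  then show "Q h \<otimes> (T i \<otimes> X i) = q_param powi (s * weight K h i) \<odot> (T i \<otimes> X i \<otimes> Q h)"
    using car weightD[OF w hi] by (simp add: smult_mult_right m_assoc)
qed

lemma weight_family_mult:
  assumes w: "weight_family K A Q X s" and w': "weight_family K A Q' X s'"
    and Q: "torus_family K A Q" and Q': "torus_family K A Q'" and X: "X \<in> I \<rightarrow> carrier A"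
  shows "weight_family K A (\<lambda>h. Q h \<otimes> Q' h) X (s + s')"
  unfolding weight_family_def
proof (intro ballI)
  fix h i assume hi: "h \<in> P" "i \<in> I"
  then have car: "Q h \<in> carrier A" "Q' h \<in> carrier A" "X i \<in> carrier A" using Q Q' X by (auto simp: torusD)
  have "Q h \<otimes> Q' h \<otimes> X i = q_param powi (s' * weight K h i) \<odot> (Q h \<otimes> X i \<otimes> Q' h)"
    using car weightD[OF w' hi] by (simp add: m_assoc smult_mult_right)
  then show "Q h \<otimes> Q' h \<otimes> X i = q_param powi ((s + s') * weight K h i) \<odot> (X i \<otimes> (Q h \<otimes> Q' h))"
    using car weightD[OF w hi]
    by (simp add: smult_mult_left scalar_scalar m_assoc powi_mult_powi algebra_simps)
qed

lemma weight_family_commuting: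
  assumes "\<And>h i. h \<in> P \<Longrightarrow> i \<in> I \<Longrightarrow> Q h \<otimes> X i = X i \<otimes> Q h" "Q \<in> P \<rightarrow> carrier A" "X \<in> I \<rightarrow> carrier A"
  shows "weight_family K A Q X 0"
  using assms by (auto simp: weight_family_def Pi_iff)

lemma q_familyD:
  assumes "q_family K A E F Q"
  shows "torus_family K A Q" "weight_family K A Q E 1" "weight_family K A Q F (- 1)"
    "serre_family K A E" "serre_family K A F" "E \<in> I \<rightarrow> carrier A" "F \<in> I \<rightarrow> carrier A" "Q \<in> P \<rightarrow> carrier A"
  using assms by (auto simp: q_family_def serre_family_def torus_family_def)

lemma t_weight:
  "i \<in> I \<Longrightarrow> j \<in> I \<Longrightarrow> weight K (t_exponent K i) j = root_pairing K i j"
  "i \<in> I \<Longrightarrow> j \<in> I \<Longrightarrow> weight K (- t_exponent K i) j = - root_pairing K i j"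
  by (simp_all add: root_pairing_def weight_uminus t_exponent_closed)

lemma U_familyD: "U_family K A E F Q \<Longrightarrow> q_family K A E F Q"
  by (simp add: U_family_def)

lemma B_familyD: "B_family K A E F Q \<Longrightarrow> q_family K A E F Q"
  by (simp add: B_family_def)

text \<open>
  The common shape of the relation between \<open>e\<^sub>i\<close> and \<open>f\<^sub>j\<close> for all structure maps: the mixed products
  commute up to the scalar \<open>s\<close>, and the two diagonal ones contribute the inhomogeneous terms.
\<close>

lemma bracket_sum:
  assumes c: "x \<in> carrier A" "x' \<in> carrier A" "y \<in> carrier A" "y' \<in> carrier A" "d \<in> carrier A" "d' \<in> carrier A"
    and "x \<otimes> y = s \<odot> (y \<otimes> x) \<oplus> d" "x \<otimes> y' = s \<odot> (y' \<otimes> x)"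
    and "x' \<otimes> y = s \<odot> (y \<otimes> x')" "x' \<otimes> y' = s \<odot> (y' \<otimes> x') \<oplus> d'"
  shows "(x \<oplus> x') \<otimes> (y \<oplus> y') = s \<odot> ((y \<oplus> y') \<otimes> (x \<oplus> x')) \<oplus> (d \<oplus> d')"
  using c by (simp add: l_distr r_distr assms(7-10) scalar_add_right a_ac)

end

lemma torus_family_hom:
  assumes "f \<in> alg_hom A A'" "torus_family K A Q"
  shows "torus_family K A' (\<lambda>h. f (Q h))"
  using assms(2) alg_homD(1,5)[OF assms(1)]
  by (auto simp: torus_family_def Pi_iff alg_homD(4)[OF assms(1), symmetric])

lemma weight_family_hom:
  assumes "f \<in> alg_hom A A'" "weight_family K A Q X s" "assoc_algebra A"
    "X \<in> index_set K \<rightarrow> carrier A" "Q \<in> coroot_lattice K \<rightarrow> carrier A"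
  shows "weight_family K A' (\<lambda>h. f (Q h)) (\<lambda>i. f (X i)) s"
  unfolding weight_family_def
proof (intro ballI)
  fix h i assume hi: "h \<in> coroot_lattice K" "i \<in> index_set K"
  interpret A: assoc_algebra A by fact
  have c: "Q h \<in> carrier A" "X i \<in> carrier A" using assms(4,5) hi by auto
  have "f (Q h \<otimes>\<^bsub>A\<^esub> X i) = f (q_param powi (s * weight K h i) \<odot>\<^bsub>A\<^esub> (X i \<otimes>\<^bsub>A\<^esub> Q h))"
    using assms(2) hi by (simp add: weight_family_def)
  then show "f (Q h) \<otimes>\<^bsub>A'\<^esub> f (X i) = q_param powi (s * weight K h i) \<odot>\<^bsub>A'\<^esub> (f (X i) \<otimes>\<^bsub>A'\<^esub> f (Q h))"
    using c by (simp add: alg_homD[OF assms(1)])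
qed

lemma serre_family_hom:
  assumes f: "f \<in> alg_hom A A'" and X: "serre_family K A X" and A: "assoc_algebra A" "assoc_algebra A'"
  shows "serre_family K A' (\<lambda>i. f (X i))"
  using X alg_homD(1)[OF f] linear_maps_zero[OF alg_hom_linear[OF f] A]
  by (auto simp: serre_family_def Pi_iff serre_element_hom[OF f A, symmetric])

lemma q_family_hom:
  assumes "f \<in> alg_hom A A'" "q_family K A E F Q" "assoc_algebra A" "assoc_algebra A'"
  shows "q_family K A' (\<lambda>i. f (E i)) (\<lambda>i. f (F i)) (\<lambda>h. f (Q h))"
proof -
  have q: "torus_family K A Q" "weight_family K A Q E 1" "weight_family K A Q F (- 1)"
    "serre_family K A E" "serre_family K A F"
    using assms(2) by (simp_all add: q_family_def)
  have c: "E \<in> index_set K \<rightarrow> carrier A" "F \<in> index_set K \<rightarrow> carrier A" "Q \<in> coroot_lattice K \<rightarrow> carrier A"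
    using q(1,4,5) by (simp_all add: serre_family_def torus_family_def)
  show ?thesis unfolding q_family_def
    by (intro conjI torus_family_hom[OF assms(1) q(1)] serre_family_hom[OF assms(1) _ assms(3,4)] q(4,5)
        weight_family_hom[OF assms(1) q(2) assms(3) c(1,3)] weight_family_hom[OF assms(1) q(3) assms(3) c(2,3)])
qed

lemma U_family_hom:
  assumes f: "f \<in> alg_hom A A'" and U: "U_family K A E F Q" and A: "assoc_algebra A" "assoc_algebra A'"
    and K: "symmetrizable_kac_moody K"
  shows "U_family K A' (\<lambda>i. f (E i)) (\<lambda>i. f (F i)) (\<lambda>h. f (Q h))"
  unfolding U_family_def
proof (intro conjI ballI)
  interpret km_algebra K A using K A by (simp add: km_algebra_def)
  interpret A': assoc_algebra A' by fact
  note q = U_familyD[OF U]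
  show "q_family K A' (\<lambda>i. f (E i)) (\<lambda>i. f (F i)) (\<lambda>h. f (Q h))" by (rule q_family_hom[OF f q A])
  fix i j assume ij: "i \<in> I" "j \<in> I"
  have c: "E i \<in> carrier A" "F j \<in> carrier A" "Q (t_exponent K i) \<in> carrier A" "Q (- t_exponent K i) \<in> carrier A"
    using ij q_familyD[OF q] t_exponent_closed lattice_uminus by auto
  have "f (E i \<otimes>\<^bsub>A\<^esub> F j) = f ((F j \<otimes>\<^bsub>A\<^esub> E i) \<oplus>\<^bsub>A\<^esub>
       (if i = j then inverse (q_index K i - inverse (q_index K i)) \<odot>\<^bsub>A\<^esub>
          (Q (t_exponent K i) \<ominus>\<^bsub>A\<^esub> Q (- t_exponent K i)) else \<zero>\<^bsub>A\<^esub>))"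
    using U ij by (simp add: U_family_def)
  then show "f (E i) \<otimes>\<^bsub>A'\<^esub> f (F j) = (f (F j) \<otimes>\<^bsub>A'\<^esub> f (E i)) \<oplus>\<^bsub>A'\<^esub>
       (if i = j then inverse (q_index K i - inverse (q_index K i)) \<odot>\<^bsub>A'\<^esub>
          (f (Q (t_exponent K i)) \<ominus>\<^bsub>A'\<^esub> f (Q (- t_exponent K i))) else \<zero>\<^bsub>A'\<^esub>)"
    using c by (auto simp: alg_homD[OF f] linear_maps_minus[OF alg_hom_linear[OF f] A]
        linear_maps_zero[OF alg_hom_linear[OF f] A] split: if_splits)
qed

lemma B_family_hom:
  assumes f: "f \<in> alg_hom A A'" and U: "B_family K A E F Q" and A: "assoc_algebra A" "assoc_algebra A'"
    and K: "symmetrizable_kac_moody K"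
  shows "B_family K A' (\<lambda>i. f (E i)) (\<lambda>i. f (F i)) (\<lambda>h. f (Q h))"
  unfolding B_family_def
proof (intro conjI ballI)
  interpret km_algebra K A using K A by (simp add: km_algebra_def)
  interpret A': assoc_algebra A' by fact
  note q = B_familyD[OF U]
  show "q_family K A' (\<lambda>i. f (E i)) (\<lambda>i. f (F i)) (\<lambda>h. f (Q h))" by (rule q_family_hom[OF f q A])
  fix i j assume ij: "i \<in> I" "j \<in> I"
  have c: "E i \<in> carrier A" "F j \<in> carrier A" using ij q_familyD[OF q] by auto
  have "f (E i \<otimes>\<^bsub>A\<^esub> F j) = f (q_param powi root_pairing K i j \<odot>\<^bsub>A\<^esub> (F j \<otimes>\<^bsub>A\<^esub> E i) \<oplus>\<^bsub>A\<^esub> (if i = j then \<one>\<^bsub>A\<^esub> else \<zero>\<^bsub>A\<^esub>))"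
    using U ij by (simp add: B_family_def)
  then show "f (E i) \<otimes>\<^bsub>A'\<^esub> f (F j) = q_param powi root_pairing K i j \<odot>\<^bsub>A'\<^esub> (f (F j) \<otimes>\<^bsub>A'\<^esub> f (E i)) \<oplus>\<^bsub>A'\<^esub>
       (if i = j then \<one>\<^bsub>A'\<^esub> else \<zero>\<^bsub>A'\<^esub>)"
    using c by (auto simp: alg_homD[OF f] linear_maps_zero[OF alg_hom_linear[OF f] A] split: if_splits)
qed

text \<open>
  Reversing products inverts the exchange factors of the torus elements; replacing \<open>h\<close> by \<open>-h\<close> inverts them back.
\<close>

lemma (in km_algebra) q_family_opposite:
  assumes q: "q_family K A E F Q"
  shows "q_family K (opposite_algebra A) E F (\<lambda>h. Q (- h))"
proof -
  note d = q_familyD[OF q]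
  note Q = torusD[OF d(1)]
  have t: "torus_family K (opposite_algebra A) (\<lambda>h. Q (- h))"
    using Q lattice_uminus by (auto simp: torus_family_def add.commute)
  have w: "weight_family K (opposite_algebra A) (\<lambda>h. Q (- h)) X s"
    if "weight_family K A Q X s" "X \<in> I \<rightarrow> carrier A" for X s
    using that lattice_uminus
    by (auto simp: weight_family_def weight_rev[OF that(1) d(1)] weight_uminus Pi_iff simp del: power_int_minus)
  have s: "serre_family K (opposite_algebra A) X" if "serre_family K A X" for X
    using that by (auto simp: serre_family_def serre_element_opposite[OF assoc_algebra_axioms] Pi_iff)
  show ?thesis unfolding q_family_def using t w s d by blast
qed

lemma powi_mult_powi_left: "q_param powi a * (q_param powi b * z) = q_param powi (a + b) * z"
  by (simp only: powi_mult_powi mult.assoc[symmetric])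

lemma powi_mult_powi_mid: "q_param powi a * (z * q_param powi b) = z * q_param powi (a + b)"
  by (simp only: powi_mult_powi[symmetric] mult_ac)

section \<open>Combining two commuting families\<close>

text \<open>
  The families stand for \<open>x \<otimes> 1\<close> and \<open>1 \<otimes> x\<close> in a tensor product.  Working in one algebra with two commuting
  families treats the comultiplication, the coaction and the map \<open>\<tau>\<close> alike.
\<close>

locale commuting_families = km_algebra K A
  for K :: "('i, 't::ab_group_add) km_datum" and A :: "(laurent, 'a) module" (structure) +
  fixes E1 F1 :: "'i \<Rightarrow> 'a" and Q1 :: "'t \<Rightarrow> 'a" and E2 F2 :: "'i \<Rightarrow> 'a" and Q2 :: "'t \<Rightarrow> 'a"
  assumes family1: "q_family K A E1 F1 Q1" and family2: "q_family K A E2 F2 Q2"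
    and families_commute: "\<And>x y. x \<in> E1 ` index_set K \<union> F1 ` index_set K \<union> Q1 ` coroot_lattice K \<Longrightarrow>
      y \<in> E2 ` index_set K \<union> F2 ` index_set K \<union> Q2 ` coroot_lattice K \<Longrightarrow> y \<otimes> x = x \<otimes> y"
begin

abbreviation "t i \<equiv> t_exponent K i"
abbreviation "c i \<equiv> q_index K i - inverse (q_index K i)"

lemmas d1 = q_familyD[OF family1] and d2 = q_familyD[OF family2]

lemma closed [simp]:
  "i \<in> I \<Longrightarrow> E1 i \<in> carrier A" "i \<in> I \<Longrightarrow> F1 i \<in> carrier A" "h \<in> P \<Longrightarrow> Q1 h \<in> carrier A"
  "i \<in> I \<Longrightarrow> E2 i \<in> carrier A" "i \<in> I \<Longrightarrow> F2 i \<in> carrier A" "h \<in> P \<Longrightarrow> Q2 h \<in> carrier A"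
  using d1 d2 by auto

lemma lattice_closed [simp]: "i \<in> I \<Longrightarrow> t i \<in> P" "h \<in> P \<Longrightarrow> - h \<in> P" "h \<in> P \<Longrightarrow> h' \<in> P \<Longrightarrow> h + h' \<in> P" "0 \<in> P"
  "h \<in> P \<Longrightarrow> h' \<in> P \<Longrightarrow> h - h' \<in> P"
  using lattice_add[OF _ lattice_uminus, of h h'] by (simp_all add: index_closed)

lemma cross:
  "i \<in> I \<Longrightarrow> j \<in> I \<Longrightarrow> E2 j \<otimes> E1 i = E1 i \<otimes> E2 j"
  "i \<in> I \<Longrightarrow> j \<in> I \<Longrightarrow> F2 j \<otimes> E1 i = E1 i \<otimes> F2 j"
  "i \<in> I \<Longrightarrow> h \<in> P \<Longrightarrow> Q2 h \<otimes> E1 i = E1 i \<otimes> Q2 h"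
  "i \<in> I \<Longrightarrow> j \<in> I \<Longrightarrow> E2 j \<otimes> F1 i = F1 i \<otimes> E2 j"
  "i \<in> I \<Longrightarrow> j \<in> I \<Longrightarrow> F2 j \<otimes> F1 i = F1 i \<otimes> F2 j"
  "i \<in> I \<Longrightarrow> h \<in> P \<Longrightarrow> Q2 h \<otimes> F1 i = F1 i \<otimes> Q2 h"
  "h \<in> P \<Longrightarrow> j \<in> I \<Longrightarrow> E2 j \<otimes> Q1 h = Q1 h \<otimes> E2 j"
  "h \<in> P \<Longrightarrow> j \<in> I \<Longrightarrow> F2 j \<otimes> Q1 h = Q1 h \<otimes> F2 j"
  "h \<in> P \<Longrightarrow> h' \<in> P \<Longrightarrow> Q2 h' \<otimes> Q1 h = Q1 h \<otimes> Q2 h'"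
  by (rule families_commute; blast)+

lemma tail: "y \<otimes> x = r \<odot> (x \<otimes> y) \<Longrightarrow> x \<in> carrier A \<Longrightarrow> y \<in> carrier A \<Longrightarrow> z \<in> carrier A \<Longrightarrow>
    y \<otimes> (x \<otimes> z) = r \<odot> (x \<otimes> (y \<otimes> z))"
  by (simp add: m_assoc[symmetric] smult_mult_left)

lemma tail1: "y \<otimes> x = x \<otimes> y \<Longrightarrow> x \<in> carrier A \<Longrightarrow> y \<in> carrier A \<Longrightarrow> z \<in> carrier A \<Longrightarrow>
    y \<otimes> (x \<otimes> z) = x \<otimes> (y \<otimes> z)"
  by (simp add: m_assoc[symmetric])

lemma cross_tail:
  "i \<in> I \<Longrightarrow> j \<in> I \<Longrightarrow> z \<in> carrier A \<Longrightarrow> E2 j \<otimes> (E1 i \<otimes> z) = E1 i \<otimes> (E2 j \<otimes> z)"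
  "i \<in> I \<Longrightarrow> j \<in> I \<Longrightarrow> z \<in> carrier A \<Longrightarrow> F2 j \<otimes> (E1 i \<otimes> z) = E1 i \<otimes> (F2 j \<otimes> z)"
  "i \<in> I \<Longrightarrow> h \<in> P \<Longrightarrow> z \<in> carrier A \<Longrightarrow> Q2 h \<otimes> (E1 i \<otimes> z) = E1 i \<otimes> (Q2 h \<otimes> z)"
  "i \<in> I \<Longrightarrow> j \<in> I \<Longrightarrow> z \<in> carrier A \<Longrightarrow> E2 j \<otimes> (F1 i \<otimes> z) = F1 i \<otimes> (E2 j \<otimes> z)"
  "i \<in> I \<Longrightarrow> j \<in> I \<Longrightarrow> z \<in> carrier A \<Longrightarrow> F2 j \<otimes> (F1 i \<otimes> z) = F1 i \<otimes> (F2 j \<otimes> z)"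
  "i \<in> I \<Longrightarrow> h \<in> P \<Longrightarrow> z \<in> carrier A \<Longrightarrow> Q2 h \<otimes> (F1 i \<otimes> z) = F1 i \<otimes> (Q2 h \<otimes> z)"
  "h \<in> P \<Longrightarrow> j \<in> I \<Longrightarrow> z \<in> carrier A \<Longrightarrow> E2 j \<otimes> (Q1 h \<otimes> z) = Q1 h \<otimes> (E2 j \<otimes> z)"
  "h \<in> P \<Longrightarrow> j \<in> I \<Longrightarrow> z \<in> carrier A \<Longrightarrow> F2 j \<otimes> (Q1 h \<otimes> z) = Q1 h \<otimes> (F2 j \<otimes> z)"
  "h \<in> P \<Longrightarrow> h' \<in> P \<Longrightarrow> z \<in> carrier A \<Longrightarrow> Q2 h' \<otimes> (Q1 h \<otimes> z) = Q1 h \<otimes> (Q2 h' \<otimes> z)"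
  by (rule tail1; simp add: cross)+

lemma torus_merge:
  "h \<in> P \<Longrightarrow> h' \<in> P \<Longrightarrow> Q1 h \<otimes> Q1 h' = Q1 (h + h')"
  "h \<in> P \<Longrightarrow> h' \<in> P \<Longrightarrow> Q2 h \<otimes> Q2 h' = Q2 (h + h')"
  "h \<in> P \<Longrightarrow> h' \<in> P \<Longrightarrow> z \<in> carrier A \<Longrightarrow> Q1 h \<otimes> (Q1 h' \<otimes> z) = Q1 (h + h') \<otimes> z"
  "h \<in> P \<Longrightarrow> h' \<in> P \<Longrightarrow> z \<in> carrier A \<Longrightarrow> Q2 h \<otimes> (Q2 h' \<otimes> z) = Q2 (h + h') \<otimes> z"
  "Q1 0 = \<one>" "Q2 0 = \<one>"
  using torusD[OF d1(1)] torusD[OF d2(1)] by (simp_all add: m_assoc[symmetric])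

lemma weights:
  "h \<in> P \<Longrightarrow> i \<in> I \<Longrightarrow> Q1 h \<otimes> E1 i = q_param powi weight K h i \<odot> (E1 i \<otimes> Q1 h)"
  "h \<in> P \<Longrightarrow> i \<in> I \<Longrightarrow> Q1 h \<otimes> F1 i = q_param powi (- weight K h i) \<odot> (F1 i \<otimes> Q1 h)"
  "h \<in> P \<Longrightarrow> i \<in> I \<Longrightarrow> Q2 h \<otimes> E2 i = q_param powi weight K h i \<odot> (E2 i \<otimes> Q2 h)"
  "h \<in> P \<Longrightarrow> i \<in> I \<Longrightarrow> Q2 h \<otimes> F2 i = q_param powi (- weight K h i) \<odot> (F2 i \<otimes> Q2 h)"
  using weightD[OF d1(2), of h i] weightD[OF d1(3), of h i] weightD[OF d2(2), of h i] weightD[OF d2(3), of h i]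
  by (simp_all del: power_int_minus)

lemma weights_tail:
  "h \<in> P \<Longrightarrow> i \<in> I \<Longrightarrow> z \<in> carrier A \<Longrightarrow> Q1 h \<otimes> (E1 i \<otimes> z) = q_param powi weight K h i \<odot> (E1 i \<otimes> (Q1 h \<otimes> z))"
  "h \<in> P \<Longrightarrow> i \<in> I \<Longrightarrow> z \<in> carrier A \<Longrightarrow> Q1 h \<otimes> (F1 i \<otimes> z) = q_param powi (- weight K h i) \<odot> (F1 i \<otimes> (Q1 h \<otimes> z))"
  "h \<in> P \<Longrightarrow> i \<in> I \<Longrightarrow> z \<in> carrier A \<Longrightarrow> Q2 h \<otimes> (E2 i \<otimes> z) = q_param powi weight K h i \<odot> (E2 i \<otimes> (Q2 h \<otimes> z))"
  "h \<in> P \<Longrightarrow> i \<in> I \<Longrightarrow> z \<in> carrier A \<Longrightarrow> Q2 h \<otimes> (F2 i \<otimes> z) = q_param powi (- weight K h i) \<odot> (F2 i \<otimes> (Q2 h \<otimes> z))"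
  by (rule tail; simp add: weights del: power_int_minus)+

text \<open>
  A normal form for products: factors of the first family precede those of the second, and
  in each family the torus elements come last and are merged.  The relative order of \<open>E\<close> and \<open>F\<close> in one family is not changed.
\<close>

lemmas normal = cross cross_tail torus_merge weights weights_tail m_assoc smult_mult_left smult_mult_right
  scalar_scalar powi_mult_powi powi_mult_powi_left powi_mult_powi_mid t_weight

lemma torus_prod: "torus_family K A (\<lambda>h. Q1 h \<otimes> Q2 h)"
  unfolding torus_family_def by (auto simp: normal)

lemma Q12_weight1:
  assumes "weight_family K A Q1 X s" "X \<in> I \<rightarrow> carrier A"
    "\<And>h i. h \<in> P \<Longrightarrow> i \<in> I \<Longrightarrow> Q2 h \<otimes> X i = X i \<otimes> Q2 h"
  shows "weight_family K A (\<lambda>h. Q1 h \<otimes> Q2 h) X s"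
  using weight_family_mult[OF assms(1) weight_family_commuting[OF assms(3) d2(8) assms(2)] d1(1) d2(1) assms(2)]
  by simp

lemma Q12_weight2:
  assumes "weight_family K A Q2 X s" "X \<in> I \<rightarrow> carrier A"
    "\<And>h i. h \<in> P \<Longrightarrow> i \<in> I \<Longrightarrow> Q1 h \<otimes> X i = X i \<otimes> Q1 h"
  shows "weight_family K A (\<lambda>h. Q1 h \<otimes> Q2 h) X s"
  using weight_family_mult[OF weight_family_commuting[OF assms(3) d1(8) assms(2)] assms(1) d1(1) d2(1) assms(2)]
  by simp

lemma Q12_weights:
  "weight_family K A (\<lambda>h. Q1 h \<otimes> Q2 h) E1 1" "weight_family K A (\<lambda>h. Q1 h \<otimes> Q2 h) F1 (- 1)"
  "weight_family K A (\<lambda>h. Q1 h \<otimes> Q2 h) E2 1" "weight_family K A (\<lambda>h. Q1 h \<otimes> Q2 h) F2 (- 1)"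
  using Q12_weight1[OF d1(2,6)] Q12_weight1[OF d1(3,7)] Q12_weight2[OF d2(2,6)] Q12_weight2[OF d2(3,7)]
  by (simp_all add: cross)

lemma Q12_twist:
  assumes "weight_family K A (\<lambda>h. Q1 h \<otimes> Q2 h) X s" "X \<in> I \<rightarrow> carrier A" "\<And>i. i \<in> I \<Longrightarrow> g i \<in> P"
  shows "weight_family K A (\<lambda>h. Q1 h \<otimes> Q2 h) (\<lambda>i. Q1 (g i) \<otimes> X i) s"
    and "weight_family K A (\<lambda>h. Q1 h \<otimes> Q2 h) (\<lambda>i. Q2 (g i) \<otimes> X i) s"
  using assms by (auto intro!: weight_family_twist[OF _ torus_prod] simp: normal add.commute)

lemma Q1_weight0: "weight_family K A Q1 E2 0" "weight_family K A Q1 F2 0"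
  by (rule weight_family_commuting; auto simp: cross)+

lemma Q2_weight0: "weight_family K A Q2 E1 0" "weight_family K A Q2 F1 0"
  by (rule weight_family_commuting; auto simp: cross)+

lemma t_sym:
  "i \<in> I \<Longrightarrow> j \<in> I \<Longrightarrow> weight K (t i) j = weight K (t j) i"
  "i \<in> I \<Longrightarrow> j \<in> I \<Longrightarrow> weight K (- t i) j = weight K (- t j) i"
  by (simp_all add: t_weight root_pairing_sym[of i j])

text \<open>The element \<open>f \<otimes> t\<^sup>-\<^sup>1 + 1 \<otimes> f\<close>, common to the comultiplication and the coaction.\<close>

definition F_sum where "F_sum i = Q2 (- t i) \<otimes> F1 i \<oplus> F2 i"

lemma F_sum_serre: "serre_family K A F_sum"
proof -
  have "serre_family K A (\<lambda>i. Q2 (- t i) \<otimes> F1 i)"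
    by (rule serre_family_twist[OF d1(5) d2(1) Q2_weight0(2)]) (simp_all add: t_sym)
  from serre_family_add[OF d2(5) this]
  have "serre_family K A (\<lambda>i. F2 i \<oplus> Q2 (- t i) \<otimes> F1 i)"
    by (simp del: add_uminus_conv_diff add: normal root_pairing_sym)
  then show ?thesis
    by (simp add: serre_family_def F_sum_def[abs_def] a_comm Pi_iff cong: conj_cong ball_cong_simp)
qed

lemma F_sum_weight: "weight_family K A (\<lambda>h. Q1 h \<otimes> Q2 h) F_sum (- 1)"
  unfolding F_sum_def by (intro weight_family_add Q12_weights Q12_twist torus_prod) auto

text \<open>The element \<open>e \<otimes> 1 + t \<otimes> e\<close> of the comultiplication.\<close>

definition E_comult where "E_comult i = E1 i \<oplus> Q1 (t i) \<otimes> E2 i"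

lemma E_comult_serre: "serre_family K A E_comult"
proof -
  have "serre_family K A (\<lambda>i. Q1 (t i) \<otimes> E2 i)"
    by (rule serre_family_twist[OF d2(4) d1(1) Q1_weight0(1)]) (simp_all add: t_sym)
  from serre_family_add[OF d1(4) this] show ?thesis
    unfolding E_comult_def[abs_def] by (simp del: add_uminus_conv_diff add: normal root_pairing_sym)
qed

lemma E_comult_weight: "weight_family K A (\<lambda>h. Q1 h \<otimes> Q2 h) E_comult 1"
  unfolding E_comult_def[abs_def] by (intro weight_family_add Q12_weights Q12_twist torus_prod) auto

text \<open>The element \<open>e' \<otimes> t\<^sup>-\<^sup>1 + (q\<^sub>i - q\<^sub>i\<^sup>-\<^sup>1) 1 \<otimes> t\<^sup>-\<^sup>1 e\<close>.\<close>

definition E_coact where "E_coact i = Q2 (- t i) \<otimes> E1 i \<oplus> c i \<odot> (Q2 (- t i) \<otimes> E2 i)"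

lemma E_coact_serre: "serre_family K A E_coact"
proof -
  have 1: "serre_family K A (\<lambda>i. Q2 (- t i) \<otimes> E1 i)"
    by (rule serre_family_twist[OF d1(4) d2(1) Q2_weight0(1)]) (simp_all add: t_sym)
  have 2: "serre_family K A (\<lambda>i. c i \<odot> (Q2 (- t i) \<otimes> E2 i))"
    by (rule serre_family_scale, rule serre_family_twist[OF d2(4) d2(1,2)]) (simp_all add: t_sym)
  from serre_family_add[OF 1 2] show ?thesis
    unfolding E_coact_def[abs_def] by (simp del: add_uminus_conv_diff add: normal root_pairing_sym add.commute mult.commute del: power_int_minus)
qed

lemma E_coact_weight: "weight_family K A (\<lambda>h. Q1 h \<otimes> Q2 h) E_coact 1"
  unfolding E_coact_def[abs_def]
  by (intro weight_family_add weight_family_scale Q12_weights Q12_twist torus_prod) auto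

text \<open>
  The values of \<open>\<tau>\<close>.  The first family lives in \<open>B\<^sup>o\<^sup>p\<close>, with \<open>Q1 h\<close> standing for \<open>q\<^sup>-\<^sup>h\<close>.
\<close>

definition E_trans where
  "E_trans i = inverse (c i) \<odot> (Q1 (t i) \<otimes> (Q2 (t i) \<otimes> E2 i)) \<oplus> (- inverse (c i)) \<odot> E1 i"

definition F_trans where "F_trans i = F2 i \<oplus> (- 1) \<odot> (Q2 (- t i) \<otimes> (Q1 (- t i) \<otimes> F1 i))"

lemma E_trans_serre: "serre_family K A E_trans"
proof -
  have "serre_family K A (\<lambda>i. Q2 (t i) \<otimes> E2 i)"
    by (rule serre_family_twist[OF d2(4) d2(1,2)]) (simp_all add: t_sym)
  moreover have "weight_family K A Q1 (\<lambda>i. Q2 (t i) \<otimes> E2 i) 0"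
    by (rule weight_family_commuting) (auto simp: normal)
  ultimately have "serre_family K A (\<lambda>i. Q1 (t i) \<otimes> (Q2 (t i) \<otimes> E2 i))"
    by (rule serre_family_twist[OF _ d1(1)]) (simp_all add: t_sym)
  then have 1: "serre_family K A (\<lambda>i. inverse (c i) \<odot> (Q1 (t i) \<otimes> (Q2 (t i) \<otimes> E2 i)))"
    by (rule serre_family_scale)
  have 2: "serre_family K A (\<lambda>i. (- inverse (c i)) \<odot> E1 i)" by (rule serre_family_scale[OF d1(4)])
  have "serre_family K A (\<lambda>i. (- inverse (c i)) \<odot> E1 i \<oplus> inverse (c i) \<odot> (Q1 (t i) \<otimes> (Q2 (t i) \<otimes> E2 i)))"
    by (rule serre_family_add[OF 2 1]) (simp del: add_uminus_conv_diff add: normal mult_ac)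
  then show ?thesis
    by (simp add: serre_family_def E_trans_def[abs_def] a_comm Pi_iff cong: conj_cong ball_cong_simp)
qed

lemma E_trans_weight: "weight_family K A (\<lambda>h. Q1 h \<otimes> Q2 h) E_trans 1"
  unfolding E_trans_def[abs_def]
  by (intro weight_family_add weight_family_scale Q12_weights Q12_twist torus_prod) auto

lemma F_trans_serre: "serre_family K A F_trans"
proof -
  have "serre_family K A (\<lambda>i. Q1 (- t i) \<otimes> F1 i)"
    by (rule serre_family_twist[OF d1(5) d1(1,3)]) (simp_all add: t_sym)
  moreover have "weight_family K A Q2 (\<lambda>i. Q1 (- t i) \<otimes> F1 i) 0"
    by (rule weight_family_commuting) (auto simp: normal)
  ultimately have "serre_family K A (\<lambda>i. Q2 (- t i) \<otimes> (Q1 (- t i) \<otimes> F1 i))"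
    by (rule serre_family_twist[OF _ d2(1)]) (simp_all add: t_sym)
  then have 1: "serre_family K A (\<lambda>i. (- 1) \<odot> (Q2 (- t i) \<otimes> (Q1 (- t i) \<otimes> F1 i)))"
    by (rule serre_family_scale)
  show ?thesis unfolding F_trans_def[abs_def]
    by (rule serre_family_add[OF d2(5) 1]) (simp del: add_uminus_conv_diff add: normal mult_ac add.commute)
qed

lemma F_trans_weight: "weight_family K A (\<lambda>h. Q1 h \<otimes> Q2 h) F_trans (- 1)"
  unfolding F_trans_def[abs_def]
  by (intro weight_family_add weight_family_scale Q12_weights Q12_twist torus_prod) auto

lemma scalar_collect: "x \<in> carrier A \<Longrightarrow> r \<odot> x \<oplus> s \<odot> x = (r + s) \<odot> x"
  by (simp add: scalar_add_left)

lemma comult_family: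
  assumes U1: "U_family K A E1 F1 Q1" and U2: "U_family K A E2 F2 Q2"
  shows "U_family K A E_comult F_sum (\<lambda>h. Q1 h \<otimes> Q2 h)"
  unfolding U_family_def q_family_def
proof (intro conjI ballI torus_prod E_comult_weight F_sum_weight E_comult_serre F_sum_serre)
  fix i j assume ij: "i \<in> I" "j \<in> I"
  let ?b1 = "if i = j then inverse (c i) \<odot> (Q1 (t i) \<ominus> Q1 (- t i)) else \<zero>"
  let ?b2 = "if i = j then inverse (c i) \<odot> (Q2 (t i) \<ominus> Q2 (- t i)) else \<zero>"
  obtain b1 b2 where b: "b1 = ?b1" "b2 = ?b2" by blast
  have bc: "b1 \<in> carrier A" "b2 \<in> carrier A" using ij by (auto simp: b)
  have r1: "E1 i \<otimes> F1 j = F1 j \<otimes> E1 i \<oplus> b1" using U1 ij by (simp add: U_family_def b)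
  have r2: "E2 i \<otimes> F2 j = F2 j \<otimes> E2 i \<oplus> b2" using U2 ij by (simp add: U_family_def b)
  have r1t: "E1 i \<otimes> (F1 j \<otimes> z) = F1 j \<otimes> (E1 i \<otimes> z) \<oplus> b1 \<otimes> z" if "z \<in> carrier A" for z
    using that ij bc by (simp add: m_assoc[symmetric] r1 l_distr)
  have "E_comult i \<otimes> F_sum j = 1 \<odot> (F_sum j \<otimes> E_comult i) \<oplus> (b1 \<otimes> Q2 (- t j) \<oplus> Q1 (t i) \<otimes> b2)"
    unfolding E_comult_def F_sum_def
    by (rule bracket_sum)
      (use ij bc in \<open>simp_all del: add_uminus_conv_diff add: normal r1t r1 r2 r_distr root_pairing_sym[of j i]\<close>)
  also have "b1 \<otimes> Q2 (- t j) \<oplus> Q1 (t i) \<otimes> b2 = (if i = j then inverse (c i) \<odot>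
      (Q1 (t i) \<otimes> Q2 (t i) \<ominus> Q1 (- t i) \<otimes> Q2 (- t i)) else \<zero>)"
  proof (cases "i = j")
    case True
    let ?k = "inverse (c i)"
    let ?L = "Q1 (t i) \<otimes> Q2 (t i)" and ?M = "Q1 (t i) \<otimes> Q2 (- t i)" and ?N = "Q1 (- t i) \<otimes> Q2 (- t i)"
    have "b1 \<otimes> Q2 (- t j) = ?k \<odot> ?M \<oplus> (- ?k) \<odot> ?N" "Q1 (t i) \<otimes> b2 = ?k \<odot> ?L \<oplus> (- ?k) \<odot> ?M"
      using ij True
      by (simp_all add: b minus_eq_scalar scalar_add_right scalar_scalar l_distr r_distr smult_mult_left smult_mult_right)
    then have "b1 \<otimes> Q2 (- t j) \<oplus> Q1 (t i) \<otimes> b2 = (?k \<odot> ?L \<oplus> (- ?k) \<odot> ?N) \<oplus> (?k \<odot> ?M \<oplus> (- ?k) \<odot> ?M)"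
      using ij by (simp add: a_ac)
    also have "?k \<odot> ?M \<oplus> (- ?k) \<odot> ?M = \<zero>" using ij by (subst scalar_collect) auto
    finally show ?thesis using ij True by (simp add: minus_eq_scalar scalar_add_right scalar_scalar)
  qed (use ij in \<open>simp add: b\<close>)
  finally show "E_comult i \<otimes> F_sum j = F_sum j \<otimes> E_comult i \<oplus> (if i = j then inverse (c i) \<odot>
      (Q1 (t i) \<otimes> Q2 (t i) \<ominus> Q1 (- t i) \<otimes> Q2 (- t i)) else \<zero>)"
    using ij by (simp add: E_comult_def F_sum_def)
qed

lemma coact_family:
  assumes B1: "B_family K A E1 F1 Q1" and U2: "U_family K A E2 F2 Q2"
  shows "B_family K A E_coact F_sum (\<lambda>h. Q1 h \<otimes> Q2 h)"
  unfolding B_family_def q_family_def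
proof (intro conjI ballI torus_prod E_coact_weight F_sum_weight E_coact_serre F_sum_serre)
  fix i j assume ij: "i \<in> I" "j \<in> I"
  let ?b1 = "if i = j then \<one> else \<zero>"
  let ?b2 = "if i = j then inverse (c i) \<odot> (Q2 (t i) \<ominus> Q2 (- t i)) else \<zero>"
  obtain b1 b2 where b: "b1 = ?b1" "b2 = ?b2" by blast
  have bc: "b1 \<in> carrier A" "b2 \<in> carrier A" using ij by (auto simp: b)
  let ?p = "root_pairing K i j"
  have r1: "E1 i \<otimes> F1 j = q_param powi ?p \<odot> (F1 j \<otimes> E1 i) \<oplus> b1" using B1 ij by (simp add: B_family_def b)
  have r2: "E2 i \<otimes> F2 j = F2 j \<otimes> E2 i \<oplus> b2" using U2 ij by (simp add: U_family_def b)
  have r1t: "E1 i \<otimes> (F1 j \<otimes> z) = q_param powi ?p \<odot> (F1 j \<otimes> (E1 i \<otimes> z)) \<oplus> b1 \<otimes> z" if "z \<in> carrier A" for z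
    using that ij bc by (simp add: m_assoc[symmetric] r1 l_distr smult_mult_left)
  have r2t: "E2 i \<otimes> (F2 j \<otimes> z) = F2 j \<otimes> (E2 i \<otimes> z) \<oplus> b2 \<otimes> z" if "z \<in> carrier A" for z
    using that ij bc by (simp add: m_assoc[symmetric] r2 l_distr)
  have "E_coact i \<otimes> F_sum j = q_param powi ?p \<odot> (F_sum j \<otimes> E_coact i) \<oplus>
      (b1 \<otimes> Q2 (- t i + - t j) \<oplus> (c i * q_param powi (?p + - root_pairing K i i)) \<odot> (b2 \<otimes> Q2 (- t i)))"
    unfolding E_coact_def F_sum_def
    by (rule bracket_sum)
      (use ij bc in \<open>simp_all del: add_uminus_conv_diff add: normal r1t r1 r2t r2 r_distr scalar_add_right root_pairing_sym[of j i]
        add.commute add.left_commute mult_ac del: power_int_minus\<close>)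
  also have "b1 \<otimes> Q2 (- t i + - t j) \<oplus> (c i * q_param powi (?p + - root_pairing K i i)) \<odot> (b2 \<otimes> Q2 (- t i)) =
     (if i = j then \<one> else \<zero>)"
  proof (cases "i = j")
    case True
    have z: "Q2 (- t i + - t i) \<oplus> (- 1) \<odot> Q2 (- t i + - t i) = \<zero>"
      using ij scalar_collect[of "Q2 (- t i + - t i)" 1 "- 1"] by simp
    have "b2 \<otimes> Q2 (- t i) = inverse (c i) \<odot> (\<one> \<oplus> (- 1) \<odot> Q2 (- t i + - t i))"
      using ij True by (simp add: b minus_eq_scalar smult_mult_left l_distr torus_merge del: add_uminus_conv_diff)
    then have "c i \<odot> (b2 \<otimes> Q2 (- t i)) = \<one> \<oplus> (- 1) \<odot> Q2 (- t i + - t i)"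
      using ij q_index_diff_nonzero[OF ij(1)] by (simp add: scalar_scalar)
    then have "b1 \<otimes> Q2 (- t i + - t j) \<oplus> (c i * q_param powi (?p + - root_pairing K i i)) \<odot> (b2 \<otimes> Q2 (- t i)) =
       (Q2 (- t i + - t i) \<oplus> (- 1) \<odot> Q2 (- t i + - t i)) \<oplus> \<one>"
      using ij True by (simp add: b a_ac del: add_uminus_conv_diff)
    also have "\<dots> = \<one>" by (simp only: z) simp
    finally show ?thesis using True by simp
  qed (use ij in \<open>simp add: b\<close>)
  finally show "E_coact i \<otimes> F_sum j = q_param powi ?p \<odot> (F_sum j \<otimes> E_coact i) \<oplus> (if i = j then \<one> else \<zero>)" .
qed

text \<open>
  Here the first family comes from the opposite of a Kashiwara algebra, so that the commutation relation
  between \<open>E1\<close> and \<open>F1\<close> is reversed.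
\<close>

lemma trans_family:
  assumes B1: "\<And>i j. i \<in> I \<Longrightarrow> j \<in> I \<Longrightarrow>
      F1 j \<otimes> E1 i = q_param powi root_pairing K i j \<odot> (E1 i \<otimes> F1 j) \<oplus> (if i = j then \<one> else \<zero>)"
    and B2: "B_family K A E2 F2 Q2"
  shows "U_family K A E_trans F_trans (\<lambda>h. Q1 h \<otimes> Q2 h)"
  unfolding U_family_def q_family_def
proof (intro conjI ballI torus_prod E_trans_weight F_trans_weight E_trans_serre F_trans_serre)
  fix i j assume ij: "i \<in> I" "j \<in> I"
  let ?b = "if i = j then \<one> else \<zero>"
  let ?p = "root_pairing K i j"
  obtain b where b: "b = ?b" by blast
  have bc: "b \<in> carrier A" using ij by (auto simp: b)
  have r1: "F1 j \<otimes> E1 i = q_param powi ?p \<odot> (E1 i \<otimes> F1 j) \<oplus> b" using B1 ij by (simp add: b)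
  have r2: "E2 i \<otimes> F2 j = q_param powi ?p \<odot> (F2 j \<otimes> E2 i) \<oplus> b" using B2 ij by (simp add: B_family_def b)
  have r1t: "F1 j \<otimes> (E1 i \<otimes> z) = q_param powi ?p \<odot> (E1 i \<otimes> (F1 j \<otimes> z)) \<oplus> b \<otimes> z" if "z \<in> carrier A" for z
    using that ij bc by (simp add: m_assoc[symmetric] r1 l_distr smult_mult_left)
  have r2t: "E2 i \<otimes> (F2 j \<otimes> z) = q_param powi ?p \<odot> (F2 j \<otimes> (E2 i \<otimes> z)) \<oplus> b \<otimes> z" if "z \<in> carrier A" for z
    using that ij bc by (simp add: m_assoc[symmetric] r2 l_distr smult_mult_left)
  have bt: "b \<otimes> x = x \<otimes> b" if "x \<in> carrier A" for x using that by (simp add: b)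
  let ?k = "inverse (c i)"
  have x2: "((- ?k) \<odot> E1 i) \<otimes> ((- 1) \<odot> (Q2 (- t j) \<otimes> (Q1 (- t j) \<otimes> F1 j))) =
      1 \<odot> (((- 1) \<odot> (Q2 (- t j) \<otimes> (Q1 (- t j) \<otimes> F1 j))) \<otimes> ((- ?k) \<odot> E1 i)) \<oplus>
        (- ?k) \<odot> (Q1 (- t j) \<otimes> (Q2 (- t j) \<otimes> b))"
  proof -
    let ?M = "Q1 (- t j) \<otimes> (Q2 (- t j) \<otimes> b)"
    let ?L = "?k \<odot> (E1 i \<otimes> (Q1 (- t j) \<otimes> (F1 j \<otimes> Q2 (- t j))))"
    have M: "?M \<in> carrier A" and L: "?L \<in> carrier A" using ij bc by simp_all
    have "((- 1) \<odot> (Q2 (- t j) \<otimes> (Q1 (- t j) \<otimes> F1 j))) \<otimes> ((- ?k) \<odot> E1 i) =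
        ?k \<odot> (Q1 (- t j) \<otimes> (F1 j \<otimes> E1 i) \<otimes> Q2 (- t j))"
      using ij by (simp add: smult_mult_left smult_mult_right scalar_scalar m_assoc cross cross_tail)
    also have "\<dots> = ?L \<oplus> ?k \<odot> ?M"
      using ij bc by (simp add: r1 r_distr l_distr smult_mult_left smult_mult_right scalar_scalar m_assoc scalar_add_right
          bt weights_tail weights t_weight powi_mult_powi root_pairing_sym[of j i] mult_ac)
    finally have "1 \<odot> (((- 1) \<odot> (Q2 (- t j) \<otimes> (Q1 (- t j) \<otimes> F1 j))) \<otimes> ((- ?k) \<odot> E1 i)) \<oplus> (- ?k) \<odot> ?M =
        ?L \<oplus> (?k \<odot> ?M \<oplus> (- ?k) \<odot> ?M)" using M L ij by (simp add: a_assoc)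
    also have "\<dots> = ?L" using M L by (simp add: scalar_collect)
    also have "\<dots> = ((- ?k) \<odot> E1 i) \<otimes> ((- 1) \<odot> (Q2 (- t j) \<otimes> (Q1 (- t j) \<otimes> F1 j)))"
      using ij by (simp add: smult_mult_left smult_mult_right scalar_scalar m_assoc cross cross_tail)
    finally show ?thesis by (rule sym)
  qed
  have "E_trans i \<otimes> F_trans j = 1 \<odot> (F_trans j \<otimes> E_trans i) \<oplus>
      ((?k * q_param powi (root_pairing K i i + - ?p)) \<odot> (Q1 (t i) \<otimes> (Q2 (t i) \<otimes> b)) \<oplus> (- ?k) \<odot> (Q1 (- t j) \<otimes> (Q2 (- t j) \<otimes> b)))"
    unfolding E_trans_def F_trans_def
    by (rule bracket_sum[OF _ _ _ _ _ _ _ _ _ x2])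
      (use ij bc in \<open>simp_all del: add_uminus_conv_diff add: normal r2t r2 r_distr scalar_add_right root_pairing_sym[of j i] bt
        add.commute add.left_commute mult_ac del: power_int_minus\<close>)
  also have "(?k * q_param powi (root_pairing K i i + - ?p)) \<odot> (Q1 (t i) \<otimes> (Q2 (t i) \<otimes> b)) \<oplus> (- ?k) \<odot> (Q1 (- t j) \<otimes> (Q2 (- t j) \<otimes> b)) =
     (if i = j then ?k \<odot> (Q1 (t i) \<otimes> Q2 (t i) \<ominus> Q1 (- t i) \<otimes> Q2 (- t i)) else \<zero>)"
    using ij by (simp add: b minus_eq_scalar scalar_add_right scalar_scalar)
  finally show "E_trans i \<otimes> F_trans j = F_trans j \<otimes> E_trans i \<oplus>
     (if i = j then ?k \<odot> (Q1 (t i) \<otimes> Q2 (t i) \<ominus> Q1 (- t i) \<otimes> Q2 (- t i)) else \<zero>)"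
    using ij by (simp add: E_trans_def F_trans_def)
qed

end

section \<open>The presentations\<close>

lemma ball_pairs:
  "(\<forall>p\<in>{(a x y, b x y) |x y. x \<in> X \<and> y \<in> Y}. R p) \<longleftrightarrow> (\<forall>x\<in>X. \<forall>y\<in>Y. R (a x y, b x y))"
  by blast

lemma ball_distinct_pairs:
  "(\<forall>p\<in>{(a x y, b x y) |x y. x \<in> X \<and> y \<in> Y \<and> x \<noteq> y}. R p) \<longleftrightarrow>
     (\<forall>x\<in>X. \<forall>y\<in>Y. x \<noteq> y \<longrightarrow> R (a x y, b x y))"
  by blast

lemma ball_singleton: "(\<forall>p\<in>{q}. R p) \<longleftrightarrow> R q"
  by blast

context symmetrizable_kac_moody
begin

abbreviation "GA \<equiv> free_algebra (generators K) :: (laurent, ('i, 't) gen_poly) module"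

lemma gen_var_closed [simp]:
  "i \<in> I \<Longrightarrow> gen_var (GenE i) \<in> carrier GA" "i \<in> I \<Longrightarrow> gen_var (GenF i) \<in> carrier GA"
  "h \<in> P \<Longrightarrow> gen_var (GenQ h) \<in> carrier GA"
  unfolding gen_var_def by (rule free_gen_closed; simp add: generators_def)+

lemma lattice_closed [simp]: "i \<in> I \<Longrightarrow> t_exponent K i \<in> P" "h \<in> P \<Longrightarrow> - h \<in> P"
    "h \<in> P \<Longrightarrow> h' \<in> P \<Longrightarrow> h + h' \<in> P" "0 \<in> P"
  using t_exponent_closed lattice_uminus lattice_zero lattice_add by blast+

lemma GA_algebra: "assoc_algebra GA" by (rule free_algebra_assoc)

lemma common_relations_ball:
  "(\<forall>p\<in>common_relations K. R p) \<longleftrightarrow>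
    R (gen_var (GenQ 0), \<one>\<^bsub>GA\<^esub>) \<and>
    (\<forall>h\<in>P. \<forall>h'\<in>P. R (gen_var (GenQ h) \<otimes>\<^bsub>GA\<^esub> gen_var (GenQ h'), gen_var (GenQ (h + h')))) \<and>
    (\<forall>h\<in>P. \<forall>i\<in>I. R (gen_var (GenQ h) \<otimes>\<^bsub>GA\<^esub> gen_var (GenE i) \<otimes>\<^bsub>GA\<^esub> gen_var (GenQ (- h)),
        q_param powi (weight K h i) \<odot>\<^bsub>GA\<^esub> gen_var (GenE i))) \<and>
    (\<forall>h\<in>P. \<forall>i\<in>I. R (gen_var (GenQ h) \<otimes>\<^bsub>GA\<^esub> gen_var (GenF i) \<otimes>\<^bsub>GA\<^esub> gen_var (GenQ (- h)),
        q_param powi (- weight K h i) \<odot>\<^bsub>GA\<^esub> gen_var (GenF i))) \<and>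
    (\<forall>i\<in>I. \<forall>j\<in>I. i \<noteq> j \<longrightarrow> R (serre_element GA (q_index K i) (nat (1 - cartan_entry K i j))
        (gen_var (GenE i)) (gen_var (GenE j)), \<zero>\<^bsub>GA\<^esub>)) \<and>
    (\<forall>i\<in>I. \<forall>j\<in>I. i \<noteq> j \<longrightarrow> R (serre_element GA (q_index K i) (nat (1 - cartan_entry K i j))
        (gen_var (GenF i)) (gen_var (GenF j)), \<zero>\<^bsub>GA\<^esub>))"
  unfolding common_relations_def Let_def ball_Un ball_pairs ball_distinct_pairs ball_singleton by (simp only: conj_assoc)

lemma kashiwara_relations_ball:
  "(\<forall>p\<in>kashiwara_relations K. R p) \<longleftrightarrow> (\<forall>p\<in>common_relations K. R p) \<and>
    (\<forall>i\<in>I. \<forall>j\<in>I. R (gen_var (GenE i) \<otimes>\<^bsub>GA\<^esub> gen_var (GenF j),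
       (q_index K i powi (cartan_entry K i j) \<odot>\<^bsub>GA\<^esub> (gen_var (GenF j) \<otimes>\<^bsub>GA\<^esub> gen_var (GenE i)))
         \<oplus>\<^bsub>GA\<^esub> (if i = j then \<one>\<^bsub>GA\<^esub> else \<zero>\<^bsub>GA\<^esub>)))"
  unfolding kashiwara_relations_def Let_def ball_Un ball_pairs ball_distinct_pairs ball_singleton by (rule refl)

lemma quantum_group_relations_ball:
  "(\<forall>p\<in>quantum_group_relations K. R p) \<longleftrightarrow> (\<forall>p\<in>common_relations K. R p) \<and>
    (\<forall>i\<in>I. \<forall>j\<in>I. R ((gen_var (GenE i) \<otimes>\<^bsub>GA\<^esub> gen_var (GenF j)) \<ominus>\<^bsub>GA\<^esub> (gen_var (GenF j) \<otimes>\<^bsub>GA\<^esub> gen_var (GenE i)),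
       (if i = j then inverse (q_index K i - inverse (q_index K i)) \<odot>\<^bsub>GA\<^esub>
              (gen_var (GenQ (t_exponent K i)) \<ominus>\<^bsub>GA\<^esub> gen_var (GenQ (- t_exponent K i)))
            else \<zero>\<^bsub>GA\<^esub>)))"
  unfolding quantum_group_relations_def Let_def ball_Un ball_pairs ball_distinct_pairs ball_singleton by (rule refl)

lemma relations_closed:
  "common_relations K \<subseteq> carrier GA \<times> carrier GA"
  "kashiwara_relations K \<subseteq> carrier GA \<times> carrier GA"
  "quantum_group_relations K \<subseteq> carrier GA \<times> carrier GA"
proof -
  interpret GA: assoc_algebra GA by (rule GA_algebra)
  let ?R = "\<lambda>p. p \<in> carrier GA \<times> carrier GA"
  have 1: "\<forall>p\<in>common_relations K. ?R p"
    unfolding common_relations_ball by (auto intro!: serre_element_closed[OF GA_algebra])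
  moreover have "\<forall>p\<in>kashiwara_relations K. ?R p" unfolding kashiwara_relations_ball using 1 by auto
  moreover have "\<forall>p\<in>quantum_group_relations K. ?R p" unfolding quantum_group_relations_ball using 1 by auto
  ultimately show "common_relations K \<subseteq> carrier GA \<times> carrier GA"
    "kashiwara_relations K \<subseteq> carrier GA \<times> carrier GA"
    "quantum_group_relations K \<subseteq> carrier GA \<times> carrier GA" by blast+
qed

sublocale BP: presentation "generators K" "kashiwara_relations K"
  by unfold_locales (rule relations_closed)

sublocale UP: presentation "generators K" "quantum_group_relations K"
  by unfold_locales (rule relations_closed)

lemma U_algebra: "assoc_algebra (U_alg K)" unfolding U_alg_def by (rule UP.assoc_presented)
lemma B_algebra: "assoc_algebra (B_alg K)" unfolding B_alg_def by (rule BP.assoc_presented)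

lemma km_algebraI: "assoc_algebra A \<Longrightarrow> km_algebra K A"
  by (intro km_algebra.intro symmetrizable_kac_moody_axioms)

text \<open>
  Used in both directions: for the residue class map it shows that the generators of \<open>B\<close> and \<open>U\<close> satisfy the relations,
  for evaluation maps it reduces the existence of a homomorphism to a statement about families.
\<close>

lemma common_relations_iff:
  assumes f: "f \<in> alg_hom GA N" and N: "assoc_algebra N"
  shows "(\<forall>p\<in>common_relations K. f (fst p) = f (snd p)) \<longleftrightarrow>
    q_family K N (\<lambda>i. f (gen_var (GenE i))) (\<lambda>i. f (gen_var (GenF i))) (\<lambda>h. f (gen_var (GenQ h)))"
proof -
  interpret N: km_algebra K N by (rule km_algebraI) fact
  interpret GA: assoc_algebra GA by (rule GA_algebra)
  note h = alg_homD[OF f] linear_maps_zero[OF alg_hom_linear[OF f] GA_algebra N]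
    serre_element_hom[OF f GA_algebra N]
  define E F Q where EFQ: "E i = f (gen_var (GenE i))" "F i = f (gen_var (GenF i))" "Q t = f (gen_var (GenQ t))" for i t
  have c: "\<And>i. i \<in> I \<Longrightarrow> E i \<in> carrier N" "\<And>i. i \<in> I \<Longrightarrow> F i \<in> carrier N" "\<And>t. t \<in> P \<Longrightarrow> Q t \<in> carrier N"
    by (simp_all add: EFQ h)
  have w: "(\<forall>t\<in>P. \<forall>i\<in>I. Q t \<otimes>\<^bsub>N\<^esub> X i \<otimes>\<^bsub>N\<^esub> Q (- t) = q_param powi (s * weight K t i) \<odot>\<^bsub>N\<^esub> X i) \<longleftrightarrow>
      weight_family K N Q X s"
    if T: "torus_family K N Q" and X: "\<And>i. i \<in> I \<Longrightarrow> X i \<in> carrier N" for X s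
    unfolding weight_family_def
  proof (intro ball_cong refl)
    fix t i assume ti: "t \<in> P" "i \<in> I"
    note Q = N.torusD[OF T]
    note car = c(3)[OF ti(1)] c(3)[OF lattice_uminus[OF ti(1)]] X[OF ti(2)]
    show "(Q t \<otimes>\<^bsub>N\<^esub> X i \<otimes>\<^bsub>N\<^esub> Q (- t) = q_param powi (s * weight K t i) \<odot>\<^bsub>N\<^esub> X i) =
       (Q t \<otimes>\<^bsub>N\<^esub> X i = q_param powi (s * weight K t i) \<odot>\<^bsub>N\<^esub> (X i \<otimes>\<^bsub>N\<^esub> Q t))" (is "?l = ?r")
    proof
      assume ?l
      then have "Q t \<otimes>\<^bsub>N\<^esub> X i \<otimes>\<^bsub>N\<^esub> Q (- t) \<otimes>\<^bsub>N\<^esub> Q t = q_param powi (s * weight K t i) \<odot>\<^bsub>N\<^esub> X i \<otimes>\<^bsub>N\<^esub> Q t" by simp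
      then show ?r using car Q(5)[OF ti(1)] by (simp add: N.m_assoc N.smult_mult_left)
    next
      assume ?r
      then have "Q t \<otimes>\<^bsub>N\<^esub> X i \<otimes>\<^bsub>N\<^esub> Q (- t) = q_param powi (s * weight K t i) \<odot>\<^bsub>N\<^esub> (X i \<otimes>\<^bsub>N\<^esub> Q t) \<otimes>\<^bsub>N\<^esub> Q (- t)" by simp
      then show ?l using car Q(4)[OF ti(1)] by (simp add: N.m_assoc N.smult_mult_left)
    qed
  qed
  have tor: "(Q 0 = \<one>\<^bsub>N\<^esub> \<and> (\<forall>t\<in>P. \<forall>t'\<in>P. Q t \<otimes>\<^bsub>N\<^esub> Q t' = Q (t + t'))) \<longleftrightarrow> torus_family K N Q"
    using c by (auto simp: torus_family_def)
  have ser: "(\<forall>i\<in>I. \<forall>j\<in>I. i \<noteq> j \<longrightarrow>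
      serre_element N (q_index K i) (nat (1 - cartan_entry K i j)) (X i) (X j) = \<zero>\<^bsub>N\<^esub>) \<longleftrightarrow> serre_family K N X"
    if "\<And>i. i \<in> I \<Longrightarrow> X i \<in> carrier N" for X
    using that by (auto simp: serre_family_def)
  have "(\<forall>p\<in>common_relations K. f (fst p) = f (snd p)) \<longleftrightarrow>
    (Q 0 = \<one>\<^bsub>N\<^esub> \<and> (\<forall>t\<in>P. \<forall>t'\<in>P. Q t \<otimes>\<^bsub>N\<^esub> Q t' = Q (t + t'))) \<and>
    (\<forall>t\<in>P. \<forall>i\<in>I. Q t \<otimes>\<^bsub>N\<^esub> E i \<otimes>\<^bsub>N\<^esub> Q (- t) = q_param powi (1 * weight K t i) \<odot>\<^bsub>N\<^esub> E i) \<and>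
    (\<forall>t\<in>P. \<forall>i\<in>I. Q t \<otimes>\<^bsub>N\<^esub> F i \<otimes>\<^bsub>N\<^esub> Q (- t) = q_param powi ((- 1) * weight K t i) \<odot>\<^bsub>N\<^esub> F i) \<and>
    (\<forall>i\<in>I. \<forall>j\<in>I. i \<noteq> j \<longrightarrow> serre_element N (q_index K i) (nat (1 - cartan_entry K i j)) (E i) (E j) = \<zero>\<^bsub>N\<^esub>) \<and>
    (\<forall>i\<in>I. \<forall>j\<in>I. i \<noteq> j \<longrightarrow> serre_element N (q_index K i) (nat (1 - cartan_entry K i j)) (F i) (F j) = \<zero>\<^bsub>N\<^esub>)"
    unfolding common_relations_ball EFQ
    by (simp add: h conj_assoc del: power_int_minus cong: ball_cong_simp)
  also have "\<dots> \<longleftrightarrow> q_family K N E F Q"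
  proof (cases "torus_family K N Q")
    case True
    have wE: "(\<forall>t\<in>P. \<forall>i\<in>I. Q t \<otimes>\<^bsub>N\<^esub> E i \<otimes>\<^bsub>N\<^esub> Q (- t) = q_param powi (1 * weight K t i) \<odot>\<^bsub>N\<^esub> E i) \<longleftrightarrow>
        weight_family K N Q E 1" by (rule w[OF True]) (rule c)
    have wF: "(\<forall>t\<in>P. \<forall>i\<in>I. Q t \<otimes>\<^bsub>N\<^esub> F i \<otimes>\<^bsub>N\<^esub> Q (- t) = q_param powi ((- 1) * weight K t i) \<odot>\<^bsub>N\<^esub> F i) \<longleftrightarrow>
        weight_family K N Q F (- 1)" by (rule w[OF True]) (rule c)
    have sE: "(\<forall>i\<in>I. \<forall>j\<in>I. i \<noteq> j \<longrightarrow>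
      serre_element N (q_index K i) (nat (1 - cartan_entry K i j)) (E i) (E j) = \<zero>\<^bsub>N\<^esub>) \<longleftrightarrow> serre_family K N E"
      by (rule ser) (rule c)
    have sF: "(\<forall>i\<in>I. \<forall>j\<in>I. i \<noteq> j \<longrightarrow>
      serre_element N (q_index K i) (nat (1 - cartan_entry K i j)) (F i) (F j) = \<zero>\<^bsub>N\<^esub>) \<longleftrightarrow> serre_family K N F"
      by (rule ser) (rule c)
    show ?thesis by (simp only: tor wE wF sE sF q_family_def)
  next
    case False
    then show ?thesis by (simp only: tor q_family_def simp_thms)
  qed
  finally show ?thesis by (simp only: EFQ[abs_def])
qed

lemma kashiwara_relations_iff:
  assumes f: "f \<in> alg_hom GA N" and N: "assoc_algebra N"
  shows "(\<forall>p\<in>kashiwara_relations K. f (fst p) = f (snd p)) \<longleftrightarrow>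
    B_family K N (\<lambda>i. f (gen_var (GenE i))) (\<lambda>i. f (gen_var (GenF i))) (\<lambda>h. f (gen_var (GenQ h)))"
proof -
  interpret GA: assoc_algebra GA by (rule GA_algebra)
  note h = alg_homD[OF f] linear_maps_zero[OF alg_hom_linear[OF f] GA_algebra N]
  show ?thesis unfolding kashiwara_relations_ball common_relations_iff[OF assms] B_family_def
    by (simp add: h q_index_powi_cartan if_distrib[where f = f] cong: ball_cong_simp)
qed

lemma quantum_group_relations_iff:
  assumes f: "f \<in> alg_hom GA N" and N: "assoc_algebra N"
  shows "(\<forall>p\<in>quantum_group_relations K. f (fst p) = f (snd p)) \<longleftrightarrow>
    U_family K N (\<lambda>i. f (gen_var (GenE i))) (\<lambda>i. f (gen_var (GenF i))) (\<lambda>h. f (gen_var (GenQ h)))"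
proof -
  interpret GA: assoc_algebra GA by (rule GA_algebra)
  interpret N: assoc_algebra N by (rule N)
  note h = alg_homD[OF f] linear_maps_zero[OF alg_hom_linear[OF f] GA_algebra N]
    linear_maps_minus[OF alg_hom_linear[OF f] GA_algebra N]
  have m: "x \<ominus>\<^bsub>N\<^esub> y = z \<longleftrightarrow> x = y \<oplus>\<^bsub>N\<^esub> z" if "x \<in> carrier N" "y \<in> carrier N" "z \<in> carrier N" for x y z
  proof -
    have "y \<oplus>\<^bsub>N\<^esub> (x \<ominus>\<^bsub>N\<^esub> y) = (y \<oplus>\<^bsub>N\<^esub> \<ominus>\<^bsub>N\<^esub> y) \<oplus>\<^bsub>N\<^esub> x" "(y \<oplus>\<^bsub>N\<^esub> z) \<ominus>\<^bsub>N\<^esub> y = (y \<oplus>\<^bsub>N\<^esub> \<ominus>\<^bsub>N\<^esub> y) \<oplus>\<^bsub>N\<^esub> z"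
      using that by (simp_all add: a_minus_def N.a_ac)
    then show ?thesis using that by (auto simp: N.r_neg)
  qed
  have c: "f (gen_var (GenE i)) \<in> carrier N" "f (gen_var (GenF i)) \<in> carrier N" if "i \<in> I" for i
    using that by (simp_all add: h)
  have d: "f (gen_var (GenQ t)) \<in> carrier N" if "t \<in> P" for t
    using that by (simp_all add: h)
  show ?thesis unfolding quantum_group_relations_ball common_relations_iff[OF assms] U_family_def
    by (intro conj_cong refl ball_cong) (auto simp: h m c d)
qed

lemma cls_gen: "BP.cls (gen_var x) = B_gen K x" "UP.cls (gen_var x) = U_gen K x"
  by (simp_all add: B_gen_def U_gen_def presented_gen_def gen_var_def)

lemma B_gen_family:
  "B_family K (B_alg K) (\<lambda>i. B_gen K (GenE i)) (\<lambda>i. B_gen K (GenF i)) (\<lambda>h. B_gen K (GenQ h))"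
  using kashiwara_relations_iff[OF BP.cls_hom BP.assoc_presented] BP.cls_relation
  by (auto simp: cls_gen B_alg_def)

lemma U_gen_family:
  "U_family K (U_alg K) (\<lambda>i. U_gen K (GenE i)) (\<lambda>i. U_gen K (GenF i)) (\<lambda>h. U_gen K (GenQ h))"
  using quantum_group_relations_iff[OF UP.cls_hom UP.assoc_presented] UP.cls_relation
  by (auto simp: cls_gen U_alg_def)

lemma generator_cases:
  assumes "x \<in> generators K"
  obtains i where "x = GenE i" "i \<in> I" | i where "x = GenF i" "i \<in> I" | h where "x = GenQ h" "h \<in> P"
  using assms by (auto simp: generators_def)

lemma family_closed:
  assumes "q_family K N (\<lambda>i. g (GenE i)) (\<lambda>i. g (GenF i)) (\<lambda>h. g (GenQ h))"
  shows "g \<in> generators K \<rightarrow> carrier N"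
  using assms by (auto simp: q_family_def serre_family_def torus_family_def generators_def)

lemma family_cong:
  assumes "\<And>i. i \<in> I \<Longrightarrow> E i = E' i" "\<And>i. i \<in> I \<Longrightarrow> F i = F' i" "\<And>h. h \<in> P \<Longrightarrow> Q h = Q' h"
  shows "q_family K N E F Q \<longleftrightarrow> q_family K N E' F' Q'"
    and "B_family K N E F Q \<longleftrightarrow> B_family K N E' F' Q'"
    and "U_family K N E F Q \<longleftrightarrow> U_family K N E' F' Q'"
proof -
  have Pi: "X \<in> J \<rightarrow> carrier N \<longleftrightarrow> X' \<in> J \<rightarrow> carrier N" if "\<And>i. i \<in> J \<Longrightarrow> X i = X' i" for X X' :: "'z \<Rightarrow> _" and J
    using that by (auto simp: Pi_iff)
  show q: "q_family K N E F Q \<longleftrightarrow> q_family K N E' F' Q'"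
    unfolding q_family_def torus_family_def weight_family_def serre_family_def
    using Pi[of I E E'] Pi[of I F F'] Pi[of P Q Q'] by (simp add: assms cong: ball_cong_simp)
  show "B_family K N E F Q \<longleftrightarrow> B_family K N E' F' Q'" "U_family K N E F Q \<longleftrightarrow> U_family K N E' F' Q'"
    unfolding B_family_def U_family_def q by (simp_all add: assms cong: ball_cong_simp)
qed

lemma B_lift:
  assumes N: "assoc_algebra N" and fam: "B_family K N (\<lambda>i. g (GenE i)) (\<lambda>i. g (GenF i)) (\<lambda>h. g (GenQ h))"
  shows "presented_lift N g \<in> alg_hom (B_alg K) N"
    and "x \<in> generators K \<Longrightarrow> presented_lift N g (B_gen K x) = g x"
proof -
  have g: "g \<in> generators K \<rightarrow> carrier N" using fam by (intro family_closed) (simp add: B_family_def)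
  note f = free_lift_hom[OF N g]
  have gv: "free_lift N g (gen_var x) = g x" if "x \<in> generators K" for x
    unfolding gen_var_def using that g by (intro free_lift_gen N) auto
  have "B_family K N (\<lambda>i. free_lift N g (gen_var (GenE i))) (\<lambda>i. free_lift N g (gen_var (GenF i)))
      (\<lambda>h. free_lift N g (gen_var (GenQ h)))"
    by (subst family_cong(2)[OF gv gv gv]) (auto simp: generators_def fam)
  then have rel: "free_lift N g u = free_lift N g v" if "(u, v) \<in> kashiwara_relations K" for u v
    using kashiwara_relations_iff[OF f N] that by fastforce
  show "presented_lift N g \<in> alg_hom (B_alg K) N"
    unfolding B_alg_def by (rule BP.presented_lift_hom[OF N g rel])
  show "presented_lift N g (B_gen K x) = g x" if "x \<in> generators K"
    unfolding B_gen_def by (rule BP.presented_lift_gen[OF N g rel that])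
qed

lemma U_lift:
  assumes N: "assoc_algebra N" and fam: "U_family K N (\<lambda>i. g (GenE i)) (\<lambda>i. g (GenF i)) (\<lambda>h. g (GenQ h))"
  shows "presented_lift N g \<in> alg_hom (U_alg K) N"
    and "x \<in> generators K \<Longrightarrow> presented_lift N g (U_gen K x) = g x"
proof -
  have g: "g \<in> generators K \<rightarrow> carrier N" using fam by (intro family_closed) (simp add: U_family_def)
  note f = free_lift_hom[OF N g]
  have gv: "free_lift N g (gen_var x) = g x" if "x \<in> generators K" for x
    unfolding gen_var_def using that g by (intro free_lift_gen N) auto
  have "U_family K N (\<lambda>i. free_lift N g (gen_var (GenE i))) (\<lambda>i. free_lift N g (gen_var (GenF i)))
      (\<lambda>h. free_lift N g (gen_var (GenQ h)))"
    by (subst family_cong(3)[OF gv gv gv]) (auto simp: generators_def fam)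
  then have rel: "free_lift N g u = free_lift N g v" if "(u, v) \<in> quantum_group_relations K" for u v
    using quantum_group_relations_iff[OF f N] that by fastforce
  show "presented_lift N g \<in> alg_hom (U_alg K) N"
    unfolding U_alg_def by (rule UP.presented_lift_hom[OF N g rel])
  show "presented_lift N g (U_gen K x) = g x" if "x \<in> generators K"
    unfolding U_gen_def by (rule UP.presented_lift_gen[OF N g rel that])
qed

lemma B_generates: "generates (B_alg K) (B_gen K ` generators K)"
  unfolding B_alg_def B_gen_def by (rule BP.presented_generates)

lemma U_generates: "generates (U_alg K) (U_gen K ` generators K)"
  unfolding U_alg_def U_gen_def by (rule UP.presented_generates)

end

section \<open>The structure maps\<close>

text \<open>
  Applied in the opposite algebra, where \<open>Q h\<close> stands for \<open>q\<^sup>-\<^sup>h\<close>, this yields the antipode: there \<open>E\<^sub>i Q(t\<^sub>i)\<close> is the element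
  \<open>t\<^sub>i\<^sup>-\<^sup>1 e\<^sub>i\<close>, and \<open>Q(- t\<^sub>i) F\<^sub>i\<close> is \<open>f\<^sub>i t\<^sub>i\<close>.
\<close>

lemma (in km_algebra) antipode_family:
  assumes U: "U_family K A E F Q"
  shows "U_family K A (\<lambda>i. (- 1) \<odot> (E i \<otimes> Q (t_exponent K i))) (\<lambda>i. (- 1) \<odot> (Q (- t_exponent K i) \<otimes> F i)) Q"
proof -
  let ?t = "t_exponent K"
  note q = q_familyD[OF U_familyD[OF U]]
  note Q = torusD[OF q(1)]
  have c [simp]: "i \<in> I \<Longrightarrow> E i \<in> carrier A" "i \<in> I \<Longrightarrow> F i \<in> carrier A" "h \<in> P \<Longrightarrow> Q h \<in> carrier A" for i h
    using q by auto
  have tP [simp]: "i \<in> I \<Longrightarrow> ?t i \<in> P" "i \<in> I \<Longrightarrow> - ?t i \<in> P" for i by (simp_all add: index_closed)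
  have ts: "i \<in> I \<Longrightarrow> j \<in> I \<Longrightarrow> weight K (?t i) j = weight K (?t j) i"
    "i \<in> I \<Longrightarrow> j \<in> I \<Longrightarrow> weight K (- ?t i) j = weight K (- ?t j) i" for i j
    by (simp_all add: t_weight root_pairing_sym[of i j])
  have EQ: "E i \<otimes> Q (?t i) = q_param powi (- root_pairing K i i) \<odot> (Q (?t i) \<otimes> E i)" if "i \<in> I" for i
    using weight_rev[OF q(2,1), of "?t i" i] that by (simp add: t_weight)
  have sE: "serre_family K A (\<lambda>i. (- 1) \<odot> (E i \<otimes> Q (?t i)))"
  proof -
    have "serre_family K A (\<lambda>i. (- 1 * q_param powi (- root_pairing K i i)) \<odot> (Q (?t i) \<otimes> E i))"
      by (rule serre_family_scale, rule serre_family_twist[OF q(4,1,2)]) (simp_all add: ts)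
    then show ?thesis
      by (simp add: serre_family_def Pi_iff EQ scalar_scalar del: power_int_minus cong: ball_cong_simp)
  qed
  have sF: "serre_family K A (\<lambda>i. (- 1) \<odot> (Q (- ?t i) \<otimes> F i))"
    by (rule serre_family_scale, rule serre_family_twist[OF q(5,1,3)]) (simp_all add: ts)
  have wE: "weight_family K A Q (\<lambda>i. (- 1) \<odot> (E i \<otimes> Q (?t i))) 1"
  proof -
    have "weight_family K A Q (\<lambda>i. (- 1 * q_param powi (- root_pairing K i i)) \<odot> (Q (?t i) \<otimes> E i)) 1"
      by (intro weight_family_scale weight_family_twist q) (auto intro: torus_commute[OF q(1)])
    then show ?thesis
      by (simp add: weight_family_def EQ scalar_scalar del: power_int_minus cong: ball_cong_simp)
  qed
  have wF: "weight_family K A Q (\<lambda>i. (- 1) \<odot> (Q (- ?t i) \<otimes> F i)) (- 1)"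
    by (intro weight_family_scale weight_family_twist q) (auto intro: torus_commute[OF q(1)])
  show ?thesis unfolding U_family_def q_family_def
  proof (intro conjI ballI q(1) sE sF wE wF)
    fix i j assume ij: "i \<in> I" "j \<in> I"
    obtain b where b: "b = (if i = j then inverse (q_index K i - inverse (q_index K i)) \<odot>
       (Q (?t i) \<ominus> Q (- ?t i)) else \<zero>)" by blast
    have bc: "b \<in> carrier A" using ij by (simp add: b)
    have r: "E i \<otimes> F j = F j \<otimes> E i \<oplus> b" using U ij by (simp add: U_family_def b)
    let ?s = "q_param powi (root_pairing K j j + - root_pairing K i j)"
    have tt: "?t i + - ?t j \<in> P" using ij by (intro lattice_add) simp_all
    have w1: "Q (?t i + - ?t j) \<otimes> F j = ?s \<odot> (F j \<otimes> Q (?t i + - ?t j))"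
      using weightD[OF q(3) tt ij(2)] ij
      by (simp add: weight_add t_weight del: add_uminus_conv_diff) (simp add: add.commute)
    have w2: "Q (- ?t j) \<otimes> (F j \<otimes> E i) = ?s \<odot> (F j \<otimes> (E i \<otimes> Q (- ?t j)))"
    proof -
      have "Q (- ?t j) \<otimes> (F j \<otimes> E i) = q_param powi (root_pairing K j j) \<odot> (F j \<otimes> (Q (- ?t j) \<otimes> E i))"
        using weightD[OF q(3), of "- ?t j" j] ij by (simp add: m_assoc[symmetric] t_weight smult_mult_left)
      then show ?thesis
        using weightD[OF q(2), of "- ?t j" i] ij
        by (simp add: t_weight smult_mult_right scalar_scalar powi_mult_powi root_pairing_sym[of j i] del: power_int_minus)
    qed
    have "((- 1) \<odot> (E i \<otimes> Q (?t i))) \<otimes> ((- 1) \<odot> (Q (- ?t j) \<otimes> F j)) = E i \<otimes> (Q (?t i + - ?t j) \<otimes> F j)"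
      using ij Q(3)[of "?t i" "- ?t j", symmetric]
      by (simp add: smult_mult_left smult_mult_right scalar_scalar m_assoc del: add_uminus_conv_diff)
    also have "\<dots> = ?s \<odot> (F j \<otimes> E i \<otimes> Q (?t i + - ?t j)) \<oplus> ?s \<odot> (b \<otimes> Q (?t i + - ?t j))"
    proof -
      have "E i \<otimes> (Q (?t i + - ?t j) \<otimes> F j) = ?s \<odot> (E i \<otimes> F j \<otimes> Q (?t i + - ?t j))"
        unfolding w1 using ij tt by (simp add: smult_mult_right m_assoc del: add_uminus_conv_diff)
      then show ?thesis unfolding r using ij tt bc
        by (simp add: l_distr scalar_add_right del: add_uminus_conv_diff)
    qed
    also have "?s \<odot> (F j \<otimes> E i \<otimes> Q (?t i + - ?t j)) = ((- 1) \<odot> (Q (- ?t j) \<otimes> F j)) \<otimes> ((- 1) \<odot> (E i \<otimes> Q (?t i)))"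
    proof -
      have "((- 1) \<odot> (Q (- ?t j) \<otimes> F j)) \<otimes> ((- 1) \<odot> (E i \<otimes> Q (?t i))) = Q (- ?t j) \<otimes> (F j \<otimes> E i) \<otimes> Q (?t i)"
        using ij by (simp add: smult_mult_left smult_mult_right scalar_scalar m_assoc)
      then show ?thesis unfolding w2 using ij Q(3)[of "- ?t j" "?t i"]
        by (simp add: smult_mult_left m_assoc add.commute del: add_uminus_conv_diff)
    qed
    also have "?s \<odot> (b \<otimes> Q (?t i + - ?t j)) = b"
      using ij c(3)[OF tt] by (cases "i = j") (simp_all add: b Q(2) del: add_uminus_conv_diff)
    finally show "((- 1) \<odot> (E i \<otimes> Q (?t i))) \<otimes> ((- 1) \<odot> (Q (- ?t j) \<otimes> F j)) =
      ((- 1) \<odot> (Q (- ?t j) \<otimes> F j)) \<otimes> ((- 1) \<odot> (E i \<otimes> Q (?t i))) \<oplus>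
      (if i = j then inverse (q_index K i - inverse (q_index K i)) \<odot> (Q (?t i) \<ominus> Q (- ?t i)) else \<zero>)"
      by (simp only: b)
  qed
qed

text \<open>
  The commutator of \<open>e\<^sub>i\<close> and \<open>f\<^sub>i\<close> changes sign, and so does \<open>t\<^sub>i - t\<^sub>i\<^sup>-\<^sup>1\<close> when \<open>h\<close> is replaced by \<open>-h\<close>.
\<close>

lemma (in km_algebra) U_family_opposite:
  assumes U: "U_family K A E F Q"
  shows "U_family K (opposite_algebra A) E F (\<lambda>h. Q (- h))"
proof -
  note q = q_familyD[OF U_familyD[OF U]]
  let ?O = "opposite_algebra A"
  show ?thesis unfolding U_family_def
  proof (intro conjI ballI q_family_opposite[OF U_familyD[OF U]])
    fix i j assume ij: "i \<in> I" "j \<in> I"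
    have c: "E i \<in> carrier A" "F j \<in> carrier A" "Q (t_exponent K i) \<in> carrier A" "Q (- t_exponent K i) \<in> carrier A"
      using q ij index_closed by auto
    let ?k = "inverse (q_index K i - inverse (q_index K i))"
    let ?b = "if i = j then ?k \<odot> (Q (t_exponent K i) \<ominus> Q (- t_exponent K i)) else \<zero>"
    let ?b' = "if i = j then ?k \<odot> (Q (- t_exponent K i) \<ominus> Q (t_exponent K i)) else \<zero>"
    have bc: "?b \<in> carrier A" "?b' \<in> carrier A" using c by auto
    have z: "?b \<oplus> ?b' = \<zero>"
    proof (cases "i = j")
      case True
      have "(Q (t_exponent K i) \<ominus> Q (- t_exponent K i)) \<oplus> (Q (- t_exponent K i) \<ominus> Q (t_exponent K i)) =
        (Q (t_exponent K i) \<oplus> \<ominus> Q (t_exponent K i)) \<oplus> (Q (- t_exponent K i) \<oplus> \<ominus> Q (- t_exponent K i))"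
        using c by (simp add: a_minus_def a_ac)
      then show ?thesis using c True by (simp add: scalar_add_right[symmetric] r_neg)
    qed simp
    have "E i \<otimes> F j = F j \<otimes> E i \<oplus> ?b" using U ij by (simp add: U_family_def)
    then have "E i \<otimes> F j \<oplus> ?b' = F j \<otimes> E i \<oplus> (?b \<oplus> ?b')"
      using c bc by (simp only: a_assoc m_closed)
    then have "F j \<otimes> E i = E i \<otimes> F j \<oplus> ?b'" unfolding z using c by simp
    then show "E i \<otimes>\<^bsub>?O\<^esub> F j = (F j \<otimes>\<^bsub>?O\<^esub> E i) \<oplus>\<^bsub>?O\<^esub> (if i = j then ?k \<odot>\<^bsub>?O\<^esub>
          (Q (- t_exponent K i) \<ominus>\<^bsub>?O\<^esub> Q (- (- t_exponent K i))) else \<zero>\<^bsub>?O\<^esub>)"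
      by (simp add: a_minus_def)
  qed
qed

context symmetrizable_kac_moody
begin

abbreviation "t i \<equiv> t_exponent K i"
abbreviation "c i \<equiv> q_index K i - inverse (q_index K i)"
abbreviation "U \<equiv> U_alg K"
abbreviation "B \<equiv> B_alg K"
abbreviation "UU \<equiv> tensor_algebra U U"
abbreviation "BU \<equiv> tensor_algebra B U"
abbreviation "OB \<equiv> tensor_algebra (opposite_algebra B) B"
abbreviation "eU i \<equiv> U_gen K (GenE i)"
abbreviation "fU i \<equiv> U_gen K (GenF i)"
abbreviation "qU h \<equiv> U_gen K (GenQ h)"
abbreviation "eB i \<equiv> B_gen K (GenE i)"
abbreviation "fB i \<equiv> B_gen K (GenF i)"
abbreviation "qB h \<equiv> B_gen K (GenQ h)"

sublocale U: km_algebra K U by (rule km_algebraI[OF U_algebra])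
sublocale B: km_algebra K B by (rule km_algebraI[OF B_algebra])

lemma gens_closed [simp]:
  "i \<in> I \<Longrightarrow> eU i \<in> carrier U" "i \<in> I \<Longrightarrow> fU i \<in> carrier U" "h \<in> P \<Longrightarrow> qU h \<in> carrier U"
  "i \<in> I \<Longrightarrow> eB i \<in> carrier B" "i \<in> I \<Longrightarrow> fB i \<in> carrier B" "h \<in> P \<Longrightarrow> qB h \<in> carrier B"
  using U.q_familyD(6-8)[OF U.U_familyD[OF U_gen_family]] B.q_familyD(6-8)[OF B.B_familyD[OF B_gen_family]] by auto

lemmas qU_torus = U.torusD[OF U.q_familyD(1)[OF U.U_familyD[OF U_gen_family]]]
lemmas qB_torus = B.torusD[OF B.q_familyD(1)[OF B.B_familyD[OF B_gen_family]]]

lemma torus_cancel [simp]: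
  "h \<in> P \<Longrightarrow> qU h \<otimes>\<^bsub>U\<^esub> qU (- h) = \<one>\<^bsub>U\<^esub>" "h \<in> P \<Longrightarrow> qU (- h) \<otimes>\<^bsub>U\<^esub> qU h = \<one>\<^bsub>U\<^esub>"
  "h \<in> P \<Longrightarrow> qB h \<otimes>\<^bsub>B\<^esub> qB (- h) = \<one>\<^bsub>B\<^esub>" "h \<in> P \<Longrightarrow> qB (- h) \<otimes>\<^bsub>B\<^esub> qB h = \<one>\<^bsub>B\<^esub>"
  by (simp_all add: qU_torus(4,5) qB_torus(4,5))

lemma torus_cancel_tail [simp]:
  "h \<in> P \<Longrightarrow> z \<in> carrier U \<Longrightarrow> qU h \<otimes>\<^bsub>U\<^esub> (qU (- h) \<otimes>\<^bsub>U\<^esub> z) = z"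
  "h \<in> P \<Longrightarrow> z \<in> carrier U \<Longrightarrow> qU (- h) \<otimes>\<^bsub>U\<^esub> (qU h \<otimes>\<^bsub>U\<^esub> z) = z"
  "h \<in> P \<Longrightarrow> z \<in> carrier B \<Longrightarrow> qB h \<otimes>\<^bsub>B\<^esub> (qB (- h) \<otimes>\<^bsub>B\<^esub> z) = z"
  "h \<in> P \<Longrightarrow> z \<in> carrier B \<Longrightarrow> qB (- h) \<otimes>\<^bsub>B\<^esub> (qB h \<otimes>\<^bsub>B\<^esub> z) = z"
  by (simp_all add: U.m_assoc[symmetric] B.m_assoc[symmetric])

lemma c_inverse [simp]: "i \<in> I \<Longrightarrow> inverse (c i) * c i = 1" "i \<in> I \<Longrightarrow> c i * inverse (c i) = 1"
  by (rule left_inverse[OF q_index_diff_nonzero] right_inverse[OF q_index_diff_nonzero], assumption)+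

end

lemma tensor_embeddings:
  assumes "assoc_algebra A" "assoc_algebra C"
  shows "(\<lambda>a. pure_tensor A C a \<one>\<^bsub>C\<^esub>) \<in> alg_hom A (tensor_algebra A C)"
    and "(\<lambda>x. pure_tensor A C \<one>\<^bsub>A\<^esub> x) \<in> alg_hom C (tensor_algebra A C)"
proof -
  interpret algebra_pair A C using assms by (rule algebra_pairI)
  show "(\<lambda>a. pure_tensor A C a \<one>\<^bsub>C\<^esub>) \<in> alg_hom A (tensor_algebra A C)"
    by (rule alg_homI, rule linear_mapsI) (simp_all add: tens_add_left tens_smult_left tens_mult tens_one)
  show "(\<lambda>x. pure_tensor A C \<one>\<^bsub>A\<^esub> x) \<in> alg_hom C (tensor_algebra A C)"
    by (rule alg_homI, rule linear_mapsI) (simp_all add: tens_add_right tens_smult_right tens_mult tens_one)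
qed

lemma (in symmetrizable_kac_moody) tensor_commuting_families:
  assumes A: "assoc_algebra A" and C: "assoc_algebra C"
    and 1: "q_family K A E F Q" and 2: "q_family K C E' F' Q'"
  shows "commuting_families K (tensor_algebra A C)
     (\<lambda>i. pure_tensor A C (E i) \<one>\<^bsub>C\<^esub>) (\<lambda>i. pure_tensor A C (F i) \<one>\<^bsub>C\<^esub>) (\<lambda>h. pure_tensor A C (Q h) \<one>\<^bsub>C\<^esub>)
     (\<lambda>i. pure_tensor A C \<one>\<^bsub>A\<^esub> (E' i)) (\<lambda>i. pure_tensor A C \<one>\<^bsub>A\<^esub> (F' i)) (\<lambda>h. pure_tensor A C \<one>\<^bsub>A\<^esub> (Q' h))"
proof -
  interpret AC: algebra_pair A C using A C by (rule algebra_pairI)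
  interpret A: km_algebra K A by (rule km_algebraI[OF A])
  interpret C: km_algebra K C by (rule km_algebraI[OF C])
  note q1 = A.q_familyD(6-8)[OF 1] and q2 = C.q_familyD(6-8)[OF 2]
  have comm: "pure_tensor A C \<one>\<^bsub>A\<^esub> y \<otimes>\<^bsub>tensor_algebra A C\<^esub> pure_tensor A C x \<one>\<^bsub>C\<^esub> =
     pure_tensor A C x \<one>\<^bsub>C\<^esub> \<otimes>\<^bsub>tensor_algebra A C\<^esub> pure_tensor A C \<one>\<^bsub>A\<^esub> y"
    if "x \<in> carrier A" "y \<in> carrier C" for x y
    using that by (simp add: AC.tens_mult)
  show ?thesis
  proof (intro commuting_families.intro commuting_families_axioms.intro km_algebraI AC.tensor_assoc_algebra
      q_family_hom[OF tensor_embeddings(1)[OF A C] 1 A AC.tensor_assoc_algebra]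
      q_family_hom[OF tensor_embeddings(2)[OF A C] 2 C AC.tensor_assoc_algebra])
    fix x y
    assume x: "x \<in> (\<lambda>i. pure_tensor A C (E i) \<one>\<^bsub>C\<^esub>) ` I \<union> (\<lambda>i. pure_tensor A C (F i) \<one>\<^bsub>C\<^esub>) ` I \<union>
        (\<lambda>h. pure_tensor A C (Q h) \<one>\<^bsub>C\<^esub>) ` P"
      and y: "y \<in> (\<lambda>i. pure_tensor A C \<one>\<^bsub>A\<^esub> (E' i)) ` I \<union> (\<lambda>i. pure_tensor A C \<one>\<^bsub>A\<^esub> (F' i)) ` I \<union>
        (\<lambda>h. pure_tensor A C \<one>\<^bsub>A\<^esub> (Q' h)) ` P"
    have "\<exists>a\<in>carrier A. x = pure_tensor A C a \<one>\<^bsub>C\<^esub>" using x q1 by (auto simp: Pi_iff)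
    moreover have "\<exists>b\<in>carrier C. y = pure_tensor A C \<one>\<^bsub>A\<^esub> b" using y q2 by (auto simp: Pi_iff)
    ultimately show "y \<otimes>\<^bsub>tensor_algebra A C\<^esub> x = x \<otimes>\<^bsub>tensor_algebra A C\<^esub> y" using comm by blast
  qed
qed

context symmetrizable_kac_moody
begin

lemma comult_properties:
  shows U_comult_hom: "U_comult K \<in> alg_hom U UU"
    and "i \<in> I \<Longrightarrow> U_comult K (eU i) = pure_tensor U U (eU i) \<one>\<^bsub>U\<^esub> \<oplus>\<^bsub>UU\<^esub> pure_tensor U U (qU (t i)) (eU i)"
    and "i \<in> I \<Longrightarrow> U_comult K (fU i) = pure_tensor U U (fU i) (qU (- t i)) \<oplus>\<^bsub>UU\<^esub> pure_tensor U U \<one>\<^bsub>U\<^esub> (fU i)"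
    and "h \<in> P \<Longrightarrow> U_comult K (qU h) = pure_tensor U U (qU h) (qU h)"
proof -
  interpret UU: algebra_pair U U by (rule algebra_pairI[OF U_algebra U_algebra])
  note q = U.U_familyD[OF U_gen_family]
  interpret C: commuting_families K "UU" "\<lambda>i. pure_tensor U U (eU i) \<one>\<^bsub>U\<^esub>" "\<lambda>i. pure_tensor U U (fU i) \<one>\<^bsub>U\<^esub>"
     "\<lambda>h. pure_tensor U U (qU h) \<one>\<^bsub>U\<^esub>" "\<lambda>i. pure_tensor U U \<one>\<^bsub>U\<^esub> (eU i)" "\<lambda>i. pure_tensor U U \<one>\<^bsub>U\<^esub> (fU i)"
     "\<lambda>h. pure_tensor U U \<one>\<^bsub>U\<^esub> (qU h)"
    by (rule tensor_commuting_families[OF U_algebra U_algebra q q])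
  define g where "g = (\<lambda>x. case x of
           GenE i \<Rightarrow> pure_tensor U U (U_gen K (GenE i)) \<one>\<^bsub>U\<^esub>
             \<oplus>\<^bsub>UU\<^esub> pure_tensor U U (U_t K i) (U_gen K (GenE i))
         | GenF i \<Rightarrow> pure_tensor U U (U_gen K (GenF i)) (U_t_inv K i)
             \<oplus>\<^bsub>UU\<^esub> pure_tensor U U \<one>\<^bsub>U\<^esub> (U_gen K (GenF i))
         | GenQ h \<Rightarrow> pure_tensor U U (U_gen K (GenQ h)) (U_gen K (GenQ h)))"
  have eq: "U_comult K = presented_lift UU g"
    by (simp add: U_comult_def g_def Let_def)
  have fam: "U_family K UU C.E_comult C.F_sum
     (\<lambda>h. pure_tensor U U (qU h) \<one>\<^bsub>U\<^esub> \<otimes>\<^bsub>UU\<^esub> pure_tensor U U \<one>\<^bsub>U\<^esub> (qU h))"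
    by (intro C.comult_family U_family_hom[OF tensor_embeddings(1)[OF U_algebra U_algebra]]
      U_family_hom[OF tensor_embeddings(2)[OF U_algebra U_algebra]] U_gen_family U_algebra UU.tensor_assoc_algebra
      symmetrizable_kac_moody_axioms)
  have "U_family K UU (\<lambda>i. g (GenE i)) (\<lambda>i. g (GenF i)) (\<lambda>h. g (GenQ h))"
    by (rule iffD1[OF family_cong(3) fam])
      (simp_all add: g_def C.E_comult_def C.F_sum_def UU.tens_mult U_t_def U_t_inv_def)
  note lift = U_lift[OF UU.tensor_assoc_algebra this]
  show "U_comult K \<in> alg_hom U UU" unfolding eq by (rule lift)
  show "i \<in> I \<Longrightarrow> U_comult K (eU i) = pure_tensor U U (eU i) \<one>\<^bsub>U\<^esub> \<oplus>\<^bsub>UU\<^esub> pure_tensor U U (qU (t i)) (eU i)"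
    "i \<in> I \<Longrightarrow> U_comult K (fU i) = pure_tensor U U (fU i) (qU (- t i)) \<oplus>\<^bsub>UU\<^esub> pure_tensor U U \<one>\<^bsub>U\<^esub> (fU i)"
    "h \<in> P \<Longrightarrow> U_comult K (qU h) = pure_tensor U U (qU h) (qU h)"
    unfolding eq by (simp_all add: lift(2) generators_def) (simp_all add: g_def U_t_def U_t_inv_def)
qed

lemma coaction_properties:
  shows B_coaction_hom: "B_coaction K \<in> alg_hom B BU"
    and B_coaction_gen: "x \<in> generators K \<Longrightarrow> B_coaction K (B_gen K x) = B_coaction_gen K x"
    and "i \<in> I \<Longrightarrow> B_coaction K (eB i) = c i \<odot>\<^bsub>BU\<^esub> pure_tensor B U \<one>\<^bsub>B\<^esub> (qU (- t i) \<otimes>\<^bsub>U\<^esub> eU i)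
       \<oplus>\<^bsub>BU\<^esub> pure_tensor B U (eB i) (qU (- t i))"
    and "i \<in> I \<Longrightarrow> B_coaction K (fB i) = pure_tensor B U (fB i) (qU (- t i)) \<oplus>\<^bsub>BU\<^esub> pure_tensor B U \<one>\<^bsub>B\<^esub> (fU i)"
    and "h \<in> P \<Longrightarrow> B_coaction K (qB h) = pure_tensor B U (qB h) (qU h)"
proof -
  interpret BU: algebra_pair B U by (rule algebra_pairI[OF B_algebra U_algebra])
  interpret C: commuting_families K "BU" "\<lambda>i. pure_tensor B U (eB i) \<one>\<^bsub>U\<^esub>" "\<lambda>i. pure_tensor B U (fB i) \<one>\<^bsub>U\<^esub>"
     "\<lambda>h. pure_tensor B U (qB h) \<one>\<^bsub>U\<^esub>" "\<lambda>i. pure_tensor B U \<one>\<^bsub>B\<^esub> (eU i)" "\<lambda>i. pure_tensor B U \<one>\<^bsub>B\<^esub> (fU i)"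
     "\<lambda>h. pure_tensor B U \<one>\<^bsub>B\<^esub> (qU h)"
    by (rule tensor_commuting_families[OF B_algebra U_algebra B.B_familyD[OF B_gen_family] U.U_familyD[OF U_gen_family]])
  have fam: "B_family K BU C.E_coact C.F_sum
     (\<lambda>h. pure_tensor B U (qB h) \<one>\<^bsub>U\<^esub> \<otimes>\<^bsub>BU\<^esub> pure_tensor B U \<one>\<^bsub>B\<^esub> (qU h))"
    by (intro C.coact_family B_family_hom[OF tensor_embeddings(1)[OF B_algebra U_algebra]]
      U_family_hom[OF tensor_embeddings(2)[OF B_algebra U_algebra]] U_gen_family B_gen_family U_algebra B_algebra
      BU.tensor_assoc_algebra symmetrizable_kac_moody_axioms)
  have "B_family K BU (\<lambda>i. B_coaction_gen K (GenE i)) (\<lambda>i. B_coaction_gen K (GenF i)) (\<lambda>h. B_coaction_gen K (GenQ h))"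
    by (rule iffD1[OF family_cong(2) fam])
      (simp_all add: B_coaction_gen_def Let_def C.E_coact_def C.F_sum_def BU.tens_mult U_t_inv_def BU.T.a_comm)
  note lift = B_lift[OF BU.tensor_assoc_algebra this, folded B_coaction_def]
  show "B_coaction K \<in> alg_hom B BU" by (rule lift)
  show *: "B_coaction K (B_gen K x) = B_coaction_gen K x" if "x \<in> generators K" for x
    using that by (rule lift)
  show "i \<in> I \<Longrightarrow> B_coaction K (eB i) = c i \<odot>\<^bsub>BU\<^esub> pure_tensor B U \<one>\<^bsub>B\<^esub> (qU (- t i) \<otimes>\<^bsub>U\<^esub> eU i)
       \<oplus>\<^bsub>BU\<^esub> pure_tensor B U (eB i) (qU (- t i))"
    "i \<in> I \<Longrightarrow> B_coaction K (fB i) = pure_tensor B U (fB i) (qU (- t i)) \<oplus>\<^bsub>BU\<^esub> pure_tensor B U \<one>\<^bsub>B\<^esub> (fU i)"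
    "h \<in> P \<Longrightarrow> B_coaction K (qB h) = pure_tensor B U (qB h) (qU h)"
    by (simp_all add: * generators_def) (simp_all add: B_coaction_gen_def Let_def U_t_inv_def)
qed

lemma antipode_properties:
  shows U_antipode_hom: "U_antipode K \<in> alg_hom U (opposite_algebra U)"
    and "i \<in> I \<Longrightarrow> U_antipode K (eU i) = \<ominus>\<^bsub>U\<^esub> (qU (- t i) \<otimes>\<^bsub>U\<^esub> eU i)"
    and "i \<in> I \<Longrightarrow> U_antipode K (fU i) = \<ominus>\<^bsub>U\<^esub> (fU i \<otimes>\<^bsub>U\<^esub> qU (t i))"
    and "h \<in> P \<Longrightarrow> U_antipode K (qU h) = qU (- h)"
proof -
  note O = opposite_assoc_algebra[OF U_algebra]
  interpret O: km_algebra K "opposite_algebra U" by (rule km_algebraI[OF O])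
  define g where "g = (\<lambda>x. case x of
           GenE i \<Rightarrow> \<ominus>\<^bsub>U\<^esub> (U_t_inv K i \<otimes>\<^bsub>U\<^esub> U_gen K (GenE i))
         | GenF i \<Rightarrow> \<ominus>\<^bsub>U\<^esub> (U_gen K (GenF i) \<otimes>\<^bsub>U\<^esub> U_t K i)
         | GenQ h \<Rightarrow> U_gen K (GenQ (- h)))"
  have eq: "U_antipode K = presented_lift (opposite_algebra U) g"
    by (simp add: U_antipode_def g_def Let_def)
  note fam = O.antipode_family[OF U.U_family_opposite[OF U_gen_family]]
  have "U_family K (opposite_algebra U) (\<lambda>i. g (GenE i)) (\<lambda>i. g (GenF i)) (\<lambda>h. g (GenQ h))"
    by (rule iffD1[OF family_cong(3) fam]) (simp_all add: g_def U_t_def U_t_inv_def U.uminus_eq_scalar)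
  note lift = U_lift[OF O this]
  show "U_antipode K \<in> alg_hom U (opposite_algebra U)" unfolding eq by (rule lift)
  show "i \<in> I \<Longrightarrow> U_antipode K (eU i) = \<ominus>\<^bsub>U\<^esub> (qU (- t i) \<otimes>\<^bsub>U\<^esub> eU i)"
    "i \<in> I \<Longrightarrow> U_antipode K (fU i) = \<ominus>\<^bsub>U\<^esub> (fU i \<otimes>\<^bsub>U\<^esub> qU (t i))"
    "h \<in> P \<Longrightarrow> U_antipode K (qU h) = qU (- h)"
    unfolding eq by (simp_all add: lift(2) generators_def) (simp_all add: g_def U_t_def U_t_inv_def)
qed

lemma counit_properties:
  shows U_counit_hom: "U_counit K \<in> alg_hom U (ground_algebra :: (laurent, laurent) module)"
    and "i \<in> I \<Longrightarrow> U_counit K (eU i) = 0"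
    and "i \<in> I \<Longrightarrow> U_counit K (fU i) = 0"
    and "h \<in> P \<Longrightarrow> U_counit K (qU h) = 1"
proof -
  let ?G = "ground_algebra :: (laurent, laurent) module"
  interpret G: assoc_algebra ?G by (rule ground_algebra_assoc)
  define g where "g = (\<lambda>x :: ('i, 't) gen. case x of GenE i \<Rightarrow> 0 | GenF i \<Rightarrow> 0 | GenQ h \<Rightarrow> (1 :: laurent))"
  have eq: "U_counit K = presented_lift ?G g" by (simp add: U_counit_def g_def)
  have z: "q_ad ?G v a 0 0 m = 0" for v a m using G.q_ad_zero[of 0 v a m] by simp
  have "serre_family K ?G (\<lambda>i. 0)"
    unfolding serre_family_def
    using serre_element_eq_0_iff[OF ground_algebra_assoc q_index_generic, of _ 0 0] by (simp add: z)
  moreover have "x \<ominus>\<^bsub>?G\<^esub> x = 0" for x by (simp add: G.minus_eq_scalar)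
  ultimately have "U_family K ?G (\<lambda>i. g (GenE i)) (\<lambda>i. g (GenF i)) (\<lambda>h. g (GenQ h))"
    by (simp add: g_def U_family_def q_family_def torus_family_def weight_family_def)
  note lift = U_lift[OF ground_algebra_assoc this]
  show "U_counit K \<in> alg_hom U ?G" unfolding eq by (rule lift)
  show "i \<in> I \<Longrightarrow> U_counit K (eU i) = 0"
    "i \<in> I \<Longrightarrow> U_counit K (fU i) = 0"
    "h \<in> P \<Longrightarrow> U_counit K (qU h) = 1"
    unfolding eq by (simp_all add: lift(2) generators_def) (simp_all add: g_def)
qed

lemma U_hopf_algebra: "hopf_algebra U (U_comult K) (U_counit K) (U_antipode K)"
proof -
  interpret UU: algebra_pair U U by (rule algebra_pairI[OF U_algebra U_algebra])
  interpret L: algebra_pair "UU" U by (rule algebra_pairI[OF UU.tensor_assoc_algebra U_algebra])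
  interpret R: algebra_pair U "UU" by (rule algebra_pairI[OF U_algebra UU.tensor_assoc_algebra])
  note \<Delta> = comult_properties and \<epsilon> = counit_properties and S = antipode_properties
  note hD = alg_homD[OF \<Delta>(1)] alg_homD[OF \<epsilon>(1), simplified] alg_homD[OF S(1), simplified]
  note m1 = tensor_map_hom[OF U_algebra U_algebra UU.tensor_assoc_algebra U_algebra \<Delta>(1) alg_hom_id']
  note m2 = tensor_map_hom[OF U_algebra U_algebra U_algebra UU.tensor_assoc_algebra alg_hom_id' \<Delta>(1)]
  note as = tensor_assoc_hom[OF U_algebra U_algebra U_algebra]
  note coas = alg_homD[OF m1(1)] m1(2) alg_homD[OF m2(1)] m2(2) alg_homD[OF as(1)] as(2)
  note cu = counit_bilinear[OF U_algebra U_algebra \<epsilon>(1)]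
  note an1 = tensor_lift_anti_hom(1)[OF U_algebra U_algebra U_algebra S(1) alg_hom_id]
  note an2 = tensor_lift_hom_anti(1)[OF U_algebra U_algebra U_algebra S(1) alg_hom_id]
  note cus = alg_homD[OF cu(1)] alg_homD[OF cu(3)] cu(2,4)
  note ans = linear_mapsD[OF UU.tensor_lift_linear[OF U_algebra an1]] UU.tensor_lift_tens[OF U_algebra an1]
    linear_mapsD[OF UU.tensor_lift_linear[OF U_algebra an2]] UU.tensor_lift_tens[OF U_algebra an2]
  show ?thesis
  proof (rule hopf_algebra_generatedI[OF U_algebra U_generates \<Delta>(1) \<epsilon>(1) S(1)])
    fix h assume "h \<in> U_gen K ` generators K"
    then obtain x where x: "x \<in> generators K" "h = U_gen K x" by blast
    show "tensor_assoc U U U (tensor_map UU U (U_comult K) id (U_comult K h)) =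
        tensor_map U UU id (U_comult K) (U_comult K h)"
      using x(1) by (cases rule: generator_cases)
        (simp_all add: x(2) \<Delta>(2-4) coas hD UU.tens_one L.tens_add_left R.tens_add_right R.T.a_assoc)
    show "tensor_lift U (\<lambda>a b. U_counit K a \<odot>\<^bsub>U\<^esub> b) (U_comult K h) = h"
      using x(1) by (cases rule: generator_cases) (simp_all add: x(2) \<Delta>(2-4) \<epsilon>(2-4) cus hD)
    show "tensor_lift U (\<lambda>a b. U_counit K b \<odot>\<^bsub>U\<^esub> a) (U_comult K h) = h"
      using x(1) by (cases rule: generator_cases) (simp_all add: x(2) \<Delta>(2-4) \<epsilon>(2-4) cus hD)
    show "tensor_lift U (\<lambda>a b. U_antipode K a \<otimes>\<^bsub>U\<^esub> b) (U_comult K h) = U_counit K h \<odot>\<^bsub>U\<^esub> \<one>\<^bsub>U\<^esub>"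
      using x(1) by (cases rule: generator_cases)
        (simp_all add: x(2) \<Delta>(2-4) \<epsilon>(2-4) S(2-4) ans hD U.l_minus U.l_neg U.m_assoc)
    show "tensor_lift U (\<lambda>a b. a \<otimes>\<^bsub>U\<^esub> U_antipode K b) (U_comult K h) = U_counit K h \<odot>\<^bsub>U\<^esub> \<one>\<^bsub>U\<^esub>"
      using x(1) by (cases rule: generator_cases)
        (simp_all add: x(2) \<Delta>(2-4) \<epsilon>(2-4) S(2-4) ans hD U.r_minus U.r_neg U.m_assoc)
  qed
qed

lemma B_comodule_algebra:
  "comodule_algebra U (U_comult K) (U_counit K) (U_antipode K) B (B_coaction K)"
proof -
  interpret UU: algebra_pair U U by (rule algebra_pairI[OF U_algebra U_algebra])
  interpret BU: algebra_pair B U by (rule algebra_pairI[OF B_algebra U_algebra])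
  interpret L: algebra_pair "BU" U by (rule algebra_pairI[OF BU.tensor_assoc_algebra U_algebra])
  interpret R: algebra_pair B "UU" by (rule algebra_pairI[OF B_algebra UU.tensor_assoc_algebra])
  note \<Delta> = comult_properties and \<epsilon> = counit_properties and \<beta> = coaction_properties(1,3-5)
  note hD = alg_homD[OF \<Delta>(1)] alg_homD[OF \<epsilon>(1), simplified] alg_homD[OF \<beta>(1)]
  note m1 = tensor_map_hom[OF B_algebra U_algebra BU.tensor_assoc_algebra U_algebra \<beta>(1) alg_hom_id']
  note m2 = tensor_map_hom[OF B_algebra U_algebra B_algebra UU.tensor_assoc_algebra alg_hom_id' \<Delta>(1)]
  note as = tensor_assoc_hom[OF B_algebra U_algebra U_algebra]
  note coas = alg_homD[OF m1(1)] m1(2) alg_homD[OF m2(1)] m2(2) alg_homD[OF as(1)] as(2)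
  note cu = counit_bilinear[OF B_algebra U_algebra \<epsilon>(1)]
  note cus = alg_homD[OF cu(1)] cu(2)
  show ?thesis
  proof (rule comodule_algebra_generatedI[OF U_hopf_algebra B_algebra B_generates \<beta>(1)])
    fix h assume "h \<in> B_gen K ` generators K"
    then obtain x where x: "x \<in> generators K" "h = B_gen K x" by blast
    show "tensor_assoc B U U (tensor_map BU U (B_coaction K) id (B_coaction K h)) =
        tensor_map B UU id (U_comult K) (B_coaction K h)"
      using x(1) by (cases rule: generator_cases)
        (simp_all add: x(2) \<Delta>(2-4) \<beta>(2-4) coas hD UU.tens_one BU.tens_one UU.T.r_distr UU.tens_mult
           L.tens_add_left L.tens_smult_left R.tens_add_right R.T.scalar_add_right R.T.a_ac)
    show "tensor_lift B (\<lambda>y h. U_counit K h \<odot>\<^bsub>B\<^esub> y) (B_coaction K h) = h"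
      using x(1) by (cases rule: generator_cases) (simp_all add: x(2) \<beta>(2-4) \<epsilon>(2-4) cus hD)
  qed
qed

text \<open>
  The formulas come from solving for \<open>can\<^sup>-\<^sup>1\<close>.  For instance \<open>\<beta>(f\<^sub>i) = f\<^sub>i \<otimes> t\<^sub>i\<^sup>-\<^sup>1 + 1 \<otimes> f\<^sub>i\<close> is the image of \<open>1 \<otimes> f\<^sub>i\<close> under
  \<open>can\<close>, and \<open>f\<^sub>i \<otimes> t\<^sub>i\<^sup>-\<^sup>1\<close> that of \<open>f\<^sub>i t\<^sub>i \<otimes> t\<^sub>i\<^sup>-\<^sup>1\<close>.
\<close>

definition B_translation where
  "B_translation = presented_lift OB (\<lambda>x. case x of
      GenE i \<Rightarrow> inverse (c i) \<odot>\<^bsub>OB\<^esub>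
            pure_tensor (opposite_algebra B) B (qB (- t i)) (qB (t i) \<otimes>\<^bsub>B\<^esub> eB i)
          \<oplus>\<^bsub>OB\<^esub> (- inverse (c i)) \<odot>\<^bsub>OB\<^esub>
            pure_tensor (opposite_algebra B) B (eB i) \<one>\<^bsub>B\<^esub>
    | GenF i \<Rightarrow> pure_tensor (opposite_algebra B) B \<one>\<^bsub>B\<^esub> (fB i)
          \<oplus>\<^bsub>OB\<^esub> (- 1) \<odot>\<^bsub>OB\<^esub>
            pure_tensor (opposite_algebra B) B (fB i \<otimes>\<^bsub>B\<^esub> qB (t i)) (qB (- t i))
    | GenQ h \<Rightarrow> pure_tensor (opposite_algebra B) B (qB (- h)) (qB h))"

lemma translation_properties:
  defines "Bo \<equiv> opposite_algebra B"
  shows "B_translation \<in> alg_hom U (tensor_algebra Bo B)"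
    and "i \<in> I \<Longrightarrow> B_translation (eU i) =
      inverse (c i) \<odot>\<^bsub>tensor_algebra Bo B\<^esub> pure_tensor Bo B (qB (- t i)) (qB (t i) \<otimes>\<^bsub>B\<^esub> eB i)
          \<oplus>\<^bsub>tensor_algebra Bo B\<^esub> (- inverse (c i)) \<odot>\<^bsub>tensor_algebra Bo B\<^esub> pure_tensor Bo B (eB i) \<one>\<^bsub>B\<^esub>"
    and "i \<in> I \<Longrightarrow> B_translation (fU i) = pure_tensor Bo B \<one>\<^bsub>B\<^esub> (fB i)
          \<oplus>\<^bsub>tensor_algebra Bo B\<^esub> (- 1) \<odot>\<^bsub>tensor_algebra Bo B\<^esub> pure_tensor Bo B (fB i \<otimes>\<^bsub>B\<^esub> qB (t i)) (qB (- t i))"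
    and "h \<in> P \<Longrightarrow> B_translation (qU h) = pure_tensor Bo B (qB (- h)) (qB h)"
proof -
  note OA = opposite_assoc_algebra[OF B_algebra, folded Bo_def]
  have [simp]: "carrier Bo = carrier B" "\<one>\<^bsub>Bo\<^esub> = \<one>\<^bsub>B\<^esub>" "x \<otimes>\<^bsub>Bo\<^esub> y = y \<otimes>\<^bsub>B\<^esub> x" for x y by (simp_all add: Bo_def)
  interpret OB: algebra_pair Bo B by (rule algebra_pairI[OF OA B_algebra])
  interpret C: commuting_families K "tensor_algebra Bo B" "\<lambda>i. pure_tensor Bo B (eB i) \<one>\<^bsub>B\<^esub>" "\<lambda>i. pure_tensor Bo B (fB i) \<one>\<^bsub>B\<^esub>"
     "\<lambda>h. pure_tensor Bo B (qB (- h)) \<one>\<^bsub>B\<^esub>" "\<lambda>i. pure_tensor Bo B \<one>\<^bsub>Bo\<^esub> (eB i)" "\<lambda>i. pure_tensor Bo B \<one>\<^bsub>Bo\<^esub> (fB i)"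
     "\<lambda>h. pure_tensor Bo B \<one>\<^bsub>Bo\<^esub> (qB h)"
    by (rule tensor_commuting_families[OF OA B_algebra
          B.q_family_opposite[OF B.B_familyD[OF B_gen_family], folded Bo_def] B.B_familyD[OF B_gen_family]])
  define g where "g = (\<lambda>x. case x of
      GenE i \<Rightarrow> inverse (c i) \<odot>\<^bsub>tensor_algebra Bo B\<^esub> pure_tensor Bo B (qB (- t i)) (qB (t i) \<otimes>\<^bsub>B\<^esub> eB i)
          \<oplus>\<^bsub>tensor_algebra Bo B\<^esub> (- inverse (c i)) \<odot>\<^bsub>tensor_algebra Bo B\<^esub> pure_tensor Bo B (eB i) \<one>\<^bsub>B\<^esub>
    | GenF i \<Rightarrow> pure_tensor Bo B \<one>\<^bsub>B\<^esub> (fB i)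
          \<oplus>\<^bsub>tensor_algebra Bo B\<^esub> (- 1) \<odot>\<^bsub>tensor_algebra Bo B\<^esub> pure_tensor Bo B (fB i \<otimes>\<^bsub>B\<^esub> qB (t i)) (qB (- t i))
    | GenQ h \<Rightarrow> pure_tensor Bo B (qB (- h)) (qB h))"
  have eq: "B_translation = presented_lift (tensor_algebra Bo B) g"
    unfolding B_translation_def g_def Bo_def by (rule refl)
  have rel: "pure_tensor Bo B (fB j) \<one>\<^bsub>B\<^esub> \<otimes>\<^bsub>tensor_algebra Bo B\<^esub> pure_tensor Bo B (eB i) \<one>\<^bsub>B\<^esub> =
      q_param powi root_pairing K i j \<odot>\<^bsub>tensor_algebra Bo B\<^esub>
        (pure_tensor Bo B (eB i) \<one>\<^bsub>B\<^esub> \<otimes>\<^bsub>tensor_algebra Bo B\<^esub> pure_tensor Bo B (fB j) \<one>\<^bsub>B\<^esub>)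
      \<oplus>\<^bsub>tensor_algebra Bo B\<^esub> (if i = j then \<one>\<^bsub>tensor_algebra Bo B\<^esub> else \<zero>\<^bsub>tensor_algebra Bo B\<^esub>)"
    if ij: "i \<in> I" "j \<in> I" for i j
  proof -
    let ?f = "\<lambda>a. pure_tensor Bo B a \<one>\<^bsub>B\<^esub>"
    note f = alg_homD[OF tensor_embeddings(1)[OF OA B_algebra]]
    have "eB i \<otimes>\<^bsub>B\<^esub> fB j = q_param powi root_pairing K i j \<odot>\<^bsub>B\<^esub> (fB j \<otimes>\<^bsub>B\<^esub> eB i) \<oplus>\<^bsub>B\<^esub> (if i = j then \<one>\<^bsub>B\<^esub> else \<zero>\<^bsub>B\<^esub>)"
      using B_gen_family ij by (simp add: B_family_def)
    then have "fB j \<otimes>\<^bsub>Bo\<^esub> eB i = q_param powi root_pairing K i j \<odot>\<^bsub>Bo\<^esub> (eB i \<otimes>\<^bsub>Bo\<^esub> fB j) \<oplus>\<^bsub>Bo\<^esub> (if i = j then \<one>\<^bsub>Bo\<^esub> else \<zero>\<^bsub>Bo\<^esub>)"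
      by (simp add: Bo_def)
    then have "?f (fB j \<otimes>\<^bsub>Bo\<^esub> eB i) = ?f (q_param powi root_pairing K i j \<odot>\<^bsub>Bo\<^esub> (eB i \<otimes>\<^bsub>Bo\<^esub> fB j) \<oplus>\<^bsub>Bo\<^esub> (if i = j then \<one>\<^bsub>Bo\<^esub> else \<zero>\<^bsub>Bo\<^esub>))"
      by (rule arg_cong)
    moreover have "fB j \<in> carrier Bo" "eB i \<in> carrier Bo" "eB i \<otimes>\<^bsub>Bo\<^esub> fB j \<in> carrier Bo"
      "(if i = j then \<one>\<^bsub>Bo\<^esub> else \<zero>\<^bsub>Bo\<^esub>) \<in> carrier Bo" "q_param powi root_pairing K i j \<odot>\<^bsub>Bo\<^esub> (eB i \<otimes>\<^bsub>Bo\<^esub> fB j) \<in> carrier Bo"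
      using ij OB.A.scalar_closed OB.A.m_closed[of "eB i" "fB j"] OB.A.zero_closed by auto
    ultimately have "?f (fB j) \<otimes>\<^bsub>tensor_algebra Bo B\<^esub> ?f (eB i) =
       q_param powi root_pairing K i j \<odot>\<^bsub>tensor_algebra Bo B\<^esub> (?f (eB i) \<otimes>\<^bsub>tensor_algebra Bo B\<^esub> ?f (fB j))
       \<oplus>\<^bsub>tensor_algebra Bo B\<^esub> ?f (if i = j then \<one>\<^bsub>Bo\<^esub> else \<zero>\<^bsub>Bo\<^esub>)"
      by (simp only: f)
    moreover have "?f (if i = j then \<one>\<^bsub>Bo\<^esub> else \<zero>\<^bsub>Bo\<^esub>) = (if i = j then \<one>\<^bsub>tensor_algebra Bo B\<^esub> else \<zero>\<^bsub>tensor_algebra Bo B\<^esub>)"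
      using f(5) linear_maps_zero[OF alg_hom_linear[OF tensor_embeddings(1)[OF OA B_algebra]] OA OB.tensor_assoc_algebra]
      by simp
    ultimately show ?thesis by simp
  qed
  have fam: "U_family K (tensor_algebra Bo B) C.E_trans C.F_trans
     (\<lambda>h. pure_tensor Bo B (qB (- h)) \<one>\<^bsub>B\<^esub> \<otimes>\<^bsub>tensor_algebra Bo B\<^esub> pure_tensor Bo B \<one>\<^bsub>Bo\<^esub> (qB h))"
    by (rule C.trans_family[OF rel B_family_hom[OF tensor_embeddings(2)[OF OA B_algebra] B_gen_family B_algebra
       OB.tensor_assoc_algebra symmetrizable_kac_moody_axioms]])
  have "U_family K (tensor_algebra Bo B) (\<lambda>i. g (GenE i)) (\<lambda>i. g (GenF i)) (\<lambda>h. g (GenQ h))"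
    by (rule iffD1[OF family_cong(3) fam]; (unfold C.E_trans_def C.F_trans_def)?)
      (simp_all add: g_def OB.tens_mult)
  note lift = U_lift[OF OB.tensor_assoc_algebra this]
  show "B_translation \<in> alg_hom U (tensor_algebra Bo B)" unfolding eq by (rule lift)
  show "i \<in> I \<Longrightarrow> B_translation (eU i) =
      inverse (c i) \<odot>\<^bsub>tensor_algebra Bo B\<^esub> pure_tensor Bo B (qB (- t i)) (qB (t i) \<otimes>\<^bsub>B\<^esub> eB i)
          \<oplus>\<^bsub>tensor_algebra Bo B\<^esub> (- inverse (c i)) \<odot>\<^bsub>tensor_algebra Bo B\<^esub> pure_tensor Bo B (eB i) \<one>\<^bsub>B\<^esub>"
    "i \<in> I \<Longrightarrow> B_translation (fU i) = pure_tensor Bo B \<one>\<^bsub>B\<^esub> (fB i)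
          \<oplus>\<^bsub>tensor_algebra Bo B\<^esub> (- 1) \<odot>\<^bsub>tensor_algebra Bo B\<^esub> pure_tensor Bo B (fB i \<otimes>\<^bsub>B\<^esub> qB (t i)) (qB (- t i))"
    "h \<in> P \<Longrightarrow> B_translation (qU h) = pure_tensor Bo B (qB (- h)) (qB h)"
    unfolding eq by (simp_all add: lift(2) generators_def) (simp_all add: g_def)
qed

text \<open>
  On \<open>e\<^sub>i\<close> and \<open>f\<^sub>i\<close> both identities hold because the two terms other than the desired one cancel.
\<close>

lemma B_hopf_galois:
  assumes \<phi>: "\<phi> \<in> linear_maps B (ground_algebra :: (laurent, laurent) module)" "\<phi> \<one>\<^bsub>B\<^esub> = 1"
  shows "hopf_galois_extension U (U_comult K) (U_counit K) (U_antipode K) B (B_coaction K)"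
proof -
  interpret T: translation_map U "U_comult K" "U_counit K" "U_antipode K" B "B_coaction K" B_translation
    by (intro translation_map.intro translation_map_axioms.intro B_comodule_algebra translation_properties)
  note \<beta> = coaction_properties(3-5) and \<tau> = translation_properties(2-4)
  have cancel: "r \<odot>\<^bsub>N\<^esub> x \<oplus>\<^bsub>N\<^esub> s \<odot>\<^bsub>N\<^esub> x = \<zero>\<^bsub>N\<^esub>" if "assoc_algebra N" "x \<in> carrier N" "r + s = 0" for N :: "(laurent, 'n) module" and r s x
  proof -
    interpret N: assoc_algebra N by fact
    show ?thesis using N.scalar_add_left[of x r s] that by simp
  qed
  show ?thesis
  proof (rule T.hopf_galois_extensionI[OF U_generates _ B_generates _ \<phi>])
    fix h assume "h \<in> U_gen K ` generators K"
    then obtain x where x: "x \<in> generators K" "h = U_gen K x" by blast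
    show "T.can_op (B_translation h) = pure_tensor B U \<one>\<^bsub>B\<^esub> h"
      using x(1)
    proof (cases rule: generator_cases)
      case (1 i)
      have "T.can_op (B_translation h) = (inverse (c i) * c i) \<odot>\<^bsub>T.TH\<^esub> pure_tensor B U \<one>\<^bsub>B\<^esub> (eU i) \<oplus>\<^bsub>T.TH\<^esub>
          (inverse (c i) \<odot>\<^bsub>T.TH\<^esub> pure_tensor B U (eB i) \<one>\<^bsub>U\<^esub> \<oplus>\<^bsub>T.TH\<^esub>
           (- inverse (c i)) \<odot>\<^bsub>T.TH\<^esub> pure_tensor B U (eB i) \<one>\<^bsub>U\<^esub>)"
        using 1 by (simp add: x(2) \<tau> T.can_opD T.can_op_tens T.\<beta>D \<beta> T.TH.T.r_distr T.TH.tens_mult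
            T.TH.T.smult_mult_right T.TH.T.scalar_add_right T.TH.T.scalar_scalar T.TH.T.a_assoc T.TH.tens_one)
      then show ?thesis using 1 by (simp add: x(2) cancel[OF T.TH.tensor_assoc_algebra])
    next
      case (2 i)
      have "T.can_op (B_translation h) = pure_tensor B U \<one>\<^bsub>B\<^esub> (fU i) \<oplus>\<^bsub>T.TH\<^esub>
          (1 \<odot>\<^bsub>T.TH\<^esub> pure_tensor B U (fB i) (qU (- t i)) \<oplus>\<^bsub>T.TH\<^esub> (- 1) \<odot>\<^bsub>T.TH\<^esub> pure_tensor B U (fB i) (qU (- t i)))"
        using 2 by (simp add: x(2) \<tau> T.can_opD T.can_op_tens T.\<beta>D \<beta> T.TH.T.r_distr T.TH.tens_mult
            B.m_assoc T.TH.T.a_ac)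
      then show ?thesis using 2 cancel[OF T.TH.tensor_assoc_algebra, of "pure_tensor B U (fB i) (qU (- t i))" 1 "- 1"]
        by (simp add: x(2))
    next
      case (3 h')
      then show ?thesis by (simp add: x(2) \<tau> T.can_op_tens \<beta> T.TH.tens_mult)
    qed
  next
    fix y assume "y \<in> B_gen K ` generators K"
    then obtain x where x: "x \<in> generators K" "y = B_gen K x" by blast
    show "T.can_inv (B_coaction K y) = pure_tensor B B \<one>\<^bsub>B\<^esub> y"
      using x(1)
    proof (cases rule: generator_cases)
      case (1 i)
      have "T.can_inv (B_coaction K y) = (c i * inverse (c i)) \<odot>\<^bsub>T.TT\<^esub> pure_tensor B B \<one>\<^bsub>B\<^esub> (eB i) \<oplus>\<^bsub>T.TT\<^esub>
         ((- (c i * inverse (c i))) \<odot>\<^bsub>T.TT\<^esub> pure_tensor B B (eB i \<otimes>\<^bsub>B\<^esub> qB (t i)) (qB (- t i)) \<oplus>\<^bsub>T.TT\<^esub>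
           1 \<odot>\<^bsub>T.TT\<^esub> pure_tensor B B (eB i \<otimes>\<^bsub>B\<^esub> qB (t i)) (qB (- t i)))"
        using 1 by (simp add: x(2) \<beta> T.can_invD T.can_inv_tens T.\<tau>D \<tau> T.OTT.T.r_distr T.OTT.T.smult_mult_right
            T.OTT.tens_mult T.actD T.act_tens T.TT.T.scalar_add_right T.TT.T.scalar_scalar T.TT.T.a_assoc)
      then show ?thesis using 1
        cancel[OF T.TT.tensor_assoc_algebra, of "pure_tensor B B (eB i \<otimes>\<^bsub>B\<^esub> qB (t i)) (qB (- t i))" "- 1" 1] by (simp add: x(2))
    next
      case (2 i)
      have "T.can_inv (B_coaction K y) = pure_tensor B B \<one>\<^bsub>B\<^esub> (fB i) \<oplus>\<^bsub>T.TT\<^esub>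
         (1 \<odot>\<^bsub>T.TT\<^esub> pure_tensor B B (fB i \<otimes>\<^bsub>B\<^esub> qB (t i)) (qB (- t i)) \<oplus>\<^bsub>T.TT\<^esub>
          (- 1) \<odot>\<^bsub>T.TT\<^esub> pure_tensor B B (fB i \<otimes>\<^bsub>B\<^esub> qB (t i)) (qB (- t i)))"
        using 2 by (simp add: x(2) \<beta> T.can_invD T.can_inv_tens T.\<tau>D \<tau> T.actD T.act_tens T.TT.T.a_ac)
      then show ?thesis using 2
        cancel[OF T.TT.tensor_assoc_algebra, of "pure_tensor B B (fB i \<otimes>\<^bsub>B\<^esub> qB (t i)) (qB (- t i))" 1 "- 1"] by (simp add: x(2))
    next
      case (3 h')
      then show ?thesis by (simp add: x(2) \<beta> T.can_inv_tens \<tau> T.act_tens)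
    qed
  qed
qed

end

section \<open>Nontriviality of the Kashiwara algebra\<close>

abbreviation scale :: "'k::field \<Rightarrow> ('x \<Rightarrow>\<^sub>0 'k) \<Rightarrow> 'x \<Rightarrow>\<^sub>0 'k" where
  "scale r \<equiv> Poly_Mapping.map ((*) r)"

lemma scale_simps:
  "scale r (scale s p) = scale (r * s) p" "scale 1 p = p" "scale 0 p = 0"
  "scale (r + s) p = scale r p + scale s p" "scale (- 1) p = - p"
  by (rule poly_mapping_eqI; simp add: lookup_map_times lookup_add algebra_simps)+

lemma map_trivial [simp]:
  "Poly_Mapping.map (\<lambda>a. 0) p = (0 :: 'x \<Rightarrow>\<^sub>0 'k::field)" "Poly_Mapping.map (\<lambda>a. a) p = (p :: 'x \<Rightarrow>\<^sub>0 'k)"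
  by (rule poly_mapping_eqI; simp add: Poly_Mapping.map.rep_eq when_def)+

definition linear_op :: "(('x \<Rightarrow>\<^sub>0 'k::field) \<Rightarrow> ('x \<Rightarrow>\<^sub>0 'k)) \<Rightarrow> bool" where
  "linear_op f \<longleftrightarrow> (\<forall>p q. f (p + q) = f p + f q) \<and> (\<forall>r p. f (scale r p) = scale r (f p))"

lemma linear_opD:
  assumes "linear_op f"
  shows "f (p + q) = f p + f q" "f (scale r p) = scale r (f p)" "f 0 = 0"
proof -
  show 1: "f (p + q) = f p + f q" "f (scale r p) = scale r (f p)" for p q r
    using assms by (auto simp: linear_op_def)
  show "f 0 = 0" using 1(1)[of 0 0] by simp
qed

definition extend_linear :: "('x \<Rightarrow> 'y \<Rightarrow>\<^sub>0 'k::field) \<Rightarrow> ('x \<Rightarrow>\<^sub>0 'k) \<Rightarrow> 'y \<Rightarrow>\<^sub>0 'k" where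
  "extend_linear \<phi> p = (\<Sum>w\<in>Poly_Mapping.keys p. scale (Poly_Mapping.lookup p w) (\<phi> w))"

lemma extend_linear_single [simp]: "extend_linear \<phi> (Poly_Mapping.single w r) = scale r (\<phi> w)"
  by (simp add: extend_linear_def scale_simps)

lemma extend_linear_linear: "linear_op (extend_linear \<phi>)"
  unfolding linear_op_def
proof (intro conjI allI)
  fix p q :: "'a \<Rightarrow>\<^sub>0 'b"
  show "extend_linear \<phi> (p + q) = extend_linear \<phi> p + extend_linear \<phi> q"
    unfolding extend_linear_def by (rule setsum_keys_plus_distrib) (simp_all add: scale_simps)
  fix r :: 'b
  show "extend_linear \<phi> (scale r p) = scale r (extend_linear \<phi> p)"
  proof (cases "r = 0")
    case True
    then show ?thesis by (simp add: extend_linear_def scale_simps)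
  next
    case False
    have "Poly_Mapping.keys (scale r p) = Poly_Mapping.keys p"
      using False by (auto simp: in_keys_iff lookup_map_times)
    moreover have "scale r (\<Sum>w\<in>X. g w) = (\<Sum>w\<in>X. scale r (g w))" for X and g :: "'a \<Rightarrow> 'a \<Rightarrow>\<^sub>0 'b"
      by (induction X rule: infinite_finite_induct) (simp_all add: map_times_add)
    ultimately show ?thesis by (simp add: extend_linear_def scale_simps lookup_map_times)
  qed
qed

lemma linear_op_eqI:
  fixes f g :: "('x \<Rightarrow>\<^sub>0 'k::field) \<Rightarrow> ('x \<Rightarrow>\<^sub>0 'k)"
  assumes "linear_op f" "linear_op g" "\<And>w. f (Poly_Mapping.single w 1) = g (Poly_Mapping.single w 1)"
  shows "f = g"
proof
  fix p :: "'x \<Rightarrow>\<^sub>0 'k"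
  let ?M = "\<lparr>carrier = UNIV, monoid.mult = (\<lambda>x y. x), one = undefined\<rparr>"
  have "p \<in> carrier (monoid_algebra ?M)" by (simp add: monoid_algebra_carrier)
  then show "f p = g p"
  proof (induction p rule: monoid_algebra_induct)
    case (single w c)
    have "Poly_Mapping.single w c = scale c (Poly_Mapping.single w 1)" by (simp add: map_times_single)
    then show ?case using assms by (simp only: linear_opD)
  qed (simp_all add: linear_opD[OF assms(1)] linear_opD[OF assms(2)])
qed

text \<open>
  The operators preserving a subspace \<open>J\<close>.  Dividing by the ideal of operators with image in \<open>J\<close> gives the algebra of
  operators that they induce on the quotient by \<open>J\<close>, without introducing the quotient space.
\<close>

definition stable_operators :: "('x \<Rightarrow>\<^sub>0 'k) set \<Rightarrow> ('k::field, ('x \<Rightarrow>\<^sub>0 'k) \<Rightarrow> ('x \<Rightarrow>\<^sub>0 'k)) module" where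
  "stable_operators J = \<lparr>carrier = {f. linear_op f \<and> (\<forall>x\<in>J. f x \<in> J)}, monoid.mult = (\<lambda>f g x. f (g x)), one = (\<lambda>x. x),
     ring.zero = (\<lambda>x. 0), add = (\<lambda>f g x. f x + g x), module.smult = (\<lambda>r f x. scale r (f x))\<rparr>"

lemma stable_operators_simps:
  "f \<in> carrier (stable_operators J) \<longleftrightarrow> linear_op f \<and> (\<forall>x\<in>J. f x \<in> J)"
  "f \<otimes>\<^bsub>stable_operators J\<^esub> g = (\<lambda>x. f (g x))" "\<one>\<^bsub>stable_operators J\<^esub> = (\<lambda>x. x)" "\<zero>\<^bsub>stable_operators J\<^esub> = (\<lambda>x. 0)"
  "f \<oplus>\<^bsub>stable_operators J\<^esub> g = (\<lambda>x. f x + g x)" "r \<odot>\<^bsub>stable_operators J\<^esub> f = (\<lambda>x. scale r (f x))"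
  by (simp_all add: stable_operators_def)

definition subspace_of :: "('x \<Rightarrow>\<^sub>0 'k::field) set \<Rightarrow> bool" where
  "subspace_of J \<longleftrightarrow> 0 \<in> J \<and> (\<forall>x\<in>J. \<forall>y\<in>J. x + y \<in> J) \<and> (\<forall>r. \<forall>x\<in>J. scale r x \<in> J)"

lemma linear_op_simps:
  "linear_op (\<lambda>x. x)" "linear_op (\<lambda>x. 0)"
  "linear_op f \<Longrightarrow> linear_op g \<Longrightarrow> linear_op (\<lambda>x. f (g x))"
  "linear_op f \<Longrightarrow> linear_op g \<Longrightarrow> linear_op (\<lambda>x. f x + g x)"
  "linear_op f \<Longrightarrow> linear_op (\<lambda>x. scale r (f x))"
  by (auto simp: linear_op_def map_times_add scale_simps algebra_simps)

lemma stable_operators_algebra: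
  fixes J :: "('x \<Rightarrow>\<^sub>0 'k::field) set"
  assumes J: "subspace_of J"
  shows "assoc_algebra (stable_operators J)"
proof -
  let ?N = "stable_operators J"
  note S = stable_operators_simps
  have "abelian_group ?N"
  proof (rule abelian_groupI)
    fix f assume "f \<in> carrier ?N"
    then have "(\<lambda>x. scale (- 1) (f x)) \<in> carrier ?N" using J by (simp add: S linear_op_simps subspace_of_def)
    then show "\<exists>g\<in>carrier ?N. g \<oplus>\<^bsub>?N\<^esub> f = \<zero>\<^bsub>?N\<^esub>"
      by (rule bexI[rotated]) (simp add: S scale_simps)
  qed (use J in \<open>auto simp: S linear_op_simps subspace_of_def fun_eq_iff algebra_simps\<close>)
  then have "ring ?N"
    by (intro ringI monoidI) (auto simp: S linear_op_simps linear_opD)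
  then show ?thesis
    by (rule assoc_algebraI)
      (use J in \<open>auto simp: S linear_op_simps subspace_of_def fun_eq_iff scale_simps map_times_add linear_opD\<close>)
qed

lemma q_ad_stable_operators: "q_ad (stable_operators J) v a x u l = q_ad (stable_operators J') v a x u l"
  by (induction l) (simp_all add: stable_operators_simps)

context symmetrizable_kac_moody
begin

text \<open>
  Words have letters in the whole type \<open>'i\<close>.  Letters outside \<open>I\<close> count as \<open>0\<close>, since \<open>weight\<close> is additive in \<open>h\<close>
  only on simple roots.
\<close>

definition word_weight :: "'t \<Rightarrow> 'i list \<Rightarrow> int" where
  "word_weight h w = (\<Sum>j\<leftarrow>w. if j \<in> I then weight K h j else 0)"

definition creation :: "'i \<Rightarrow> ('i list \<Rightarrow>\<^sub>0 laurent) \<Rightarrow> 'i list \<Rightarrow>\<^sub>0 laurent" where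
  "creation i = extend_linear (\<lambda>w. Poly_Mapping.single (i # w) 1)"

definition torus_op :: "'t \<Rightarrow> ('i list \<Rightarrow>\<^sub>0 laurent) \<Rightarrow> 'i list \<Rightarrow>\<^sub>0 laurent" where
  "torus_op h = extend_linear (\<lambda>w. Poly_Mapping.single w (q_param powi (- word_weight h w)))"

text \<open>
  Kashiwara's \<open>q\<close>-derivation \<open>e'\<^sub>i\<close> of the free algebra, forced by \<open>e'\<^sub>i(1) = 0\<close> and the relation between \<open>e'\<^sub>i\<close> and \<open>f\<^sub>j\<close>.
\<close>

primrec skew_derivation :: "'i \<Rightarrow> 'i list \<Rightarrow> 'i list \<Rightarrow>\<^sub>0 laurent" where
  "skew_derivation i [] = 0"
| "skew_derivation i (j # w) = scale (q_param powi root_pairing K i j) (creation j (skew_derivation i w)) +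
     (if i = j then Poly_Mapping.single w 1 else 0)"

definition annihilation :: "'i \<Rightarrow> ('i list \<Rightarrow>\<^sub>0 laurent) \<Rightarrow> 'i list \<Rightarrow>\<^sub>0 laurent" where
  "annihilation i = extend_linear (skew_derivation i)"

lemma operators_linear [simp]: "linear_op (creation i)" "linear_op (torus_op h)" "linear_op (annihilation i)"
  by (simp_all add: creation_def torus_op_def annihilation_def extend_linear_linear)

lemmas op_linear = linear_opD[OF operators_linear(1)] linear_opD[OF operators_linear(2)] linear_opD[OF operators_linear(3)]

lemma op_single:
  "creation i (Poly_Mapping.single w 1) = Poly_Mapping.single (i # w) 1"
  "torus_op h (Poly_Mapping.single w r) = Poly_Mapping.single w (r * q_param powi (- word_weight h w))"
  "annihilation i (Poly_Mapping.single w 1) = skew_derivation i w"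
  by (simp_all add: creation_def torus_op_def annihilation_def scale_simps map_times_single)

lemma annihilation_creation:
  "annihilation i (creation j x) = scale (q_param powi root_pairing K i j) (creation j (annihilation i x)) +
     (if i = j then x else 0)"
proof -
  have "(\<lambda>x. annihilation i (creation j x)) =
    (\<lambda>x. scale (q_param powi root_pairing K i j) (creation j (annihilation i x)) + (if i = j then x else 0))"
    by (cases "i = j"; rule linear_op_eqI) (simp_all add: linear_op_simps op_single)
  then show ?thesis by (rule fun_cong)
qed

lemma torus_creation:
  "torus_op h (creation j x) = scale (q_param powi (- (if j \<in> I then weight K h j else 0))) (creation j (torus_op h x))"
proof -
  have "(\<lambda>x. torus_op h (creation j x)) =
    (\<lambda>x. scale (q_param powi (- (if j \<in> I then weight K h j else 0))) (creation j (torus_op h x)))"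
  proof (rule linear_op_eqI)
    fix w
    have "Poly_Mapping.single (j # w) r = scale r (creation j (Poly_Mapping.single w 1))" for r
      by (simp add: op_single map_times_single)
    moreover have "creation j (Poly_Mapping.single w r) = scale r (creation j (Poly_Mapping.single w 1))" for r
      using op_linear(2)[of j r "Poly_Mapping.single w 1"] by (simp add: map_times_single)
    ultimately show "torus_op h (creation j (Poly_Mapping.single w 1)) =
       scale (q_param powi (- (if j \<in> I then weight K h j else 0))) (creation j (torus_op h (Poly_Mapping.single w 1)))"
      by (simp add: op_single scale_simps word_weight_def powi_mult_powi map_times_single del: power_int_minus)
  qed (simp_all add: linear_op_simps)
  then show ?thesis by (rule fun_cong)
qed

lemma torus_annihilation:
  assumes i: "i \<in> I"
  shows "torus_op h (annihilation i x) = scale (q_param powi weight K h i) (annihilation i (torus_op h x))"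
proof -
  have w: "torus_op h (skew_derivation i w) = scale (q_param powi (weight K h i - word_weight h w)) (skew_derivation i w)" for w
  proof (induction w)
    case Nil
    then show ?case by (simp add: op_linear)
  next
    case (Cons j w)
    have "torus_op h (skew_derivation i (j # w)) =
      scale (q_param powi (root_pairing K i j) * q_param powi (- (if j \<in> I then weight K h j else 0)) *
         q_param powi (weight K h i - word_weight h w)) (creation j (skew_derivation i w)) +
      (if i = j then Poly_Mapping.single w (q_param powi (- word_weight h w)) else 0)"
      by (simp add: op_linear torus_creation Cons op_single scale_simps mult.assoc del: power_int_minus)
    also have "\<dots> = scale (q_param powi (weight K h i - word_weight h (j # w))) (skew_derivation i (j # w))"
      using i by (cases "i = j") (simp_all add: word_weight_def map_times_add scale_simps powi_mult_powi map_times_single algebra_simps del: power_int_minus)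
    finally show ?case .
  qed
  have "(\<lambda>x. torus_op h (annihilation i x)) = (\<lambda>x. scale (q_param powi weight K h i) (annihilation i (torus_op h x)))"
  proof (rule linear_op_eqI)
    fix v
    have "annihilation i (Poly_Mapping.single v r) = scale r (skew_derivation i v)" for r
      by (simp add: annihilation_def)
    then show "torus_op h (annihilation i (Poly_Mapping.single v 1)) =
       scale (q_param powi weight K h i) (annihilation i (torus_op h (Poly_Mapping.single v 1)))"
      by (simp add: op_single w scale_simps powi_mult_powi del: power_int_minus)
  qed (simp_all add: linear_op_simps)
  then show ?thesis by (rule fun_cong)
qed

lemma torus_op_add: "h \<in> P \<Longrightarrow> h' \<in> P \<Longrightarrow> torus_op h (torus_op h' x) = torus_op (h + h') x"
proof -
  assume h: "h \<in> P" "h' \<in> P"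
  have ww: "word_weight (h + h') w = word_weight h w + word_weight h' w" for w
    using h by (induction w) (auto simp: word_weight_def weight_add)
  have "(\<lambda>x. torus_op h (torus_op h' x)) = torus_op (h + h')"
    by (rule linear_op_eqI)
      (simp_all add: linear_op_simps op_single ww powi_mult_powi add.commute del: power_int_minus)
  then show ?thesis by (rule fun_cong)
qed

lemma torus_op_zero: "torus_op 0 x = x"
proof -
  have "weight K 0 j = 0" if "j \<in> I" for j
    using weight_add[OF lattice_zero lattice_zero that] by simp
  then have ww: "word_weight 0 w = 0" for w
    by (induction w) (auto simp: word_weight_def)
  have "torus_op 0 = (\<lambda>x. x)"
    by (rule linear_op_eqI) (simp_all add: linear_op_simps op_single ww)
  then show ?thesis by (rule fun_cong)
qed

abbreviation "ops \<equiv> stable_operators UNIV :: (laurent, ('i list \<Rightarrow>\<^sub>0 laurent) \<Rightarrow> ('i list \<Rightarrow>\<^sub>0 laurent)) module"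

lemma ops_algebra: "assoc_algebra ops"
  by (rule stable_operators_algebra) (simp add: subspace_of_def)

definition serre_op :: "'i \<Rightarrow> 'i \<Rightarrow> ('i list \<Rightarrow>\<^sub>0 laurent) \<Rightarrow> 'i list \<Rightarrow>\<^sub>0 laurent" where
  "serre_op i j = q_ad ops (q_index K i) (cartan_entry K i j) (creation i) (creation j) (nat (1 - cartan_entry K i j))"

text \<open>
  The ideal of the free algebra generated by the Serre elements.  Closure under right multiplication is built into the
  first rule, where \<open>y\<close> is arbitrary.
\<close>

inductive_set serre_ideal :: "('i list \<Rightarrow>\<^sub>0 laurent) set" where
  serre: "i \<in> I \<Longrightarrow> j \<in> I \<Longrightarrow> i \<noteq> j \<Longrightarrow> serre_op i j y \<in> serre_ideal"
| add: "x \<in> serre_ideal \<Longrightarrow> y \<in> serre_ideal \<Longrightarrow> x + y \<in> serre_ideal"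
| scale: "x \<in> serre_ideal \<Longrightarrow> scale r x \<in> serre_ideal"
| creation: "x \<in> serre_ideal \<Longrightarrow> creation k x \<in> serre_ideal"
| zero: "0 \<in> serre_ideal"

lemma ops_closed [simp]: "linear_op f \<Longrightarrow> f \<in> carrier ops"
  by (simp add: stable_operators_simps)

lemma serre_op_linear: "linear_op (serre_op i j)"
proof -
  interpret N: assoc_algebra ops by (rule ops_algebra)
  have "serre_op i j \<in> carrier ops" unfolding serre_op_def by (rule N.q_ad_closed) simp_all
  then show ?thesis by (simp add: stable_operators_simps)
qed

lemma serre_op_torus:
  assumes ij: "i \<in> I" "j \<in> I"
  shows "\<exists>s. \<forall>y. torus_op h (serre_op i j y) = scale s (serre_op i j (torus_op h y))"
proof -
  interpret N: assoc_algebra ops by (rule ops_algebra)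
  have "torus_op h \<otimes>\<^bsub>ops\<^esub> creation k = q_param powi (- weight K h k) \<odot>\<^bsub>ops\<^esub> (creation k \<otimes>\<^bsub>ops\<^esub> torus_op h)" if "k \<in> I" for k
    using that by (simp add: stable_operators_simps torus_creation del: power_int_minus)
  from N.q_ad_commute_left[OF _ _ _ this[OF ij(1)] this[OF ij(2)], of "q_index K i" "cartan_entry K i j" "nat (1 - cartan_entry K i j)"]
  have "\<exists>s. torus_op h \<otimes>\<^bsub>ops\<^esub> serre_op i j = s \<odot>\<^bsub>ops\<^esub> (serre_op i j \<otimes>\<^bsub>ops\<^esub> torus_op h)"
    by (auto simp: serre_op_def)
  then show ?thesis by (auto simp: stable_operators_simps fun_eq_iff)
qed

text \<open>
  The relation \<open>e'\<^sub>k f\<^sub>l = q\<^bsup>(\<alpha>\<^sub>k, \<alpha>\<^sub>l)\<^esup> f\<^sub>l e'\<^sub>k + \<delta>\<close> moves \<open>e'\<^sub>k\<close> from the left to the right, so the lemmas on \<open>q\<close>-derivations apply in the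
  opposite algebra; the Serre element there differs by a sign.
\<close>

lemma serre_op_annihilation:
  assumes ij: "i \<in> I" "j \<in> I" "i \<noteq> j" and k: "k \<in> I"
  shows "\<exists>s. \<forall>y. annihilation k (serre_op i j y) = scale s (serre_op i j (annihilation k y))"
proof -
  let ?O = "opposite_algebra ops"
  interpret N: assoc_algebra ops by (rule ops_algebra)
  interpret O: assoc_algebra ?O by (rule opposite_assoc_algebra[OF ops_algebra])
  let ?v = "q_index K i" and ?a = "cartan_entry K i j" and ?m = "nat (1 - cartan_entry K i j)"
  note deg = serre_degree[OF ij] and v = q_index_generic[OF ij(1)]
  have rel: "creation l \<otimes>\<^bsub>?O\<^esub> annihilation k = q_param powi root_pairing K k l \<odot>\<^bsub>?O\<^esub> (annihilation k \<otimes>\<^bsub>?O\<^esub> creation l)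
      \<oplus>\<^bsub>?O\<^esub> (if k = l then \<one>\<^bsub>?O\<^esub> else \<zero>\<^bsub>?O\<^esub>)" for l
    by (auto simp: stable_operators_simps annihilation_creation)
  have rel0: "creation l \<otimes>\<^bsub>?O\<^esub> annihilation k = q_param powi root_pairing K k l \<odot>\<^bsub>?O\<^esub> (annihilation k \<otimes>\<^bsub>?O\<^esub> creation l)"
    if "k \<noteq> l" for l
    using that by (auto simp: stable_operators_simps annihilation_creation)
  have car: "creation l \<in> carrier ?O" "annihilation l \<in> carrier ?O" for l by simp_all
  have vv: "q_param powi root_pairing K i i = ?v ^ 2" using ij by (simp add: q_index_square)
  have va: "q_param powi root_pairing K i j = ?v powi (1 - int ?m)" "q_param powi root_pairing K j i = ?v powi (1 - int ?m)"
    using ij by (simp_all only: deg(1) q_index_powi_cartan root_pairing_sym[of j i])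
  have "\<exists>s. q_ad ?O ?v (1 - int ?m) (creation i) (creation j) ?m \<otimes>\<^bsub>?O\<^esub> annihilation k =
      s \<odot>\<^bsub>?O\<^esub> (annihilation k \<otimes>\<^bsub>?O\<^esub> q_ad ?O ?v (1 - int ?m) (creation i) (creation j) ?m)"
  proof (cases "k = i")
    case True
    have x: "creation i \<otimes>\<^bsub>?O\<^esub> annihilation k = ?v ^ 2 \<odot>\<^bsub>?O\<^esub> (annihilation k \<otimes>\<^bsub>?O\<^esub> creation i) \<oplus>\<^bsub>?O\<^esub> \<one>\<^bsub>?O\<^esub>"
      using rel[of i] True vv by simp
    have u: "creation j \<otimes>\<^bsub>?O\<^esub> annihilation k = ?v powi (1 - int ?m) \<odot>\<^bsub>?O\<^esub> (annihilation k \<otimes>\<^bsub>?O\<^esub> creation j)"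
      using rel0[of j] ij(3) unfolding True va(1) by simp
    show ?thesis using O.q_ad_derivation_x[OF car(1,1,2) v x u deg(2)] by blast
  next
    case False
    show ?thesis
    proof (cases "k = j")
      case True
      obtain l where l: "?m = Suc l" using deg(2) by (cases ?m) auto
      have x: "creation i \<otimes>\<^bsub>?O\<^esub> annihilation k = ?v powi (1 - int ?m) \<odot>\<^bsub>?O\<^esub> (annihilation k \<otimes>\<^bsub>?O\<^esub> creation i)"
        using rel0[of i] ij(3) unfolding True va(2) by simp
      have u: "creation j \<otimes>\<^bsub>?O\<^esub> annihilation k = q_param powi root_pairing K k j \<odot>\<^bsub>?O\<^esub> (annihilation k \<otimes>\<^bsub>?O\<^esub> creation j) \<oplus>\<^bsub>?O\<^esub> \<one>\<^bsub>?O\<^esub>"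
        using rel[of j] True by simp
      show ?thesis using O.q_ad_derivation_u[OF car(1,1,2) x u, of l] unfolding l[symmetric] by blast
    next
      case False
      show ?thesis using O.q_ad_commute[OF car(1,1,2) rel0[OF \<open>k \<noteq> i\<close>] rel0[OF False], of ?v "1 - int ?m" ?m] by blast
    qed
  qed
  then obtain s where s: "q_ad ?O ?v (1 - int ?m) (creation i) (creation j) ?m \<otimes>\<^bsub>?O\<^esub> annihilation k =
      s \<odot>\<^bsub>?O\<^esub> (annihilation k \<otimes>\<^bsub>?O\<^esub> q_ad ?O ?v (1 - int ?m) (creation i) (creation j) ?m)" by blast
  have cancel_factor: "x = c \<odot>\<^bsub>ops\<^esub> y" if "inverse d \<odot>\<^bsub>ops\<^esub> x = c \<odot>\<^bsub>ops\<^esub> (inverse d \<odot>\<^bsub>ops\<^esub> y)"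
    "x \<in> carrier ops" "y \<in> carrier ops" "d \<noteq> 0" for x y c d
  proof -
    have "d \<odot>\<^bsub>ops\<^esub> (inverse d \<odot>\<^bsub>ops\<^esub> x) = d \<odot>\<^bsub>ops\<^esub> (c \<odot>\<^bsub>ops\<^esub> (inverse d \<odot>\<^bsub>ops\<^esub> y))"
      unfolding that(1) by (rule refl)
    moreover have "d * (c * inverse d) = c" using that(4) by simp
    ultimately show ?thesis using that(2-4) by (simp add: N.scalar_scalar)
  qed
  have "\<exists>r. q_ad ?O ?v (1 - int ?m) (creation i) (creation j) ?m = r \<odot>\<^bsub>ops\<^esub> serre_op i j \<and> r \<noteq> 0"
  proof -
    have c: "creation i \<in> carrier ops" "creation j \<in> carrier ops" by simp_all
    have "inverse (q_fact ?v ?m) \<odot>\<^bsub>ops\<^esub> q_ad ?O ?v (1 - int ?m) (creation i) (creation j) ?m =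
      (-1) ^ ?m \<odot>\<^bsub>ops\<^esub> (inverse (q_fact ?v ?m) \<odot>\<^bsub>ops\<^esub> serre_op i j)"
      using serre_element_opposite[OF ops_algebra c, of ?v ?m] c
        serre_element_eq_q_ad[OF ops_algebra v c, of ?m] serre_element_eq_q_ad[OF O.assoc_algebra_axioms v, of "creation i" "creation j" ?m]
      by (simp only: deg(1) serre_op_def opposite_algebra_simps)
    moreover have "q_ad ?O ?v (1 - int ?m) (creation i) (creation j) ?m \<in> carrier ops"
      using O.q_ad_closed[of "creation i" "creation j" ?v "1 - int ?m" ?m] c by (simp only: opposite_algebra_simps)
    moreover have "serre_op i j \<in> carrier ops" using serre_op_linear by simp
    ultimately have "q_ad ?O ?v (1 - int ?m) (creation i) (creation j) ?m = (-1) ^ ?m \<odot>\<^bsub>ops\<^esub> serre_op i j"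
      using q_fact_nonzero[OF v] by (rule cancel_factor)
    then show ?thesis by (intro exI[of _ "(-1) ^ ?m"]) simp
  qed
  then obtain r where r: "q_ad ?O ?v (1 - int ?m) (creation i) (creation j) ?m = r \<odot>\<^bsub>ops\<^esub> serre_op i j" "r \<noteq> 0" by blast
  have "scale r (annihilation k (serre_op i j y)) = scale (s * r) (serre_op i j (annihilation k y))" for y
    using fun_cong[OF s[unfolded r(1)], of y] by (simp add: stable_operators_simps op_linear scale_simps)
  then have "scale (inverse r) (scale r (annihilation k (serre_op i j y))) =
      scale (inverse r) (scale (s * r) (serre_op i j (annihilation k y)))" for y by simp
  then have "annihilation k (serre_op i j y) = scale (inverse r * (s * r)) (serre_op i j (annihilation k y))" for y
    using r(2) by (simp add: scale_simps)
  then show ?thesis by blast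
qed

lemma serre_ideal_annihilation:
  assumes "k \<in> I" "x \<in> serre_ideal"
  shows "annihilation k x \<in> serre_ideal"
  using assms(2)
proof (induction rule: serre_ideal.induct)
  case (serre i j y)
  then show ?case using serre_op_annihilation[of i j k] assms(1)
    by (metis serre_ideal.serre serre_ideal.scale)
next
  case (creation x l)
  then show ?case
    by (auto simp: annihilation_creation intro!: serre_ideal.add serre_ideal.scale serre_ideal.creation serre_ideal.zero)
qed (simp_all add: op_linear serre_ideal.intros)

lemma serre_ideal_torus:
  assumes "x \<in> serre_ideal"
  shows "torus_op h x \<in> serre_ideal"
  using assms
proof (induction rule: serre_ideal.induct)
  case (serre i j y)
  then show ?case using serre_op_torus[of i j h] by (metis serre_ideal.serre serre_ideal.scale)
next
  case (creation x l)
  then show ?case by (auto simp: torus_creation intro!: serre_ideal.scale serre_ideal.creation)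
qed (simp_all add: op_linear serre_ideal.intros)

lemma lookup_creation_Nil: "Poly_Mapping.lookup (creation i x) [] = 0"
proof -
  have "Poly_Mapping.lookup (scale r (Poly_Mapping.single (i # w) (1 :: laurent))) [] = 0" for r w
    by (simp add: lookup_map_times lookup_single when_def)
  then show ?thesis unfolding creation_def extend_linear_def by (simp add: lookup_sum)
qed

lemma lookup_serre_ideal_Nil: "x \<in> serre_ideal \<Longrightarrow> Poly_Mapping.lookup x [] = 0"
proof (induction rule: serre_ideal.induct)
  case (serre i j y)
  have "Poly_Mapping.lookup (q_ad ops v a (creation i) (creation j) l z) [] = 0" for v a l z
  proof (induction l arbitrary: z)
    case 0
    then show ?case by (simp add: lookup_creation_Nil)
  next
    case (Suc l)
    then show ?case by (simp add: stable_operators_simps lookup_add lookup_map_times lookup_creation_Nil)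
  qed
  then show ?case by (simp add: serre_op_def)
qed (simp_all add: lookup_add lookup_map_times lookup_creation_Nil)

text \<open>
  In contrast to the \<open>f\<^sub>i\<close>, the \<open>q\<close>-derivations satisfy the Serre relations on the free algebra itself: their Serre
  element commutes with every \<open>f\<^sub>k\<close> up to a scalar and kills \<open>1\<close>.
\<close>

lemma serre_annihilation_zero:
  assumes ij: "i \<in> I" "j \<in> I" "i \<noteq> j"
  shows "q_ad ops (q_index K i) (1 - int (nat (1 - cartan_entry K i j))) (annihilation i) (annihilation j)
     (nat (1 - cartan_entry K i j)) = (\<lambda>x. 0)"
proof -
  interpret N: assoc_algebra ops by (rule ops_algebra)
  let ?v = "q_index K i" and ?m = "nat (1 - cartan_entry K i j)"
  let ?S = "q_ad ops ?v (1 - int ?m) (annihilation i) (annihilation j)"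
  note deg = serre_degree[OF ij] and v = q_index_generic[OF ij(1)]
  have car: "annihilation l \<in> carrier ops" "creation l \<in> carrier ops" for l by simp_all
  have Sl: "linear_op (q_ad ops v a (annihilation i) (annihilation j) l)" for v a l
    using N.q_ad_closed[OF car(1,1), of v a i j l] by (simp add: stable_operators_simps)
  have rel: "annihilation l \<otimes>\<^bsub>ops\<^esub> creation k = q_param powi root_pairing K l k \<odot>\<^bsub>ops\<^esub> (creation k \<otimes>\<^bsub>ops\<^esub> annihilation l)
      \<oplus>\<^bsub>ops\<^esub> (if l = k then \<one>\<^bsub>ops\<^esub> else \<zero>\<^bsub>ops\<^esub>)" for l k
    by (auto simp: stable_operators_simps annihilation_creation)
  have rel0: "annihilation l \<otimes>\<^bsub>ops\<^esub> creation k = q_param powi root_pairing K l k \<odot>\<^bsub>ops\<^esub> (creation k \<otimes>\<^bsub>ops\<^esub> annihilation l)"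
    if "l \<noteq> k" for l k
    using that by (auto simp: stable_operators_simps annihilation_creation)
  have vv: "q_param powi root_pairing K i i = ?v ^ 2" using ij by (simp add: q_index_square)
  have va: "q_param powi root_pairing K i j = ?v powi (1 - int ?m)" "q_param powi root_pairing K j i = ?v powi (1 - int ?m)"
    using ij by (simp_all only: deg(1) q_index_powi_cartan root_pairing_sym[of j i])
  have comm: "\<exists>s. ?S ?m \<otimes>\<^bsub>ops\<^esub> creation k = s \<odot>\<^bsub>ops\<^esub> (creation k \<otimes>\<^bsub>ops\<^esub> ?S ?m)" for k
  proof (cases "k = i")
    case True
    have x: "annihilation i \<otimes>\<^bsub>ops\<^esub> creation k = ?v ^ 2 \<odot>\<^bsub>ops\<^esub> (creation k \<otimes>\<^bsub>ops\<^esub> annihilation i) \<oplus>\<^bsub>ops\<^esub> \<one>\<^bsub>ops\<^esub>"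
      using rel[of i i] True vv by simp
    have u: "annihilation j \<otimes>\<^bsub>ops\<^esub> creation k = ?v powi (1 - int ?m) \<odot>\<^bsub>ops\<^esub> (creation k \<otimes>\<^bsub>ops\<^esub> annihilation j)"
      using rel0[of j i] ij(3) unfolding True va(2) by simp
    show ?thesis using N.q_ad_derivation_x[OF car(1,1,2) v x u deg(2)] by blast
  next
    case False
    show ?thesis
    proof (cases "k = j")
      case True
      obtain l where l: "?m = Suc l" using deg(2) by (cases ?m) auto
      have x: "annihilation i \<otimes>\<^bsub>ops\<^esub> creation k = ?v powi (1 - int ?m) \<odot>\<^bsub>ops\<^esub> (creation k \<otimes>\<^bsub>ops\<^esub> annihilation i)"
        using rel0[of i j] ij(3) unfolding True va(1) by simp
      have u: "annihilation j \<otimes>\<^bsub>ops\<^esub> creation k = q_param powi root_pairing K j k \<odot>\<^bsub>ops\<^esub> (creation k \<otimes>\<^bsub>ops\<^esub> annihilation j) \<oplus>\<^bsub>ops\<^esub> \<one>\<^bsub>ops\<^esub>"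
        using rel[of j k] True by simp
      show ?thesis using N.q_ad_derivation_u[OF car(1,1,2) x u, of l] unfolding l[symmetric] by blast
    next
      case False
      then show ?thesis
        using N.q_ad_commute[OF car(1,1,2) rel0[of i k] rel0[of j k], of ?v "1 - int ?m" ?m] \<open>k \<noteq> i\<close> by blast
    qed
  qed
  show ?thesis
  proof (rule linear_op_eqI[OF Sl])
    fix w
    show "?S ?m (Poly_Mapping.single w 1) = 0"
    proof (induction w)
      case Nil
      have "q_ad ops v a (annihilation i) (annihilation j) l (Poly_Mapping.single [] 1) = 0" for v a l
        by (induction l) (simp_all add: op_single stable_operators_simps linear_opD[OF Sl] op_linear)
      then show ?case .
    next
      case (Cons k w)
      obtain s where "?S ?m \<otimes>\<^bsub>ops\<^esub> creation k = s \<odot>\<^bsub>ops\<^esub> (creation k \<otimes>\<^bsub>ops\<^esub> ?S ?m)" using comm by blast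
      from fun_cong[OF this, of "Poly_Mapping.single w 1"] Cons show ?case
        by (simp add: stable_operators_simps op_single op_linear)
    qed
  qed (simp add: linear_op_simps)
qed

text \<open>
  The functional sends \<open>b\<close> to the coefficient of the empty word in \<open>b \<cdot> 1\<close>.  This is well defined modulo \<open>serre_ideal\<close>,
  whose elements have constant term \<open>0\<close>.
\<close>

lemma B_functional_exists:
  "\<exists>\<phi> \<in> linear_maps B (ground_algebra :: (laurent, laurent) module). \<phi> \<one>\<^bsub>B\<^esub> = 1"
proof -
  let ?J = serre_ideal
  let ?N = "stable_operators ?J"
  have J: "subspace_of ?J" by (simp add: subspace_of_def serre_ideal.intros)
  note NA = stable_operators_algebra[OF J]
  interpret N: km_algebra K ?N by (rule km_algebraI[OF NA])
  \<comment> \<open>The operators that vanish on the quotient by the Serre ideal.\<close>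
  define Z where "Z = {f \<in> carrier ?N. \<forall>x. f x \<in> ?J}"
  have "ideal Z ?N"
  proof (rule idealI[OF N.ring_axioms])
    show "subgroup Z (add_monoid ?N)"
    proof (rule group.subgroupI[OF N.a_group])
      show "Z \<subseteq> carrier (add_monoid ?N)" by (auto simp: Z_def)
      show "Z \<noteq> {}" using N.zero_closed by (auto simp: Z_def stable_operators_simps serre_ideal.zero)
      fix f assume f: "f \<in> Z"
      then have "f \<in> carrier ?N" by (simp add: Z_def)
      then have "\<ominus>\<^bsub>?N\<^esub> f = (\<lambda>x. scale (- 1) (f x))" "\<ominus>\<^bsub>?N\<^esub> f \<in> carrier ?N"
        by (simp_all add: N.uminus_eq_scalar) (simp add: stable_operators_simps)
      then show "inv\<^bsub>add_monoid ?N\<^esub> f \<in> Z" using f by (simp add: Z_def serre_ideal.scale flip: a_inv_def)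
      fix g assume g: "g \<in> Z"
      have "f \<oplus>\<^bsub>?N\<^esub> g \<in> carrier ?N" using f g by (simp add: Z_def)
      then show "f \<otimes>\<^bsub>add_monoid ?N\<^esub> g \<in> Z" using f g by (simp add: Z_def stable_operators_simps serre_ideal.add)
    qed
    fix f g assume fg: "f \<in> Z" "g \<in> carrier ?N"
    then have "g \<otimes>\<^bsub>?N\<^esub> f \<in> carrier ?N" "f \<otimes>\<^bsub>?N\<^esub> g \<in> carrier ?N" by (simp_all add: Z_def)
    then show "g \<otimes>\<^bsub>?N\<^esub> f \<in> Z" "f \<otimes>\<^bsub>?N\<^esub> g \<in> Z" using fg by (auto simp: Z_def stable_operators_simps)
  qed
  then interpret Z: algebra_ideal ?N Z by (intro algebra_ideal.intro NA)
  let ?Q = "quot_algebra ?N Z"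
  let ?cl = "\<lambda>f. Z +>\<^bsub>?N\<^esub> f"
  note QA = Z.quot_assoc_algebra and cl = Z.coset_hom
  interpret Q: km_algebra K ?Q by (rule km_algebraI[OF QA])
  have clf: "creation i \<in> carrier ?N" "torus_op h \<in> carrier ?N" for i h
    by (simp_all add: stable_operators_simps serre_ideal.creation serre_ideal_torus)
  have cle: "annihilation i \<in> carrier ?N" if "i \<in> I" for i
    using that by (simp add: stable_operators_simps serre_ideal_annihilation)
  have tor: "torus_family K ?N torus_op"
    by (auto simp: torus_family_def clf) (auto simp: stable_operators_simps torus_op_zero torus_op_add fun_eq_iff)
  have wE: "weight_family K ?N torus_op annihilation 1" and wF: "weight_family K ?N torus_op creation (- 1)"
    by (auto simp: weight_family_def stable_operators_simps torus_annihilation torus_creation fun_eq_iff simp del: power_int_minus)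
  have sE: "serre_family K ?N annihilation"
    unfolding serre_family_def
  proof (intro conjI ballI impI)
    show "annihilation \<in> I \<rightarrow> carrier ?N" using cle by auto
    fix i j assume ij: "i \<in> I" "j \<in> I" "i \<noteq> j"
    show "serre_element ?N (q_index K i) (nat (1 - cartan_entry K i j)) (annihilation i) (annihilation j) = \<zero>\<^bsub>?N\<^esub>"
      unfolding serre_element_eq_0_iff[OF NA q_index_generic[OF ij(1)] cle[OF ij(1)] cle[OF ij(2)]]
      using serre_annihilation_zero[OF ij] q_ad_stable_operators[where J = ?J and J' = UNIV]
      by (simp only: stable_operators_simps)
  qed
  have sF: "serre_family K ?Q (\<lambda>i. ?cl (creation i))"
    unfolding serre_family_def
  proof (intro conjI ballI impI)
    show "(\<lambda>i. ?cl (creation i)) \<in> I \<rightarrow> carrier ?Q" using alg_homD(1)[OF cl] clf by auto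
    fix i j assume ij: "i \<in> I" "j \<in> I" "i \<noteq> j"
    let ?m = "nat (1 - cartan_entry K i j)"
    have eq: "q_ad ?N (q_index K i) (1 - int ?m) (creation i) (creation j) ?m = serre_op i j"
      unfolding serre_op_def serre_degree(1)[OF ij] by (rule q_ad_stable_operators)
    have "serre_op i j \<in> carrier ?N"
      unfolding eq[symmetric] by (rule N.q_ad_closed) (simp_all add: clf)
    then have "serre_op i j \<in> Z"
      unfolding Z_def by (intro CollectI conjI allI serre_ideal.serre[OF ij])
    then have "serre_element ?N (q_index K i) ?m (creation i) (creation j) \<in> Z"
      unfolding serre_element_eq_q_ad[OF NA q_index_generic[OF ij(1)] clf(1) clf(1)] eq by (rule Z.scalar_mem)
    then have "?cl (serre_element ?N (q_index K i) ?m (creation i) (creation j)) = \<zero>\<^bsub>?Q\<^esub>"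
      using Z.coset_eq_zero_iff serre_element_closed[OF NA clf(1) clf(1)] by blast
    then show "serre_element ?Q (q_index K i) ?m (?cl (creation i)) (?cl (creation j)) = \<zero>\<^bsub>?Q\<^esub>"
      using serre_element_hom[OF cl NA QA clf(1) clf(1)] by simp
  qed
  define g where "g = case_gen (\<lambda>i. ?cl (annihilation i)) (\<lambda>i. ?cl (creation i)) (\<lambda>h. ?cl (torus_op h))"
  have fam: "B_family K ?Q (\<lambda>i. ?cl (annihilation i)) (\<lambda>i. ?cl (creation i)) (\<lambda>h. ?cl (torus_op h))"
    unfolding B_family_def q_family_def
  proof (intro conjI ballI sF torus_family_hom[OF cl tor] serre_family_hom[OF cl sE NA QA])
    show "weight_family K ?Q (\<lambda>h. ?cl (torus_op h)) (\<lambda>i. ?cl (annihilation i)) 1"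
      by (rule weight_family_hom[OF cl wE NA]) (auto simp: cle clf)
    show "weight_family K ?Q (\<lambda>h. ?cl (torus_op h)) (\<lambda>i. ?cl (creation i)) (- 1)"
      by (rule weight_family_hom[OF cl wF NA]) (auto simp: clf)
    fix i j assume ij: "i \<in> I" "j \<in> I"
    have "annihilation i \<otimes>\<^bsub>?N\<^esub> creation j = q_param powi root_pairing K i j \<odot>\<^bsub>?N\<^esub> (creation j \<otimes>\<^bsub>?N\<^esub> annihilation i)
      \<oplus>\<^bsub>?N\<^esub> (if i = j then \<one>\<^bsub>?N\<^esub> else \<zero>\<^bsub>?N\<^esub>)"
      by (auto simp: stable_operators_simps annihilation_creation)
    then have "?cl (annihilation i \<otimes>\<^bsub>?N\<^esub> creation j) = ?cl (q_param powi root_pairing K i j \<odot>\<^bsub>?N\<^esub> (creation j \<otimes>\<^bsub>?N\<^esub> annihilation i)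
      \<oplus>\<^bsub>?N\<^esub> (if i = j then \<one>\<^bsub>?N\<^esub> else \<zero>\<^bsub>?N\<^esub>))" by simp
    then show "?cl (annihilation i) \<otimes>\<^bsub>?Q\<^esub> ?cl (creation j) = q_param powi root_pairing K i j \<odot>\<^bsub>?Q\<^esub> (?cl (creation j) \<otimes>\<^bsub>?Q\<^esub> ?cl (annihilation i))
      \<oplus>\<^bsub>?Q\<^esub> (if i = j then \<one>\<^bsub>?Q\<^esub> else \<zero>\<^bsub>?Q\<^esub>)"
      using clf cle ij alg_homD[OF cl] linear_maps_zero[OF alg_hom_linear[OF cl] NA QA] by (cases "i = j") simp_all
  qed
  have "B_family K ?Q (\<lambda>i. g (GenE i)) (\<lambda>i. g (GenF i)) (\<lambda>h. g (GenQ h))"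
    using fam by (simp add: g_def)
  note L = B_lift(1)[OF QA this]
  define f where "f = (\<lambda>u :: ('i list \<Rightarrow>\<^sub>0 laurent) \<Rightarrow> ('i list \<Rightarrow>\<^sub>0 laurent). Poly_Mapping.lookup (u (Poly_Mapping.single [] 1)) [])"
  have fl: "f \<in> linear_maps ?N ground_algebra"
    by (rule linear_mapsI) (simp_all add: f_def stable_operators_simps lookup_add lookup_map_times)
  have f0: "f u = \<zero>\<^bsub>ground_algebra :: (laurent, laurent) module\<^esub>" if "u \<in> Z" for u
  proof -
    have "u (Poly_Mapping.single [] 1) \<in> ?J" using that unfolding Z_def by blast
    then show ?thesis unfolding f_def ground_algebra_simps by (rule lookup_serre_ideal_Nil)
  qed
  note lift = Z.quot_lift_linear[OF fl ground_algebra_assoc f0]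
  show ?thesis
  proof (rule bexI)
    show "(\<lambda>b. the_elem (f ` presented_lift ?Q g b)) \<in> linear_maps B ground_algebra"
      by (rule linear_maps_comp[OF alg_hom_linear[OF L] lift])
    have "the_elem (f ` presented_lift ?Q g \<one>\<^bsub>B\<^esub>) = f \<one>\<^bsub>?N\<^esub>"
      unfolding alg_homD(5)[OF L] Z.quot_simps(3) by (rule Z.quot_lift[OF fl ground_algebra_assoc f0 N.one_closed])
    also have "\<dots> = 1" by (simp add: f_def stable_operators_simps)
    finally show "the_elem (f ` presented_lift ?Q g \<one>\<^bsub>B\<^esub>) = 1" .
  qed
qed

end

theorem theorem5:
  fixes K :: "('i, 't::ab_group_add) km_datum"
  assumes "symmetrizable_kac_moody K"
  shows "(\<forall>x\<in>generators K. B_coaction K (B_gen K x) = B_coaction_gen K x) \<and>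
    hopf_galois_extension (U_alg K) (U_comult K) (U_counit K) (U_antipode K)
      (B_alg K) (B_coaction K)"
proof -
  interpret symmetrizable_kac_moody K by fact
  show ?thesis using B_coaction_gen B_hopf_galois B_functional_exists by blast
qed

end
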